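(* Fix a partition $I\cup J=\{1,\dots,n\}$, $I\cap J=\varnothing$, with $|I|=k$, $|J|=m=n-k$. There exists a $2$-parametric family of Poisson brackets on the space $\mathrm{Mat}_{k,m}$ of real $k\times m$ matrices with the following property: for any choice of the parameters $\alpha_{ij}$, $\beta_{ij}$ defining the brackets $\{\cdot,\cdot\}_N$ on the spaces of edge weights, this family contains a unique Poisson bracket on $\mathrm{Mat}_{k,m}$ such that for any network $N\in\mathrm{Net}_{I,J}$ the (rational) boundary measurement map $M_N:(\mathbb R\setminus 0)^{|E|}\to\mathrm{Mat}_{k,m}$ is Poisson.
   Context: **Networks.** $G=(V,E)$ is a directed planar graph without loops and parallel edges drawn in a disk. Exactly $n$ vertices $b_1,\dots,b_n$ lie on the boundary circle, labelled counterclockwise; $b_i$ is a source (exactly one outgoing edge, no incoming edges) for $i\in I$ and a sink (exactly one incoming edge, no outgoing edges) for $i\in J$. All internal vertices have degree 3 and are either white (exactly one incoming edge) or black (exactly one outgoing edge). $\mathrm{Net}_{I,J}$ is the set of all perfect planar networks $N=(G,w)$ with such $G$ and edge weights as follows. **Weights and brackets.** A flag is a pair $(v,e)$ with $v$ an endpoint of $e$. To each internal vertex $v$ attach coordinates $x_v^1,x_v^2,x_v^3\in\mathbb R\setminus 0$ labelling the three flags at $v$: $x_v^1$ labels the flag of the unique incoming edge if $v$ is white, of the unique outgoing edge if $v$ is black, and the flags labelled $x_v^1,x_v^2,x_v^3$ follow each other clockwise around $v$. To each boundary vertex attach one coordinate in $\mathbb R\setminus 0$ labelling its unique flag. $\mathcal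 R$ is the product of all these coordinate spaces. The weight $w_e$ of an edge is the product of the coordinates labelling its two flags, so the space of edge weights is $(\mathbb R\setminus 0)^{|E|}$. For constants $\alpha_{ij}=-\alpha_{ji}$, $\beta_{ij}=-\beta_{ji}$ ($i,j\in\{1,2,3\}$), the bracket on $\mathcal R$ is given by $\{x_v^i,x_v^j\}=\alpha_{ij}x_v^ix_v^j$ at white $v$, $\{x_v^i,x_v^j\}=\beta_{ij}x_v^ix_v^j$ at black $v$, all other brackets of coordinates (in particular those of coordinates at different vertices) being zero. $\{\cdot,\cdot\}_N$ denotes its pushforward to $(\mathbb R\setminus 0)^{|E|}$, which is a well-defined Poisson bracket. **Path weights.** For a closed oriented polygonal plane curve $C$ (collinear consecutive segments having the same direction) and an oriented line $l$ not collinear to any segment of $C$, let $c_l(C)\in\mathbb Z/2\mathbb Z$ be the number mod 2 of pairs $(e',e'')$ of consecutive segments such that the direction vector of $l$ lies in the interior of the cone spanned by $e'$ and $e''$; it does not depend on $l$ and is denoted $c(C)$ (the concordance number). Draw $N$ with straight edges and with all internal vertices in the interior of the convex hull of the boundary vertices. For a path $P$ from a source $b_i$ to a sink $b_j$ (edges may repeat), $C_P$ is the closed curve obtained by adding to $P$ the path from $b_j$ to $b_i$ going counterclockwise along the boundary of the convex hull of the boundary vertices, and $w_P=(-1)^{c(C_P)-1}\prod_{e\in P}w_e$. **Boundary measurements.** $M(i,j)$ is the sum of $w_P$ over all paths from $b_i$ to $b_j$; this formal series represents a rational function of the edge weights. With $I=\{i_1<\dots<i_k\}$, $J=\{j_1<\dots<j_m\}$,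 the boundary measurement matrix is $M_N=(M_{pq})$, $M_{pq}=M(i_p,j_q)$; it defines the rational boundary measurement map $M_N$. *)

theory Defs
  imports "HOL-Analysis.Analysis" "HOL-Library.Poly_Mapping" "Graph_Theory.Graph_Theory"
begin

section \<open>Poisson brackets on coordinate spaces\<close>

text \<open>
  The space of real vectors with coordinates indexed by a finite set \<open>S\<close> is the set of
  extensional functions on \<open>S\<close>, topologised as a subspace of the product topology. Partial
  derivatives are taken by updating one coordinate, so they are meaningful as soon as the function
  is defined near the point.
\<close>

definition coord_space :: "'i set \<Rightarrow> ('i \<Rightarrow> real) set" where
  "coord_space S = S \<rightarrow>\<^sub>E UNIV"

definition torus :: "'i set \<Rightarrow> ('i \<Rightarrow> real) set" where
  "torus S = S \<rightarrow>\<^sub>E (- {0})"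

definition partial_deriv :: "'i \<Rightarrow> (('i \<Rightarrow> real) \<Rightarrow> real) \<Rightarrow> ('i \<Rightarrow> real) \<Rightarrow> real" where
  "partial_deriv a f x = deriv (\<lambda>t. f (x(a := t))) (x a)"

definition smooth :: "'i set \<Rightarrow> (('i \<Rightarrow> real) \<Rightarrow> real) \<Rightarrow> bool" where
  "smooth S f \<longleftrightarrow> (\<forall>as \<in> lists S. let D = foldr partial_deriv as f in
      continuous_on (coord_space S) D \<and>
      (\<forall>a\<in>S. \<forall>x\<in>coord_space S. (\<lambda>t. D (x(a := t))) field_differentiable (at (x a))))"

definition smooth_functions :: "'i set \<Rightarrow> (('i \<Rightarrow> real) \<Rightarrow> real) set" where
  "smooth_functions S = {f \<in> extensional (coord_space S). smooth S f}"

type_synonym 'i bracket =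
  "(('i \<Rightarrow> real) \<Rightarrow> real) \<Rightarrow> (('i \<Rightarrow> real) \<Rightarrow> real) \<Rightarrow> ('i \<Rightarrow> real) \<Rightarrow> real"

definition poisson_bracket :: "'i set \<Rightarrow> 'i bracket \<Rightarrow> bool" where
  "poisson_bracket S B \<longleftrightarrow>
     (let X = coord_space S; C = smooth_functions S in
      B \<in> C \<rightarrow>\<^sub>E C \<rightarrow>\<^sub>E C \<and>
      (\<forall>f\<in>C. \<forall>g\<in>C. \<forall>x\<in>X. B f g x = - B g f x) \<and>
      (\<forall>f\<in>C. \<forall>g\<in>C. \<forall>h\<in>C. \<forall>x\<in>X. \<forall>r s.
         B (\<lambda>y\<in>X. r * f y + s * g y) h x = r * B f h x + s * B g h x) \<and>
      (\<forall>f\<in>C. \<forall>g\<in>C. \<forall>h\<in>C. \<forall>x\<in>X.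
         B (\<lambda>y\<in>X. f y * g y) h x = f x * B g h x + g x * B f h x) \<and>
      (\<forall>f\<in>C. \<forall>g\<in>C. \<forall>h\<in>C. \<forall>x\<in>X.
         B f (B g h) x + B g (B h f) x + B h (B f g) x = 0))"

text \<open>
  A 2-parametric family: Poisson brackets indexed by pairs of real parameters, with brackets of
  smooth functions depending smoothly on the parameters and the point jointly (the index set
  \<open>{..<2} <+> S\<close> is that of the product of the parameter plane and the space). Different
  parameters may give the same bracket; this is unavoidable, as on a line all Poisson brackets
  vanish.
\<close>

definition two_parametric_family :: "'i set \<Rightarrow> ((nat \<Rightarrow> real) \<Rightarrow> 'i bracket) \<Rightarrow> bool" where
  "two_parametric_family S F \<longleftrightarrow>
     (\<forall>\<theta>\<in>coord_space {..<2}. poisson_bracket S (F \<theta>)) \<and>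
     (\<forall>f\<in>smooth_functions S. \<forall>g\<in>smooth_functions S.
        smooth ({..<2} <+> S) (\<lambda>y. F (\<lambda>i\<in>{..<2}. y (Inl i)) f g (\<lambda>a\<in>S. y (Inr a))))"

text \<open>
  The bracket with \<open>{x\<^sub>a, x\<^sub>b} = c a b\<close> on coordinates, extended by bilinearity and
  the Leibniz rule. Its value at a point depends on the germs of the arguments only, so it also
  applies to functions defined on open subsets.
\<close>

definition coord_bracket ::
    "'i set \<Rightarrow> ('i \<Rightarrow> 'i \<Rightarrow> ('i \<Rightarrow> real) \<Rightarrow> real) \<Rightarrow> 'i bracket" where
  "coord_bracket S c f g x =
     (\<Sum>a\<in>S. \<Sum>b\<in>S. c a b x * partial_deriv a f x * partial_deriv b g x)"

text \<open>
  The pushforward of a bracket along \<open>\<phi>\<close>, characterised by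
  \<open>{f, g}' \<circ> \<phi> = {f \<circ> \<phi>, g \<circ> \<phi>}\<close>; where it is well defined, it does not depend on the chosen
  preimage.
\<close>

definition pushforward :: "('i \<Rightarrow> real) set \<Rightarrow> (('i \<Rightarrow> real) \<Rightarrow> ('j \<Rightarrow> real)) \<Rightarrow> 'i bracket \<Rightarrow> 'j bracket" where
  "pushforward X \<phi> B f g y = B (f \<circ> \<phi>) (g \<circ> \<phi>) (SOME x. x \<in> X \<and> \<phi> x = y)"


section \<open>Formal series representing rational functions\<close>

text \<open>
  Monomials in the variables \<open>'e\<close> are multisets, polynomials are finitely supported functions on
  monomials, formal power series are arbitrary functions on monomials.
\<close>

definition poly_eval :: "('e multiset \<Rightarrow>\<^sub>0 real) \<Rightarrow> ('e \<Rightarrow> real) \<Rightarrow> real" where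
  "poly_eval p w = (\<Sum>a\<in>Poly_Mapping.keys p. Poly_Mapping.lookup p a * (\<Prod>e\<in>#a. w e))"

definition poly_times_series ::
    "('e multiset \<Rightarrow>\<^sub>0 real) \<Rightarrow> ('e multiset \<Rightarrow> real) \<Rightarrow> 'e multiset \<Rightarrow> real" where
  "poly_times_series q s a =
     (\<Sum>b\<in>{b \<in> Poly_Mapping.keys q. b \<subseteq># a}. Poly_Mapping.lookup q b * s (a - b))"

definition represents_fraction ::
    "'e set \<Rightarrow> ('e multiset \<Rightarrow> real) \<Rightarrow> ('e multiset \<Rightarrow>\<^sub>0 real) \<Rightarrow> ('e multiset \<Rightarrow>\<^sub>0 real) \<Rightarrow> bool" where
  "represents_fraction E s p q \<longleftrightarrow>
     q \<noteq> 0 \<and> (\<forall>a \<in> Poly_Mapping.keys p \<union> Poly_Mapping.keys q. set_mset a \<subseteq> E) \<and>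
     poly_times_series q s = Poly_Mapping.lookup p"

definition rational_regular :: "'e set \<Rightarrow> ('e multiset \<Rightarrow> real) \<Rightarrow> ('e \<Rightarrow> real) \<Rightarrow> bool" where
  "rational_regular E s w \<longleftrightarrow> (\<exists>p q. represents_fraction E s p q \<and> poly_eval q w \<noteq> 0)"

definition rational_value :: "'e set \<Rightarrow> ('e multiset \<Rightarrow> real) \<Rightarrow> ('e \<Rightarrow> real) \<Rightarrow> real" where
  "rational_value E s w =
     (THE r. \<exists>p q. represents_fraction E s p q \<and> poly_eval q w \<noteq> 0 \<and>
                   r = poly_eval p w / poly_eval q w)"


section \<open>Networks\<close>

text \<open>
  Vertices are points of the closed unit disk, and the edge \<open>(u, v)\<close> is drawn as the straight
  segment from \<open>u\<close> to \<open>v\<close>; \<open>bdry N i\<close> is the boundary vertex \<open>b\<^sub>i\<close>. All notions below except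
  membership in \<open>Net\<close> ignore the weights, since the boundary measurement map is a function on the
  space of all weights on the graph.
\<close>

record network =
  graph :: "complex pair_pre_digraph"
  bdry :: "nat \<Rightarrow> complex"
  weight :: "complex \<times> complex \<Rightarrow> real"

definition boundary_vertices :: "nat \<Rightarrow> network \<Rightarrow> complex set" where
  "boundary_vertices n N = bdry N ` {1..n}"

definition internal_vertices :: "nat \<Rightarrow> network \<Rightarrow> complex set" where
  "internal_vertices n N = pverts (graph N) - boundary_vertices n N"

definition white :: "nat \<Rightarrow> network \<Rightarrow> complex \<Rightarrow> bool" where
  "white n N v \<longleftrightarrow> v \<in> internal_vertices n N \<and> in_degree (graph N) v = 1"

definition black :: "nat \<Rightarrow> network \<Rightarrow> complex \<Rightarrow> bool" where
  "black n N v \<longleftrightarrow> v \<in> internal_vertices n N \<and> out_degree (graph N) v = 1"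

text \<open>The angles \<open>\<theta> i\<close> express that the boundary vertices are distinct and labelled counterclockwise.\<close>

definition boundary_on_circle :: "nat \<Rightarrow> network \<Rightarrow> bool" where
  "boundary_on_circle n N \<longleftrightarrow>
     (\<exists>\<theta> :: nat \<Rightarrow> real. strict_mono_on {1..n} \<theta> \<and>
        (\<forall>i\<in>{1..n}. \<forall>j\<in>{1..n}. \<theta> j < \<theta> i + 2 * pi) \<and>
        (\<forall>i\<in>{1..n}. bdry N i = cis (\<theta> i)))"

definition straight_plane_drawing :: "network \<Rightarrow> bool" where
  "straight_plane_drawing N \<longleftrightarrow>
     (\<forall>e \<in> parcs (graph N). closed_segment (fst e) (snd e) \<inter> pverts (graph N) = {fst e, snd e}) \<and>
     (\<forall>e \<in> parcs (graph N). \<forall>e' \<in> parcs (graph N). e \<noteq> e' \<longrightarrow>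
        closed_segment (fst e) (snd e) \<inter> closed_segment (fst e') (snd e')
          \<subseteq> {fst e, snd e} \<inter> {fst e', snd e'})"

definition Net :: "nat \<Rightarrow> nat set \<Rightarrow> nat set \<Rightarrow> network set" where
  "Net n I J = {N.
     pair_digraph (graph N) \<and>
     boundary_vertices n N \<subseteq> pverts (graph N) \<and>
     boundary_on_circle n N \<and>
     internal_vertices n N \<subseteq> interior (convex hull (boundary_vertices n N)) \<and>
     straight_plane_drawing N \<and>
     (\<forall>i\<in>I. in_degree (graph N) (bdry N i) = 0 \<and> out_degree (graph N) (bdry N i) = 1) \<and>
     (\<forall>j\<in>J. in_degree (graph N) (bdry N j) = 1 \<and> out_degree (graph N) (bdry N j) = 0) \<and>
     (\<forall>v\<in>internal_vertices n N.
        in_degree (graph N) v + out_degree (graph N) v = 3 \<and> (white n N v \<or> black n N v)) \<and>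
     weight N \<in> torus (parcs (graph N))}"


section \<open>The bracket on the space of edge weights\<close>

type_synonym edge = "complex \<times> complex"
type_synonym flag = "complex \<times> edge"

definition flags :: "network \<Rightarrow> flag set" where
  "flags N = {(v, e). e \<in> parcs (graph N) \<and> (v = fst e \<or> v = snd e)}"

definition flag_direction :: "flag \<Rightarrow> complex" where
  "flag_direction = (\<lambda>(v, e). (if v = fst e then snd e else fst e) - v)"

definition root_flag :: "nat \<Rightarrow> network \<Rightarrow> complex \<Rightarrow> flag" where
  "root_flag n N v =
     (v, THE e. e \<in> parcs (graph N) \<and> (if white n N v then snd e = v else fst e = v))"

text \<open>
  \<open>Arg2pi (d / d')\<close> is the angle in \<open>[0, 2\<pi>)\<close> by which \<open>d\<close> has to be rotated clockwise to point in
  the direction of \<open>d'\<close>. Hence the root flag gets label 1 and the labels increase clockwise.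
\<close>

definition clockwise_angle :: "nat \<Rightarrow> network \<Rightarrow> flag \<Rightarrow> real" where
  "clockwise_angle n N a = Arg2pi (flag_direction (root_flag n N (fst a)) / flag_direction a)"

definition flag_label :: "nat \<Rightarrow> network \<Rightarrow> flag \<Rightarrow> nat" where
  "flag_label n N a =
     1 + card {a' \<in> flags N. fst a' = fst a \<and> clockwise_angle n N a' < clockwise_angle n N a}"

definition flag_bracket ::
    "nat \<Rightarrow> (nat \<Rightarrow> nat \<Rightarrow> real) \<Rightarrow> (nat \<Rightarrow> nat \<Rightarrow> real) \<Rightarrow> network \<Rightarrow> flag bracket" where
  "flag_bracket n \<alpha> \<beta> N = coord_bracket (flags N) (\<lambda>a b x.
     if fst a = fst b \<and> white n N (fst a)
     then \<alpha> (flag_label n N a) (flag_label n N b) * x a * x b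
     else if fst a = fst b \<and> black n N (fst a)
     then \<beta> (flag_label n N a) (flag_label n N b) * x a * x b
     else 0)"

definition edge_weights :: "network \<Rightarrow> (flag \<Rightarrow> real) \<Rightarrow> edge \<Rightarrow> real" where
  "edge_weights N x = (\<lambda>e\<in>parcs (graph N). x (fst e, e) * x (snd e, e))"

definition network_bracket ::
    "nat \<Rightarrow> (nat \<Rightarrow> nat \<Rightarrow> real) \<Rightarrow> (nat \<Rightarrow> nat \<Rightarrow> real) \<Rightarrow> network \<Rightarrow> edge bracket" where
  "network_bracket n \<alpha> \<beta> N =
     pushforward (torus (flags N)) (edge_weights N) (flag_bracket n \<alpha> \<beta> N)"


section \<open>Concordance numbers and boundary measurements\<close>

text \<open>A closed polygonal curve is given by the cyclic list of its vertices.\<close>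

definition segment_vector :: "complex list \<Rightarrow> nat \<Rightarrow> complex" where
  "segment_vector ps i = ps ! (Suc i mod length ps) - ps ! (i mod length ps)"

definition concordance_along :: "complex \<Rightarrow> complex list \<Rightarrow> nat" where
  "concordance_along l ps =
     card {i. i < length ps \<and>
       l \<in> interior (convex_cone hull {segment_vector ps i, segment_vector ps (Suc i)})} mod 2"

text \<open>The value does not depend on the chosen direction \<open>l\<close>.\<close>

definition concordance :: "complex list \<Rightarrow> nat" where
  "concordance ps =
     concordance_along (SOME l. \<forall>i<length ps. \<not> collinear {0, l, segment_vector ps i}) ps"

text \<open>The labels passed strictly between \<open>j\<close> and \<open>i\<close> when going around counterclockwise.\<close>

definition labels_between :: "nat \<Rightarrow> nat \<Rightarrow> nat \<Rightarrow> nat list" where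
  "labels_between n j i = (if j < i then [Suc j..<i] else [Suc j..<Suc n] @ [1..<i])"

definition closed_path :: "nat \<Rightarrow> network \<Rightarrow> nat \<Rightarrow> nat \<Rightarrow> edge list \<Rightarrow> complex list" where
  "closed_path n N i j P =
     pre_digraph.awalk_verts (graph N) (bdry N i) P @ map (bdry N) (labels_between n j i)"

definition path_sign :: "nat \<Rightarrow> network \<Rightarrow> nat \<Rightarrow> nat \<Rightarrow> edge list \<Rightarrow> real" where
  "path_sign n N i j P = (- 1) powi (int (concordance (closed_path n N i j P)) - 1)"

text \<open>
  The formal sum of the weights of all paths from \<open>b\<^sub>i\<close> to \<open>b\<^sub>j\<close>: each path contributes its sign
  to the coefficient of the monomial given by its multiset of edges.
\<close>

definition boundary_series :: "nat \<Rightarrow> network \<Rightarrow> nat \<Rightarrow> nat \<Rightarrow> edge multiset \<Rightarrow> real" where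
  "boundary_series n N i j a =
     (\<Sum>P | pre_digraph.awalk (graph N) (bdry N i) P (bdry N j) \<and> mset P = a. path_sign n N i j P)"

text \<open>Rows and columns are numbered from 0, in increasing order of the labels in \<open>I\<close> and \<open>J\<close>.\<close>

definition mat_index :: "nat \<Rightarrow> nat \<Rightarrow> (nat \<times> nat) set" where
  "mat_index k m = {..<k} \<times> {..<m}"

definition measurement_series ::
    "nat \<Rightarrow> nat set \<Rightarrow> nat set \<Rightarrow> network \<Rightarrow> nat \<times> nat \<Rightarrow> edge multiset \<Rightarrow> real" where
  "measurement_series n I J N = (\<lambda>(p, q).
     boundary_series n N (sorted_list_of_set I ! p) (sorted_list_of_set J ! q))"

definition measurement_domain :: "nat \<Rightarrow> nat set \<Rightarrow> nat set \<Rightarrow> network \<Rightarrow> (edge \<Rightarrow> real) set" where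
  "measurement_domain n I J N =
     {w \<in> torus (parcs (graph N)). \<forall>c \<in> mat_index (card I) (card J).
        rational_regular (parcs (graph N)) (measurement_series n I J N c) w}"

definition boundary_measurement ::
    "nat \<Rightarrow> nat set \<Rightarrow> nat set \<Rightarrow> network \<Rightarrow> (edge \<Rightarrow> real) \<Rightarrow> nat \<times> nat \<Rightarrow> real" where
  "boundary_measurement n I J N w =
     (\<lambda>c \<in> mat_index (card I) (card J).
        rational_value (parcs (graph N)) (measurement_series n I J N c) w)"

text \<open>
  The Poisson property of the rational map is required at every point of its domain of definition.
  The domain is open, so the values of the composed functions outside it are irrelevant.
\<close>

definition boundary_measurement_poisson ::
    "nat \<Rightarrow> nat set \<Rightarrow> nat set \<Rightarrow> (nat \<Rightarrow> nat \<Rightarrow> real) \<Rightarrow> (nat \<Rightarrow> nat \<Rightarrow> real) \<Rightarrow>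
     (nat \<times> nat) bracket \<Rightarrow> network \<Rightarrow> bool" where
  "boundary_measurement_poisson n I J \<alpha> \<beta> B N \<longleftrightarrow>
     (let M = boundary_measurement n I J N; C = smooth_functions (mat_index (card I) (card J)) in
      \<forall>w \<in> measurement_domain n I J N. \<forall>f\<in>C. \<forall>g\<in>C.
        network_bracket n \<alpha> \<beta> N (f \<circ> M) (g \<circ> M) w = B f g (M w))"

definition skew3 :: "(nat \<Rightarrow> nat \<Rightarrow> real) \<Rightarrow> bool" where
  "skew3 \<alpha> \<longleftrightarrow> (\<forall>i\<in>{1..3}. \<forall>j\<in>{1..3}. \<alpha> i j = - \<alpha> j i)"

end

theory Submission
  imports Defs "HOL-Computational_Algebra.Polynomial_FPS"
begin

text \<open>
  On coordinates the family is
  \<open>{x\<^sub>i\<^sub>j, x\<^sub>i\<^sub>'\<^sub>j\<^sub>'} = u c x\<^sub>i\<^sub>j x\<^sub>i\<^sub>'\<^sub>j\<^sub>' + v d x\<^sub>i\<^sub>j\<^sub>' x\<^sub>i\<^sub>'\<^sub>j\<close>, where \<open>c\<close> and \<open>d\<close> depend on the cyclic order of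
  \<open>i, i', j, j'\<close> only. The bracket of two boundary measurements is a sum over pairs of paths and
  their common vertices. At a common vertex, the flag brackets contribute the local intersection
  number of the two paths times \<open>\<alpha>\<^sub>1\<^sub>3 + \<alpha>\<^sub>2\<^sub>3 - \<alpha>\<^sub>1\<^sub>2\<close> (white) or \<open>\<beta>\<^sub>1\<^sub>3 + \<beta>\<^sub>2\<^sub>3 - \<beta>\<^sub>1\<^sub>2\<close> (black).
  The sum of all local intersection numbers depends on the ends of the paths only, as it can be
  computed from the angles swept by one path as seen from the other. Exchanging the tails of the paths at a common vertex is
  an involution between pairs \<open>i \<rightarrow> j, i' \<rightarrow> j'\<close> and pairs \<open>i \<rightarrow> j', i' \<rightarrow> j\<close>; it negates the local
  intersection number at white vertices, keeps it at black vertices, and changes the signs of the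
  paths in a way depending on \<open>i, i', j, j'\<close> only, because the concordance number measures half of
  the total turning. These two relations determine the white and the black part of the sum, which
  gives \<open>u\<close> and \<open>v\<close>. Conversely, on a caterpillar tree the entries in the row of the first source
  and in the column of the last sink are nonzero monomials up to sign, and their brackets determine
  \<open>u - v\<close> and \<open>u + v\<close>.
\<close>

section \<open>Smooth functions and brackets of coordinates\<close>

text \<open>Paths may run around cycles, so the identity for pairs of paths is one between formal
  series, which need not converge at the given weights. Pairs are therefore sorted by total length,
  which the exchange of tails preserves; this makes the sums finite, and the identity passes to
  rational functions by substituting t w for the weights w, clearing denominators and setting t = 1.
  The other obstacle is the branch cut of \<open>Arg\<close>. Intersection numbers avoid it by
  working within half planes: disjoint segments are separated by a line, and the disk lies on one
  side of a tangent. For concordance numbers the jumps across the cut are what is counted, as each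
  changes the sign of a half-angle exponential. With a and b the values of
  \<open>triple_param\<close> for white and black vertices, the bracket has u = (a + b) / 2 and v =
  (b - a) / 2; so brackets within a row see a = u - v and brackets within a column see b = u + v.
  With a single row or column one of them disappears, which is why uniqueness is proved for brackets
  and not for parameters.\<close>

lemma coord_space_upd: "x \<in> coord_space S \<Longrightarrow> a \<in> S \<Longrightarrow> x(a := t) \<in> coord_space S"
  unfolding coord_space_def by auto

lemma tendsto_fun_coordinatewise:
  fixes y :: "'b \<Rightarrow> 'i \<Rightarrow> real"
  assumes "\<And>i. ((\<lambda>t. y t i) \<longlongrightarrow> l i) F"
  shows "(y \<longlongrightarrow> l) F"
proof -
  have "limitin (product_topology (\<lambda>i. euclidean) UNIV) y l F"
    using assms by (simp add: limitin_componentwise)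
  then show ?thesis by (simp add: euclidean_product_topology)
qed

lemma partial_deriv_cong:
  assumes "\<And>y. y \<in> coord_space S \<Longrightarrow> f y = g y" "x \<in> coord_space S" "a \<in> S"
  shows "partial_deriv a f x = partial_deriv a g x"
proof -
  have "(\<lambda>t. f (x(a := t))) = (\<lambda>t. g (x(a := t)))"
    using assms coord_space_upd by metis
  then show ?thesis by (simp add: partial_deriv_def)
qed

lemma foldr_partial_deriv_cong:
  assumes "as \<in> lists S" "\<And>y. y \<in> coord_space S \<Longrightarrow> f y = g y" "x \<in> coord_space S"
  shows "foldr partial_deriv as f x = foldr partial_deriv as g x"
  using assms(1,3)
proof (induction as arbitrary: x)
  case Nil
  then show ?case using assms(2) by simp
next
  case (Cons a as)
  then show ?case by (auto intro: partial_deriv_cong)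
qed

lemma smooth_partial_deriv:
  assumes "smooth S f" "a \<in> S"
  shows "smooth S (partial_deriv a f)"
  unfolding smooth_def
proof
  fix as assume "as \<in> lists S"
  then have "as @ [a] \<in> lists S" using assms(2) by auto
  from bspec[OF assms(1)[unfolded smooth_def] this]
  show "let D = foldr partial_deriv as (partial_deriv a f) in
      continuous_on (coord_space S) D \<and>
      (\<forall>a\<in>S. \<forall>x\<in>coord_space S. (\<lambda>t. D (x(a := t))) field_differentiable (at (x a)))"
    by simp
qed

lemma smooth_continuous_on: "smooth S f \<Longrightarrow> continuous_on (coord_space S) f"
  unfolding smooth_def by (drule bspec[where x = "[]"]) (auto simp: Let_def)

lemma smooth_has_partial_deriv:
  assumes "smooth S f" "a \<in> S" "x \<in> coord_space S"
  shows "((\<lambda>t. f (x(a := t))) has_real_derivative partial_deriv a f (x(a := s))) (at s)"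
proof -
  have "(\<lambda>t. f ((x(a := s))(a := t))) field_differentiable (at ((x(a := s)) a))"
  proof -
    have "\<forall>a\<in>S. \<forall>x\<in>coord_space S. (\<lambda>t. f (x(a := t))) field_differentiable (at (x a))"
      using bspec[OF assms(1)[unfolded smooth_def], of "[]"] by simp
    from bspec[OF bspec[OF this assms(2)] coord_space_upd[OF assms(3,2)]] show ?thesis .
  qed
  then show ?thesis
    unfolding DERIV_deriv_iff_field_differentiable[symmetric] partial_deriv_def by simp
qed

lemma smooth_has_partial_deriv':
  assumes "smooth S f" "a \<in> S" "x \<in> coord_space S"
  shows "((\<lambda>t. f (x(a := t))) has_real_derivative partial_deriv a f x) (at (x a))"
  using smooth_has_partial_deriv[OF assms, of "x a"] by simp

lemma partial_deriv_eqI: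
  "((\<lambda>t. f (x(a := t))) has_real_derivative D) (at (x a)) \<Longrightarrow> partial_deriv a f x = D"
  unfolding partial_deriv_def by (rule DERIV_imp_deriv)

text \<open>Smoothness is the largest property that implies continuity and is inherited by partial
  derivatives, hence a coinduction rule. Derivatives have to be matched on the coordinate space
  only, where \<open>foldr_partial_deriv_cong\<close> allows functions to be replaced.\<close>

lemma smooth_coinduct:
  assumes "R f"
    and "\<And>g. R g \<Longrightarrow> continuous_on (coord_space S) g"
    and "\<And>g a. R g \<Longrightarrow> a \<in> S \<Longrightarrow> \<exists>h. R h \<and>
      (\<forall>x\<in>coord_space S. ((\<lambda>t. g (x(a := t))) has_real_derivative h x) (at (x a)))"
  shows "smooth S f"
proof -
  \<comment> \<open>\<open>foldr\<close> applies the last entry of the list first, so the list is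
    taken apart at its end.\<close>
  have step: "\<exists>h. R h \<and> (\<forall>x\<in>coord_space S. foldr partial_deriv as g x = h x)"
    if "as \<in> lists S" "R g" for as g
    using that
  proof (induction as arbitrary: g rule: rev_induct)
    case Nil
    then show ?case by auto
  next
    case (snoc a as)
    from snoc.prems(1) have a: "a \<in> S" "as \<in> lists S" by auto
    from assms(3)[OF snoc.prems(2) a(1)] obtain h where h: "R h"
      "\<And>x. x \<in> coord_space S \<Longrightarrow> ((\<lambda>t. g (x(a := t))) has_real_derivative h x) (at (x a))" by metis
    have "foldr partial_deriv (as @ [a]) g x = foldr partial_deriv as h x" if "x \<in> coord_space S" for x
    proof -
      have "foldr partial_deriv as (partial_deriv a g) x = foldr partial_deriv as h x"
        by (rule foldr_partial_deriv_cong) (use a that h(2) in \<open>blast intro: partial_deriv_eqI\<close>)+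
      then show ?thesis by simp
    qed
    with snoc.IH[OF a(2) h(1)] show ?case by metis
  qed
  show ?thesis
    unfolding smooth_def Let_def
  proof (intro ballI conjI)
    fix as assume "as \<in> lists S"
    with step assms(1) obtain h where h: "R h" "\<And>x. x \<in> coord_space S \<Longrightarrow> foldr partial_deriv as f x = h x"
      by blast
    show "continuous_on (coord_space S) (foldr partial_deriv as f)"
      using assms(2)[OF h(1)] h(2) by (simp cong: continuous_on_cong)
    fix a x assume a: "a \<in> S" "x \<in> coord_space S"
    then have "(\<lambda>t. foldr partial_deriv as f (x(a := t))) = (\<lambda>t. h (x(a := t)))"
      using h(2) coord_space_upd by metis
    then show "(\<lambda>t. foldr partial_deriv as f (x(a := t))) field_differentiable at (x a)"
      using assms(3)[OF h(1) a(1)] a(2) unfolding field_differentiable_def by auto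
  qed
qed

lemma smooth_cong:
  assumes "smooth S f" "\<And>x. x \<in> coord_space S \<Longrightarrow> f x = g x"
  shows "smooth S g"
proof (rule smooth_coinduct[where R = "\<lambda>g. \<exists>f. smooth S f \<and> (\<forall>x\<in>coord_space S. f x = g x)"])
  show "\<exists>f. smooth S f \<and> (\<forall>x\<in>coord_space S. f x = g x)" using assms by blast
next
  fix g assume "\<exists>f. smooth S f \<and> (\<forall>x\<in>coord_space S. f x = g x)"
  then obtain f where f: "smooth S f" "\<And>x. x \<in> coord_space S \<Longrightarrow> f x = g x" by blast
  show "continuous_on (coord_space S) g"
    using smooth_continuous_on[OF f(1)] f(2) by (simp cong: continuous_on_cong)
  fix a assume a: "a \<in> S"
  have "((\<lambda>t. g (x(a := t))) has_real_derivative partial_deriv a f x) (at (x a))"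
    if "x \<in> coord_space S" for x
  proof -
    have "(\<lambda>t. g (x(a := t))) = (\<lambda>t. f (x(a := t)))"
      using f(2)[OF coord_space_upd[OF that a]] by metis
    then show ?thesis using smooth_has_partial_deriv'[OF f(1) a that] by simp
  qed
  then show "\<exists>h. (\<exists>f. smooth S f \<and> (\<forall>x\<in>coord_space S. f x = h x)) \<and>
      (\<forall>x\<in>coord_space S. ((\<lambda>t. g (x(a := t))) has_real_derivative h x) (at (x a)))"
    using smooth_partial_deriv[OF f(1) a] by (intro exI[of _ "partial_deriv a f"] conjI) auto
qed

text \<open>The derivative of a product is a sum of products. The algebra generated by the smooth
  functions is closed under this, and thus a class to which \<open>smooth_coinduct\<close>
  applies.\<close>

inductive smooth_algebra :: "'i set \<Rightarrow> (('i \<Rightarrow> real) \<Rightarrow> real) \<Rightarrow> bool" for S where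
  base: "smooth S f \<Longrightarrow> smooth_algebra S f"
| add: "smooth_algebra S f \<Longrightarrow> smooth_algebra S g \<Longrightarrow> smooth_algebra S (\<lambda>x. f x + g x)"
| mult: "smooth_algebra S f \<Longrightarrow> smooth_algebra S g \<Longrightarrow> smooth_algebra S (\<lambda>x. f x * g x)"

lemma smooth_algebra_smooth:
  assumes "smooth_algebra S f"
  shows "smooth S f"
proof (rule smooth_coinduct[where R = "smooth_algebra S", OF assms])
  fix g assume "smooth_algebra S g"
  then show "continuous_on (coord_space S) g"
    by induction (auto intro: smooth_continuous_on continuous_intros)
next
  fix g a assume "smooth_algebra S g" and a: "a \<in> S"
  then show "\<exists>h. smooth_algebra S h \<and>
      (\<forall>x\<in>coord_space S. ((\<lambda>t. g (x(a := t))) has_real_derivative h x) (at (x a)))"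
  proof induction
    case (base f)
    then show ?case
      by (intro exI[of _ "partial_deriv a f"] conjI ballI smooth_algebra.base smooth_partial_deriv
          smooth_has_partial_deriv') (use a in auto)
  next
    case (add f g)
    then obtain f' g' where h: "smooth_algebra S f'" "smooth_algebra S g'"
      "\<forall>x\<in>coord_space S. ((\<lambda>t. f (x(a := t))) has_real_derivative f' x) (at (x a))"
      "\<forall>x\<in>coord_space S. ((\<lambda>t. g (x(a := t))) has_real_derivative g' x) (at (x a))" by metis
    have "\<forall>x\<in>coord_space S. ((\<lambda>t. f (x(a := t)) + g (x(a := t))) has_real_derivative f' x + g' x) (at (x a))"
      using h(3,4) by (simp add: DERIV_add)
    with smooth_algebra.add[OF h(1,2)] show ?case by (intro exI[of _ "\<lambda>x. f' x + g' x"] conjI)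
  next
    case (mult f g)
    then obtain f' g' where h: "smooth_algebra S f'" "smooth_algebra S g'"
      "\<forall>x\<in>coord_space S. ((\<lambda>t. f (x(a := t))) has_real_derivative f' x) (at (x a))"
      "\<forall>x\<in>coord_space S. ((\<lambda>t. g (x(a := t))) has_real_derivative g' x) (at (x a))" by metis
    have "\<forall>x\<in>coord_space S. ((\<lambda>t. f (x(a := t)) * g (x(a := t))) has_real_derivative f' x * g x + g' x * f x) (at (x a))"
    proof
      fix x assume "x \<in> coord_space S"
      with h(3,4) have "((\<lambda>t. f (x(a := t))) has_real_derivative f' x) (at (x a))"
        "((\<lambda>t. g (x(a := t))) has_real_derivative g' x) (at (x a))" by auto
      from DERIV_mult[OF this] show "((\<lambda>t. f (x(a := t)) * g (x(a := t))) has_real_derivative f' x * g x + g' x * f x) (at (x a))"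
        by simp
    qed
    moreover have "smooth_algebra S (\<lambda>x. f' x * g x + g' x * f x)"
      by (intro smooth_algebra.add smooth_algebra.mult h mult.hyps)
    ultimately show ?case by (intro exI[of _ "\<lambda>x. f' x * g x + g' x * f x"] conjI)
  qed
qed

lemma smooth_add: "smooth S f \<Longrightarrow> smooth S g \<Longrightarrow> smooth S (\<lambda>x. f x + g x)"
  and smooth_mult: "smooth S f \<Longrightarrow> smooth S g \<Longrightarrow> smooth S (\<lambda>x. f x * g x)"
  by (rule smooth_algebra_smooth, (rule smooth_algebra.intros(2,3); rule smooth_algebra.base; assumption))+

lemma smooth_const: "smooth S (\<lambda>x. c)"
proof (rule smooth_coinduct[where R = "\<lambda>f. \<exists>c. f = (\<lambda>x. c)"])
  fix g :: "('a \<Rightarrow> real) \<Rightarrow> real" assume "\<exists>c. g = (\<lambda>x. c)"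
  then have "\<forall>x\<in>coord_space S. ((\<lambda>t. g (x(a := t))) has_real_derivative 0) (at (x a))" for a
    by (elim exE) simp
  then show "\<exists>h. (\<exists>c. h = (\<lambda>x. c)) \<and>
      (\<forall>x\<in>coord_space S. ((\<lambda>t. g (x(a := t))) has_real_derivative h x) (at (x a)))" for a
    by metis
qed (blast, elim exE, simp)

lemma smooth_sum: "(\<And>i. i \<in> A \<Longrightarrow> smooth S (f i)) \<Longrightarrow> smooth S (\<lambda>x. \<Sum>i\<in>A. f i x)"
  by (induction A rule: infinite_finite_induct) (auto intro: smooth_const smooth_add)

lemma smooth_coordinate: "smooth S (\<lambda>x. x a)"
proof (rule smooth_coinduct[where R = "\<lambda>f. f = (\<lambda>x. x a) \<or> smooth S f"])
  fix f b assume "f = (\<lambda>x. x a) \<or> smooth S f" and b: "b \<in> S"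
  then show "\<exists>h. (h = (\<lambda>x. x a) \<or> smooth S h) \<and>
      (\<forall>x\<in>coord_space S. ((\<lambda>t. f (x(b := t))) has_real_derivative h x) (at (x b)))"
  proof (elim disjE)
    assume f: "f = (\<lambda>x. x a)"
    have "\<forall>x\<in>coord_space S. ((\<lambda>t. f (x(b := t))) has_real_derivative (if a = b then 1 else 0)) (at (x b))"
      unfolding f by simp
    with smooth_const show ?thesis by (intro exI[of _ "\<lambda>x. if a = b then 1 else 0"] conjI disjI2)
  next
    assume "smooth S f"
    then show ?thesis
      by (intro exI[of _ "partial_deriv b f"] conjI disjI2 ballI smooth_partial_deriv smooth_has_partial_deriv')
        (use b in auto)
  qed
next
  fix f assume "f = (\<lambda>x. x a) \<or> smooth S f"
  then show "continuous_on (coord_space S) f"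
    by (elim disjE) (auto intro: smooth_continuous_on continuous_on_subset[OF continuous_on_product_coordinates])
qed simp

lemma smooth_mean_value:
  assumes f: "smooth S f" and a: "a \<in> S" and x: "x \<in> coord_space S"
  shows "\<exists>s. \<bar>s - x a\<bar> \<le> \<bar>t - x a\<bar> \<and>
    f (x(a := t)) - f x = (t - x a) * partial_deriv a f (x(a := s))"
proof -
  have D: "((\<lambda>t. f (x(a := t))) has_real_derivative partial_deriv a f (x(a := s))) (at s)" for s
    by (rule smooth_has_partial_deriv[OF f a x])
  consider "t = x a" | "t > x a" | "t < x a" by linarith
  then show ?thesis
  proof cases
    case 1
    then show ?thesis by (intro exI[of _ t]) simp
  next
    case 2
    from MVT2[OF this D] obtain s where "x a < s" "s < t"
      "f (x(a := t)) - f (x(a := x a)) = (t - x a) * partial_deriv a f (x(a := s))" by metis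
    then show ?thesis by (intro exI[of _ s]) simp
  next
    case 3
    from MVT2[OF this D] obtain s where "t < s" "s < x a"
      "f (x(a := x a)) - f (x(a := t)) = (x a - t) * partial_deriv a f (x(a := s))" by metis
    then show ?thesis by (intro exI[of _ s]) (simp add: algebra_simps)
  qed
qed

lemma tendsto_squeeze_abs:
  fixes s t l :: "'a \<Rightarrow> real"
  assumes "\<And>h. \<bar>s h - l h\<bar> \<le> \<bar>t h - l h\<bar>" "(t \<longlongrightarrow> c) F" "(l \<longlongrightarrow> c) F"
  shows "(s \<longlongrightarrow> c) F"
proof -
  have "((\<lambda>h. \<bar>t h - l h\<bar>) \<longlongrightarrow> \<bar>c - c\<bar>) F"
    by (intro tendsto_intros assms)
  then have "((\<lambda>h. \<bar>t h - l h\<bar>) \<longlongrightarrow> 0) F" by simp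
  then have "((\<lambda>h. s h - l h) \<longlongrightarrow> 0) F"
    by (rule tendsto_0_le[where K = 1]) (simp add: assms(1))
  from tendsto_add[OF this assms(3)] show ?thesis by simp
qed

lemma smooth_tendsto:
  assumes "smooth S f" "\<And>t. y t \<in> coord_space S" "x \<in> coord_space S"
    "\<And>a. a \<in> S \<Longrightarrow> ((\<lambda>t. y t a) \<longlongrightarrow> x a) F"
  shows "((\<lambda>t. f (y t)) \<longlongrightarrow> f x) F"
proof -
  have "(y \<longlongrightarrow> x) F"
  proof (rule tendsto_fun_coordinatewise)
    fix i show "((\<lambda>t. y t i) \<longlongrightarrow> x i) F"
    proof (cases "i \<in> S")
      case False
      then have "y t i = x i" for t
        using PiE_arb[of "y t" S _ i] PiE_arb[of x S _ i] assms(2)[of t] assms(3)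
        unfolding coord_space_def by simp
      then show ?thesis by simp
    qed (rule assms(4))
  qed
  from continuous_on_tendsto_compose[OF smooth_continuous_on[OF assms(1)] this assms(3)] assms(2)
  show ?thesis by simp
qed

text \<open>
  The chain rule is obtained by changing one coordinate at a time; by the mean value theorem, each
  change contributes one partial derivative.
\<close>

lemma smooth_one_coordinate_derivative:
  fixes y :: "real \<Rightarrow> 'i \<Rightarrow> real"
  assumes f: "smooth S f" and a: "a \<in> S" and y: "\<And>t. y t \<in> coord_space S"
    and D: "((\<lambda>t. y t a) has_real_derivative y') (at t0)"
    and lim: "\<And>b. ((\<lambda>t. y t b) \<longlongrightarrow> y t0 b) (at t0)"
  shows "((\<lambda>t. f (y t) - f ((y t)(a := y t0 a))) has_real_derivative partial_deriv a f (y t0) * y') (at t0)"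
proof -
  define z where "z t = (y t)(a := y t0 a)" for t
  have z0: "z t0 = y t0" by (simp add: z_def)
  have zX: "z t \<in> coord_space S" for t unfolding z_def by (rule coord_space_upd[OF y a])
  define Q where "Q t s \<longleftrightarrow> \<bar>s - y t0 a\<bar> \<le> \<bar>y t a - y t0 a\<bar> \<and>
      f (y t) - f (z t) = (y t a - y t0 a) * partial_deriv a f ((z t)(a := s))" for t s
  have "\<exists>s. Q t s" for t
  proof -
    have e: "(z t)(a := y t a) = y t" by (simp add: z_def)
    have "z t a = y t0 a" by (simp add: z_def)
    with smooth_mean_value[OF f a zX[of t], of "y t a"] show ?thesis unfolding e Q_def by simp
  qed
  then obtain s where Q: "\<And>t. Q t (s t)" by metis
  have s1: "\<bar>s t - y t0 a\<bar> \<le> \<bar>y t a - y t0 a\<bar>"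
    and s2: "f (y t) - f (z t) = (y t a - y t0 a) * partial_deriv a f ((z t)(a := s t))" for t
    using Q[of t] by (simp_all add: Q_def)
  define w where "w t = (z t)(a := s t)" for t
  have 1: "w t \<in> coord_space S" for t unfolding w_def by (rule coord_space_upd[OF zX a])
  have 2: "((\<lambda>t. w t b) \<longlongrightarrow> y t0 b) (at t0)" for b
  proof (cases "b = a")
    case True
    have "(s \<longlongrightarrow> y t0 a) (at t0)"
      by (rule tendsto_squeeze_abs[where t = "\<lambda>t. y t a" and l = "\<lambda>t. y t0 a"]) (simp_all add: s1 lim)
    then show ?thesis using True by (simp add: w_def)
  next
    case False
    then have "(\<lambda>t. w t b) = (\<lambda>t. y t b)" by (simp add: w_def z_def)
    then show ?thesis using lim by simp
  qed
  have "((\<lambda>t. partial_deriv a f (w t)) \<longlongrightarrow> partial_deriv a f (y t0)) (at t0)"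
    using smooth_partial_deriv[OF f a] 1 y 2 by (rule smooth_tendsto)
  moreover have "((\<lambda>t. (y t a - y t0 a) / (t - t0)) \<longlongrightarrow> y') (at t0)"
    using D by (simp add: has_field_derivative_iff)
  ultimately have "((\<lambda>t. partial_deriv a f (w t) * ((y t a - y t0 a) / (t - t0)))
      \<longlongrightarrow> partial_deriv a f (y t0) * y') (at t0)"
    by (rule tendsto_mult)
  moreover have "(\<lambda>t. partial_deriv a f (w t) * ((y t a - y t0 a) / (t - t0)))
      = (\<lambda>t. (f (y t) - f (z t) - (f (y t0) - f (z t0))) / (t - t0))"
    by (simp add: s2 z0 w_def mult.commute)
  ultimately show ?thesis
    unfolding has_field_derivative_iff z_def[symmetric] by simp
qed

lemma smooth_chain_rule:
  fixes y :: "real \<Rightarrow> 'i \<Rightarrow> real"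
  assumes fin: "finite S" and f: "smooth S f" and y: "\<And>t. y t \<in> coord_space S"
    and D: "\<And>a. a \<in> S \<Longrightarrow> ((\<lambda>t. y t a) has_real_derivative y' a) (at t0)"
  shows "((\<lambda>t. f (y t)) has_real_derivative (\<Sum>a\<in>S. partial_deriv a f (y t0) * y' a)) (at t0)"
proof -
  \<comment> \<open>Only the coordinates in \<open>T\<close> move along \<open>y\<close>; the
    induction on \<open>T\<close> freezes one of them at a time.\<close>
  define H where "H T y \<longleftrightarrow> T \<subseteq> S \<and> (\<forall>t. y t \<in> coord_space S) \<and>
      (\<forall>a\<in>T. ((\<lambda>t. y t a) has_real_derivative y' a) (at t0)) \<and>
      (\<forall>a t. a \<notin> T \<longrightarrow> y t a = y t0 a)" for T and y :: "real \<Rightarrow> 'i \<Rightarrow> real"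
  have main: "((\<lambda>t. f (y t)) has_real_derivative (\<Sum>a\<in>T. partial_deriv a f (y t0) * y' a)) (at t0)"
    if "finite T" "H T y" for T and y :: "real \<Rightarrow> 'i \<Rightarrow> real"
    using that
  proof (induction T arbitrary: y rule: finite_induct)
    case empty
    then have "y t a = y t0 a" for t a unfolding H_def by blast
    then have "y t = y t0" for t by (rule ext)
    then have "(\<lambda>t. f (y t)) = (\<lambda>t. f (y t0))" by metis
    then show ?case by simp
  next
    case (insert a T)
    note H = insert.prems[unfolded H_def]
    have aS: "a \<in> S" and yX: "y t \<in> coord_space S" and Da: "((\<lambda>t. y t a) has_real_derivative y' a) (at t0)" for t
      using H by auto
    have lim: "((\<lambda>t. y t b) \<longlongrightarrow> y t0 b) (at t0)" for b
    proof (cases "b \<in> insert a T")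
      case True
      then have "((\<lambda>t. y t b) has_real_derivative y' b) (at t0)" using H by blast
      from DERIV_isCont[OF this] show ?thesis by (simp add: isCont_def)
    next
      case False
      then have "(\<lambda>t. y t b) = (\<lambda>t. y t0 b)" using H by metis
      then show ?thesis by simp
    qed
    define z where "z t = (y t)(a := y t0 a)" for t
    have z0: "z t0 = y t0" by (simp add: z_def)
    have "((\<lambda>t. z t b) has_real_derivative y' b) (at t0)" if "b \<in> T" for b
    proof -
      have "(\<lambda>t. z t b) = (\<lambda>t. y t b)" using insert.hyps that by (auto simp: z_def)
      then show ?thesis using H that by simp
    qed
    moreover have "z t \<in> coord_space S" for t unfolding z_def by (rule coord_space_upd[OF yX aS])
    moreover have "z t b = z t0 b" if "b \<notin> T" for b t
    proof (cases "b = a")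
      case False
      then have "y t b = y t0 b" using H that by blast
      then show ?thesis using False by (simp add: z_def)
    qed (simp add: z_def)
    ultimately have "H T z" using H unfolding H_def by blast
    from DERIV_add[OF insert.IH[OF this] smooth_one_coordinate_derivative[OF f aS yX Da lim]]
    show ?case using insert.hyps z0 unfolding z_def[symmetric] by (simp add: add.commute)
  qed
  have "y t a = y t0 a" if "a \<notin> S" for a t
    using PiE_arb[OF y[of t, unfolded coord_space_def] that] PiE_arb[OF y[of t0, unfolded coord_space_def] that]
    by simp
  with y D have "H S y" unfolding H_def by blast
  from main[OF fin this] show ?thesis .
qed

text \<open>The second difference of \<open>f\<close> over a square of side \<open>h\<close> is
  symmetric in \<open>a\<close> and \<open>b\<close>. Two applications of the mean value theorem
  make it \<open>h * h\<close> times either mixed derivative at a point of the square, and both tend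
  to the values at \<open>x\<close>.\<close>

lemma partial_deriv_commute:
  assumes f: "smooth S f" and a: "a \<in> S" and b: "b \<in> S" and x: "x \<in> coord_space S"
  shows "partial_deriv a (partial_deriv b f) x = partial_deriv b (partial_deriv a f) x"
proof (cases "a = b")
  case False
  have mixed: "\<exists>s r. \<bar>s - x a\<bar> \<le> \<bar>h\<bar> \<and> \<bar>r - x b\<bar> \<le> \<bar>h\<bar> \<and>
      f (x(a := x a + h, b := x b + h)) - f (x(a := x a + h)) - f (x(b := x b + h)) + f x
        = h * h * partial_deriv b (partial_deriv a f) (x(a := s, b := r))"
    if f: "smooth S f" and a: "a \<in> S" and b: "b \<in> S" and ab: "a \<noteq> b" for h a b f
  proof (cases "h = 0")
    case True
    then show ?thesis by (intro exI[of _ "x a"] exI[of _ "x b"]) simp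
  next
    case h: False
    define x' where "x' = x(b := x b + h)"
    have x': "x' \<in> coord_space S" unfolding x'_def by (rule coord_space_upd[OF x b])
    have D': "((\<lambda>t. f (x'(a := t)) - f (x(a := t))) has_real_derivative
        partial_deriv a f (x'(a := s)) - partial_deriv a f (x(a := s))) (at s)" for s
      by (intro DERIV_diff smooth_has_partial_deriv[OF f a] x x')
    have "\<exists>s. \<bar>s - x a\<bar> \<le> \<bar>h\<bar> \<and>
      (f (x'(a := x a + h)) - f (x(a := x a + h))) - (f (x'(a := x a)) - f (x(a := x a)))
       = h * (partial_deriv a f (x'(a := s)) - partial_deriv a f (x(a := s)))"
    proof (cases "h > 0")
      case True
      then have "x a < x a + h" by simp
      from MVT2[OF this D']
      obtain s where "x a < s" "s < x a + h"
        "(f (x'(a := x a + h)) - f (x(a := x a + h))) - (f (x'(a := x a)) - f (x(a := x a)))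
       = (x a + h - x a) * (partial_deriv a f (x'(a := s)) - partial_deriv a f (x(a := s)))"
        by blast
      then show ?thesis by (intro exI[of _ s]) simp
    next
      case False
      then have "x a + h < x a" using h by simp
      from MVT2[OF this D']
      obtain s where "x a + h < s" "s < x a"
        "(f (x'(a := x a)) - f (x(a := x a))) - (f (x'(a := x a + h)) - f (x(a := x a + h)))
       = (x a - (x a + h)) * (partial_deriv a f (x'(a := s)) - partial_deriv a f (x(a := s)))"
        by blast
      then show ?thesis using False by (intro exI[of _ s]) (simp add: algebra_simps)
    qed
    then obtain s where s: "\<bar>s - x a\<bar> \<le> \<bar>h\<bar>"
      "(f (x'(a := x a + h)) - f (x(a := x a + h))) - (f (x'(a := x a)) - f (x(a := x a)))
       = h * (partial_deriv a f (x'(a := s)) - partial_deriv a f (x(a := s)))" by blast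
    have "x(a := s) \<in> coord_space S" by (rule coord_space_upd[OF x a])
    from smooth_mean_value[OF smooth_partial_deriv[OF f a] b this, of "x b + h"] ab
    obtain r where r: "\<bar>r - x b\<bar> \<le> \<bar>h\<bar>"
      "partial_deriv a f (x(a := s, b := x b + h)) - partial_deriv a f (x(a := s))
       = h * partial_deriv b (partial_deriv a f) (x(a := s, b := r))" by auto
    have e1: "x'(a := s) = x(a := s, b := x b + h)" for s
      unfolding x'_def using ab by (rule fun_upd_twist[symmetric])
    have "x a = x' a" using ab by (simp add: x'_def)
    then have e2: "x'(a := x a) = x'" by simp
    have "f (x(a := x a + h, b := x b + h)) - f (x(a := x a + h)) - f x' + f x
        = h * h * partial_deriv b (partial_deriv a f) (x(a := s, b := r))"
      using s(2) unfolding e2 unfolding e1 fun_upd_triv r(2) by (simp only: algebra_simps)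
    then show ?thesis
      unfolding x'_def using s(1) r(1) by (intro exI[of _ s] exI[of _ r] conjI)
  qed
  define Q where "Q h s r s' r' \<longleftrightarrow> \<bar>s - x a\<bar> \<le> \<bar>h\<bar> \<and> \<bar>r - x b\<bar> \<le> \<bar>h\<bar> \<and> \<bar>s' - x a\<bar> \<le> \<bar>h\<bar> \<and> \<bar>r' - x b\<bar> \<le> \<bar>h\<bar> \<and>
     (h \<noteq> 0 \<longrightarrow> partial_deriv b (partial_deriv a f) (x(a := s, b := r))
       = partial_deriv a (partial_deriv b f) (x(a := s', b := r')))" for h s r s' r'
  have "\<exists>s r s' r'. Q h s r s' r'" for h
  proof -
    from mixed[OF f a b False, of h] obtain s r where 1: "\<bar>s - x a\<bar> \<le> \<bar>h\<bar>" "\<bar>r - x b\<bar> \<le> \<bar>h\<bar>"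
      "f (x(a := x a + h, b := x b + h)) - f (x(a := x a + h)) - f (x(b := x b + h)) + f x
        = h * h * partial_deriv b (partial_deriv a f) (x(a := s, b := r))" by (elim exE conjE) (rule that)
    from mixed[OF f b a not_sym[OF False], of h] obtain r' s' where 2: "\<bar>s' - x a\<bar> \<le> \<bar>h\<bar>" "\<bar>r' - x b\<bar> \<le> \<bar>h\<bar>"
      "f (x(b := x b + h, a := x a + h)) - f (x(b := x b + h)) - f (x(a := x a + h)) + f x
        = h * h * partial_deriv a (partial_deriv b f) (x(b := r', a := s'))" by (elim exE conjE) (rule that)
    have tw: "x(b := u, a := v) = x(a := v, b := u)" for u v using False by (rule fun_upd_twist[OF not_sym])
    have "h * h * partial_deriv b (partial_deriv a f) (x(a := s, b := r))
       = h * h * partial_deriv a (partial_deriv b f) (x(a := s', b := r'))"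
      using 1(3) 2(3) unfolding tw by linarith
    then have "h \<noteq> 0 \<longrightarrow> partial_deriv b (partial_deriv a f) (x(a := s, b := r))
       = partial_deriv a (partial_deriv b f) (x(a := s', b := r'))" by auto
    with 1(1,2) 2(1,2) have "Q h s r s' r'" unfolding Q_def by (intro conjI)
    then show ?thesis by (intro exI)
  qed
  then have "\<forall>h. \<exists>s r s' r'. Q h s r s' r'" by (rule allI)
  then obtain s r s' r' where "\<forall>h. Q h (s h) (r h) (s' h) (r' h)"
    unfolding choice_iff by (elim exE)
  then have sr: "\<bar>s h - x a\<bar> \<le> \<bar>h\<bar>" "\<bar>r h - x b\<bar> \<le> \<bar>h\<bar>"
    "\<bar>s' h - x a\<bar> \<le> \<bar>h\<bar>" "\<bar>r' h - x b\<bar> \<le> \<bar>h\<bar>"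
    "h \<noteq> 0 \<Longrightarrow> partial_deriv b (partial_deriv a f) (x(a := s h, b := r h))
       = partial_deriv a (partial_deriv b f) (x(a := s' h, b := r' h))" for h
    unfolding Q_def by blast+
  have sq: "(q \<longlongrightarrow> c) (at 0)" if "\<And>h. \<bar>q h - c\<bar> \<le> \<bar>h\<bar>" for q and c :: real
    by (rule tendsto_squeeze_abs[where t = "\<lambda>h. c + h" and l = "\<lambda>h. c"])
      (use that in \<open>auto intro!: tendsto_eq_intros\<close>)
  have lim: "((\<lambda>h. F (x(a := q h, b := p h))) \<longlongrightarrow> F x) (at 0)"
    if "smooth S F" "\<And>h. \<bar>q h - x a\<bar> \<le> \<bar>h\<bar>" "\<And>h. \<bar>p h - x b\<bar> \<le> \<bar>h\<bar>" for F q p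
  proof (rule smooth_tendsto[OF that(1)])
    show "x(a := q t, b := p t) \<in> coord_space S" for t
      by (intro coord_space_upd x a b)
    fix c
    consider "c = b" | "c = a" "c \<noteq> b" | "c \<noteq> a" "c \<noteq> b" by blast
    then show "((\<lambda>t. (x(a := q t, b := p t)) c) \<longlongrightarrow> x c) (at 0)"
      by cases (simp_all add: sq that)
  qed (rule x)
  have "((\<lambda>h. partial_deriv b (partial_deriv a f) (x(a := s h, b := r h)))
      \<longlongrightarrow> partial_deriv b (partial_deriv a f) x) (at 0)"
    by (rule lim) (use sr in \<open>auto intro: smooth_partial_deriv f a b\<close>)
  moreover have "((\<lambda>h. partial_deriv a (partial_deriv b f) (x(a := s' h, b := r' h)))
      \<longlongrightarrow> partial_deriv a (partial_deriv b f) x) (at 0)"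
    by (rule lim) (use sr in \<open>auto intro: smooth_partial_deriv f a b\<close>)
  then have "((\<lambda>h. partial_deriv b (partial_deriv a f) (x(a := s h, b := r h)))
      \<longlongrightarrow> partial_deriv a (partial_deriv b f) x) (at 0)"
    by (rule Lim_transform_eventually) (auto simp: eventually_at_filter sr(5))
  ultimately show ?thesis using tendsto_unique[of "at (0::real)"] by force
qed simp

section \<open>Brackets of smooth functions given by their values on coordinates\<close>

lemma restrict_smooth_functions:
  "smooth S f \<Longrightarrow> restrict f (coord_space S) \<in> smooth_functions S"
  unfolding smooth_functions_def by (auto intro: smooth_cong)

lemma smooth_functionsD: "f \<in> smooth_functions S \<Longrightarrow> smooth S f"
  unfolding smooth_functions_def by simp

lemma smooth_coord_bracket:
  assumes "\<And>a b. a \<in> S \<Longrightarrow> b \<in> S \<Longrightarrow> smooth S (c a b)" "smooth S f" "smooth S g"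
  shows "smooth S (coord_bracket S c f g)"
  unfolding coord_bracket_def by (intro smooth_sum smooth_mult smooth_partial_deriv assms)

text \<open>All three arguments are restricted because \<open>poisson_bracket\<close> asks for
  extensional maps. This also makes two brackets with the same coefficients equal as
  functions.\<close>

definition smooth_bracket ::
    "'i set \<Rightarrow> ('i \<Rightarrow> 'i \<Rightarrow> ('i \<Rightarrow> real) \<Rightarrow> real) \<Rightarrow> 'i bracket" where
  "smooth_bracket S c =
     (\<lambda>f\<in>smooth_functions S. \<lambda>g\<in>smooth_functions S. \<lambda>x\<in>coord_space S. coord_bracket S c f g x)"

lemma coord_bracket_cong:
  assumes "\<And>y. y \<in> coord_space S \<Longrightarrow> f y = f' y" "\<And>y. y \<in> coord_space S \<Longrightarrow> g y = g' y" "x \<in> coord_space S"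
  shows "coord_bracket S c f g x = coord_bracket S c f' g' x"
  unfolding coord_bracket_def
  by (intro sum.cong refl) (simp add: partial_deriv_cong[OF assms(1) assms(3)] partial_deriv_cong[OF assms(2) assms(3)])

lemma partial_deriv_add:
  assumes "smooth S f" "smooth S g" "a \<in> S" "x \<in> coord_space S"
  shows "partial_deriv a (\<lambda>x. f x + g x) x = partial_deriv a f x + partial_deriv a g x"
  by (rule partial_deriv_eqI) (intro DERIV_add smooth_has_partial_deriv'[OF _ assms(3,4)] assms(1,2))

lemma partial_deriv_mult:
  assumes "smooth S f" "smooth S g" "a \<in> S" "x \<in> coord_space S"
  shows "partial_deriv a (\<lambda>x. f x * g x) x = f x * partial_deriv a g x + g x * partial_deriv a f x"
proof (rule partial_deriv_eqI)
  from DERIV_mult[OF smooth_has_partial_deriv'[OF assms(1,3,4)] smooth_has_partial_deriv'[OF assms(2,3,4)]]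
  show "((\<lambda>t. f (x(a := t)) * g (x(a := t))) has_real_derivative
      f x * partial_deriv a g x + g x * partial_deriv a f x) (at (x a))"
    by (simp add: algebra_simps)
qed

lemma partial_deriv_const: "partial_deriv a (\<lambda>x. c) x = 0"
  by (rule partial_deriv_eqI) simp

lemma partial_deriv_cmult:
  assumes "smooth S f" "a \<in> S" "x \<in> coord_space S"
  shows "partial_deriv a (\<lambda>x. r * f x) x = r * partial_deriv a f x"
  using partial_deriv_mult[OF smooth_const assms] by (simp add: partial_deriv_const)

lemma partial_deriv_sum:
  assumes "\<And>i. i \<in> A \<Longrightarrow> smooth S (f i)" "a \<in> S" "x \<in> coord_space S"
  shows "partial_deriv a (\<lambda>x. \<Sum>i\<in>A. f i x) x = (\<Sum>i\<in>A. partial_deriv a (f i) x)"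
  using assms(1)
proof (induction A rule: infinite_finite_induct)
  case (insert i A)
  have "partial_deriv a (\<lambda>x. f i x + (\<Sum>i\<in>A. f i x)) x = partial_deriv a (f i) x + partial_deriv a (\<lambda>x. \<Sum>i\<in>A. f i x) x"
    by (rule partial_deriv_add[OF _ _ assms(2,3)]) (use insert.prems in \<open>auto intro: smooth_sum\<close>)
  then show ?case using insert by simp
qed (simp_all add: partial_deriv_const)

lemma coord_bracket_coord_bracket:
  assumes c: "\<And>a b. a \<in> S \<Longrightarrow> b \<in> S \<Longrightarrow> smooth S (c a b)"
    and f: "smooth S f" "smooth S g" "smooth S h" and x: "x \<in> coord_space S"
  shows "coord_bracket S c f (coord_bracket S c g h) x =
    (\<Sum>a\<in>S. \<Sum>e\<in>S. \<Sum>b\<in>S. \<Sum>d\<in>S. c a e x * partial_deriv a f x *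
      (partial_deriv e (c b d) x * partial_deriv b g x * partial_deriv d h x
       + c b d x * partial_deriv e (partial_deriv b g) x * partial_deriv d h x
       + c b d x * partial_deriv b g x * partial_deriv e (partial_deriv d h) x))"
proof -
  have "partial_deriv e (coord_bracket S c g h) x = (\<Sum>b\<in>S. \<Sum>d\<in>S.
      partial_deriv e (c b d) x * partial_deriv b g x * partial_deriv d h x
       + c b d x * partial_deriv e (partial_deriv b g) x * partial_deriv d h x
       + c b d x * partial_deriv b g x * partial_deriv e (partial_deriv d h) x)" if e: "e \<in> S" for e
  proof -
    have sm: "smooth S (\<lambda>x. c b d x * partial_deriv b g x * partial_deriv d h x)" if "b \<in> S" "d \<in> S" for b d
      by (intro smooth_mult smooth_partial_deriv c f that)
    have "partial_deriv e (\<lambda>x. c b d x * partial_deriv b g x * partial_deriv d h x) x =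
        partial_deriv e (c b d) x * partial_deriv b g x * partial_deriv d h x
       + c b d x * partial_deriv e (partial_deriv b g) x * partial_deriv d h x
       + c b d x * partial_deriv b g x * partial_deriv e (partial_deriv d h) x"
      if bd: "b \<in> S" "d \<in> S" for b d
    proof -
      note s = c[OF bd] smooth_partial_deriv[OF f(2) bd(1)] smooth_partial_deriv[OF f(3) bd(2)]
      show ?thesis
        unfolding partial_deriv_mult[OF smooth_mult[OF s(1,2)] s(3) e x] partial_deriv_mult[OF s(1,2) e x]
        by (simp add: algebra_simps)
    qed
    then show ?thesis
      unfolding coord_bracket_def
      by (simp add: partial_deriv_sum[OF smooth_sum e x] partial_deriv_sum[OF _ e x] sm cong: sum.cong)
  qed
  then show ?thesis
    unfolding coord_bracket_def[of S c f] by (simp add: sum_distrib_left cong: sum.cong)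
qed

text \<open>Reversing the chain of indices a, e, b, d matches the term with second derivatives of
  \<open>g\<close> in {f, {g, h}} with the one in {h, {g, f}}.\<close>

lemma sum_rotate4:
  fixes F :: "'a \<Rightarrow> 'a \<Rightarrow> 'a \<Rightarrow> 'a \<Rightarrow> real"
  shows "(\<Sum>a\<in>S. \<Sum>e\<in>S. \<Sum>b\<in>S. \<Sum>d\<in>S. F a e b d) = (\<Sum>a\<in>S. \<Sum>e\<in>S. \<Sum>b\<in>S. \<Sum>d\<in>S. F d b e a)"
proof -
  have "(\<Sum>a\<in>S. \<Sum>e\<in>S. \<Sum>b\<in>S. \<Sum>d\<in>S. F a e b d) = (\<Sum>(a, e, b, d)\<in>S \<times> S \<times> S \<times> S. F a e b d)"
    by (simp add: sum.cartesian_product)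
  also have "\<dots> = (\<Sum>(a, e, b, d)\<in>S \<times> S \<times> S \<times> S. F d b e a)"
    by (rule sum.reindex_bij_witness[of _ "\<lambda>(a, e, b, d). (d, b, e, a)" "\<lambda>(a, e, b, d). (d, b, e, a)"]) auto
  also have "\<dots> = (\<Sum>a\<in>S. \<Sum>e\<in>S. \<Sum>b\<in>S. \<Sum>d\<in>S. F d b e a)"
    by (simp add: sum.cartesian_product)
  finally show ?thesis .
qed

lemma sum_swap_last:
  fixes F :: "'a \<Rightarrow> 'a \<Rightarrow> 'a \<Rightarrow> 'a \<Rightarrow> real"
  shows "(\<Sum>a\<in>S. \<Sum>e\<in>S. \<Sum>b\<in>S. \<Sum>d\<in>S. F a e b d) = (\<Sum>a\<in>S. \<Sum>e\<in>S. \<Sum>b\<in>S. \<Sum>d\<in>S. F a e d b)"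
  by (intro sum.cong refl sum.swap)

lemma sum_triple:
  fixes G :: "'a \<Rightarrow> 'a \<Rightarrow> 'a \<Rightarrow> real"
  shows "(\<Sum>a\<in>S. \<Sum>b\<in>S. \<Sum>d\<in>S. G a b d) = (\<Sum>(a, b, d)\<in>S \<times> S \<times> S. G a b d)"
  by (simp add: sum.cartesian_product)

text \<open>The indices are named so that the three cyclic summands of the Jacobi identity become
  sums over the same triples.\<close>

lemma sum_first_order:
  fixes F :: "'a \<Rightarrow> 'a \<Rightarrow> 'a \<Rightarrow> 'a \<Rightarrow> real"
  shows "(\<Sum>a\<in>S. \<Sum>e\<in>S. \<Sum>b\<in>S. \<Sum>d\<in>S. F a e b d) = (\<Sum>(a, b, d)\<in>S \<times> S \<times> S. \<Sum>e\<in>S. F a e b d)"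
    "(\<Sum>a\<in>S. \<Sum>e\<in>S. \<Sum>b\<in>S. \<Sum>d\<in>S. F a e b d) = (\<Sum>(b, d, a)\<in>S \<times> S \<times> S. \<Sum>e\<in>S. F a e b d)"
    "(\<Sum>a\<in>S. \<Sum>e\<in>S. \<Sum>b\<in>S. \<Sum>d\<in>S. F a e b d) = (\<Sum>(d, a, b)\<in>S \<times> S \<times> S. \<Sum>e\<in>S. F a e b d)"
proof -
  have "(\<Sum>a\<in>S. \<Sum>e\<in>S. \<Sum>b\<in>S. \<Sum>d\<in>S. F a e b d) = (\<Sum>a\<in>S. \<Sum>b\<in>S. \<Sum>e\<in>S. \<Sum>d\<in>S. F a e b d)"
    by (intro sum.cong refl sum.swap)
  also have "\<dots> = (\<Sum>a\<in>S. \<Sum>b\<in>S. \<Sum>d\<in>S. \<Sum>e\<in>S. F a e b d)"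
    by (intro sum.cong refl sum.swap)
  also have "\<dots> = (\<Sum>(a, b, d)\<in>S \<times> S \<times> S. \<Sum>e\<in>S. F a e b d)"
    by (rule sum_triple)
  finally show 1: "(\<Sum>a\<in>S. \<Sum>e\<in>S. \<Sum>b\<in>S. \<Sum>d\<in>S. F a e b d) = (\<Sum>(a, b, d)\<in>S \<times> S \<times> S. \<Sum>e\<in>S. F a e b d)" .
  show "(\<Sum>a\<in>S. \<Sum>e\<in>S. \<Sum>b\<in>S. \<Sum>d\<in>S. F a e b d) = (\<Sum>(b, d, a)\<in>S \<times> S \<times> S. \<Sum>e\<in>S. F a e b d)"
    unfolding 1 by (rule sum.reindex_bij_witness[of _ "\<lambda>(b, d, a). (a, b, d)" "\<lambda>(a, b, d). (b, d, a)"]) auto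
  show "(\<Sum>a\<in>S. \<Sum>e\<in>S. \<Sum>b\<in>S. \<Sum>d\<in>S. F a e b d) = (\<Sum>(d, a, b)\<in>S \<times> S \<times> S. \<Sum>e\<in>S. F a e b d)"
    unfolding 1 by (rule sum.reindex_bij_witness[of _ "\<lambda>(d, a, b). (a, b, d)" "\<lambda>(a, b, d). (d, a, b)"]) auto
qed

text \<open>
  The terms with second derivatives of \<open>f\<close>, \<open>g\<close>, \<open>h\<close> cancel in pairs, since second partial
  derivatives commute and \<open>c\<close> is skew-symmetric.
\<close>

lemma coord_bracket_jacobi:
  assumes c: "\<And>a b. a \<in> S \<Longrightarrow> b \<in> S \<Longrightarrow> smooth S (c a b)"
    and skew: "\<And>a b x. a \<in> S \<Longrightarrow> b \<in> S \<Longrightarrow> c b a x = - c a b x"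
    and jacobi: "\<And>a b d x. a \<in> S \<Longrightarrow> b \<in> S \<Longrightarrow> d \<in> S \<Longrightarrow> x \<in> coord_space S \<Longrightarrow>
      (\<Sum>e\<in>S. c a e x * partial_deriv e (c b d) x + c b e x * partial_deriv e (c d a) x
        + c d e x * partial_deriv e (c a b) x) = 0"
    and f: "smooth S f" "smooth S g" "smooth S h" and x: "x \<in> coord_space S"
  shows "coord_bracket S c f (coord_bracket S c g h) x + coord_bracket S c g (coord_bracket S c h f) x
    + coord_bracket S c h (coord_bracket S c f g) x = 0"
proof -
  let ?d = "\<lambda>a f. partial_deriv a f x"
  \<comment> \<open>\<open>U\<close> collects the terms with a derivative of \<open>c\<close>, and
    \<open>T\<close> those with second derivatives of the middle argument. By skew-symmetry of
    \<open>c\<close>, the terms with second derivatives of the last argument are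
    \<open>- T f h g\<close>.\<close>
  define U where "U f g h = (\<Sum>a\<in>S. \<Sum>e\<in>S. \<Sum>b\<in>S. \<Sum>d\<in>S. c a e x * ?d a f * (?d e (c b d) * ?d b g * ?d d h))" for f g h
  define T where "T f g h = (\<Sum>a\<in>S. \<Sum>e\<in>S. \<Sum>b\<in>S. \<Sum>d\<in>S.
      c a e x * ?d a f * (c b d x * partial_deriv e (partial_deriv b g) x * ?d d h))" for f g h
  have dec: "coord_bracket S c f (coord_bracket S c g h) x = U f g h + T f g h - T f h g"
    if s: "smooth S f" "smooth S g" "smooth S h" for f g h
  proof -
    define W where "W = (\<Sum>a\<in>S. \<Sum>e\<in>S. \<Sum>b\<in>S. \<Sum>d\<in>S.
      c a e x * ?d a f * (c b d x * ?d b g * partial_deriv e (partial_deriv d h) x))"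
    have "T f h g = (\<Sum>a\<in>S. \<Sum>e\<in>S. \<Sum>b\<in>S. \<Sum>d\<in>S.
      c a e x * ?d a f * (c d b x * partial_deriv e (partial_deriv d h) x * ?d b g))"
      unfolding T_def by (rule sum_swap_last)
    also have "\<dots> = (\<Sum>a\<in>S. \<Sum>e\<in>S. \<Sum>b\<in>S. \<Sum>d\<in>S.
      - (c a e x * ?d a f * (c b d x * ?d b g * partial_deriv e (partial_deriv d h) x)))"
    proof (intro sum.cong refl)
      fix a e b d assume "b \<in> S" "d \<in> S"
      then have "c d b x = - c b d x" by (rule skew)
      then show "c a e x * ?d a f * (c d b x * partial_deriv e (partial_deriv d h) x * ?d b g)
          = - (c a e x * ?d a f * (c b d x * ?d b g * partial_deriv e (partial_deriv d h) x))" by simp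
    qed
    finally have W: "W = - T f h g" unfolding W_def by (simp add: sum_negf)
    have "coord_bracket S c f (coord_bracket S c g h) x = U f g h + T f g h + W"
      unfolding U_def T_def W_def
      by (subst coord_bracket_coord_bracket[OF _ s x]) (simp_all add: c distrib_left sum.distrib)
    then show ?thesis unfolding W by simp
  qed
  have sym: "T h g f = T f g h" if s: "smooth S f" "smooth S g" "smooth S h" for f g h
  proof -
    have "T h g f = (\<Sum>a\<in>S. \<Sum>e\<in>S. \<Sum>b\<in>S. \<Sum>d\<in>S.
      c d b x * ?d d h * (c e a x * partial_deriv b (partial_deriv e g) x * ?d a f))"
      unfolding T_def by (rule sum_rotate4)
    also have "\<dots> = T f g h"
      unfolding T_def
    proof (intro sum.cong refl)
      fix a e b d assume S: "a \<in> S" "e \<in> S" "b \<in> S" "d \<in> S"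
      have "c d b x = - c b d x" "c e a x = - c a e x" using S skew by blast+
      then show "c d b x * ?d d h * (c e a x * partial_deriv b (partial_deriv e g) x * ?d a f)
         = c a e x * ?d a f * (c b d x * partial_deriv e (partial_deriv b g) x * ?d d h)"
        using partial_deriv_commute[OF s(2) S(3,2) x] by simp
    qed
    finally show ?thesis .
  qed
  have "U f g h + U g h f + U h f g = 0"
  proof -
    have "U f g h + U g h f + U h f g = (\<Sum>(a, b, d)\<in>S \<times> S \<times> S.
        (\<Sum>e\<in>S. c a e x * ?d a f * (?d e (c b d) * ?d b g * ?d d h))
        + (\<Sum>e\<in>S. c b e x * ?d b g * (?d e (c d a) * ?d d h * ?d a f))
        + (\<Sum>e\<in>S. c d e x * ?d d h * (?d e (c a b) * ?d a f * ?d b g)))"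
      unfolding U_def
      by (subst sum_first_order(1), subst sum_first_order(3), subst sum_first_order(2))
         (simp add: sum.distrib[symmetric] case_prod_beta)
    also have "\<dots> = (\<Sum>(a, b, d)\<in>S \<times> S \<times> S. ?d a f * ?d b g * ?d d h *
        (\<Sum>e\<in>S. c a e x * ?d e (c b d) + c b e x * ?d e (c d a) + c d e x * ?d e (c a b)))"
      by (intro sum.cong refl) (auto simp: sum_distrib_left sum.distrib[symmetric] algebra_simps)
    also have "\<dots> = 0"
      by (intro sum.neutral) (auto simp: jacobi x)
    finally show ?thesis .
  qed
  then show ?thesis
    using dec[OF f(1,2,3)] dec[OF f(2,3,1)] dec[OF f(3,1,2)]
      sym[OF f(1,2,3)] sym[OF f(2,3,1)] sym[OF f(3,1,2)] by linarith
qed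

text \<open>The hypothesis \<open>jacobi\<close> is the Jacobi identity for three coordinate
  functions; \<open>coord_bracket_jacobi\<close> extends it to all smooth functions.\<close>

lemma poisson_bracket_smooth_bracket:
  assumes c: "\<And>a b. a \<in> S \<Longrightarrow> b \<in> S \<Longrightarrow> smooth S (c a b)"
    and skew: "\<And>a b x. a \<in> S \<Longrightarrow> b \<in> S \<Longrightarrow> c b a x = - c a b x"
    and jacobi: "\<And>a b d x. a \<in> S \<Longrightarrow> b \<in> S \<Longrightarrow> d \<in> S \<Longrightarrow> x \<in> coord_space S \<Longrightarrow>
      (\<Sum>e\<in>S. c a e x * partial_deriv e (c b d) x + c b e x * partial_deriv e (c d a) x
        + c d e x * partial_deriv e (c a b) x) = 0"
  shows "poisson_bracket S (smooth_bracket S c)"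
proof -
  let ?C = "smooth_functions S" and ?X = "coord_space S" and ?B = "smooth_bracket S c"
  have B: "?B f g x = coord_bracket S c f g x" if "f \<in> ?C" "g \<in> ?C" "x \<in> ?X" for f g x
    using that by (simp add: smooth_bracket_def)
  have C: "?B f g \<in> ?C" if "f \<in> ?C" "g \<in> ?C" for f g
    using that restrict_smooth_functions[OF smooth_coord_bracket[of S c f g]] c
    by (simp add: smooth_bracket_def smooth_functionsD)
  have BB: "?B f (?B g h) x = coord_bracket S c f (coord_bracket S c g h) x"
    if "f \<in> ?C" "g \<in> ?C" "h \<in> ?C" "x \<in> ?X" for f g h x
    unfolding B[OF that(1) C[OF that(2,3)] that(4)]
    by (rule coord_bracket_cong) (use that B in auto)
  have sk: "?B f g x = - ?B g f x" if "f \<in> ?C" "g \<in> ?C" "x \<in> ?X" for f g x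
  proof -
    have "coord_bracket S c f g x = (\<Sum>a\<in>S. \<Sum>b\<in>S. c b a x * partial_deriv b f x * partial_deriv a g x)"
      unfolding coord_bracket_def by (rule sum.swap)
    also have "\<dots> = (\<Sum>a\<in>S. \<Sum>b\<in>S. - (c a b x * partial_deriv a g x * partial_deriv b f x))"
    proof (intro sum.cong refl)
      fix a b assume "a \<in> S" "b \<in> S"
      then have "c b a x = - c a b x" by (rule skew)
      then show "c b a x * partial_deriv b f x * partial_deriv a g x
          = - (c a b x * partial_deriv a g x * partial_deriv b f x)" by simp
    qed
    also have "\<dots> = - coord_bracket S c g f x"
      by (simp add: coord_bracket_def sum_negf)
    finally show ?thesis using that B by simp
  qed
  have lin: "?B (\<lambda>y\<in>?X. r * f y + s * g y) h x = r * ?B f h x + s * ?B g h x"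
    if fgh: "f \<in> ?C" "g \<in> ?C" "h \<in> ?C" and x: "x \<in> ?X" for f g h x r s
  proof -
    note sm = smooth_functionsD[OF fgh(1)] smooth_functionsD[OF fgh(2)]
    note sm' = smooth_mult[OF smooth_const sm(1), of r] smooth_mult[OF smooth_const sm(2), of s]
    have "(\<lambda>y\<in>?X. r * f y + s * g y) \<in> ?C"
      by (rule restrict_smooth_functions[OF smooth_add[OF sm']])
    then have "?B (\<lambda>y\<in>?X. r * f y + s * g y) h x = coord_bracket S c (\<lambda>y\<in>?X. r * f y + s * g y) h x"
      using B fgh x by blast
    also have "\<dots> = coord_bracket S c (\<lambda>y. r * f y + s * g y) h x"
      by (rule coord_bracket_cong) (use x in auto)
    also have "\<dots> = r * coord_bracket S c f h x + s * coord_bracket S c g h x"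
      unfolding coord_bracket_def
      by (simp add: partial_deriv_add[OF sm' _ x] partial_deriv_cmult[OF sm(1) _ x] partial_deriv_cmult[OF sm(2) _ x]
           sum_distrib_left sum.distrib algebra_simps cong: sum.cong)
    finally show ?thesis using B fgh x by simp
  qed
  have leibniz: "?B (\<lambda>y\<in>?X. f y * g y) h x = f x * ?B g h x + g x * ?B f h x"
    if fgh: "f \<in> ?C" "g \<in> ?C" "h \<in> ?C" and x: "x \<in> ?X" for f g h x
  proof -
    note sm = smooth_functionsD[OF fgh(1)] smooth_functionsD[OF fgh(2)]
    have "(\<lambda>y\<in>?X. f y * g y) \<in> ?C"
      by (rule restrict_smooth_functions[OF smooth_mult[OF sm]])
    then have "?B (\<lambda>y\<in>?X. f y * g y) h x = coord_bracket S c (\<lambda>y\<in>?X. f y * g y) h x"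
      using B fgh x by blast
    also have "\<dots> = coord_bracket S c (\<lambda>y. f y * g y) h x"
      by (rule coord_bracket_cong) (use x in auto)
    also have "\<dots> = f x * coord_bracket S c g h x + g x * coord_bracket S c f h x"
      unfolding coord_bracket_def
      by (simp add: partial_deriv_mult[OF sm _ x] sum_distrib_left sum.distrib algebra_simps cong: sum.cong)
    finally show ?thesis using B fgh x by simp
  qed
  have jac: "?B f (?B g h) x + ?B g (?B h f) x + ?B h (?B f g) x = 0"
    if fgh: "f \<in> ?C" "g \<in> ?C" "h \<in> ?C" and x: "x \<in> ?X" for f g h x
    unfolding BB[OF fgh x] BB[OF fgh(2,3,1) x] BB[OF fgh(3,1,2) x]
    by (rule coord_bracket_jacobi[OF c skew jacobi smooth_functionsD[OF fgh(1)]
        smooth_functionsD[OF fgh(2)] smooth_functionsD[OF fgh(3)] x])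
  have "?B \<in> ?C \<rightarrow>\<^sub>E ?C \<rightarrow>\<^sub>E ?C"
    using C by (auto simp: PiE_iff smooth_bracket_def extensional_def)
  then show ?thesis
    unfolding poisson_bracket_def Let_def
    using sk lin leibniz jac by (intro conjI ballI allI)
qed

section \<open>The family of brackets on matrices\<close>

definition sg :: "nat \<Rightarrow> nat \<Rightarrow> real" where
  "sg a b = sgn (real a - real b)"

text \<open>
  \<open>cyc i i' j j'\<close> is twice the intersection number of the chords of the circle from \<open>i\<close> to \<open>j\<close> and
  from \<open>i'\<close> to \<open>j'\<close>, where a crossing at a common end counts half.
\<close>

definition cyc :: "nat \<Rightarrow> nat \<Rightarrow> nat \<Rightarrow> nat \<Rightarrow> real" where
  "cyc a b c d = sg a b + sg b c + sg c d + sg d a"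

text \<open>
  The contribution of the boundary arc from \<open>j\<close> to \<open>i\<close> to the sign of a path, which changes when
  the arc passes from label \<open>n\<close> to label 1.
\<close>

definition wrap_sign :: "nat \<Rightarrow> nat \<Rightarrow> real" where
  "wrap_sign i j = (if i < j then - 1 else 1)"

text \<open>This is the factor by which an exchange of tails changes the product of the signs of two
  paths, see \<open>sign_swap\<close>.\<close>

definition swap_sign :: "nat \<Rightarrow> nat \<Rightarrow> nat \<Rightarrow> nat \<Rightarrow> real" where
  "swap_sign i i' j j' = wrap_sign i j * wrap_sign i' j' * wrap_sign i j' * wrap_sign i' j"

text \<open>The order \<open>j' j\<close> in \<open>cyc\<close> is that of the pair after the
  exchange of tails, which joins \<open>i\<close> to \<open>j'\<close> and \<open>i'\<close> to
  \<open>j\<close>.\<close>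

definition par_coef :: "nat \<Rightarrow> nat \<Rightarrow> nat \<Rightarrow> nat \<Rightarrow> real" where
  "par_coef i i' j j' = cyc i i' j' j * swap_sign i i' j j'"

lemma sg_skew: "sg b a = - sg a b"
  by (simp add: sg_def sgn_real_def)

lemma sg_self [simp]: "sg a a = 0"
  by (simp add: sg_def)

lemma wrap_sign_sq: "wrap_sign i j * wrap_sign i j = 1"
  by (simp add: wrap_sign_def)

text \<open>No labels satisfy a < b < c < a, so the three signs around a triangle of distinct labels
  never agree; two of the products are - 1 and one is 1. If just two labels coincide, a single
  product - 1 is left.\<close>

lemma sg_cycle:
  "sg a b * sg b c + sg b c * sg c a + sg c a * sg a b = (if a = b \<and> b = c then 0 else - 1)"
  by (auto simp: sg_def sgn_real_def)

lemma cyc_skew: "cyc b a d c = - cyc a b c d"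
  using sg_skew[of a b] sg_skew[of c b] sg_skew[of d c] sg_skew[of a d] unfolding cyc_def by simp

lemma par_coef_skew: "par_coef b a d c = - par_coef a b c d"
  unfolding par_coef_def cyc_skew[of a b d c, symmetric] swap_sign_def by (simp add: cyc_skew[of b a])

text \<open>The left side is a signed sum of the relations \<open>sg_cycle\<close> for eight
  triangles. The six triangles with both kinds of labels come with opposite signs and cancel in
  pairs, so that only the triangle of the \<open>a\<close> and that of the \<open>b\<close> remain.
  The sum is the coefficient of a cubic monomial in the Jacobi identity.\<close>

lemma cyc_cubic:
  assumes "a1 \<noteq> b1" "a1 \<noteq> b2" "a1 \<noteq> b3" "a2 \<noteq> b1" "a2 \<noteq> b2" "a2 \<noteq> b3" "a3 \<noteq> b1" "a3 \<noteq> b2" "a3 \<noteq> b3"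
  shows "cyc a2 a3 b3 b2 * cyc a1 a3 b2 b1 + cyc a3 a1 b1 b3 * cyc a2 a1 b3 b2 + cyc a1 a2 b2 b1 * cyc a3 a2 b1 b3
    = (if a1 = a2 \<and> a2 = a3 then 0 else 1) - (if b1 = b2 \<and> b2 = b3 then 0 else 1)"
    (is "?L = _")
proof -
  have "?L = - (sg a1 a2 * sg a2 a3 + sg a2 a3 * sg a3 a1 + sg a3 a1 * sg a1 a2)
     + (sg b1 b2 * sg b2 b3 + sg b2 b3 * sg b3 b1 + sg b3 b1 * sg b1 b2)
     + (sg a1 a2 * sg a2 b1 + sg a2 b1 * sg b1 a1 + sg b1 a1 * sg a1 a2)
     + (sg a1 a3 * sg a3 b3 + sg a3 b3 * sg b3 a1 + sg b3 a1 * sg a1 a3)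
     + (sg a2 a3 * sg a3 b2 + sg a3 b2 * sg b2 a2 + sg b2 a2 * sg a2 a3)
     - (sg a1 b1 * sg b1 b3 + sg b1 b3 * sg b3 a1 + sg b3 a1 * sg a1 b1)
     - (sg a2 b1 * sg b1 b2 + sg b1 b2 * sg b2 a2 + sg b2 a2 * sg a2 b1)
     - (sg a3 b2 * sg b2 b3 + sg b2 b3 * sg b3 a3 + sg b3 a3 * sg a3 b2)"
    unfolding cyc_def sg_skew[of a2 a1] sg_skew[of a3 a1] sg_skew[of a3 a2]
      sg_skew[of b2 b1] sg_skew[of b3 b1] sg_skew[of b3 b2]
      sg_skew[of b1 a1] sg_skew[of b1 a2] sg_skew[of b1 a3]
      sg_skew[of b2 a1] sg_skew[of b2 a2] sg_skew[of b2 a3]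
      sg_skew[of b3 a1] sg_skew[of b3 a2] sg_skew[of b3 a3]
    by algebra
  then show ?thesis unfolding sg_cycle using assms by auto
qed

text \<open>Interchanging the indices 2 and 3 in \<open>cyc_cubic\<close> gives the coefficient of
  the other cubic monomial.\<close>

lemma cyc_cubic':
  assumes "a1 \<noteq> b1" "a1 \<noteq> b2" "a1 \<noteq> b3" "a2 \<noteq> b1" "a2 \<noteq> b2" "a2 \<noteq> b3" "a3 \<noteq> b1" "a3 \<noteq> b2" "a3 \<noteq> b3"
  shows "cyc a2 a3 b3 b2 * cyc a1 a2 b3 b1 + cyc a3 a1 b1 b3 * cyc a2 a3 b1 b2 + cyc a1 a2 b2 b1 * cyc a3 a1 b2 b3
    = (if b1 = b2 \<and> b2 = b3 then 0 else 1) - (if a1 = a2 \<and> a2 = a3 then 0 else 1)"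
proof -
  have "cyc a3 a2 b2 b3 * cyc a1 a2 b3 b1 + cyc a2 a1 b1 b2 * cyc a3 a1 b2 b3 + cyc a1 a3 b3 b1 * cyc a2 a3 b1 b2
    = (if a1 = a3 \<and> a3 = a2 then 0 else 1) - (if b1 = b3 \<and> b3 = b2 then 0 else 1)"
    by (rule cyc_cubic) (use assms in auto)
  moreover have "(a1 = a3 \<and> a3 = a2) = (a1 = a2 \<and> a2 = a3)" "(b1 = b3 \<and> b3 = b2) = (b1 = b2 \<and> b2 = b3)"
    by auto
  ultimately show ?thesis
    unfolding cyc_skew[of a2 a3 b3 b2] cyc_skew[of a1 a2 b2 b1] cyc_skew[of a3 a1 b1 b3] by simp
qed

definition mat_coef ::
    "real \<Rightarrow> real \<Rightarrow> (nat \<Rightarrow> nat) \<Rightarrow> (nat \<Rightarrow> nat) \<Rightarrow> nat \<times> nat \<Rightarrow> nat \<times> nat \<Rightarrow> (nat \<times> nat \<Rightarrow> real) \<Rightarrow> real" where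
  "mat_coef u v r q a b x =
     u * cyc (r (fst a)) (r (fst b)) (q (snd a)) (q (snd b)) * x a * x b
     + v * par_coef (r (fst a)) (r (fst b)) (q (snd a)) (q (snd b)) * x (fst a, snd b) * x (fst b, snd a)"

lemma mat_coef_skew: "mat_coef u v r q b a x = - mat_coef u v r q a b x"
  unfolding mat_coef_def cyc_skew[of "r (fst a)" "r (fst b)"] par_coef_skew[of "r (fst a)" "r (fst b)"]
  by (simp add: algebra_simps)

lemma smooth_mat_coef: "smooth S (mat_coef u v r q a b)"
  unfolding mat_coef_def by (intro smooth_add smooth_mult smooth_const smooth_coordinate)

lemma partial_deriv_coordinate: "partial_deriv a (\<lambda>x. x b) x = (if a = b then 1 else 0)"
  by (rule partial_deriv_eqI) auto

lemma partial_deriv_mat_coef: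
  assumes x: "x \<in> coord_space S" and e: "e \<in> S"
  shows "partial_deriv e (mat_coef u v r q a b) x =
     u * cyc (r (fst a)) (r (fst b)) (q (snd a)) (q (snd b)) *
       ((if e = a then x b else 0) + (if e = b then x a else 0))
     + v * par_coef (r (fst a)) (r (fst b)) (q (snd a)) (q (snd b)) *
       ((if e = (fst a, snd b) then x (fst b, snd a) else 0) + (if e = (fst b, snd a) then x (fst a, snd b) else 0))"
proof -
  have *: "partial_deriv e (\<lambda>x. k * x c * x d) x = k * ((if e = c then x d else 0) + (if e = d then x c else 0))"
    for k c d
  proof -
    have "smooth S (\<lambda>x. k * x c)" by (intro smooth_mult smooth_const smooth_coordinate)
    from partial_deriv_mult[OF this smooth_coordinate e x]
    show ?thesis
      unfolding partial_deriv_cmult[OF smooth_coordinate e x] partial_deriv_coordinate by simp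
  qed
  have sm: "smooth S (\<lambda>x. k * x c * x d)" for k c d
    by (intro smooth_mult smooth_const smooth_coordinate)
  show ?thesis
    unfolding mat_coef_def[abs_def] partial_deriv_add[OF sm sm e x] * ..
qed

text \<open>By the Leibniz rule, this is the bracket of the coordinate \<open>a\<close> with the
  quadratic function that is the bracket of \<open>b\<close> and \<open>d\<close>.\<close>

lemma sum_mat_coef_deriv:
  assumes S: "S = mat_index k m" and x: "x \<in> coord_space S" and abd: "a \<in> S" "b \<in> S" "d \<in> S"
  shows "(\<Sum>e\<in>S. mat_coef u v r q a e x * partial_deriv e (mat_coef u v r q b d) x) =
     u * cyc (r (fst b)) (r (fst d)) (q (snd b)) (q (snd d)) *
       (mat_coef u v r q a b x * x d + mat_coef u v r q a d x * x b)
     + v * par_coef (r (fst b)) (r (fst d)) (q (snd b)) (q (snd d)) *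
       (mat_coef u v r q a (fst b, snd d) x * x (fst d, snd b) + mat_coef u v r q a (fst d, snd b) x * x (fst b, snd d))"
proof -
  have fin: "finite S" unfolding S mat_index_def by simp
  have mem: "(fst b, snd d) \<in> S" "(fst d, snd b) \<in> S" using abd unfolding S mat_index_def by auto
  have pick: "(\<Sum>e\<in>S. g e * (if e = c then t else 0)) = g c * t" if "c \<in> S" for g c and t :: real
    using sum.delta[OF fin, of c "\<lambda>e. g e * t"] that by (simp add: if_distrib cong: if_cong)
  let ?M = "mat_coef u v r q a" and ?A = "u * cyc (r (fst b)) (r (fst d)) (q (snd b)) (q (snd d))"
    and ?C = "v * par_coef (r (fst b)) (r (fst d)) (q (snd b)) (q (snd d))"
  have "(\<Sum>e\<in>S. ?M e x * partial_deriv e (mat_coef u v r q b d) x) =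
    (\<Sum>e\<in>S. ?A * (?M e x * (if e = b then x d else 0)) + ?A * (?M e x * (if e = d then x b else 0))
      + ?C * (?M e x * (if e = (fst b, snd d) then x (fst d, snd b) else 0))
      + ?C * (?M e x * (if e = (fst d, snd b) then x (fst b, snd d) else 0)))"
  proof (intro sum.cong refl)
    fix e assume "e \<in> S"
    show "?M e x * partial_deriv e (mat_coef u v r q b d) x =
      ?A * (?M e x * (if e = b then x d else 0)) + ?A * (?M e x * (if e = d then x b else 0))
      + ?C * (?M e x * (if e = (fst b, snd d) then x (fst d, snd b) else 0))
      + ?C * (?M e x * (if e = (fst d, snd b) then x (fst b, snd d) else 0))"
      unfolding partial_deriv_mat_coef[OF x \<open>e \<in> S\<close>] by (simp only: distrib_left mult_ac add_ac)
  qed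
  also have "\<dots> = ?A * (?M b x * x d) + ?A * (?M d x * x b)
      + ?C * (?M (fst b, snd d) x * x (fst d, snd b)) + ?C * (?M (fst d, snd b) x * x (fst b, snd d))"
    unfolding sum.distrib sum_distrib_left[symmetric] pick[OF abd(2)] pick[OF abd(3)] pick[OF mem(1)] pick[OF mem(2)] ..
  finally show ?thesis by (simp only: distrib_left add_ac)
qed

text \<open>All terms with \<open>u\<close> cancel by skew-symmetry and the relations
  \<open>B\<close>. The terms with \<open>v * v\<close> leave two monomials with coefficients
  \<open>K * E1\<close> and \<open>- K * E2\<close>. If neither all three rows nor all three columns
  agree, \<open>K\<close> is 0; otherwise the two monomials and the two signs are the same.\<close>

lemma mat_coef_jacobi:
  assumes S: "S = mat_index k m" and x: "x \<in> coord_space S" and abd: "a \<in> S" "b \<in> S" "d \<in> S"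
    and r: "inj_on r {..<k}" and q: "inj_on q {..<m}" and rq: "\<And>i j. i < k \<Longrightarrow> j < m \<Longrightarrow> r i \<noteq> q j"
  shows "(\<Sum>e\<in>S. mat_coef u v r q a e x * partial_deriv e (mat_coef u v r q b d) x
      + mat_coef u v r q b e x * partial_deriv e (mat_coef u v r q d a) x
      + mat_coef u v r q d e x * partial_deriv e (mat_coef u v r q a b) x) = 0"
proof -
  obtain p1 c1 p2 c2 p3 c3 where a: "a = (p1, c1)" and b: "b = (p2, c2)" and d: "d = (p3, c3)"
    by (metis prod.exhaust)
  have lt: "p1 < k" "p2 < k" "p3 < k" "c1 < m" "c2 < m" "c3 < m"
    using abd unfolding a b d S mat_index_def by auto
  define E1 where "E1 = wrap_sign (r p1) (q c1) * wrap_sign (r p2) (q c2) * wrap_sign (r p3) (q c3)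
    * wrap_sign (r p1) (q c2) * wrap_sign (r p2) (q c3) * wrap_sign (r p3) (q c1)"
  define E2 where "E2 = wrap_sign (r p1) (q c1) * wrap_sign (r p2) (q c2) * wrap_sign (r p3) (q c3)
    * wrap_sign (r p1) (q c3) * wrap_sign (r p2) (q c1) * wrap_sign (r p3) (q c2)"
  define A where "A i j i' j' = cyc (r i) (r i') (q j) (q j')" for i j i' j'
  define C where "C i j i' j' = par_coef (r i) (r i') (q j) (q j')" for i j i' j'
  define D where "D i j i' j' = cyc (r i) (r i') (q j') (q j)" for i j i' j'
  define K where "K = (if r p1 = r p2 \<and> r p2 = r p3 then 0 else 1) - (if q c1 = q c2 \<and> q c2 = q c3 then 0 else (1::real))"
  have sw: "swap_sign (r p2) (r p3) (q c2) (q c3) * swap_sign (r p1) (r p3) (q c1) (q c2) = E1"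
    "swap_sign (r p3) (r p1) (q c3) (q c1) * swap_sign (r p2) (r p1) (q c2) (q c3) = E1"
    "swap_sign (r p1) (r p2) (q c1) (q c2) * swap_sign (r p3) (r p2) (q c3) (q c1) = E1"
    "swap_sign (r p2) (r p3) (q c2) (q c3) * swap_sign (r p1) (r p2) (q c1) (q c3) = E2"
    "swap_sign (r p3) (r p1) (q c3) (q c1) * swap_sign (r p2) (r p3) (q c2) (q c1) = E2"
    "swap_sign (r p1) (r p2) (q c1) (q c2) * swap_sign (r p3) (r p1) (q c3) (q c2) = E2"
    unfolding E1_def E2_def swap_sign_def by (simp_all add: wrap_sign_def)
  have CD: "par_coef i i' j j' * par_coef l l' o' o'' = (cyc i i' j' j * cyc l l' o'' o') * (swap_sign i i' j j' * swap_sign l l' o' o'')" for i i' j j' l l' o' o''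
    by (simp add: par_coef_def)
  have "r p1 \<noteq> q c1" "r p1 \<noteq> q c2" "r p1 \<noteq> q c3" "r p2 \<noteq> q c1" "r p2 \<noteq> q c2" "r p2 \<noteq> q c3" "r p3 \<noteq> q c1" "r p3 \<noteq> q c2" "r p3 \<noteq> q c3"
    using lt rq by auto
  note K1 = cyc_cubic[OF this, folded K_def] and K2 = cyc_cubic'[OF this]
  have K2: "cyc (r p2) (r p3) (q c3) (q c2) * cyc (r p1) (r p2) (q c3) (q c1) + cyc (r p3) (r p1) (q c1) (q c3) * cyc (r p2) (r p3) (q c1) (q c2)
      + cyc (r p1) (r p2) (q c2) (q c1) * cyc (r p3) (r p1) (q c2) (q c3) = - K"
    unfolding K2 K_def by simp
  have C1: "C p2 c2 p3 c3 * C p1 c1 p3 c2 + C p3 c3 p1 c1 * C p2 c2 p1 c3 + C p1 c1 p2 c2 * C p3 c3 p2 c1 = K * E1"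
    unfolding C_def CD sw K1[symmetric] by (simp add: distrib_right)
  have C2: "C p2 c2 p3 c3 * C p1 c1 p2 c3 + C p3 c3 p1 c1 * C p2 c2 p3 c1 + C p1 c1 p2 c2 * C p3 c3 p1 c2 = - K * E2"
    unfolding C_def CD sw K2[symmetric] by (simp add: distrib_right)
  have A: "A p2 c2 p1 c1 = - A p1 c1 p2 c2" "A p3 c3 p2 c2 = - A p2 c2 p3 c3" "A p1 c1 p3 c3 = - A p3 c3 p1 c1"
    "C p2 c2 p1 c1 = - C p1 c1 p2 c2" "C p3 c3 p2 c2 = - C p2 c2 p3 c3" "C p1 c1 p3 c3 = - C p3 c3 p1 c1"
    unfolding A_def C_def by (rule cyc_skew par_coef_skew)+
  \<comment> \<open>For a fixed first entry, \<open>A\<close> is a function of the row plus a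
    function of the column of the second entry.\<close>
  have B: "A p1 c1 p2 c3 = A p1 c1 p2 c2 + A p1 c1 p3 c3 - A p1 c1 p3 c2"
    "A p2 c2 p3 c1 = A p2 c2 p3 c3 + A p2 c2 p1 c1 - A p2 c2 p1 c3"
    "A p3 c3 p1 c2 = A p3 c3 p1 c1 + A p3 c3 p2 c2 - A p3 c3 p2 c1"
    unfolding A_def by (simp_all add: cyc_def)
  have tail: "K * (E1 * (x (p1, c2) * x (p2, c3) * x (p3, c1)) - E2 * (x (p1, c3) * x (p2, c1) * x (p3, c2))) = 0"
  proof -
    have rp: "r i = r j \<longleftrightarrow> i = j" if "i < k" "j < k" for i j using r that by (auto simp: inj_on_def)
    have qp: "q i = q j \<longleftrightarrow> i = j" if "i < m" "j < m" for i j using q that by (auto simp: inj_on_def)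
    have "(p1 = p2 \<and> p2 = p3) \<or> (c1 = c2 \<and> c2 = c3) \<or> K = 0"
      unfolding K_def rp[OF lt(1,2)] rp[OF lt(2,3)] qp[OF lt(4,5)] qp[OF lt(5,6)] by simp
    then show ?thesis
      by (elim disjE conjE) (simp_all add: E1_def E2_def)
  qed
  let ?X = "\<lambda>i j. x (i, j)"
  have "(\<Sum>e\<in>S. mat_coef u v r q a e x * partial_deriv e (mat_coef u v r q b d) x
      + mat_coef u v r q b e x * partial_deriv e (mat_coef u v r q d a) x
      + mat_coef u v r q d e x * partial_deriv e (mat_coef u v r q a b) x)
    = v * v * ((C p2 c2 p3 c3 * C p1 c1 p3 c2 + C p3 c3 p1 c1 * C p2 c2 p1 c3 + C p1 c1 p2 c2 * C p3 c3 p2 c1)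
         * (?X p1 c2 * ?X p2 c3 * ?X p3 c1)
      + (C p2 c2 p3 c3 * C p1 c1 p2 c3 + C p3 c3 p1 c1 * C p2 c2 p3 c1 + C p1 c1 p2 c2 * C p3 c3 p1 c2)
         * (?X p1 c3 * ?X p2 c1 * ?X p3 c2))"
    unfolding sum.distrib sum_mat_coef_deriv[OF S x abd] sum_mat_coef_deriv[OF S x abd(2,3,1)] sum_mat_coef_deriv[OF S x abd(3,1,2)]
    unfolding mat_coef_def a b d fst_conv snd_conv
    unfolding A_def[symmetric] C_def[symmetric] A B
    by algebra
  also have "\<dots> = v * v * (K * (E1 * (?X p1 c2 * ?X p2 c3 * ?X p3 c1) - E2 * (?X p1 c3 * ?X p2 c1 * ?X p3 c2)))"
    unfolding C1 C2 by (simp add: algebra_simps)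
  finally show ?thesis using tail by simp
qed

text \<open>Functions pulled back from the factor \<open>S\<close> have derivative 0 along
  \<open>A\<close> and pulled back derivatives along \<open>S\<close>. This serves the joint
  smoothness in the parameters and the point.\<close>

lemma smooth_compose_Inr:
  fixes S :: "'b set" and A :: "'a set"
  assumes f: "smooth S f"
  shows "smooth (A <+> S) (\<lambda>y. f (\<lambda>a\<in>S. y (Inr a)))"
proof (rule smooth_coinduct[where R = "\<lambda>g. \<exists>f. smooth S f \<and> g = (\<lambda>y. f (\<lambda>a\<in>S. y (Inr a)))"])
  show "\<exists>f'. smooth S f' \<and> (\<lambda>y. f (\<lambda>a\<in>S. y (Inr a))) = (\<lambda>y. f' (\<lambda>a\<in>S. y (Inr a)))"
    using f by (intro exI[of _ f]) simp
next
  have mem: "(\<lambda>a\<in>S. y (Inr a)) \<in> coord_space S" for y :: "'a + 'b \<Rightarrow> real"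
    by (simp add: coord_space_def)
  fix g :: "('a + 'b \<Rightarrow> real) \<Rightarrow> real"
  assume "\<exists>f. smooth S f \<and> g = (\<lambda>y. f (\<lambda>a\<in>S. y (Inr a)))"
  then obtain f where f: "smooth S f" and g: "g = (\<lambda>y. f (\<lambda>a\<in>S. y (Inr a)))" by (elim exE conjE) (rule that)
  have "continuous_on (coord_space (A <+> S)) (\<lambda>y. (\<lambda>a\<in>S. y (Inr a)) b)" for b
    by (cases "b \<in> S") (auto intro: continuous_on_subset[OF continuous_on_product_coordinates])
  then have "continuous_on (coord_space (A <+> S)) (\<lambda>y. \<lambda>a\<in>S. y (Inr a))"
    by (rule continuous_on_coordinatewise_then_product)
  from continuous_on_compose2[OF smooth_continuous_on[OF f] this] mem
  show "continuous_on (coord_space (A <+> S)) g"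
    unfolding g by blast
  fix e assume e: "e \<in> A <+> S"
  show "\<exists>h. (\<exists>f. smooth S f \<and> h = (\<lambda>y. f (\<lambda>a\<in>S. y (Inr a)))) \<and>
      (\<forall>x\<in>coord_space (A <+> S). ((\<lambda>t. g (x(e := t))) has_real_derivative h x) (at (x e)))"
  proof (cases e)
    case (Inl i)
    have "(\<lambda>a\<in>S. (x(e := t)) (Inr a)) = (\<lambda>a\<in>S. x (Inr a))" for x :: "'a + 'b \<Rightarrow> real" and t
      unfolding Inl by (rule restrict_ext) simp
    then have "((\<lambda>t. g (x(e := t))) has_real_derivative 0) (at (x e))" for x
      unfolding g by simp
    then show ?thesis by (intro exI[of _ "\<lambda>_. 0"] conjI exI[of _ "\<lambda>_. 0"] smooth_const ballI) auto
  next
    case (Inr b)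
    then have b: "b \<in> S" using e by auto
    have eq: "(\<lambda>a\<in>S. (x(e := t)) (Inr a)) = (\<lambda>a\<in>S. x (Inr a))(b := t)" for x :: "'a + 'b \<Rightarrow> real" and t
      unfolding Inr using b by (intro ext) auto
    have "((\<lambda>t. g (x(e := t))) has_real_derivative partial_deriv b f (\<lambda>a\<in>S. x (Inr a))) (at (x e))" for x
      using smooth_has_partial_deriv'[OF f b mem[of x]] b unfolding g eq by (simp add: Inr)
    then show ?thesis
      by (intro exI[of _ "\<lambda>x. partial_deriv b f (\<lambda>a\<in>S. x (Inr a))"] conjI exI[of _ "partial_deriv b f"]
          smooth_partial_deriv[OF f b] ballI) auto
  qed
qed

definition mat_family :: "nat \<Rightarrow> nat \<Rightarrow> (nat \<Rightarrow> nat) \<Rightarrow> (nat \<Rightarrow> nat) \<Rightarrow> (nat \<Rightarrow> real) \<Rightarrow> (nat \<times> nat) bracket" where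
  "mat_family k m r q \<theta> = smooth_bracket (mat_index k m) (mat_coef (\<theta> 0) (\<theta> 1) r q)"

lemma two_parametric_family_mat_family:
  assumes r: "inj_on r {..<k}" and q: "inj_on q {..<m}" and rq: "\<And>i j. i < k \<Longrightarrow> j < m \<Longrightarrow> r i \<noteq> q j"
  shows "two_parametric_family (mat_index k m) (mat_family k m r q)"
  unfolding two_parametric_family_def
proof (intro conjI ballI)
  fix \<theta> :: "nat \<Rightarrow> real"
  show "poisson_bracket (mat_index k m) (mat_family k m r q \<theta>)"
    unfolding mat_family_def
  proof (rule poisson_bracket_smooth_bracket)
    show "smooth (mat_index k m) (mat_coef (\<theta> 0) (\<theta> 1) r q a b)" for a b
      by (rule smooth_mat_coef)
    show "mat_coef (\<theta> 0) (\<theta> 1) r q b a x = - mat_coef (\<theta> 0) (\<theta> 1) r q a b x" for a b x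
      by (rule mat_coef_skew)
  qed (rule mat_coef_jacobi[OF refl _ _ _ _ r q rq])
next
  let ?S = "mat_index k m"
  fix f g assume "f \<in> smooth_functions ?S" "g \<in> smooth_functions ?S"
  note sm = smooth_functionsD[OF this(1)] smooth_functionsD[OF this(2)] and fg = this
  let ?\<rho> = "\<lambda>y. \<lambda>a\<in>?S. y (Inr a :: nat + nat \<times> nat)"
  have eq: "mat_family k m r q (\<lambda>i\<in>{..<2}. y (Inl i)) f g (?\<rho> y)
      = (\<Sum>a\<in>?S. \<Sum>b\<in>?S. mat_coef (y (Inl 0)) (y (Inl 1)) r q a b (?\<rho> y)
           * partial_deriv a f (?\<rho> y) * partial_deriv b g (?\<rho> y))" for y
    using fg by (simp add: mat_family_def smooth_bracket_def coord_space_def coord_bracket_def)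
  have coef: "smooth ({..<2} <+> ?S) (\<lambda>y. mat_coef (y (Inl 0)) (y (Inl 1)) r q a b (?\<rho> y))" if "a \<in> ?S" "b \<in> ?S" for a b
  proof -
    have \<rho>: "?\<rho> y a = y (Inr a)" "?\<rho> y b = y (Inr b)" "?\<rho> y (fst a, snd b) = y (Inr (fst a, snd b))"
      "?\<rho> y (fst b, snd a) = y (Inr (fst b, snd a))" for y
      using that by (auto simp: mat_index_def)
    show ?thesis
      unfolding mat_coef_def \<rho> by (intro smooth_add smooth_mult smooth_const smooth_coordinate)
  qed
  show "smooth ({..<2} <+> ?S) (\<lambda>y. mat_family k m r q (\<lambda>i\<in>{..<2}. y (Inl i)) f g (?\<rho> y))"
    unfolding eq by (intro smooth_sum smooth_mult coef smooth_compose_Inr smooth_partial_deriv sm)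
qed

section \<open>Intersection numbers of segments by swept angles\<close>

text \<open>This is the signed angle under which the segment \<open>e\<close> is seen from
  \<open>y\<close>. It is 0 at both ends of \<open>e\<close>, since a quotient by 0 is 0 and
  \<open>Arg 0\<close> is 0.\<close>

definition sweep :: "complex \<times> complex \<Rightarrow> complex \<Rightarrow> real" where
  "sweep e y = Arg ((snd e - y) / (fst e - y))"

text \<open>
  Both the angle swept by \<open>e\<close> as seen from a point and the difference over the ends of \<open>f\<close>
  telescope along paths.
\<close>

definition edge_int :: "complex \<times> complex \<Rightarrow> complex \<times> complex \<Rightarrow> real" where
  "edge_int e f = sweep e (fst f) - sweep e (snd f) + sweep f (snd e) - sweep f (fst e)"

text \<open>This is the value of \<open>edge_int\<close> for two segments that leave a common point
  in the directions \<open>u\<close> and \<open>w\<close>. The cut of \<open>Arg2pi\<close> is at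
  parallel directions, where the segments would overlap.\<close>

definition turn_angle :: "complex \<Rightarrow> complex \<Rightarrow> real" where
  "turn_angle u w = Arg2pi (w / u) - pi"

lemma edge_int_skew: "edge_int f e = - edge_int e f"
  by (simp add: edge_int_def)

lemma edge_int_self [simp]: "edge_int e e = 0"
  by (simp add: edge_int_def)

text \<open>On an open half plane with 0 on its boundary the argument varies by less than pi, so no
  multiple of 2 pi has to be corrected.\<close>

lemma Arg_divide_half_plane:
  assumes "Re (c * a) > 0" "Re (c * b) > 0"
  shows "Arg (b / a) = Arg (c * b) - Arg (c * a)"
proof -
  have nz: "c * a \<noteq> 0" "c * b \<noteq> 0" using assms by auto
  have "\<bar>Arg (c * a)\<bar> < pi / 2" "\<bar>Arg (c * b)\<bar> < pi / 2" using assms Arg_Re_pos by blast+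
  then have "Arg ((c * b) / (c * a)) = Arg (c * b) - Arg (c * a)"
    unfolding Arg_divide'[OF nz(2,1)] by auto
  then show ?thesis using nz by simp
qed

text \<open>A line separating the segments puts all vectors from points of \<open>f\<close> to
  points of \<open>e\<close> into one half plane. There the four sweeps are differences of one
  argument function at the four vectors between ends, and they cancel.\<close>

lemma edge_int_disjoint:
  assumes "closed_segment (fst e) (snd e) \<inter> closed_segment (fst f) (snd f) = {}"
  shows "edge_int e f = 0"
proof -
  obtain a b where ab: "\<forall>x\<in>closed_segment (fst e) (snd e). inner a x < b"
    "\<forall>x\<in>closed_segment (fst f) (snd f). inner a x > b"
    using separating_hyperplane_compact_closed[OF _ _ _ _ _ assms] by (auto simp: compact_imp_closed)
  have pos: "Re (- cnj a * (x - y)) > 0"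
    if "x \<in> closed_segment (fst e) (snd e)" "y \<in> closed_segment (fst f) (snd f)" for x y
  proof -
    have "inner a x < inner a y" using ab that by force
    then show ?thesis by (simp add: inner_complex_def algebra_simps)
  qed
  have neg: "(y - x) / (y' - x) = (x - y) / (x - y')" for x y y' :: complex
    using minus_divide_divide[of "x - y" "x - y'"] by simp
  have 1: "sweep e y = Arg (- cnj a * (snd e - y)) - Arg (- cnj a * (fst e - y))"
    if "y \<in> closed_segment (fst f) (snd f)" for y
    unfolding sweep_def by (rule Arg_divide_half_plane) (rule pos; use that in simp)+
  have 2: "sweep f x = Arg (- cnj a * (x - snd f)) - Arg (- cnj a * (x - fst f))"
    if "x \<in> closed_segment (fst e) (snd e)" for x
    unfolding sweep_def neg[of "snd f" x "fst f"] by (rule Arg_divide_half_plane) (rule pos; use that in simp)+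
  show ?thesis unfolding edge_int_def using 1 2 by simp
qed

text \<open>The quotient of \<open>1 - z\<close> by \<open>- z\<close> is
  \<open>1 - inverse z\<close>. Numerator and denominator differ by a real number and so lie on the
  same side of the real axis, whence their arguments subtract without a jump.\<close>

lemma Arg_one_minus:
  assumes z: "z \<notin> \<real> \<or> Re z < 0"
  shows "Arg (1 - z) - Arg (1 - inverse z) = Arg2pi z - pi"
proof -
  have z0: "z \<noteq> 0" and z1: "z \<noteq> 1" using z by auto
  have nz: "1 - z \<noteq> 0" "- z \<noteq> 0" using z0 z1 by auto
  have eq: "1 - inverse z = (1 - z) / (- z)" using z0 by (simp add: field_simps)
  have A: "Arg (- z) = Arg2pi z - pi"
  proof (rule Arg_unique'[of "cmod z"])
    have "z = rcis (cmod z) (Arg2pi z)"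
      using Arg2pi[of z] by (simp add: is_Arg_def rcis_def cis_conv_exp)
    moreover have "rcis (cmod z) (Arg2pi z - pi) = - rcis (cmod z) (Arg2pi z)"
      by (simp add: rcis_def cis_divide[symmetric])
    ultimately show "- z = rcis (cmod z) (Arg2pi z - pi)" by simp
    have "Arg2pi z \<noteq> 0" using z Arg2pi_eq_0 by force
    then show "Arg2pi z - pi \<in> {- pi<..pi}" using Arg2pi_ge_0[of z] Arg2pi_lt_2pi[of z] by auto
  qed (use z0 in simp)
  consider "Im z > 0" | "Im z < 0" | "z \<in> \<real>" "Re z < 0" using z complex_is_Real_iff by fastforce
  then have "\<bar>Arg (1 - z) - Arg (- z)\<bar> < pi"
  proof cases
    case 1
    then have "Arg (1 - z) < 0" "Arg (- z) < 0" by (simp_all add: Arg_neg_iff)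
    then show ?thesis using Arg_bounded[of "1 - z"] Arg_bounded[of "- z"] by auto
  next
    case 2
    then have "0 < Arg (1 - z)" "Arg (1 - z) < pi" "0 < Arg (- z)" "Arg (- z) < pi"
      using Arg_lt_pi[of "1 - z"] Arg_lt_pi[of "- z"] by auto
    then show ?thesis by auto
  next
    case 3
    then have "Arg (1 - z) = 0" "Arg (- z) = 0" by (auto simp: Arg_eq_0)
    then show ?thesis by simp
  qed
  then have "Arg (1 - inverse z) = Arg (1 - z) - Arg (- z)"
    unfolding eq Arg_divide'[OF nz] by auto
  then show ?thesis using A by simp
qed

lemma segments_meet_direction:
  assumes "closed_segment v p \<inter> closed_segment v q = {v}" "v \<noteq> p" "v \<noteq> q"
  shows "(q - v) / (p - v) \<notin> \<real> \<or> Re ((q - v) / (p - v)) < 0"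
proof (rule ccontr)
  assume "\<not> ?thesis"
  then obtain s where s: "(q - v) / (p - v) = of_real s" "s \<ge> 0" by (auto elim!: Reals_cases)
  then have q: "q - v = of_real s * (p - v)" using assms by (simp add: field_simps)
  have s0: "s > 0" using q assms s(2) by (cases "s = 0") auto
  \<comment> \<open>With this choice the point at parameter \<open>t <= 1\<close> on one segment is
    the point at parameter \<open>t * s <= 1\<close> on the other.\<close>
  define t where "t = 1 / max 1 s"
  have t: "0 < t" "t \<le> 1" "t * s \<le> 1" "0 < t * s" unfolding t_def using s0 by (auto simp: max_def)
  have "v + of_real (t * s) * (p - v) \<in> closed_segment v p"
    unfolding in_segment using t by (intro exI[of _ "t * s"]) (auto simp: scaleR_conv_of_real algebra_simps)
  moreover have "v + of_real (t * s) * (p - v) = v + of_real t * (q - v)" unfolding q by simp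
  moreover have "v + of_real t * (q - v) \<in> closed_segment v q"
    unfolding in_segment using t by (intro exI[of _ t]) (auto simp: scaleR_conv_of_real algebra_simps)
  ultimately have "v + of_real (t * s) * (p - v) \<in> closed_segment v p \<inter> closed_segment v q" by (metis IntI)
  then have "v + of_real (t * s) * (p - v) = v" unfolding assms(1) by simp
  then show False using t(4) assms(2) by auto
qed

lemma edge_int_common_tail:
  assumes "closed_segment v p \<inter> closed_segment v q = {v}" "v \<noteq> p" "v \<noteq> q"
  shows "edge_int (v, p) (v, q) = turn_angle (p - v) (q - v)"
proof -
  define z where "z = (q - v) / (p - v)"
  have pv: "p - v \<noteq> 0" "v - p \<noteq> 0" "q - v \<noteq> 0" "v - q \<noteq> 0" using assms by auto
  have "(q - p) / (v - p) = 1 - z" unfolding z_def using pv by (simp add: divide_simps) (simp add: algebra_simps)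
  moreover have "(p - q) / (v - q) = 1 - inverse z" unfolding z_def using pv by (simp add: divide_simps) (simp add: algebra_simps)
  ultimately have "edge_int (v, p) (v, q) = Arg (1 - z) - Arg (1 - inverse z)"
    by (simp add: edge_int_def sweep_def Arg_zero)
  then show ?thesis
    using Arg_one_minus[OF segments_meet_direction[OF assms, folded z_def]] by (simp add: turn_angle_def z_def)
qed

text \<open>\<open>Arg\<close> is odd under inversion except at the value pi, and a segment is seen
  under the angle pi only from a point strictly between its ends.\<close>

lemma sweep_reverse:
  assumes "y \<notin> open_segment a b"
  shows "sweep (b, a) y = - sweep (a, b) y"
proof (cases "y = a \<or> y = b")
  case True
  then show ?thesis by (auto simp: sweep_def Arg_zero)
next
  case False
  define z where "z = (b - y) / (a - y)"
  have "\<not> (z \<in> \<real> \<and> Re z < 0)"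
  proof
    assume "z \<in> \<real> \<and> Re z < 0"
    then obtain s where s: "z = of_real s" "s < 0" by (auto elim!: Reals_cases)
    have "b - y = z * (a - y)" using False unfolding z_def by (cases "a = y") auto
    then have "b - y = of_real s * (a - y)" using s(1) by simp
    then have "of_real (1 - s) * y = b - of_real s * a" by (simp add: algebra_simps)
    then have "of_real (1 - s) * y = of_real (1 - s) * ((1 - 1 / (1 - s)) *\<^sub>R a + (1 / (1 - s)) *\<^sub>R b)"
    proof -
      have "of_real (1 - s) * of_real (1 / (1 - s)) = (1 :: complex)"
        unfolding of_real_mult[symmetric] using s(2) by simp
      moreover have "of_real (1 - s) * of_real (1 - 1 / (1 - s)) = (- of_real s :: complex)"
        unfolding of_real_mult[symmetric] of_real_minus[symmetric] of_real_eq_iff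
        using s(2) by (simp add: field_simps)
      ultimately have "of_real (1 - s) * ((1 - 1 / (1 - s)) *\<^sub>R a + (1 / (1 - s)) *\<^sub>R b) = - of_real s * a + 1 * b"
        by (simp only: scaleR_conv_of_real distrib_left mult.assoc[symmetric])
      with \<open>of_real (1 - s) * y = b - of_real s * a\<close> show ?thesis by simp
    qed
    moreover have "of_real (1 - s) \<noteq> (0::complex)" using s(2) by (metis diff_gt_0_iff_gt less_trans not_less_iff_gr_or_eq of_real_eq_0_iff zero_less_one)
    ultimately have y: "y = (1 - 1 / (1 - s)) *\<^sub>R a + (1 / (1 - s)) *\<^sub>R b" by (metis mult_left_cancel)
    have "0 < 1 / (1 - s)" "1 / (1 - s) < 1" using s(2) by (auto simp: field_simps)
    then have "y \<in> closed_segment a b" unfolding in_segment y by (intro exI[of _ "1 / (1 - s)"]) auto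
    then show False using assms False by (simp add: open_segment_def)
  qed
  then have "Arg (inverse z) = - Arg z"
    unfolding Arg_inverse by (auto simp: Arg_real)
  then show ?thesis by (simp add: sweep_def z_def)
qed

lemma edge_int_reverse:
  assumes "fst f \<notin> open_segment a b" "snd f \<notin> open_segment a b"
  shows "edge_int (b, a) f = - edge_int (a, b) f"
  unfolding edge_int_def sweep_reverse[OF assms(1)] sweep_reverse[OF assms(2)] by simp

lemma edge_int_common_vertex:
  assumes seg: "closed_segment v p \<inter> closed_segment v q = {v}" "v \<noteq> p" "v \<noteq> q"
  shows "edge_int (v, p) (v, q) = turn_angle (p - v) (q - v)"
    "edge_int (p, v) (v, q) = - turn_angle (p - v) (q - v)"
    "edge_int (v, p) (q, v) = - turn_angle (p - v) (q - v)"
    "edge_int (p, v) (q, v) = turn_angle (p - v) (q - v)"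
proof -
  have qp: "q \<notin> open_segment v p" "p \<notin> open_segment v q" "v \<notin> open_segment v p" "v \<notin> open_segment v q"
    using seg by (auto simp: open_segment_def)
  show 1: "edge_int (v, p) (v, q) = turn_angle (p - v) (q - v)" by (rule edge_int_common_tail[OF seg])
  have r: "edge_int (p, v) f = - edge_int (v, p) f" if "f = (v, q) \<or> f = (q, v)" for f
    by (rule edge_int_reverse) (use qp that in auto)
  have r': "edge_int (q, v) (v, p) = - edge_int (v, q) (v, p)"
    by (rule edge_int_reverse) (use qp in auto)
  then have 2: "edge_int (v, p) (q, v) = - edge_int (v, p) (v, q)"
    using edge_int_skew[of "(v, p)"] by metis
  show "edge_int (p, v) (v, q) = - turn_angle (p - v) (q - v)"
    "edge_int (v, p) (q, v) = - turn_angle (p - v) (q - v)"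
    "edge_int (p, v) (q, v) = turn_angle (p - v) (q - v)"
    using 1 2 r by auto
qed

text \<open>Modulo 2 pi, the angles from \<open>a\<close> to \<open>c\<close> and from
  \<open>c\<close> to \<open>b\<close> add up to the angle from \<open>a\<close> to
  \<open>b\<close>. The exact angles therefore cancel, and what is left is a sign given by the
  cyclic order of the three directions. In the application \<open>c\<close> is the edge that two
  paths share at a vertex.\<close>

lemma turn_angle_fork:
  assumes nz: "a \<noteq> 0" "b \<noteq> 0" "c \<noteq> 0"
    and ne: "Arg2pi (c / a) > 0" "Arg2pi (c / b) > 0" "Arg2pi (c / a) \<noteq> Arg2pi (c / b)"
  shows "- turn_angle c b - turn_angle a c + turn_angle a b
    = (if Arg2pi (c / a) < Arg2pi (c / b) then pi else - pi)"
proof -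
  have "Arg2pi (b / c) = 2 * pi - Arg2pi (c / b)"
  proof -
    have "Arg2pi (b / c) = Arg2pi (inverse (c / b))" by simp
    also have "\<dots> = 2 * pi - Arg2pi (c / b)"
      using ne(2) by (simp only: Arg2pi_inverse) (auto simp: Arg2pi_real)
    finally show ?thesis .
  qed
  moreover have "(c / a) / (c / b) = b / a" using nz by simp
  then have "Arg2pi (c / a) - Arg2pi (c / b) = (if Arg2pi (c / b) \<le> Arg2pi (c / a) then Arg2pi (b / a) else Arg2pi (b / a) - 2 * pi)"
    using Arg2pi_diff[of "c / a" "c / b"] nz by simp
  ultimately show ?thesis
    using ne(3) unfolding turn_angle_def by (auto split: if_splits)
qed

text \<open>The disk lies on one side of its tangent at \<open>y\<close>, so the argument of points
  seen from \<open>y\<close> has a branch on the whole disk except \<open>y\<close>.\<close>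

lemma sweep_unit_disk:
  assumes "cmod y = 1" "cmod a \<le> 1" "cmod b \<le> 1" "a \<noteq> y" "b \<noteq> y"
  shows "sweep (a, b) y = Arg (1 - b / y) - Arg (1 - a / y)"
proof -
  have y0: "y \<noteq> 0" using assms by auto
  have "Re (1 - a / y) > 0" if "cmod a \<le> 1" "a \<noteq> y" for a
  proof -
    have "cmod (a / y) \<le> 1" using that assms by (simp add: norm_divide)
    then have "Re (a / y) \<le> 1" using complex_Re_le_cmod order_trans by blast
    moreover have "Re (a / y) \<noteq> 1"
    proof
      assume 1: "Re (a / y) = 1"
      then have "Im (a / y) = 0"
        using \<open>cmod (a / y) \<le> 1\<close> cmod_power2[of "a / y"] power_le_one[of "cmod (a / y)" 2] by auto
      with 1 have "a / y = 1" by (simp add: complex_eq_iff)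
      then show False using that y0 by simp
    qed
    ultimately show ?thesis by simp
  qed
  moreover have eq: "- inverse y * (c - y) = 1 - c / y" for c using y0 by (simp add: field_simps)
  ultimately have pos: "Re (- inverse y * (a - y)) > 0" "Re (- inverse y * (b - y)) > 0"
    unfolding eq using assms by blast+
  show ?thesis
    using Arg_divide_half_plane[OF pos] unfolding eq by (simp add: sweep_def)
qed

text \<open>By the inscribed angle theorem the angle is half the central angle. The term with the
  sign tells on which side of the base point the other point comes; it is the origin of the signs in
  \<open>cyc\<close>.\<close>

lemma Arg_one_minus_cis:
  assumes "\<bar>\<delta>\<bar> < 2 * pi" "\<delta> \<noteq> 0"
  shows "Arg (1 - cis \<delta>) = \<delta> / 2 - pi / 2 * sgn \<delta>"
proof -
  have eq: "1 - cis \<delta> = rcis (2 * sin (\<delta> / 2)) (\<delta> / 2 - pi / 2)"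
  proof -
    have c: "cis \<delta> = cis (\<delta> / 2) * cis (\<delta> / 2)" by (simp add: cis_mult)
    have d: "cis (\<delta> / 2 - pi / 2) = - \<i> * cis (\<delta> / 2)"
      unfolding cis_divide[symmetric] cis_pi_half by (simp add: field_simps)
    have "cis (\<delta> / 2) * (cis (- (\<delta> / 2)) - cis (\<delta> / 2)) = 1 - cis \<delta>"
      unfolding c by (simp add: right_diff_distrib cis_mult)
    moreover have "cis (- (\<delta> / 2)) - cis (\<delta> / 2) = - 2 * \<i> * sin (\<delta> / 2)" by (simp add: complex_eq_iff)
    ultimately show ?thesis unfolding rcis_def d by (simp add: algebra_simps)
  qed
  consider "\<delta> > 0" | "\<delta> < 0" using assms by linarith
  then show ?thesis
  proof cases
    case 1
    then have "sin (\<delta> / 2) > 0" using assms by (intro sin_gt_zero) auto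
    then show ?thesis
      unfolding eq using 1 assms by (subst Arg_rcis) auto
  next
    case 2
    then have s: "sin (\<delta> / 2) < 0" using assms sin_gt_zero[of "- \<delta> / 2"] by auto
    have "1 - cis \<delta> = rcis (- 2 * sin (\<delta> / 2)) (\<delta> / 2 + pi / 2)"
    proof -
      have "cis (\<delta> / 2 + pi / 2) = - cis (\<delta> / 2 - pi / 2)"
        by (simp add: complex_eq_iff cos_add sin_add cos_diff sin_diff)
      then show ?thesis unfolding eq rcis_def by simp
    qed
    then show ?thesis
      using 2 assms s by (simp only:) (subst Arg_rcis, auto)
  qed
qed

section \<open>Pairs of paths in a perfect network\<close>

lemma card_eq_oneD:
  assumes "card {x. P x} = 1"
  shows "\<exists>!x. P x"
proof -
  from assms obtain x where x: "{x. P x} = {x}" by (rule card_1_singletonE)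
  then show ?thesis by (intro ex1I[of _ x]) auto
qed

locale perfect_network =
  fixes n :: nat and I J :: "nat set" and N :: network
  assumes labels: "I \<union> J = {1..n}" "I \<inter> J = {}" and net: "N \<in> Net n I J"
begin

abbreviation "E \<equiv> parcs (graph N)"
abbreviation "bd \<equiv> bdry N"

lemma pair_digraph: "pair_digraph (graph N)"
  using net by (simp add: Net_def)

sublocale pair_digraph "graph N" by (rule pair_digraph)

lemma finite_E: "finite E" by (rule pair_finite_arcs)

lemma edge_vertices: "e \<in> E \<Longrightarrow> fst e \<in> pverts (graph N)" "e \<in> E \<Longrightarrow> snd e \<in> pverts (graph N)"
  by (rule arc_fst_in_verts arc_snd_in_verts; assumption)+

lemma edge_ends_neq: "e \<in> E \<Longrightarrow> fst e \<noteq> snd e"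
  by (rule pair_no_loops)

lemma in_degree_conv: "in_degree (graph N) v = card {e \<in> E. snd e = v}"
  by (simp add: in_degree_def in_arcs_def)

lemma out_degree_conv: "out_degree (graph N) v = card {e \<in> E. fst e = v}"
  by (simp add: out_degree_def out_arcs_def)

definition bangle :: "nat \<Rightarrow> real" where
  "bangle = (SOME \<theta>. strict_mono_on {1..n} \<theta> \<and>
        (\<forall>i\<in>{1..n}. \<forall>j\<in>{1..n}. \<theta> j < \<theta> i + 2 * pi) \<and>
        (\<forall>i\<in>{1..n}. bdry N i = cis (\<theta> i)))"

lemma bangle:
  "strict_mono_on {1..n} bangle"
  "i \<in> {1..n} \<Longrightarrow> j \<in> {1..n} \<Longrightarrow> bangle j < bangle i + 2 * pi"
  "i \<in> {1..n} \<Longrightarrow> bd i = cis (bangle i)"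
proof -
  have "boundary_on_circle n N" using net by (simp add: Net_def)
  from someI_ex[OF this[unfolded boundary_on_circle_def], folded bangle_def]
  show "strict_mono_on {1..n} bangle"
    "i \<in> {1..n} \<Longrightarrow> j \<in> {1..n} \<Longrightarrow> bangle j < bangle i + 2 * pi"
    "i \<in> {1..n} \<Longrightarrow> bd i = cis (bangle i)" by blast+
qed

lemma bangle_diff:
  assumes "i \<in> {1..n}" "j \<in> {1..n}"
  shows "sgn (bangle i - bangle j) = sg i j" "\<bar>bangle i - bangle j\<bar> < 2 * pi"
proof -
  consider "i < j" | "i = j" | "j < i" by linarith
  then show "sgn (bangle i - bangle j) = sg i j"
  proof cases
    case 1
    with strict_mono_onD[OF bangle(1) assms 1] show ?thesis by (simp add: sg_def)
  next
    case 3
    with strict_mono_onD[OF bangle(1) assms(2,1) 3] show ?thesis by (simp add: sg_def)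
  qed (simp add: sg_def)
  show "\<bar>bangle i - bangle j\<bar> < 2 * pi" using bangle(2)[OF assms] bangle(2)[OF assms(2,1)] by linarith
qed

lemma bd_ratio: "i \<in> {1..n} \<Longrightarrow> j \<in> {1..n} \<Longrightarrow> bd i / bd j = cis (bangle i - bangle j)"
  by (simp add: bangle(3) cis_divide)

lemma bd_inj: "i \<in> {1..n} \<Longrightarrow> j \<in> {1..n} \<Longrightarrow> bd i = bd j \<longleftrightarrow> i = j"
proof
  assume ij: "i \<in> {1..n}" "j \<in> {1..n}" "bd i = bd j"
  then have "cis (bangle i - bangle j) = 1" using bd_ratio[OF ij(1,2)] bangle(3) by simp
  then have c: "cos (bangle i - bangle j) = 1" by (simp add: complex_eq_iff)
  obtain k :: int where k: "bangle i - bangle j = of_int k * 2 * pi" using c cos_one_2pi_int by auto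
  have "\<bar>of_int k * 2 * pi\<bar> < 2 * pi" using bangle_diff(2)[OF ij(1,2)] k by simp
  then have "\<bar>real_of_int k\<bar> * (2 * pi) < 1 * (2 * pi)" by (simp add: abs_mult)
  then have "\<bar>real_of_int k\<bar> < 1" using mult_less_cancel_right_pos[of "2 * pi"] pi_gt_zero by simp
  then have "k = 0" by linarith
  then have "sg i j = 0" using bangle_diff(1)[OF ij(1,2)] k by simp
  then show "i = j" by (simp add: sg_def sgn_if split: if_splits)
qed simp

lemma bd_norm: "i \<in> {1..n} \<Longrightarrow> cmod (bd i) = 1"
  by (simp add: bangle(3))

lemma boundary_vertices_conv: "boundary_vertices n N = bd ` {1..n}"
  by (simp add: boundary_vertices_def)

lemma internal_norm:
  assumes "v \<in> internal_vertices n N"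
  shows "cmod v < 1"
proof -
  have "convex hull (boundary_vertices n N) \<subseteq> cball 0 1"
    by (rule hull_minimal) (auto simp: boundary_vertices_conv bd_norm)
  then have "interior (convex hull (boundary_vertices n N)) \<subseteq> interior (cball 0 1)"
    by (rule interior_mono)
  moreover have "v \<in> interior (convex hull (boundary_vertices n N))"
    using net assms by (auto simp: Net_def)
  ultimately have "v \<in> interior (cball 0 1)" by blast
  then show ?thesis by simp
qed

lemma internal_not_boundary: "v \<in> internal_vertices n N \<Longrightarrow> y \<in> {1..n} \<Longrightarrow> v \<noteq> bd y"
  using internal_norm bd_norm by force

lemma vertex_cases:
  assumes "v \<in> pverts (graph N)"
  obtains (boundary) y where "y \<in> {1..n}" "v = bd y" | (internal) "v \<in> internal_vertices n N"
  using assms unfolding internal_vertices_def boundary_vertices_conv by blast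

lemma vertex_norm: "v \<in> pverts (graph N) \<Longrightarrow> cmod v \<le> 1"
  by (erule vertex_cases) (auto simp: bd_norm dest: internal_norm)

lemma source_edges:
  assumes "i \<in> I"
  shows "\<not> (\<exists>e\<in>E. snd e = bd i)" "\<exists>!e. e \<in> E \<and> fst e = bd i"
proof -
  have c: "card {e \<in> E. snd e = bd i} = 0" "card {e \<in> E. fst e = bd i} = 1"
    using net assms unfolding in_degree_conv[symmetric] out_degree_conv[symmetric] by (auto simp: Net_def)
  show "\<exists>!e. e \<in> E \<and> fst e = bd i" by (rule card_eq_oneD[OF c(2)])
  show "\<not> (\<exists>e\<in>E. snd e = bd i)" using c(1) finite_E by auto
qed

lemma sink_edges:
  assumes "j \<in> J"
  shows "\<not> (\<exists>e\<in>E. fst e = bd j)" "\<exists>!e. e \<in> E \<and> snd e = bd j"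
proof -
  have c: "card {e \<in> E. fst e = bd j} = 0" "card {e \<in> E. snd e = bd j} = 1"
    using net assms unfolding in_degree_conv[symmetric] out_degree_conv[symmetric] by (auto simp: Net_def)
  show "\<exists>!e. e \<in> E \<and> snd e = bd j" by (rule card_eq_oneD[OF c(2)])
  show "\<not> (\<exists>e\<in>E. fst e = bd j)" using c(1) finite_E by auto
qed

lemma boundary_edge_unique:
  assumes "y \<in> {1..n}" "e \<in> E" "f \<in> E" "fst e = bd y \<or> snd e = bd y" "fst f = bd y \<or> snd f = bd y"
  shows "e = f"
proof -
  have "y \<in> I \<or> y \<in> J" using labels(1) assms(1) by blast
  then show ?thesis using source_edges[of y] sink_edges[of y] assms(2-) by metis
qed

lemma internal_edges:
  assumes "v \<in> internal_vertices n N"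
  shows "card {e \<in> E. snd e = v} + card {e \<in> E. fst e = v} = 3" "white n N v \<or> black n N v"
    "white n N v \<Longrightarrow> \<not> black n N v"
    "white n N v \<Longrightarrow> \<exists>!e. e \<in> E \<and> snd e = v"
    "black n N v \<Longrightarrow> \<exists>!e. e \<in> E \<and> fst e = v"
proof -
  show 1: "card {e \<in> E. snd e = v} + card {e \<in> E. fst e = v} = 3" and "white n N v \<or> black n N v"
    using net assms unfolding in_degree_conv[symmetric] out_degree_conv[symmetric] by (auto simp: Net_def)
  show "white n N v \<Longrightarrow> \<not> black n N v"
    using 1 unfolding white_def black_def in_degree_conv out_degree_conv by simp
  show "white n N v \<Longrightarrow> \<exists>!e. e \<in> E \<and> snd e = v"
    unfolding white_def in_degree_conv by (elim conjE card_eq_oneD)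
  show "black n N v \<Longrightarrow> \<exists>!e. e \<in> E \<and> fst e = v"
    unfolding black_def out_degree_conv by (elim conjE card_eq_oneD)
qed

lemma drawing_inter:
  assumes "e \<in> E" "f \<in> E" "e \<noteq> f"
  shows "closed_segment (fst e) (snd e) \<inter> closed_segment (fst f) (snd f) \<subseteq> {fst e, snd e} \<inter> {fst f, snd f}"
  using net assms unfolding Net_def straight_plane_drawing_def by blast

text \<open>Opposite edges between the same two vertices are allowed in a digraph, but as straight
  segments they would coincide and meet in their midpoint.\<close>

lemma not_both_ends:
  assumes "e \<in> E" "f \<in> E" "e \<noteq> f"
  shows "\<not> (fst e \<in> {fst f, snd f} \<and> snd e \<in> {fst f, snd f})"
proof
  assume "fst e \<in> {fst f, snd f} \<and> snd e \<in> {fst f, snd f}"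
  then have eq: "closed_segment (fst e) (snd e) = closed_segment (fst f) (snd f)"
    using edge_ends_neq[OF assms(1)] by (auto simp: closed_segment_commute)
  have "midpoint (fst e) (snd e) \<in> {fst e, snd e}"
    using drawing_inter[OF assms] unfolding eq[symmetric] Int_absorb
    using subsetD[OF _ midpoint_in_closed_segment] by blast
  then show False using edge_ends_neq[OF assms(1)] midpoint_eq_endpoint by auto
qed

lemma segments_at_vertex:
  assumes "e \<in> E" "f \<in> E" "e \<noteq> f" "v \<in> {fst e, snd e}" "v \<in> {fst f, snd f}"
  shows "closed_segment (fst e) (snd e) \<inter> closed_segment (fst f) (snd f) = {v}"
  using drawing_inter[OF assms(1-3)] not_both_ends[OF assms(1-3)] not_both_ends[OF assms(2,1) assms(3)[symmetric]] assms(4,5)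
  by auto

text \<open>
  Edges meet in common vertices only, so that the intersection number of two edges splits into
  contributions of pairs of flags at the same vertex.
\<close>

definition flag_int :: "flag \<Rightarrow> flag \<Rightarrow> real" where
  "flag_int a b = (if fst a = fst b then edge_int (snd a) (snd b) else 0)"

lemma edge_int_flags:
  assumes "e \<in> E" "f \<in> E"
  shows "edge_int e f = flag_int (fst e, e) (fst f, f) + flag_int (fst e, e) (snd f, f)
    + flag_int (snd e, e) (fst f, f) + flag_int (snd e, e) (snd f, f)"
proof (cases "e = f")
  case True
  then show ?thesis by (simp add: flag_int_def)
next
  case False
  show ?thesis
  proof (cases "{fst e, snd e} \<inter> {fst f, snd f} = {}")
    case True
    then have "closed_segment (fst e) (snd e) \<inter> closed_segment (fst f) (snd f) = {}"
      using drawing_inter[OF assms False] by blast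
    then have "edge_int e f = 0" by (rule edge_int_disjoint)
    then show ?thesis by (simp add: flag_int_def)
  next
    case nd: False
    then show ?thesis
      using not_both_ends[OF assms False] not_both_ends[OF assms(2,1) False[symmetric]]
        edge_ends_neq[OF assms(1)] edge_ends_neq[OF assms(2)]
      unfolding flag_int_def by auto
  qed
qed

lemma flag_int_boundary:
  assumes "y \<in> {1..n}" "e \<in> E" "f \<in> E" "bd y \<in> {fst e, snd e}" "b = (fst f, f) \<or> b = (snd f, f)"
  shows "flag_int (bd y, e) b = 0" "flag_int b (bd y, e) = 0"
  using boundary_edge_unique[OF assms(1-3)] assms(4,5) unfolding flag_int_def by auto

definition edge_dir :: "complex \<Rightarrow> edge \<Rightarrow> complex" where
  "edge_dir v e = flag_direction (v, e)"

lemma edge_dir_simps: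
  "e \<in> E \<Longrightarrow> edge_dir (fst e) e = snd e - fst e"
  "e \<in> E \<Longrightarrow> edge_dir (snd e) e = fst e - snd e"
  using edge_ends_neq[of e] by (auto simp: edge_dir_def flag_direction_def case_prod_beta)

lemma edge_dir_nonzero: "e \<in> E \<Longrightarrow> v \<in> {fst e, snd e} \<Longrightarrow> edge_dir v e \<noteq> 0"
  using edge_dir_simps[of e] edge_ends_neq[of e] by auto

lemma edge_int_at_vertex:
  assumes "e \<in> E" "f \<in> E" "e \<noteq> f"
  shows "fst e = v \<Longrightarrow> fst f = v \<Longrightarrow> edge_int e f = turn_angle (edge_dir v e) (edge_dir v f)"
    "snd e = v \<Longrightarrow> fst f = v \<Longrightarrow> edge_int e f = - turn_angle (edge_dir v e) (edge_dir v f)"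
    "fst e = v \<Longrightarrow> snd f = v \<Longrightarrow> edge_int e f = - turn_angle (edge_dir v e) (edge_dir v f)"
    "snd e = v \<Longrightarrow> snd f = v \<Longrightarrow> edge_int e f = turn_angle (edge_dir v e) (edge_dir v f)"
proof -
  obtain a b c d where ef: "e = (a, b)" "f = (c, d)" by (metis prod.exhaust)
  note seg = segments_at_vertex[OF assms, of v]
  note ends = edge_ends_neq[OF assms(1)] edge_ends_neq[OF assms(2)]
  note dir = edge_dir_simps[OF assms(1)] edge_dir_simps[OF assms(2)]
  show "fst e = v \<Longrightarrow> fst f = v \<Longrightarrow> edge_int e f = turn_angle (edge_dir v e) (edge_dir v f)"
    using edge_int_common_vertex(1)[of v b d] seg ends dir unfolding ef by auto
  show "snd e = v \<Longrightarrow> fst f = v \<Longrightarrow> edge_int e f = - turn_angle (edge_dir v e) (edge_dir v f)"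
    using edge_int_common_vertex(2)[of v a d] seg ends dir unfolding ef by (auto simp: closed_segment_commute)
  show "fst e = v \<Longrightarrow> snd f = v \<Longrightarrow> edge_int e f = - turn_angle (edge_dir v e) (edge_dir v f)"
    using edge_int_common_vertex(3)[of v b c] seg ends dir unfolding ef by (auto simp: closed_segment_commute)
  show "snd e = v \<Longrightarrow> snd f = v \<Longrightarrow> edge_int e f = turn_angle (edge_dir v e) (edge_dir v f)"
    using edge_int_common_vertex(4)[of v a c] seg ends dir unfolding ef by (auto simp: closed_segment_commute)
qed

lemma edge_dir_ratio:
  assumes "e \<in> E" "f \<in> E" "e \<noteq> f" "v \<in> {fst e, snd e}" "v \<in> {fst f, snd f}"
  shows "Arg2pi (edge_dir v f / edge_dir v e) > 0"
proof -
  define p where "p = v + edge_dir v e"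
  define q where "q = v + edge_dir v f"
  have p: "p = (if v = fst e then snd e else fst e)" and q: "q = (if v = fst f then snd f else fst f)"
    unfolding p_def q_def using edge_dir_simps[OF assms(1)] edge_dir_simps[OF assms(2)] assms(4,5) by auto
  have "closed_segment v p = closed_segment (fst e) (snd e)" "closed_segment v q = closed_segment (fst f) (snd f)"
    unfolding p q using assms(4,5) by (metis closed_segment_commute insertE singletonD)+
  then have "closed_segment v p \<inter> closed_segment v q = {v}"
    by (simp only: segments_at_vertex[OF assms])
  moreover have "v \<noteq> p" "v \<noteq> q" unfolding p_def q_def
    using edge_dir_nonzero[OF assms(1,4)] edge_dir_nonzero[OF assms(2,5)] by auto
  ultimately have "(q - v) / (p - v) \<notin> \<real> \<or> Re ((q - v) / (p - v)) < 0"
    by (rule segments_meet_direction)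
  then have "edge_dir v f / edge_dir v e \<notin> \<real> \<or> Re (edge_dir v f / edge_dir v e) < 0"
    unfolding p_def q_def by simp
  then have "Arg2pi (edge_dir v f / edge_dir v e) \<noteq> 0" using Arg2pi_eq_0 by force
  then show ?thesis using Arg2pi_ge_0[of "edge_dir v f / edge_dir v e"] by linarith
qed

end

section \<open>Regrouping sums over edges of paths by corners\<close>

abbreviation corners :: "'a list \<Rightarrow> ('a \<times> 'a) list" where
  "corners P \<equiv> zip P (tl P)"

lemma corners_Cons: "P \<noteq> [] \<Longrightarrow> zip (e # P) P = (e, hd P) # corners P"
  by (cases P) auto

lemma sum_list_swap:
  fixes F :: "'a \<Rightarrow> 'b \<Rightarrow> real"
  shows "(\<Sum>x\<leftarrow>xs. \<Sum>y\<leftarrow>ys. F x y) = (\<Sum>y\<leftarrow>ys. \<Sum>x\<leftarrow>xs. F x y)"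
  by (induction xs) (simp_all add: sum_list_addf)

lemma sum_list_edges_corners:
  fixes g h :: "'a \<Rightarrow> real"
  assumes "P \<noteq> []"
  shows "(\<Sum>e\<leftarrow>P. g e + h e) = g (hd P) + h (last P) + (\<Sum>(e, e')\<leftarrow>corners P. h e + g e')"
  using assms
proof (induction P)
  case (Cons e P)
  then show ?case by (cases "P = []") (simp_all add: corners_Cons)
qed simp

lemma pcas_telescope:
  fixes h :: "'a \<Rightarrow> real"
  shows "pcas u P v \<Longrightarrow> (\<Sum>e\<leftarrow>P. h (fst e) - h (snd e)) = h u - h v"
  by (induction P arbitrary: u) auto

lemma pcas_corners: "pcas u P v \<Longrightarrow> (e, e') \<in> set (corners P) \<Longrightarrow> snd e = fst e'"
proof (induction P arbitrary: u)
  case (Cons f P)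
  show ?case
  proof (cases "P = []")
    case False
    then have "fst (hd P) = snd f" using Cons.prems(1) by (cases P) simp_all
    moreover have "(e, e') = (f, hd P) \<or> (e, e') \<in> set (corners P)"
      using Cons.prems(2) False by (simp add: corners_Cons)
    moreover have "pcas (snd f) P v" using Cons.prems(1) by simp
    ultimately show ?thesis using Cons.IH by auto
  qed (use Cons.prems in simp)
qed simp

lemma set_corners: "(e, e') \<in> set (corners P) \<Longrightarrow> e \<in> set P \<and> e' \<in> set P"
  by (cases P) (auto dest: set_zip_leftD set_zip_rightD)

text \<open>\<open>K\<close> is a form on flags. Both the intersection numbers and the coefficients
  of the flag bracket are such forms, so one lemma regroups either of them from edges to the inner
  vertices of the paths.\<close>

definition corner_sum :: "(flag \<Rightarrow> flag \<Rightarrow> real) \<Rightarrow> edge \<times> edge \<Rightarrow> edge \<times> edge \<Rightarrow> real" where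
  "corner_sum K = (\<lambda>(e, e') (f, f').
     K (snd e, e) (snd f, f) + K (snd e, e) (fst f', f') + K (fst e', e') (snd f, f) + K (fst e', e') (fst f', f'))"

text \<open>For the coefficients of the flag bracket this is the bracket of log |w_e| and log |w_f|,
  as the logarithm of an edge weight is the sum of those of its two flag coordinates.\<close>

definition edge_form :: "(flag \<Rightarrow> flag \<Rightarrow> real) \<Rightarrow> edge \<Rightarrow> edge \<Rightarrow> real" where
  "edge_form K e f = K (fst e, e) (fst f, f) + K (fst e, e) (snd f, f) + K (snd e, e) (fst f, f) + K (snd e, e) (snd f, f)"

text \<open>Each inner vertex of a path collects the head of one edge and the tail of the next. The
  first tail and the last head belong to no corner; the hypotheses make them contribute 0.\<close>

lemma sum_edge_form_corners:
  assumes P: "P \<noteq> []" "P' \<noteq> []"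
    and z: "\<And>f b. f \<in> set P' \<Longrightarrow> b = (fst f, f) \<or> b = (snd f, f) \<Longrightarrow>
        K (fst (hd P), hd P) b = 0 \<and> K (snd (last P), last P) b = 0"
    and z': "\<And>e a. e \<in> set P \<Longrightarrow> a = (fst e, e) \<or> a = (snd e, e) \<Longrightarrow>
        K a (fst (hd P'), hd P') = 0 \<and> K a (snd (last P'), last P') = 0"
  shows "(\<Sum>e\<leftarrow>P. \<Sum>f\<leftarrow>P'. edge_form K e f) = (\<Sum>c\<leftarrow>corners P. \<Sum>c'\<leftarrow>corners P'. corner_sum K c c')"
proof -
  define G where "G a = (\<Sum>(f, f')\<leftarrow>corners P'. K a (snd f, f) + K a (fst f', f'))" for a
  have G: "(\<Sum>f\<leftarrow>P'. K a (fst f, f) + K a (snd f, f)) = G a" if "e \<in> set P" "a = (fst e, e) \<or> a = (snd e, e)" for a e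
    using sum_list_edges_corners[OF P(2), of "\<lambda>f. K a (fst f, f)" "\<lambda>f. K a (snd f, f)"] z'[OF that] unfolding G_def by simp
  have "(\<Sum>e\<leftarrow>P. \<Sum>f\<leftarrow>P'. edge_form K e f) = (\<Sum>e\<leftarrow>P. G (fst e, e) + G (snd e, e))"
  proof (rule arg_cong[of _ _ sum_list], rule map_cong[OF refl])
    fix e assume e: "e \<in> set P"
    have "(\<Sum>f\<leftarrow>P'. edge_form K e f) = (\<Sum>f\<leftarrow>P'. (K (fst e, e) (fst f, f) + K (fst e, e) (snd f, f))
        + (K (snd e, e) (fst f, f) + K (snd e, e) (snd f, f)))"
      unfolding edge_form_def by (simp add: add.assoc)
    also have "\<dots> = (\<Sum>f\<leftarrow>P'. K (fst e, e) (fst f, f) + K (fst e, e) (snd f, f))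
        + (\<Sum>f\<leftarrow>P'. K (snd e, e) (fst f, f) + K (snd e, e) (snd f, f))"
      by (rule sum_list_addf)
    also have "\<dots> = G (fst e, e) + G (snd e, e)"
      using G[OF e disjI1[OF refl]] G[OF e disjI2[OF refl]] by simp
    finally show "(\<Sum>f\<leftarrow>P'. edge_form K e f) = G (fst e, e) + G (snd e, e)" .
  qed
  also have "\<dots> = (\<Sum>(e, e')\<leftarrow>corners P. G (snd e, e) + G (fst e', e'))"
  proof -
    have "G a = 0" if "a = (fst (hd P), hd P) \<or> a = (snd (last P), last P)" for a
    proof -
      have "K a (snd f, f) + K a (fst f', f') = 0" if "(f, f') \<in> set (corners P')" for f f'
        using z[OF conjunct1[OF set_corners[OF that]] disjI2[OF refl]]
          z[OF conjunct2[OF set_corners[OF that]] disjI1[OF refl]] \<open>a = _ \<or> a = _\<close>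
        by (elim disjE) simp_all
      then have "G a = (\<Sum>_\<leftarrow>corners P'. 0)"
        unfolding G_def by (intro arg_cong[of _ _ sum_list] map_cong refl) auto
      then show ?thesis by simp
    qed
    then show ?thesis
      using sum_list_edges_corners[OF P(1), of "\<lambda>e. G (fst e, e)" "\<lambda>e. G (snd e, e)"] by simp
  qed
  also have "\<dots> = (\<Sum>c\<leftarrow>corners P. \<Sum>c'\<leftarrow>corners P'. corner_sum K c c')"
    unfolding G_def sum_list_addf[symmetric] corner_sum_def
    by (intro arg_cong[of _ _ sum_list] map_cong refl) (simp add: case_prod_beta add.assoc)
  finally show ?thesis .
qed

context perfect_network
begin

definition walks :: "nat \<Rightarrow> nat \<Rightarrow> edge list set" where
  "walks i j = {P. pre_digraph.awalk (graph N) (bd i) P (bd j)}"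

lemma walksD:
  assumes "P \<in> walks i j" "i \<in> I" "j \<in> J"
  shows "P \<noteq> []" "set P \<subseteq> E" "pcas (bd i) P (bd j)" "fst (hd P) = bd i" "snd (last P) = bd j"
proof -
  have w: "awalk (bd i) P (bd j)" using assms(1) by (simp add: walks_def)
  then show P: "set P \<subseteq> E" "pcas (bd i) P (bd j)" unfolding awalk_def by auto
  have "bd i \<noteq> bd j" using assms labels bd_inj[of i j] by blast
  then show ne: "P \<noteq> []" using P(2) by auto
  show "fst (hd P) = bd i" using P(2) ne by (cases P) auto
  have "pcas u P v \<Longrightarrow> P \<noteq> [] \<Longrightarrow> snd (last P) = v" for u v
    by (induction P arbitrary: u) auto
  then show "snd (last P) = bd j" using P(2) ne by blast
qed

lemma in_range: "i \<in> I \<Longrightarrow> i \<in> {1..n}" "j \<in> J \<Longrightarrow> j \<in> {1..n}"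
  using labels by blast+

lemma corner_vertex:
  assumes "P \<in> walks i j" "i \<in> I" "j \<in> J" "(e, e') \<in> set (corners P)"
  shows "e \<in> E" "e' \<in> E" "snd e = fst e'" "snd e \<in> internal_vertices n N"
proof -
  note w = walksD[OF assms(1-3)]
  show e: "e \<in> E" "e' \<in> E" using set_corners[OF assms(4)] w(2) by auto
  show v: "snd e = fst e'" by (rule pcas_corners[OF w(3) assms(4)])
  have "snd e \<noteq> bd y" if y: "y \<in> {1..n}" for y
  proof -
    have "y \<in> I \<or> y \<in> J" using labels(1) y by blast
    then show ?thesis using source_edges(1)[of y] sink_edges(1)[of y] e v by metis
  qed
  then show "snd e \<in> internal_vertices n N"
    using edge_vertices(2)[OF e(1)] by (meson vertex_cases)
qed

text \<open>
  The angle swept by the edge at a boundary vertex, as seen from that vertex, is 0 since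
  \<open>x / 0 = 0\<close> and \<open>Arg 0 = 0\<close>. Giving the vertex itself the angle of its neighbour makes the
  sweeps telescope along paths starting or ending there, too.
\<close>

definition nbr :: "nat \<Rightarrow> complex" where
  "nbr y = (SOME z. \<exists>e\<in>E. e = (bd y, z) \<or> e = (z, bd y))"

lemma nbr:
  assumes "y \<in> {1..n}" "e \<in> E" "fst e = bd y \<or> snd e = bd y"
  shows "fst e = bd y \<Longrightarrow> snd e = nbr y" "snd e = bd y \<Longrightarrow> fst e = nbr y"
proof -
  obtain a b where e: "e = (a, b)" by (metis prod.exhaust)
  have "\<exists>z. \<exists>e\<in>E. e = (bd y, z) \<or> e = (z, bd y)" using assms unfolding e by auto
  from someI_ex[OF this, folded nbr_def] obtain f where f: "f \<in> E" "f = (bd y, nbr y) \<or> f = (nbr y, bd y)" by blast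
  then have "f = e" using boundary_edge_unique[OF assms(1) f(1) assms(2)] assms(3) by auto
  then show "fst e = bd y \<Longrightarrow> snd e = nbr y" "snd e = bd y \<Longrightarrow> fst e = nbr y"
    using f(2) edge_ends_neq[OF assms(2)] by auto
qed

definition angle_at :: "nat \<Rightarrow> complex \<Rightarrow> real" where
  "angle_at y z = Arg (1 - (if z = bd y then nbr y else z) / bd y)"

lemma sweep_boundary:
  assumes "y \<in> {1..n}" "e \<in> E"
  shows "sweep e (bd y) = angle_at y (snd e) - angle_at y (fst e)"
proof (cases "fst e = bd y \<or> snd e = bd y")
  case True
  then show ?thesis using nbr[OF assms True] edge_ends_neq[OF assms(2)]
    by (auto simp: sweep_def angle_at_def Arg_zero)
next
  case False
  have "sweep (fst e, snd e) (bd y) = Arg (1 - snd e / bd y) - Arg (1 - fst e / bd y)"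
    by (rule sweep_unit_disk) (use False assms in \<open>auto simp: bd_norm intro: vertex_norm edge_vertices\<close>)
  then show ?thesis using False by (simp add: angle_at_def)
qed

lemma angle_at_boundary:
  assumes "y \<in> {1..n}" "i \<in> {1..n}" "i \<noteq> y"
  shows "angle_at y (bd i) = (bangle i - bangle y) / 2 - pi / 2 * sg i y"
proof -
  have "bd i \<noteq> bd y" using bd_inj assms by blast
  then have "angle_at y (bd i) = Arg (1 - cis (bangle i - bangle y))"
    using assms by (simp add: angle_at_def bd_ratio)
  also have "\<dots> = (bangle i - bangle y) / 2 - pi / 2 * sgn (bangle i - bangle y)"
  proof (rule Arg_one_minus_cis)
    show "\<bar>bangle i - bangle y\<bar> < 2 * pi" by (rule bangle_diff(2)[OF assms(2,1)])
    have "sg i y \<noteq> 0" using assms(3) by (simp add: sg_def sgn_if)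
    then show "bangle i - bangle y \<noteq> 0" using bangle_diff(1)[OF assms(2,1)] by (metis sgn_0)
  qed
  finally show ?thesis by (simp only: bangle_diff(1)[OF assms(2,1)])
qed

text \<open>Telescoping over \<open>P\<close> and over \<open>P'\<close> leaves the angles under
  which each path is seen from the ends of the other. These ends lie on the circle, where each angle
  is half a difference of values of \<open>bangle\<close> minus pi / 2 times a sign. The differences
  cancel, and the signs add up to \<open>cyc\<close>.\<close>

lemma sum_edge_int:
  assumes P: "P \<in> walks i j" "i \<in> I" "j \<in> J" and P': "P' \<in> walks i' j'" "i' \<in> I" "j' \<in> J"
  shows "(\<Sum>e\<leftarrow>P. \<Sum>f\<leftarrow>P'. edge_int e f) = pi * cyc i i' j j'"
proof -
  note w = walksD[OF P] and w' = walksD[OF P']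
  have "(\<Sum>f\<leftarrow>P'. edge_int e f) = sweep e (bd i') - sweep e (bd j')
      + (\<Sum>f\<leftarrow>P'. sweep f (snd e) - sweep f (fst e))" for e
    unfolding pcas_telescope[OF w'(3), of "sweep e", symmetric] sum_list_addf[symmetric]
    by (simp add: edge_int_def add_diff_eq)
  then have "(\<Sum>e\<leftarrow>P. \<Sum>f\<leftarrow>P'. edge_int e f) = (\<Sum>e\<leftarrow>P. sweep e (bd i') - sweep e (bd j'))
      + (\<Sum>e\<leftarrow>P. \<Sum>f\<leftarrow>P'. sweep f (snd e) - sweep f (fst e))"
    by (simp add: sum_list_addf)
  also have "(\<Sum>e\<leftarrow>P. \<Sum>f\<leftarrow>P'. sweep f (snd e) - sweep f (fst e)) = (\<Sum>f\<leftarrow>P'. \<Sum>e\<leftarrow>P. sweep f (snd e) - sweep f (fst e))"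
    by (rule sum_list_swap)
  also have "\<dots> = (\<Sum>f\<leftarrow>P'. sweep f (bd j) - sweep f (bd i))"
  proof -
    have "(\<Sum>e\<leftarrow>P. sweep f (snd e) - sweep f (fst e)) = sweep f (bd j) - sweep f (bd i)" for f
      using pcas_telescope[OF w(3), of "\<lambda>v. - sweep f v"] by simp
    then show ?thesis by simp
  qed
  also have "(\<Sum>f\<leftarrow>P'. sweep f (bd j) - sweep f (bd i)) = (\<Sum>f\<leftarrow>P'. sweep f (bd j)) - (\<Sum>f\<leftarrow>P'. sweep f (bd i))"
    by (simp add: sum_list_subtractf)
  also have "(\<Sum>e\<leftarrow>P. sweep e (bd i') - sweep e (bd j')) = (\<Sum>e\<leftarrow>P. sweep e (bd i')) - (\<Sum>e\<leftarrow>P. sweep e (bd j'))"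
    by (simp add: sum_list_subtractf)
  finally have sum: "(\<Sum>e\<leftarrow>P. \<Sum>f\<leftarrow>P'. edge_int e f) = (\<Sum>e\<leftarrow>P. sweep e (bd i')) - (\<Sum>e\<leftarrow>P. sweep e (bd j'))
      + ((\<Sum>f\<leftarrow>P'. sweep f (bd j)) - (\<Sum>f\<leftarrow>P'. sweep f (bd i)))" .
  have W: "(\<Sum>e\<leftarrow>Q. sweep e (bd y)) = angle_at y (bd l) - angle_at y (bd k)"
    if "set Q \<subseteq> E" "pcas (bd k) Q (bd l)" "y \<in> {1..n}" for Q k l y
  proof -
    have "(\<Sum>e\<leftarrow>Q. sweep e (bd y)) = (\<Sum>e\<leftarrow>Q. angle_at y (snd e) - angle_at y (fst e))"
      by (intro arg_cong[of _ _ sum_list] map_cong refl sweep_boundary) (use that in auto)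
    also have "\<dots> = angle_at y (bd l) - angle_at y (bd k)"
      using pcas_telescope[OF that(2), of "\<lambda>v. - angle_at y v"] by simp
    finally show ?thesis .
  qed
  have r: "i \<in> {1..n}" "j \<in> {1..n}" "i' \<in> {1..n}" "j' \<in> {1..n}" using P P' in_range by auto
  have ne: "i \<noteq> j" "i \<noteq> j'" "i' \<noteq> j" "i' \<noteq> j'" using P P' labels(2) by auto
  \<comment> \<open>If both paths start at the same vertex, the angle of its neighbour enters with
    both signs and the equation reads 0 = 0.\<close>
  have ii: "angle_at i' (bd i) - angle_at i (bd i') = bangle i - bangle i' - pi * sg i i'"
    using angle_at_boundary[OF r(3,1)] angle_at_boundary[OF r(1,3)] sg_skew[of i' i]
    by (cases "i = i'") (auto simp: field_simps)
  have jj: "angle_at j' (bd j) - angle_at j (bd j') = bangle j - bangle j' - pi * sg j j'"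
    using angle_at_boundary[OF r(4,2)] angle_at_boundary[OF r(2,4)] sg_skew[of j' j]
    by (cases "j = j'") (auto simp: field_simps)
  have "angle_at i' (bd j) - angle_at j (bd i') = bangle j - bangle i' - pi * sg j i'"
    "angle_at i (bd j') - angle_at j' (bd i) = bangle j' - bangle i - pi * sg j' i"
    using angle_at_boundary[OF r(3,2)] angle_at_boundary[OF r(2,3)] angle_at_boundary[OF r(1,4)] angle_at_boundary[OF r(4,1)]
      ne sg_skew[of j i'] sg_skew[of j' i] by (auto simp: field_simps)
  moreover have "pi * cyc i i' j j' = pi * sg i i' - pi * sg j i' + pi * sg j j' + pi * sg j' i"
    unfolding cyc_def sg_skew[of i' j] by (simp add: algebra_simps)
  ultimately show ?thesis
    unfolding sum W[OF w(2,3) r(3)] W[OF w(2,3) r(4)] W[OF w'(2,3) r(2)] W[OF w'(2,3) r(1)]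
    using ii jj by linarith
qed

text \<open>In spite of the angles in its definition, the value at two corners of paths is - 1, 0 or
  1: see \<open>white_eps\<close>, \<open>black_eps\<close> and
  \<open>eps_different_vertex\<close>.\<close>

definition eps :: "edge \<times> edge \<Rightarrow> edge \<times> edge \<Rightarrow> real" where
  "eps c c' = corner_sum flag_int c c' / pi"

lemma sum_eps:
  assumes P: "P \<in> walks i j" "i \<in> I" "j \<in> J" and P': "P' \<in> walks i' j'" "i' \<in> I" "j' \<in> J"
  shows "(\<Sum>c\<leftarrow>corners P. \<Sum>c'\<leftarrow>corners P'. eps c c') = cyc i i' j j'"
proof -
  note w = walksD[OF P] and w' = walksD[OF P']
  have hl: "hd P \<in> E" "last P \<in> E" "hd P' \<in> E" "last P' \<in> E" using w w' by auto
  have "(\<Sum>e\<leftarrow>P. \<Sum>f\<leftarrow>P'. edge_int e f) = (\<Sum>e\<leftarrow>P. \<Sum>f\<leftarrow>P'. edge_form flag_int e f)"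
    by (intro arg_cong[of _ _ sum_list] map_cong refl)
       (use w(2) w'(2) in \<open>auto simp: edge_form_def intro!: edge_int_flags\<close>)
  also have "\<dots> = (\<Sum>c\<leftarrow>corners P. \<Sum>c'\<leftarrow>corners P'. corner_sum flag_int c c')"
  proof (rule sum_edge_form_corners[OF w(1) w'(1)])
    fix f b assume f: "f \<in> set P'" "b = (fst f, f) \<or> b = (snd f, f)"
    then show "flag_int (fst (hd P), hd P) b = 0 \<and> flag_int (snd (last P), last P) b = 0"
      using flag_int_boundary(1)[OF in_range(1)[OF P(2)] hl(1), of f b]
        flag_int_boundary(1)[OF in_range(2)[OF P(3)] hl(2), of f b] w(4,5) w'(2) by auto
  next
    fix e a assume e: "e \<in> set P" "a = (fst e, e) \<or> a = (snd e, e)"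
    then show "flag_int a (fst (hd P'), hd P') = 0 \<and> flag_int a (snd (last P'), last P') = 0"
      using flag_int_boundary(2)[OF in_range(1)[OF P'(2)] hl(3), of e a]
        flag_int_boundary(2)[OF in_range(2)[OF P'(3)] hl(4), of e a] w'(4,5) w(2) by auto
  qed
  finally have "(\<Sum>c\<leftarrow>corners P. \<Sum>c'\<leftarrow>corners P'. corner_sum flag_int c c') = pi * cyc i i' j j'"
    using sum_edge_int[OF P P'] by simp
  then show ?thesis unfolding eps_def by (simp add: divide_inverse sum_list_mult_const)
qed

end

text \<open>
  The only combination of the parameters at a vertex that is seen by pairs of paths.
\<close>

definition triple_param :: "(nat \<Rightarrow> nat \<Rightarrow> real) \<Rightarrow> real" where
  "triple_param \<kappa> = \<kappa> 1 3 + \<kappa> 2 3 - \<kappa> 1 2"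

lemma skew3D: "skew3 \<kappa> \<Longrightarrow> i \<in> {1..3} \<Longrightarrow> j \<in> {1..3} \<Longrightarrow> \<kappa> i j = - \<kappa> j i"
  unfolding skew3_def by blast

lemma skew3_self: "skew3 \<kappa> \<Longrightarrow> i \<in> {1..3} \<Longrightarrow> \<kappa> i i = 0"
  using skew3D[of \<kappa> i i] by simp

text \<open>Two paths through an internal vertex share the flag with label 1. The sums are the four
  brackets between the flags of one path and those of the other, when the remaining flags have
  labels 2 and 3, labels 3 and 2, or the same label.\<close>

lemma skew3_fork:
  assumes "skew3 \<kappa>"
  shows "\<kappa> 1 1 + \<kappa> 1 3 + \<kappa> 2 1 + \<kappa> 2 3 = triple_param \<kappa>"
    "\<kappa> 1 1 + \<kappa> 1 2 + \<kappa> 3 1 + \<kappa> 3 2 = - triple_param \<kappa>"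
    "l \<in> {1..3} \<Longrightarrow> \<kappa> 1 1 + \<kappa> 1 l + \<kappa> l 1 + \<kappa> l l = 0"
  using skew3_self[OF assms, of 1] skew3_self[OF assms, of l] skew3D[OF assms, of 2 1] skew3D[OF assms, of 3 1]
    skew3D[OF assms, of 3 2] skew3D[OF assms, of l 1]
  unfolding triple_param_def by auto

context perfect_network
begin

section \<open>Labels and clockwise order of the flags at an internal vertex\<close>

definition incident :: "complex \<Rightarrow> edge set" where
  "incident v = {e \<in> E. snd e = v} \<union> {e \<in> E. fst e = v}"

lemma incident_conv: "e \<in> incident v \<longleftrightarrow> e \<in> E \<and> v \<in> {fst e, snd e}"
  unfolding incident_def by auto

lemma finite_incident: "finite (incident v)"
  unfolding incident_def using finite_E by simp

lemma card_incident:
  assumes "v \<in> internal_vertices n N"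
  shows "card (incident v) = 3"
proof -
  have "card (incident v) = card {e \<in> E. snd e = v} + card {e \<in> E. fst e = v}"
    unfolding incident_def using finite_E edge_ends_neq by (intro card_Un_disjoint) auto
  then show ?thesis using internal_edges(1)[OF assms] by simp
qed

definition root_edge :: "complex \<Rightarrow> edge" where
  "root_edge v = snd (root_flag n N v)"

definition cw :: "complex \<Rightarrow> edge \<Rightarrow> real" where
  "cw v e = clockwise_angle n N (v, e)"

lemma in_out_neq: "e \<in> E \<Longrightarrow> snd e = v \<Longrightarrow> e' \<in> E \<Longrightarrow> fst e' = v \<Longrightarrow> e \<noteq> e' \<and> e' \<noteq> e"
  using edge_ends_neq by metis

lemma root_edge_ex1:
  assumes "v \<in> internal_vertices n N"
  shows "\<exists>!e. e \<in> E \<and> (if white n N v then snd e = v else fst e = v)"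
proof (cases "white n N v")
  case True
  then show ?thesis using internal_edges(4)[OF assms True] by simp
next
  case False
  then have "black n N v" using internal_edges(2)[OF assms] by blast
  then show ?thesis using internal_edges(5)[OF assms] False by simp
qed

lemma root_edge_eqI:
  assumes "v \<in> internal_vertices n N" "e \<in> E" "if white n N v then snd e = v else fst e = v"
  shows "root_edge v = e"
  using the1_equality[OF root_edge_ex1[OF assms(1)], of e] assms
  unfolding root_edge_def root_flag_def by simp

lemma root_edge:
  assumes "v \<in> internal_vertices n N"
  shows "root_edge v \<in> E" "if white n N v then snd (root_edge v) = v else fst (root_edge v) = v"
  using theI'[OF root_edge_ex1[OF assms]] unfolding root_edge_def root_flag_def snd_conv by blast+

lemma root_edge_incident: "v \<in> internal_vertices n N \<Longrightarrow> root_edge v \<in> incident v"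
  using root_edge[of v] unfolding incident_conv by (auto split: if_splits)

lemma cw_conv: "cw v e = Arg2pi (edge_dir v (root_edge v) / edge_dir v e)"
proof -
  have "root_flag n N v = (v, root_edge v)" by (simp add: root_edge_def root_flag_def)
  then show ?thesis by (simp add: cw_def clockwise_angle_def edge_dir_def)
qed

lemma cw_root: "v \<in> internal_vertices n N \<Longrightarrow> cw v (root_edge v) = 0"
  using edge_dir_nonzero[of "root_edge v" v] root_edge_incident[of v] unfolding cw_conv incident_conv
  by (simp add: Arg2pi_eq_0)

lemma cw_pos:
  assumes "v \<in> internal_vertices n N" "e \<in> incident v" "e \<noteq> root_edge v"
  shows "cw v e > 0"
  unfolding cw_conv
  by (rule edge_dir_ratio) (use assms root_edge_incident[OF assms(1)] in \<open>auto simp: incident_conv\<close>)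

lemma cw_inj:
  assumes v: "v \<in> internal_vertices n N" and e: "e \<in> incident v" "f \<in> incident v" "e \<noteq> f"
  shows "cw v e \<noteq> cw v f"
proof
  assume eq: "cw v e = cw v f"
  let ?r = "edge_dir v (root_edge v)"
  have nz: "?r \<noteq> 0" "edge_dir v e \<noteq> 0" "edge_dir v f \<noteq> 0"
    using edge_dir_nonzero root_edge_incident[OF v] e by (auto simp: incident_conv)
  then have "(?r / edge_dir v e) / (?r / edge_dir v f) = edge_dir v f / edge_dir v e" by simp
  then have "Arg2pi (edge_dir v f / edge_dir v e) = 0"
    using Arg2pi_diff[of "?r / edge_dir v e" "?r / edge_dir v f"] eq nz unfolding cw_conv by simp
  moreover have "Arg2pi (edge_dir v f / edge_dir v e) > 0"
    by (rule edge_dir_ratio) (use e in \<open>auto simp: incident_conv\<close>)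
  ultimately show False by simp
qed

lemma flag_label_conv:
  "flag_label n N (v, e) = 1 + card {f \<in> incident v. cw v f < cw v e}"
proof -
  have "{a' \<in> flags N. fst a' = v \<and> clockwise_angle n N a' < clockwise_angle n N (v, e)}
      = Pair v ` {f \<in> incident v. cw v f < cw v e}"
    unfolding flags_def cw_def incident_conv by auto
  then show ?thesis by (simp add: flag_label_def card_image inj_on_def)
qed

lemma flag_label_range:
  assumes "v \<in> internal_vertices n N" "e \<in> incident v"
  shows "flag_label n N (v, e) \<in> {1..3}"
proof -
  have "card {f \<in> incident v. cw v f < cw v e} \<le> card (incident v - {e})"
    by (rule card_mono) (use finite_incident in auto)
  also have "\<dots> = 2" using card_incident[OF assms(1)] assms(2) finite_incident by simp
  finally show ?thesis unfolding flag_label_conv by simp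
qed

lemma flag_label_root:
  assumes "v \<in> internal_vertices n N"
  shows "flag_label n N (v, root_edge v) = 1"
proof -
  have "cw v f \<ge> 0" for f unfolding cw_conv by (rule Arg2pi_ge_0)
  then have z: "{f \<in> incident v. cw v f < cw v (root_edge v)} = {}" unfolding cw_root[OF assms] by (auto simp: not_less)
  show ?thesis unfolding flag_label_conv z by simp
qed

lemma flag_label_fork:
  assumes v: "v \<in> internal_vertices n N" and xy: "x \<in> incident v" "y \<in> incident v"
    and ne: "x \<noteq> root_edge v" "y \<noteq> root_edge v" and lt: "cw v x < cw v y"
  shows "flag_label n N (v, x) = 2" "flag_label n N (v, y) = 3"
proof -
  let ?r = "root_edge v"
  have d: "x \<noteq> y" using lt by auto
  have "card {?r, x, y} = 3" using ne d by auto
  then have inc: "incident v = {?r, x, y}"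
    using card_subset_eq[OF finite_incident, of "{?r, x, y}" v] root_edge_incident[OF v] xy card_incident[OF v] by auto
  have "{f \<in> incident v. cw v f < cw v x} = {?r}" "{f \<in> incident v. cw v f < cw v y} = {?r, x}"
    unfolding inc using cw_root[OF v] cw_pos[OF v xy(1) ne(1)] cw_pos[OF v xy(2) ne(2)] lt by auto
  then show "flag_label n N (v, x) = 2" "flag_label n N (v, y) = 3"
    unfolding flag_label_conv using ne by auto
qed

lemma fork_value:
  assumes v: "v \<in> internal_vertices n N" and xy: "x \<in> incident v" "y \<in> incident v"
    and ne: "x \<noteq> root_edge v" "y \<noteq> root_edge v" and \<kappa>: "skew3 \<kappa>"
  defines "l \<equiv> \<lambda>e. flag_label n N (v, e)"
  shows "\<kappa> 1 1 + \<kappa> 1 (l y) + \<kappa> (l x) 1 + \<kappa> (l x) (l y) = triple_param \<kappa> * sgn (cw v y - cw v x)"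
proof -
  consider "x = y" | "x \<noteq> y" "cw v x < cw v y" | "x \<noteq> y" "cw v y < cw v x"
    using cw_inj[OF v xy] by linarith
  then show ?thesis
  proof cases
    case 1
    then show ?thesis using skew3_fork(3)[OF \<kappa>] flag_label_range[OF v xy(1)] unfolding l_def by simp
  next
    case 2
    then show ?thesis using flag_label_fork[OF v xy ne 2(2)] skew3_fork(1)[OF \<kappa>] unfolding l_def by simp
  next
    case 3
    then show ?thesis using flag_label_fork[OF v xy(2,1) ne(2,1) 3(2)] skew3_fork(2)[OF \<kappa>] unfolding l_def by simp
  qed
qed

lemma fork_angle:
  assumes v: "v \<in> internal_vertices n N" and xy: "x \<in> incident v" "y \<in> incident v"
    and ne: "x \<noteq> root_edge v" "y \<noteq> root_edge v" "x \<noteq> y"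
  shows "- turn_angle (edge_dir v (root_edge v)) (edge_dir v y) - turn_angle (edge_dir v x) (edge_dir v (root_edge v))
    + turn_angle (edge_dir v x) (edge_dir v y) = pi * sgn (cw v y - cw v x)"
proof -
  have "- turn_angle (edge_dir v (root_edge v)) (edge_dir v y) - turn_angle (edge_dir v x) (edge_dir v (root_edge v))
    + turn_angle (edge_dir v x) (edge_dir v y) = (if cw v x < cw v y then pi else - pi)"
    unfolding cw_conv
  proof (rule turn_angle_fork)
    show "edge_dir v x \<noteq> 0" "edge_dir v y \<noteq> 0" "edge_dir v (root_edge v) \<noteq> 0"
      using edge_dir_nonzero root_edge_incident[OF v] xy by (auto simp: incident_conv)
  qed (use cw_pos[OF v xy(1) ne(1)] cw_pos[OF v xy(2) ne(2)] cw_inj[OF v xy ne(3)] in \<open>auto simp: cw_conv\<close>)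
  then show ?thesis using cw_inj[OF v xy ne(3)] by (auto simp: sgn_if)
qed

definition flag_coef :: "(nat \<Rightarrow> nat \<Rightarrow> real) \<Rightarrow> (nat \<Rightarrow> nat \<Rightarrow> real) \<Rightarrow> flag \<Rightarrow> flag \<Rightarrow> real" where
  "flag_coef \<alpha> \<beta> a b =
     (if fst a = fst b \<and> white n N (fst a) then \<alpha> (flag_label n N a) (flag_label n N b)
      else if fst a = fst b \<and> black n N (fst a) then \<beta> (flag_label n N a) (flag_label n N b)
      else 0)"

definition vertex_param :: "(nat \<Rightarrow> nat \<Rightarrow> real) \<Rightarrow> (nat \<Rightarrow> nat \<Rightarrow> real) \<Rightarrow> complex \<Rightarrow> real" where
  "vertex_param \<alpha> \<beta> v = (if white n N v then triple_param \<alpha> else triple_param \<beta>)"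

definition corner_at :: "complex \<Rightarrow> edge \<times> edge \<Rightarrow> bool" where
  "corner_at v c \<longleftrightarrow> fst c \<in> E \<and> snd c \<in> E \<and> snd (fst c) = v \<and> fst (snd c) = v"

lemma eps_different_vertex:
  "corner_at v c \<Longrightarrow> corner_at v' c' \<Longrightarrow> v \<noteq> v' \<Longrightarrow> eps c c' = 0"
  unfolding eps_def corner_sum_def corner_at_def by (auto simp: flag_int_def case_prod_beta)

lemma white_eps:
  assumes v: "v \<in> internal_vertices n N" "white n N v" and c: "corner_at v (e, e')" "corner_at v (f, f')"
  shows "e = root_edge v" "f = root_edge v" "eps (e, e') (f, f') = sgn (cw v f' - cw v e')"
proof -
  show e: "e = root_edge v" "f = root_edge v"
    using root_edge_eqI[OF v(1), of e] root_edge_eqI[OF v(1), of f] c v(2) by (auto simp: corner_at_def)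
  have inc: "e' \<in> incident v" "f' \<in> incident v" and ne: "e' \<noteq> e" "f' \<noteq> e"
    using c e in_out_neq unfolding corner_at_def incident_conv by auto
  show "eps (e, e') (f, f') = sgn (cw v f' - cw v e')"
  proof (cases "e' = f'")
    case True
    then show ?thesis unfolding eps_def corner_sum_def using c e edge_int_skew[of e e']
      by (simp add: flag_int_def corner_at_def)
  next
    case False
    have E: "e \<in> E" "e' \<in> E" "f' \<in> E" using c unfolding corner_at_def by auto
    have "corner_sum flag_int (e, e') (f, f') = edge_int e f' + edge_int e' e + edge_int e' f'"
      using c e unfolding corner_sum_def corner_at_def by (simp add: flag_int_def)
    also have "\<dots> = pi * sgn (cw v f' - cw v e')"
      using fork_angle[OF v(1) inc _ _ False] ne e
        edge_int_at_vertex(2)[OF E(1,3) ne(2)[symmetric], of v] edge_int_at_vertex(3)[OF E(2,1) ne(1), of v]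
        edge_int_at_vertex(1)[OF E(2,3) False, of v] c unfolding corner_at_def by simp
    finally show ?thesis by (simp add: eps_def)
  qed
qed

lemma black_eps:
  assumes v: "v \<in> internal_vertices n N" "black n N v" and c: "corner_at v (e, e')" "corner_at v (f, f')"
  shows "e' = root_edge v" "f' = root_edge v" "eps (e, e') (f, f') = sgn (cw v f - cw v e)"
proof -
  have nw: "\<not> white n N v" using internal_edges(3)[OF v(1)] v(2) by blast
  show e: "e' = root_edge v" "f' = root_edge v"
    using root_edge_eqI[OF v(1), of e'] root_edge_eqI[OF v(1), of f'] c nw by (auto simp: corner_at_def)
  have inc: "e \<in> incident v" "f \<in> incident v" and ne: "e \<noteq> e'" "f \<noteq> e'"
    using c e in_out_neq unfolding corner_at_def incident_conv by auto
  show "eps (e, e') (f, f') = sgn (cw v f - cw v e)"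
  proof (cases "e = f")
    case True
    then show ?thesis unfolding eps_def corner_sum_def using c e edge_int_skew[of e e']
      by (simp add: flag_int_def corner_at_def)
  next
    case False
    have E: "e \<in> E" "e' \<in> E" "f \<in> E" using c unfolding corner_at_def by auto
    have "corner_sum flag_int (e, e') (f, f') = edge_int e f + edge_int e e' + edge_int e' f"
      using c e unfolding corner_sum_def corner_at_def by (simp add: flag_int_def)
    also have "\<dots> = pi * sgn (cw v f - cw v e)"
      using fork_angle[OF v(1) inc _ _ False] ne e
        edge_int_at_vertex(2)[OF E(1,2) ne(1), of v] edge_int_at_vertex(3)[OF E(2,3) ne(2)[symmetric], of v]
        edge_int_at_vertex(4)[OF E(1,3) False, of v] c unfolding corner_at_def by simp
    finally show ?thesis by (simp add: eps_def)
  qed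
qed

text \<open>
  At a white vertex both paths enter by the same edge, and exchanging tails exchanges the two
  outgoing edges; at a black vertex both leave by the same edge.
\<close>

lemma eps_swap:
  assumes v: "v \<in> internal_vertices n N" and c: "corner_at v (e, e')" "corner_at v (f, f')"
  shows "eps (e, f') (f, e') = (if white n N v then - eps (e, e') (f, f') else eps (e, e') (f, f'))"
proof -
  have c': "corner_at v (e, f')" "corner_at v (f, e')" using c unfolding corner_at_def by auto
  show ?thesis
  proof (cases "white n N v")
    case True
    then show ?thesis using white_eps(3)[OF v True c] white_eps(3)[OF v True c'] by (simp add: sgn_if)
  next
    case False
    then have b: "black n N v" using internal_edges(2)[OF v] by blast
    show ?thesis using black_eps(3)[OF v b c] black_eps(3)[OF v b c'] False by simp
  qed
qed

text \<open>The bracket coefficients and the angles both depend on two corners at a vertex only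
  through the clockwise order of the edges in which they differ, by \<open>fork_value\<close> and
  \<open>fork_angle\<close>. Hence they are proportional, with a factor depending on the
  colour.\<close>

lemma corner_sum_flag_coef:
  assumes \<alpha>\<beta>: "skew3 \<alpha>" "skew3 \<beta>" and v: "v \<in> internal_vertices n N"
    and c: "corner_at v c" "corner_at v' c'"
  shows "corner_sum (flag_coef \<alpha> \<beta>) c c' = vertex_param \<alpha> \<beta> v * eps c c'"
proof (cases "v = v'")
  case False
  then have "corner_sum (flag_coef \<alpha> \<beta>) c c' = 0"
    using c unfolding corner_sum_def corner_at_def by (auto simp: flag_coef_def case_prod_beta)
  then show ?thesis using eps_different_vertex[OF c False] by simp
next
  case True
  obtain e e' f f' where cc: "c = (e, e')" "c' = (f, f')" by (metis prod.exhaust)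
  note c = c[folded True, unfolded cc]
  show ?thesis
  proof (cases "white n N v")
    case w: True
    note r = white_eps[OF v w c]
    have "e' \<in> incident v" "f' \<in> incident v" "e' \<noteq> root_edge v" "f' \<noteq> root_edge v"
      using c r(1,2) in_out_neq unfolding corner_at_def incident_conv by auto
    from fork_value[OF v this \<alpha>\<beta>(1)]
    show ?thesis unfolding cc r(3) using c r(1,2) w flag_label_root[OF v]
      by (simp add: corner_sum_def flag_coef_def corner_at_def vertex_param_def)
  next
    case nw: False
    then have b: "black n N v" using internal_edges(2)[OF v] by blast
    note r = black_eps[OF v b c]
    have "e \<in> incident v" "f \<in> incident v" "e \<noteq> root_edge v" "f \<noteq> root_edge v"
      using c r(1,2) in_out_neq unfolding corner_at_def incident_conv by auto
    from fork_value[OF v this \<alpha>\<beta>(2)]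
    show ?thesis unfolding cc r(3) using c r(1,2) nw b flag_label_root[OF v]
      by (simp add: corner_sum_def flag_coef_def corner_at_def vertex_param_def)
  qed
qed

lemma corner_at_walk:
  "P \<in> walks i j \<Longrightarrow> i \<in> I \<Longrightarrow> j \<in> J \<Longrightarrow> c \<in> set (corners P) \<Longrightarrow> corner_at (snd (fst c)) c"
  "P \<in> walks i j \<Longrightarrow> i \<in> I \<Longrightarrow> j \<in> J \<Longrightarrow> c \<in> set (corners P) \<Longrightarrow> snd (fst c) \<in> internal_vertices n N"
  using corner_vertex[of P i j "fst c" "snd c"] unfolding corner_at_def by auto

lemma sum_flag_coef:
  assumes \<alpha>\<beta>: "skew3 \<alpha>" "skew3 \<beta>"
    and P: "P \<in> walks i j" "i \<in> I" "j \<in> J" and P': "P' \<in> walks i' j'" "i' \<in> I" "j' \<in> J"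
  shows "(\<Sum>e\<leftarrow>P. \<Sum>f\<leftarrow>P'. edge_form (flag_coef \<alpha> \<beta>) e f)
    = (\<Sum>c\<leftarrow>corners P. \<Sum>c'\<leftarrow>corners P'. vertex_param \<alpha> \<beta> (snd (fst c)) * eps c c')"
proof -
  note w = walksD[OF P] and w' = walksD[OF P']
  have nb: "\<not> white n N (bd y)" "\<not> black n N (bd y)" if "y \<in> {1..n}" for y
    using internal_not_boundary[of "bd y" y] that unfolding white_def black_def by blast+
  have 0: "flag_coef \<alpha> \<beta> a b = 0" if "fst a = bd y \<or> fst b = bd y" "y \<in> {1..n}" for a b y
    using nb[OF that(2)] that(1) unfolding flag_coef_def by auto
  have "(\<Sum>e\<leftarrow>P. \<Sum>f\<leftarrow>P'. edge_form (flag_coef \<alpha> \<beta>) e f)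
      = (\<Sum>c\<leftarrow>corners P. \<Sum>c'\<leftarrow>corners P'. corner_sum (flag_coef \<alpha> \<beta>) c c')"
  proof (rule sum_edge_form_corners[OF w(1) w'(1)])
    show "flag_coef \<alpha> \<beta> (fst (hd P), hd P) b = 0 \<and> flag_coef \<alpha> \<beta> (snd (last P), last P) b = 0" for b
      using 0[of "(fst (hd P), hd P)" i b] 0[of "(snd (last P), last P)" j b] w(4,5) in_range P by simp
    show "flag_coef \<alpha> \<beta> a (fst (hd P'), hd P') = 0 \<and> flag_coef \<alpha> \<beta> a (snd (last P'), last P') = 0" for a
      using 0[of a i' "(fst (hd P'), hd P')"] 0[of a j' "(snd (last P'), last P')"] w'(4,5) in_range P' by simp
  qed
  also have "\<dots> = (\<Sum>c\<leftarrow>corners P. \<Sum>c'\<leftarrow>corners P'. vertex_param \<alpha> \<beta> (snd (fst c)) * eps c c')"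
    by (intro arg_cong[of _ _ sum_list] map_cong refl)
       (rule corner_sum_flag_coef[OF \<alpha>\<beta>]; (rule corner_at_walk[OF P] corner_at_walk[OF P']; assumption))
  finally show ?thesis .
qed

end

section \<open>Concordance numbers and turning\<close>

definition cross2 :: "complex \<Rightarrow> complex \<Rightarrow> real" where
  "cross2 u w = Im (cnj u * w)"

lemma cross2_alt: "cross2 u w = Re u * Im w - Im u * Re w"
  by (simp add: cross2_def)

lemma collinear_cross2: "collinear {0, u, w} \<longleftrightarrow> cross2 u w = 0"
proof
  assume "collinear {0, u, w}"
  then show "cross2 u w = 0" unfolding collinear_lemma by (auto simp: cross2_alt)
next
  assume z: "cross2 u w = 0"
  show "collinear {0, u, w}"
  proof (cases "u = 0")
    case False
    have "w * (cnj u * u) = (cnj u * w) * u" by (simp add: mult_ac)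
    also have "cnj u * w = of_real (Re (cnj u * w))" using z by (simp add: cross2_def complex_eq_iff)
    also have "cnj u * u = of_real ((cmod u)\<^sup>2)" by (metis complex_norm_square mult.commute of_real_power)
    finally have "w * of_real ((cmod u)\<^sup>2) = of_real (Re (cnj u * w)) * u" .
    then have "w = of_real (Re (cnj u * w) / (cmod u)\<^sup>2) * u"
      using False by (simp add: field_simps)
    then show ?thesis unfolding collinear_lemma scaleR_conv_of_real by blast
  qed (simp add: collinear_lemma)
qed

lemma convex_cone_hull_pair:
  "convex_cone hull {a, b :: complex} = {of_real x * a + of_real y * b | x y. x \<ge> 0 \<and> y \<ge> 0}" (is "_ = ?R")
proof
  show "convex_cone hull {a, b} \<subseteq> ?R"
  proof
    fix z assume "z \<in> convex_cone hull {a, b}"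
    then obtain w c where w: "w \<in> convex hull {a, b}" "c \<ge> 0" "z = c *\<^sub>R w"
      by (subst (asm) convex_cone_hull_convex_hull_nonempty) auto
    from w(1) obtain u v where "u \<ge> 0" "v \<ge> 0" "w = u *\<^sub>R a + v *\<^sub>R b"
      unfolding convex_hull_2 by blast
    then show "z \<in> ?R" using w
      by (intro CollectI exI[of _ "c * u"] exI[of _ "c * v"]) (simp add: scaleR_conv_of_real algebra_simps)
  qed
  show "?R \<subseteq> convex_cone hull {a, b}"
  proof
    fix z assume "z \<in> ?R"
    then obtain x y where xy: "x \<ge> 0" "y \<ge> 0" "z = of_real x * a + of_real y * b" by blast
    have "a \<in> convex_cone hull {a, b}" "b \<in> convex_cone hull {a, b}" by (simp_all add: hull_inc)
    then have "x *\<^sub>R a + y *\<^sub>R b \<in> convex_cone hull {a, b}"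
      using xy(1,2) by (intro convex_cone_hull_add convex_cone_hull_mul)
    then show "z \<in> convex_cone hull {a, b}" unfolding xy(3) by (simp add: scaleR_conv_of_real)
  qed
qed

text \<open>A vanishing coefficient would make \<open>l\<close> parallel to \<open>a\<close> or
  \<open>b\<close>. Conversely, if \<open>l\<close> is a positive combination that is not parallel
  to \<open>a\<close>, then \<open>a\<close> and \<open>b\<close> are independent, and by Cramer's
  rule the vectors with positive coordinates form an open subset of the cone.\<close>

lemma interior_convex_cone_pair:
  assumes "cross2 l a \<noteq> 0" "cross2 l b \<noteq> 0"
  shows "l \<in> interior (convex_cone hull {a, b}) \<longleftrightarrow> (\<exists>x>0. \<exists>y>0. l = of_real x * a + of_real y * b)"
proof
  assume "l \<in> interior (convex_cone hull {a, b})"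
  then have "l \<in> convex_cone hull {a, b}" using interior_subset by blast
  then obtain x y where xy: "x \<ge> 0" "y \<ge> 0" "l = of_real x * a + of_real y * b"
    unfolding convex_cone_hull_pair by blast
  have "x \<noteq> 0" "y \<noteq> 0" using assms unfolding xy(3) cross2_alt by (auto simp: algebra_simps)
  then have "x > 0" "y > 0" using xy(1,2) by auto
  then show "\<exists>x>0. \<exists>y>0. l = of_real x * a + of_real y * b" using xy(3) by blast
next
  assume "\<exists>x>0. \<exists>y>0. l = of_real x * a + of_real y * b"
  then obtain x y where xy: "x > 0" "y > 0" "l = of_real x * a + of_real y * b" by blast
  define D where "D = cross2 a b"
  have la: "cross2 l a = - y * D" and lb: "cross2 l b = x * D"
    unfolding xy(3) D_def cross2_alt by (simp_all add: algebra_simps)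
  have D: "D \<noteq> 0" using assms(1) la by auto
  define X where "X z = cross2 z b / D" for z
  define Y where "Y z = - cross2 z a / D" for z
  have eq: "z = of_real (X z) * a + of_real (Y z) * b" for z
  proof -
    have "of_real (cross2 z b) * a + of_real (- cross2 z a) * b = of_real D * z"
      unfolding D_def cross2_alt by (simp add: complex_eq_iff) algebra
    moreover have "of_real D * of_real (X z) = (of_real (cross2 z b) :: complex)"
      "of_real D * of_real (Y z) = (of_real (- cross2 z a) :: complex)"
      unfolding of_real_mult[symmetric] X_def Y_def using D by simp_all
    ultimately have "of_real D * z = of_real D * (of_real (X z) * a + of_real (Y z) * b)"
      by (simp only: distrib_left mult.assoc[symmetric])
    then show ?thesis using D by simp
  qed
  have "open {z. X z > 0 \<and> Y z > 0}"
    unfolding X_def Y_def cross2_def by (intro open_Collect_conj open_Collect_less continuous_intros) (simp_all add: D)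
  moreover have "l \<in> {z. X z > 0 \<and> Y z > 0}" using xy(1,2) D by (simp add: X_def Y_def la lb)
  moreover have "{z. X z > 0 \<and> Y z > 0} \<subseteq> convex_cone hull {a, b}"
    unfolding convex_cone_hull_pair using eq less_imp_le by blast
  ultimately show "l \<in> interior (convex_cone hull {a, b})" by (rule interiorI)
qed

lemma cross2_polar:
  assumes "u = rcis r a" "w = rcis s b"
  shows "cross2 u w = r * s * sin (b - a)"
  using assms by (simp add: cross2_alt sin_diff algebra_simps)

lemma rcis_Arg2pi: "z = rcis (cmod z) (Arg2pi z)"
  using Arg2pi[of z] by (simp add: is_Arg_def rcis_def cis_conv_exp)

text \<open>After division by \<open>l\<close> the direction to be tested is 1. It lies between
  \<open>u\<close> above and \<open>w\<close> below the real axis exactly if the counterclockwise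
  way from \<open>u\<close> to \<open>w\<close>, which passes - 1, is the longer one.\<close>

lemma cone_angle_opposite_sides:
  assumes u: "Im u > 0" and w: "Im w < 0" and na: "Arg2pi w - Arg2pi u \<noteq> pi"
  shows "(\<exists>x>0. \<exists>y>0. 1 = of_real x * u + of_real y * w) \<longleftrightarrow> pi < Arg2pi w - Arg2pi u"
    "0 < Arg2pi w - Arg2pi u" "Arg2pi w - Arg2pi u < 2 * pi"
proof -
  define \<delta> where "\<delta> = Arg2pi w - Arg2pi u"
  have "0 < Arg2pi u" "Arg2pi u < pi" using u Arg2pi_lt_pi by auto
  moreover have "pi < Arg2pi w" "Arg2pi w < 2 * pi" using w Arg2pi_le_pi[of w] Arg2pi_lt_2pi by auto
  ultimately have \<delta>: "0 < \<delta>" "\<delta> < 2 * pi" unfolding \<delta>_def by auto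
  then show "0 < Arg2pi w - Arg2pi u" "Arg2pi w - Arg2pi u < 2 * pi" unfolding \<delta>_def by auto
  have uw: "cmod u > 0" "cmod w > 0" using u w by auto
  have D: "cross2 u w = cmod u * cmod w * sin \<delta>"
    unfolding \<delta>_def by (rule cross2_polar[OF rcis_Arg2pi rcis_Arg2pi])
  show "(\<exists>x>0. \<exists>y>0. 1 = of_real x * u + of_real y * w) \<longleftrightarrow> pi < Arg2pi w - Arg2pi u"
  proof
    assume "\<exists>x>0. \<exists>y>0. 1 = of_real x * u + of_real y * w"
    then obtain x y where xy: "x > 0" "y > 0" "1 = of_real x * u + of_real y * w" by blast
    have re: "x * Re u + y * Re w = 1" and im: "x * Im u + y * Im w = 0"
      using arg_cong[OF xy(3), of Re] arg_cong[OF xy(3), of Im] by simp_all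
    have "x * cross2 u w = (x * Re u + y * Re w) * Im w - (x * Im u + y * Im w) * Re w"
      unfolding cross2_alt by algebra
    then have "x * cross2 u w < 0" using re im w by simp
    then have "cross2 u w < 0" using xy(1) by (simp add: mult_less_0_iff)
    then have "sin \<delta> < 0" unfolding D using uw by (simp add: mult_less_0_iff)
    then have "\<not> \<delta> < pi" using sin_gt_zero[of \<delta>] \<delta> by auto
    then show "pi < Arg2pi w - Arg2pi u" using na unfolding \<delta>_def by simp
  next
    assume "pi < Arg2pi w - Arg2pi u"
    then have "sin \<delta> < 0" using \<delta>(2) by (intro sin_lt_zero) (simp_all add: \<delta>_def)
    then have D0: "cross2 u w < 0" unfolding D using uw by (simp add: mult_less_0_iff)
    \<comment> \<open>The coefficients solve the real and imaginary part of the equation by Cramer's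
      rule.\<close>
    have "of_real (Im w / cross2 u w) * u + of_real (- Im u / cross2 u w) * w
        = (of_real (Im w) * u - of_real (Im u) * w) / of_real (cross2 u w)"
      by (simp add: diff_divide_distrib)
    also have "of_real (Im w) * u - of_real (Im u) * w = of_real (cross2 u w)"
      by (simp add: complex_eq_iff cross2_alt mult.commute)
    finally have "1 = of_real (Im w / cross2 u w) * u + of_real (- Im u / cross2 u w) * w" using D0 by simp
    moreover have "Im w / cross2 u w > 0" "- Im u / cross2 u w > 0"
      using D0 u w by (simp_all add: divide_neg_neg divide_pos_neg)
    ultimately show "\<exists>x>0. \<exists>y>0. 1 = of_real x * u + of_real y * w" by blast
  qed
qed

lemma cone_angle:
  assumes im: "Im u \<noteq> 0" "Im w \<noteq> 0" and na: "\<bar>Arg2pi w - Arg2pi u\<bar> \<noteq> pi"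
  shows "(\<exists>x>0. \<exists>y>0. 1 = of_real x * u + of_real y * w) \<longleftrightarrow> pi < \<bar>Arg2pi w - Arg2pi u\<bar>"
    "\<bar>Arg2pi w - Arg2pi u\<bar> < 2 * pi"
proof -
  have same: "\<not> (\<exists>x>0. \<exists>y>0. 1 = of_real x * u + of_real y * w)" if "Im u * Im w > 0"
  proof
    assume "\<exists>x>0. \<exists>y>0. 1 = of_real x * u + of_real y * w"
    then obtain x y where xy: "x > 0" "y > 0" "1 = of_real x * u + of_real y * w" by blast
    have "x * Im u + y * Im w = 0" using arg_cong[OF xy(3), of Im] by simp
    then have "(x * Im u + y * Im w) * Im u = 0" by simp
    moreover have "(x * Im u + y * Im w) * Im u = x * (Im u)\<^sup>2 + y * (Im u * Im w)" by algebra
    moreover have "x * (Im u)\<^sup>2 > 0" "y * (Im u * Im w) > 0" using xy im that by auto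
    ultimately show False by linarith
  qed
  consider "Im u > 0" "Im w > 0" | "Im u < 0" "Im w < 0" | "Im u > 0" "Im w < 0" | "Im u < 0" "Im w > 0"
    using im by linarith
  then have "((\<exists>x>0. \<exists>y>0. 1 = of_real x * u + of_real y * w) \<longleftrightarrow> pi < \<bar>Arg2pi w - Arg2pi u\<bar>)
    \<and> \<bar>Arg2pi w - Arg2pi u\<bar> < 2 * pi"
  proof cases
    case 1
    then have "0 < Arg2pi u \<and> Arg2pi u < pi" "0 < Arg2pi w \<and> Arg2pi w < pi" using Arg2pi_lt_pi by blast+
    then have "\<bar>Arg2pi w - Arg2pi u\<bar> < pi" by auto
    then show ?thesis using same 1 pi_gt_zero by auto
  next
    case 2
    then have "pi < Arg2pi u" "pi < Arg2pi w" using Arg2pi_le_pi[of u] Arg2pi_le_pi[of w] by auto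
    then have "\<bar>Arg2pi w - Arg2pi u\<bar> < pi" using Arg2pi_lt_2pi[of u] Arg2pi_lt_2pi[of w] by linarith
    then show ?thesis using same 2 pi_gt_zero by (auto simp: zero_less_mult_iff)
  next
    case 3
    have "Arg2pi w - Arg2pi u \<noteq> pi" using na by auto
    from cone_angle_opposite_sides[OF 3 this] show ?thesis by auto
  next
    case 4
    have "Arg2pi u - Arg2pi w \<noteq> pi" using na abs_minus_commute abs_of_pos[OF pi_gt_zero] by metis
    note r = cone_angle_opposite_sides[OF 4(2,1) this]
    have "(\<exists>x>0. \<exists>y>0. 1 = of_real x * u + of_real y * w) \<longleftrightarrow> (\<exists>x>0. \<exists>y>0. 1 = of_real x * w + of_real y * u)"
      by (metis add.commute)
    then show ?thesis using r by auto
  qed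
  then show "(\<exists>x>0. \<exists>y>0. 1 = of_real x * u + of_real y * w) \<longleftrightarrow> pi < \<bar>Arg2pi w - Arg2pi u\<bar>"
    "\<bar>Arg2pi w - Arg2pi u\<bar> < 2 * pi" by blast+
qed

text \<open>Half the turning angle is kept as a unit complex number, so that turns along parts of a
  curve multiply. For a closed curve the total turning is a multiple of 2 pi, and the product is a
  sign.\<close>

definition half_turn :: "complex \<Rightarrow> complex \<Rightarrow> complex" where
  "half_turn d d' = cis (Arg (d' / d) / 2)"

text \<open>A segment turning straight back is excluded: there \<open>Arg\<close> jumps between pi
  and - pi, and the half turn is defined up to sign only.\<close>

definition not_opposite :: "complex \<Rightarrow> complex \<Rightarrow> bool" where
  "not_opposite d d' \<longleftrightarrow> d \<noteq> 0 \<and> d' \<noteq> 0 \<and> \<not> (d' / d \<in> \<real> \<and> Re (d' / d) < 0)"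

lemma half_turn_direction:
  assumes l: "cross2 l d \<noteq> 0" "cross2 l d' \<noteq> 0" and na: "not_opposite d d'"
  shows "half_turn d d' = (if l \<in> interior (convex_cone hull {d, d'}) then - 1 else 1)
    * (cis (Arg2pi (d' / l) / 2) / cis (Arg2pi (d / l) / 2))"
proof -
  define u where "u = d / l"
  define w where "w = d' / l"
  have l0: "l \<noteq> 0" using l by (auto simp: cross2_def)
  have cr: "cross2 l x = (cmod l)\<^sup>2 * Im (x / l)" for x
  proof -
    have "cnj l * x = (cmod l)\<^sup>2 * (x / l)" using l0 complex_norm_square[of l] by (simp add: field_simps)
    then show ?thesis unfolding cross2_def by (metis Im_complex_of_real Re_complex_of_real times_complex.simps(2) add.right_neutral mult_zero_left)
  qed
  have im: "Im u \<noteq> 0" "Im w \<noteq> 0" using l unfolding cr u_def w_def by auto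
  have uw: "u \<noteq> 0" "w \<noteq> 0" using im by auto
  have wu: "d' / d = w / u" unfolding u_def w_def using l0 by simp
  define \<delta> where "\<delta> = Arg2pi w - Arg2pi u"
  have pol: "w / u = rcis (cmod w / cmod u) \<delta>"
  proof -
    have "w / u = rcis (cmod w) (Arg2pi w) / rcis (cmod u) (Arg2pi u)" using rcis_Arg2pi by metis
    then show ?thesis by (simp add: rcis_divide \<delta>_def)
  qed
  have pos: "cmod w / cmod u > 0" using uw by simp
  have npi: "\<bar>\<delta>\<bar> \<noteq> pi"
  proof
    assume "\<bar>\<delta>\<bar> = pi"
    then have "\<delta> = pi \<or> \<delta> = - pi" by linarith
    then have "cis \<delta> = - 1" by (auto simp: complex_eq_iff)
    then have "w / u = - of_real (cmod w / cmod u)" unfolding pol by (simp add: rcis_def)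
    then have "d' / d \<in> \<real> \<and> Re (d' / d) < 0" unfolding wu using pos by (simp only: Reals_minus_iff Reals_of_real) simp
    then show False using na unfolding not_opposite_def by blast
  qed
  note cone = cone_angle[OF im npi[unfolded \<delta>_def], folded \<delta>_def]
  have "l \<in> interior (convex_cone hull {d, d'}) \<longleftrightarrow> pi < \<bar>\<delta>\<bar>"
  proof -
    have "l = of_real x * d + of_real y * d' \<longleftrightarrow> 1 = of_real x * u + of_real y * w" for x y
    proof -
      have "of_real x * u + of_real y * w = (of_real x * d + of_real y * d') / l"
        by (simp add: u_def w_def add_divide_distrib)
      then show ?thesis using l0 by (auto simp: eq_divide_eq)
    qed
    then show ?thesis unfolding interior_convex_cone_pair[OF l] cone(1)[symmetric] by simp
  qed
  moreover have "half_turn d d' = (if pi < \<bar>\<delta>\<bar> then - 1 else 1) * cis (\<delta> / 2)"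
  proof -
    \<comment> \<open>The principal argument is \<delta> or differs from it by 2 pi, and a shift by
      2 pi negates the half-angle exponential.\<close>
    consider "\<bar>\<delta>\<bar> < pi" | "\<delta> > pi" | "\<delta> < - pi" using npi by linarith
    then show ?thesis
    proof cases
      case 1
      then have "Arg (w / u) = \<delta>" by (intro Arg_unique'[OF pos _ pol]) auto
      then show ?thesis using 1 by (simp add: half_turn_def wu)
    next
      case 2
      have "w / u = rcis (cmod w / cmod u) (\<delta> - 2 * pi)"
        unfolding pol rcis_def by (simp add: cis_divide[symmetric])
      then have "Arg (w / u) = \<delta> - 2 * pi" using 2 cone(2) by (intro Arg_unique'[OF pos]) auto
      moreover have "cis ((\<delta> - 2 * pi) / 2) = - cis (\<delta> / 2)"
        by (simp add: diff_divide_distrib cis_divide[symmetric])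
      ultimately show ?thesis using 2 by (simp add: half_turn_def wu)
    next
      case 3
      have "w / u = rcis (cmod w / cmod u) (\<delta> + 2 * pi)"
        unfolding pol rcis_def by (simp add: cis_mult[symmetric])
      then have "Arg (w / u) = \<delta> + 2 * pi" using 3 cone(2) by (intro Arg_unique'[OF pos]) auto
      moreover have "cis ((\<delta> + 2 * pi) / 2) = - cis (\<delta> / 2)"
        by (simp add: add_divide_distrib cis_mult[symmetric])
      ultimately show ?thesis using 3 by (simp add: half_turn_def wu)
    qed
  qed
  ultimately show ?thesis
    by (simp add: \<delta>_def cis_divide diff_divide_distrib u_def w_def)
qed

lemma prod_cyclic_quotient:
  fixes g :: "nat \<Rightarrow> complex"
  assumes "\<And>i. g i \<noteq> 0"
  shows "(\<Prod>i<L. g (Suc i) / g i) = g L / g 0"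
  by (induction L) (use assms in simp_all)

text \<open>
  A half turn is the quotient of the half-angle exponentials measured from \<open>l\<close>, up to a sign that
  is \<open>-1\<close> exactly if the turn passes through \<open>l\<close>. The quotients cancel around the closed curve.
\<close>

lemma concordance_along_half_turns:
  assumes l: "\<And>i. i < length ps \<Longrightarrow> \<not> collinear {0, l, segment_vector ps i}"
    and na: "\<And>i. i < length ps \<Longrightarrow> not_opposite (segment_vector ps i) (segment_vector ps (Suc i))"
  shows "(- 1) ^ concordance_along l ps = (\<Prod>i<length ps. half_turn (segment_vector ps i) (segment_vector ps (Suc i)))"
proof (cases "ps = []")
  case True
  then show ?thesis by (simp add: concordance_along_def)
next
  case False
  define L where "L = length ps"
  have L: "L > 0" using False by (simp add: L_def)
  define s where "s = segment_vector ps"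
  have per: "s L = s 0" unfolding s_def segment_vector_def L_def by (simp add: mod_Suc)
  have cr: "cross2 l (s i) \<noteq> 0" if "i \<le> L" for i
    using l[of i] l[of 0] that per L unfolding collinear_cross2 s_def L_def[symmetric] by (cases "i = L") auto
  have "(\<Prod>i<L. half_turn (s i) (s (Suc i))) = (\<Prod>i<L. (if l \<in> interior (convex_cone hull {s i, s (Suc i)}) then - 1 else 1)
    * (cis (Arg2pi (s (Suc i) / l) / 2) / cis (Arg2pi (s i / l) / 2)))"
    by (intro prod.cong refl half_turn_direction) (use cr na in \<open>auto simp: s_def L_def\<close>)
  also have "\<dots> = (\<Prod>i<L. if l \<in> interior (convex_cone hull {s i, s (Suc i)}) then - 1 else 1)"
    unfolding prod.distrib
    using prod_cyclic_quotient[of "\<lambda>i. cis (Arg2pi (s i / l) / 2)" L] per by simp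
  also have "\<dots> = (- 1) ^ card {i. i < L \<and> l \<in> interior (convex_cone hull {s i, s (Suc i)})}"
    by (simp add: prod.If_cases Int_def)
  also have "\<dots> = (- 1) ^ (card {i. i < L \<and> l \<in> interior (convex_cone hull {s i, s (Suc i)})} mod 2)"
    by (simp add: uminus_power_if)
  finally show ?thesis unfolding concordance_along_def s_def L_def by simp
qed

lemma exists_transversal_direction:
  fixes D :: "complex set"
  assumes "finite D" "0 \<notin> D"
  shows "\<exists>l. \<forall>d\<in>D. \<not> collinear {0, l, d}"
proof -
  define T where "T = (\<lambda>d. Im d / Re d) ` D"
  obtain t :: real where t: "t \<notin> T"
    using ex_new_if_finite[OF infinite_UNIV_char_0, of T] assms(1) unfolding T_def by auto
  have "cross2 (Complex 1 t) d \<noteq> 0" if d: "d \<in> D" for d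
  proof
    assume "cross2 (Complex 1 t) d = 0"
    then have eq: "Im d = t * Re d" by (simp add: cross2_alt)
    have "Re d \<noteq> 0"
    proof
      assume "Re d = 0"
      with eq have "d = 0" by (simp add: complex_eq_iff)
      with d assms(2) show False by simp
    qed
    then have "t = Im d / Re d" using eq by simp
    then show False using t d unfolding T_def by blast
  qed
  then show ?thesis unfolding collinear_cross2 by blast
qed

lemma concordance_half_turns:
  assumes na: "\<And>i. i < length ps \<Longrightarrow> not_opposite (segment_vector ps i) (segment_vector ps (Suc i))"
  shows "(- 1) ^ concordance ps = (\<Prod>i<length ps. half_turn (segment_vector ps i) (segment_vector ps (Suc i)))"
  unfolding concordance_def
proof (rule concordance_along_half_turns[OF _ na])
  have "\<exists>l. \<forall>d\<in>segment_vector ps ` {..<length ps}. \<not> collinear {0, l, d}"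
    by (rule exists_transversal_direction) (use na in \<open>auto simp: not_opposite_def\<close>)
  then have "\<exists>l. \<forall>i<length ps. \<not> collinear {0, l, segment_vector ps i}" by auto
  from someI_ex[OF this] show "\<And>i. i < length ps \<Longrightarrow>
    \<not> collinear {0, SOME l. \<forall>i<length ps. \<not> collinear {0, l, segment_vector ps i}, segment_vector ps i}" by blast
qed

fun half_turns :: "complex list \<Rightarrow> complex" where
  "half_turns (d # d' # ds) = half_turn d d' * half_turns (d' # ds)"
| "half_turns ds = 1"

fun no_opposite :: "complex list \<Rightarrow> bool" where
  "no_opposite (d # d' # ds) = (not_opposite d d' \<and> no_opposite (d' # ds))"
| "no_opposite ds = True"

lemma half_turns_append:
  "xs \<noteq> [] \<Longrightarrow> ys \<noteq> [] \<Longrightarrow> half_turns (xs @ ys) = half_turns xs * half_turn (last xs) (hd ys) * half_turns ys"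
proof (induction xs rule: half_turns.induct)
  case ("2_2" d)
  then show ?case by (cases ys) auto
qed (simp_all add: algebra_simps)

lemma no_opposite_append:
  "xs \<noteq> [] \<Longrightarrow> ys \<noteq> [] \<Longrightarrow> no_opposite (xs @ ys) \<longleftrightarrow> no_opposite xs \<and> not_opposite (last xs) (hd ys) \<and> no_opposite ys"
proof (induction xs rule: half_turns.induct)
  case ("2_2" d)
  then show ?case by (cases ys) auto
qed auto

lemma half_turns_nth: "half_turns ds = (\<Prod>i<length ds - 1. half_turn (ds ! i) (ds ! Suc i))"
proof (induction ds rule: half_turns.induct)
  case (1 d d' ds)
  have "(\<Prod>i<Suc (length ds). half_turn ((d # d' # ds) ! i) ((d # d' # ds) ! Suc i))
      = half_turn d d' * (\<Prod>i<length ds. half_turn ((d' # ds) ! i) ((d' # ds) ! Suc i))"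
    by (subst prod.lessThan_Suc_shift) simp
  then show ?case using 1 by simp
qed simp_all

lemma no_opposite_nth: "no_opposite ds \<longleftrightarrow> (\<forall>i<length ds - 1. not_opposite (ds ! i) (ds ! Suc i))"
proof (induction ds rule: half_turns.induct)
  case (1 d d' ds)
  have "(\<forall>i<Suc (length ds). not_opposite ((d # d' # ds) ! i) ((d # d' # ds) ! Suc i))
      \<longleftrightarrow> not_opposite d d' \<and> (\<forall>i<length ds. not_opposite ((d' # ds) ! i) ((d' # ds) ! Suc i))"
    using less_Suc_eq_0_disj by auto
  then show ?case using 1 by simp
qed simp_all

text \<open>Repeating the first direction at the end includes the turn from the last segment of the
  closed curve back to the first.\<close>

lemma concordance_segments:
  assumes len: "length ds = length ps" "ps \<noteq> []"
    and ds: "\<And>i. i < length ps \<Longrightarrow> ds ! i = (ps @ [hd ps]) ! Suc i - ps ! i"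
    and na: "no_opposite (ds @ [hd ds])"
  shows "(- 1) ^ concordance ps = half_turns (ds @ [hd ds])"
proof -
  have seg: "segment_vector ps i = (ds @ [hd ds]) ! i" if i: "i \<le> length ps" for i
  proof (cases "i < length ps")
    case True
    have "(ps @ [hd ps]) ! Suc i = ps ! (Suc i mod length ps)"
    proof (cases "Suc i = length ps")
      case True
      then show ?thesis using len(2) by (simp add: nth_append hd_conv_nth)
    next
      case False
      then show ?thesis using True by (simp add: nth_append)
    qed
    then show ?thesis using True ds[OF True] len(1) by (simp add: segment_vector_def nth_append)
  next
    case False
    then have "i = length ps" using i by simp
    moreover have "segment_vector ps (length ps) = segment_vector ps 0"
      by (simp add: segment_vector_def mod_Suc)
    moreover have "segment_vector ps 0 = ds ! 0"
    proof (cases "length ps = 1")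
      case True
      then obtain p where "ps = [p]" by (auto simp: length_Suc_conv)
      then show ?thesis using ds[of 0] by (simp add: segment_vector_def)
    next
      case False
      then have "Suc 0 < length ps" using len(2) by (cases ps) auto
      then show ?thesis using ds[of 0] len(2) by (simp add: segment_vector_def nth_append)
    qed
    moreover have "ds ! 0 = hd ds" using len by (metis hd_conv_nth length_0_conv)
    ultimately show ?thesis using len(1) by (simp add: nth_append)
  qed
  have "(- 1) ^ concordance ps = (\<Prod>i<length ps. half_turn (segment_vector ps i) (segment_vector ps (Suc i)))"
    by (rule concordance_half_turns) (use na seg len(1) in \<open>auto simp: no_opposite_nth\<close>)
  also have "\<dots> = (\<Prod>i<length ps. half_turn ((ds @ [hd ds]) ! i) ((ds @ [hd ds]) ! Suc i))"
    by (intro prod.cong refl) (simp add: seg)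
  finally show ?thesis unfolding half_turns_nth using len(1) by simp
qed

lemma corners_append:
  "xs \<noteq> [] \<Longrightarrow> ys \<noteq> [] \<Longrightarrow> corners (xs @ ys) = corners xs @ (last xs, hd ys) # corners ys"
proof (induction xs)
  case (Cons x xs)
  then show ?case by (cases "xs = []") (simp_all add: corners_Cons)
qed simp

lemma no_opposite_corners:
  "(\<And>e e'. (e, e') \<in> set (corners P) \<Longrightarrow> not_opposite (f e) (f e')) \<Longrightarrow> no_opposite (map f P)"
proof (induction P)
  case (Cons e P)
  show ?case
  proof (cases P)
    case (Cons e' P')
    then have "no_opposite (map f P)" using Cons.IH Cons.prems by (simp add: corners_Cons)
    moreover have "not_opposite (f e) (f e')" using Cons.prems Cons by simp
    ultimately show ?thesis using Cons by simp
  qed simp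
qed simp

lemma pawalk_verts_pcas: "pcas u P v \<Longrightarrow> pawalk_verts u P = map fst P @ [v]"
  by (induction P arbitrary: u) auto

lemma pcas_shift: "pcas u P v \<Longrightarrow> map fst P @ [v] = u # map snd P"
  by (induction P arbitrary: u) auto

lemma half_turn_rcis:
  assumes "r > 0" "s > 0" "\<bar>b - a\<bar> < pi"
  shows "half_turn (rcis r a) (rcis s b) = cis ((b - a) / 2)" "not_opposite (rcis r a) (rcis s b)"
proof -
  have eq: "rcis s b / rcis r a = rcis (s / r) (b - a)" by (simp add: rcis_divide)
  have A: "Arg (rcis s b / rcis r a) = b - a"
    unfolding eq by (rule Arg_rcis) (use assms in auto)
  then show "half_turn (rcis r a) (rcis s b) = cis ((b - a) / 2)" by (simp add: half_turn_def)
  have "Arg (rcis s b / rcis r a) \<noteq> pi" using A assms by auto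
  then show "not_opposite (rcis r a) (rcis s b)"
    unfolding not_opposite_def using assms Arg_eq_pi_iff by auto
qed

text \<open>A chord of the circle is perpendicular to the ray that bisects its arc.\<close>

lemma cis_diff_rcis: "cis b - cis a = rcis (2 * sin ((b - a) / 2)) ((a + b) / 2 + pi / 2)"
proof -
  have "cis b - cis a = cis ((a + b) / 2) * (cis ((b - a) / 2) - cis (- ((b - a) / 2)))"
    by (simp add: right_diff_distrib cis_mult field_simps)
  also have "cis ((b - a) / 2) - cis (- ((b - a) / 2)) = 2 * \<i> * sin ((b - a) / 2)"
    by (simp add: complex_eq_iff)
  also have "cis ((a + b) / 2) * (2 * \<i> * sin ((b - a) / 2)) = rcis (2 * sin ((b - a) / 2)) ((a + b) / 2 + pi / 2)"
    unfolding rcis_def cis_mult[symmetric] by simp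
  finally show ?thesis .
qed

text \<open>It is used with the functional of the line through a hull edge: \<open>x\<close> is the
  direction of that edge, and \<open>w\<close> leads from an internal vertex to the line or
  back.\<close>

lemma not_opposite_functional:
  assumes "x \<noteq> 0" "inner a x = 0" "inner a w \<noteq> 0"
  shows "not_opposite x w" "not_opposite w x"
proof -
  have w: "w \<noteq> 0" using assms by auto
  have "w / x \<notin> \<real>"
  proof
    assume "w / x \<in> \<real>"
    then obtain r where "w / x = of_real r" by (auto elim: Reals_cases)
    then have "w = r *\<^sub>R x" using assms(1) by (simp add: field_simps scaleR_conv_of_real)
    then show False using assms by simp
  qed
  moreover have "x / w \<notin> \<real>"
  proof
    assume "x / w \<in> \<real>"
    then obtain r where r: "x / w = of_real r" by (auto elim: Reals_cases)
    then have x: "x = r *\<^sub>R w" using w by (simp add: field_simps scaleR_conv_of_real)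
    then have "r = 0" using assms(2,3) by simp
    then show False using x assms(1) by simp
  qed
  ultimately show "not_opposite x w" "not_opposite w x" using assms(1) w by (auto simp: not_opposite_def)
qed

context perfect_network
begin

section \<open>Turning along the boundary of the convex hull\<close>

definition arrow :: "edge \<Rightarrow> complex" where
  "arrow e = snd e - fst e"

definition nx :: "nat \<Rightarrow> nat" where
  "nx y = (if y = n then 1 else Suc y)"

text \<open>After label \<open>n\<close> a full turn is added, so that the angle of the next vertex
  always exceeds that of \<open>y\<close>.\<close>

definition nx_angle :: "nat \<Rightarrow> real" where
  "nx_angle y = (if y = n then bangle 1 + 2 * pi else bangle (Suc y))"

definition hull_dir :: "nat \<Rightarrow> complex" where
  "hull_dir y = bd (nx y) - bd y"

text \<open>The direction of the hull edge leaving \<open>bd y\<close> is this angle plus pi /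
  2.\<close>

definition mid_angle :: "nat \<Rightarrow> real" where
  "mid_angle y = (bangle y + nx_angle y) / 2"

lemma bangle_less: "x \<in> {1..n} \<Longrightarrow> y \<in> {1..n} \<Longrightarrow> x < y \<Longrightarrow> bangle x < bangle y"
  using strict_mono_onD[OF bangle(1)] .

lemma bd_nx: "y \<in> {1..n} \<Longrightarrow> bd (nx y) = cis (nx_angle y)"
  by (auto simp: nx_def nx_angle_def bangle(3) cis_mult[symmetric])

lemma nx_angle_bounds:
  assumes "y \<in> {1..n}" "n \<ge> 3"
  shows "bangle y < nx_angle y" "nx_angle y < bangle y + 2 * pi"
proof (atomize(full), cases "y = n")
  case True
  then show "bangle y < nx_angle y \<and> nx_angle y < bangle y + 2 * pi"
    using bangle(2)[of 1 n] bangle_less[of 1 n] assms by (auto simp: nx_angle_def)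
next
  case False
  then show "bangle y < nx_angle y \<and> nx_angle y < bangle y + 2 * pi"
    using bangle(2)[of y "Suc y"] bangle_less[of y "Suc y"] assms by (auto simp: nx_angle_def)
qed

lemma hull_dir_rcis:
  assumes "y \<in> {1..n}"
  shows "hull_dir y = rcis (2 * sin ((nx_angle y - bangle y) / 2)) (mid_angle y + pi / 2)"
  unfolding hull_dir_def bd_nx[OF assms] bangle(3)[OF assms] mid_angle_def by (rule cis_diff_rcis)

lemma hull_dir_radius:
  assumes "y \<in> {1..n}" "n \<ge> 3"
  shows "2 * sin ((nx_angle y - bangle y) / 2) > 0"
  using nx_angle_bounds[OF assms] by (simp add: sin_gt_zero)

lemma hull_dir_nonzero: "y \<in> {1..n} \<Longrightarrow> n \<ge> 3 \<Longrightarrow> hull_dir y \<noteq> 0"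
  using hull_dir_rcis[of y] hull_dir_radius[of y] by simp

lemma hull_dir_turn:
  assumes "y \<in> {1..n}" "Suc y \<in> {1..n}" "n \<ge> 3"
  shows "half_turn (hull_dir y) (hull_dir (Suc y)) = cis ((mid_angle (Suc y) - mid_angle y) / 2)"
    "not_opposite (hull_dir y) (hull_dir (Suc y))"
proof -
  have yn: "nx_angle y = bangle (Suc y)" using assms by (auto simp: nx_angle_def)
  have "nx_angle (Suc y) - bangle y < 2 * pi"
  proof (cases "Suc y = n")
    case True
    then show ?thesis using assms bangle_less[of 1 y] by (auto simp: nx_angle_def)
  next
    case False
    then show ?thesis using assms bangle(2)[of y "Suc (Suc y)"] by (auto simp: nx_angle_def)
  qed
  moreover have "mid_angle (Suc y) - mid_angle y = (nx_angle (Suc y) - bangle y) / 2"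
    unfolding mid_angle_def yn by (simp add: field_simps)
  moreover have "0 < nx_angle (Suc y) - bangle y"
    using nx_angle_bounds(1)[OF assms(1,3)] nx_angle_bounds(1)[OF assms(2,3)] yn by simp
  ultimately have "\<bar>(mid_angle (Suc y) + pi / 2) - (mid_angle y + pi / 2)\<bar> < pi" by simp
  from half_turn_rcis[OF hull_dir_radius[OF assms(1,3)] hull_dir_radius[OF assms(2,3)] this]
  show "half_turn (hull_dir y) (hull_dir (Suc y)) = cis ((mid_angle (Suc y) - mid_angle y) / 2)"
    "not_opposite (hull_dir y) (hull_dir (Suc y))"
    unfolding hull_dir_rcis[OF assms(1)] hull_dir_rcis[OF assms(2)] by simp_all
qed

text \<open>From the last hull edge to the first, \<open>mid_angle\<close> falls back by a full
  turn. Undoing this adds pi to the half angle, which is the factor - 1 recorded by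
  \<open>wrap_sign\<close>.\<close>

lemma hull_dir_turn_wrap:
  assumes "n \<ge> 3"
  shows "half_turn (hull_dir n) (hull_dir 1) = - cis ((mid_angle 1 - mid_angle n) / 2)"
    "not_opposite (hull_dir n) (hull_dir 1)"
proof -
  have r: "n \<in> {1..n}" "1 \<in> {1..n}" using assms by auto
  have m: "mid_angle 1 + 2 * pi - mid_angle n = (bangle 2 + 2 * pi - bangle n) / 2"
    using assms unfolding mid_angle_def nx_angle_def by (simp add: field_simps numeral_2_eq_2)
  have "bangle 2 < bangle n" "bangle n < bangle 2 + 2 * pi"
    using assms bangle_less[of 2 n] bangle(2)[of 2 n] by auto
  then have b: "\<bar>((mid_angle 1 + pi / 2) + 2 * pi) - (mid_angle n + pi / 2)\<bar> < pi" using m by simp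
  have per: "rcis x (t + 2 * pi) = rcis x t" for x t by (simp add: rcis_def cis_mult[symmetric])
  have h1: "hull_dir 1 = rcis (2 * sin ((nx_angle 1 - bangle 1) / 2)) ((mid_angle 1 + pi / 2) + 2 * pi)"
    unfolding hull_dir_rcis[OF r(2)] per ..
  have e: "(((mid_angle 1 + pi / 2) + 2 * pi) - (mid_angle n + pi / 2)) / 2 = (mid_angle 1 - mid_angle n) / 2 + pi"
    by (simp add: field_simps)
  from half_turn_rcis[OF hull_dir_radius[OF r(1) assms] hull_dir_radius[OF r(2) assms] b, folded h1 hull_dir_rcis[OF r(1)]]
  have "half_turn (hull_dir n) (hull_dir 1) = cis ((mid_angle 1 - mid_angle n) / 2 + pi)" "not_opposite (hull_dir n) (hull_dir 1)"
    unfolding e by simp_all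
  then show "half_turn (hull_dir n) (hull_dir 1) = - cis ((mid_angle 1 - mid_angle n) / 2)"
    "not_opposite (hull_dir n) (hull_dir 1)" by (simp_all add: cis_mult[symmetric])
qed

lemma hull_dirs_turn:
  assumes "1 \<le> a" "a \<le> b" "b \<le> n" "n \<ge> 3"
  shows "half_turns (map hull_dir [a..<Suc b]) = cis ((mid_angle b - mid_angle a) / 2)
    \<and> no_opposite (map hull_dir [a..<Suc b])"
  using assms(2,3)
proof (induction b rule: dec_induct)
  case (step b)
  have "map hull_dir [a..<Suc (Suc b)] = map hull_dir [a..<Suc b] @ [hull_dir (Suc b)]"
    using step(1) by simp
  moreover have "map hull_dir [a..<Suc b] \<noteq> []" "last (map hull_dir [a..<Suc b]) = hull_dir b" using step(1) by auto
  moreover have "b \<in> {1..n}" "Suc b \<in> {1..n}" using step assms(1) by auto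
  note t = hull_dir_turn[OF this assms(4)]
  ultimately show ?case
    using step(3,4) t by (simp add: half_turns_append no_opposite_append cis_mult diff_divide_distrib)
qed simp

text \<open>These are the labels at which the hull edges of the arc from \<open>j\<close> to
  \<open>i\<close> start, so the last one precedes \<open>i\<close>.\<close>

definition hull_labels :: "nat \<Rightarrow> nat \<Rightarrow> nat list" where
  "hull_labels j i = j # labels_between n j i"

definition pv :: "nat \<Rightarrow> nat" where
  "pv i = (if i = 1 then n else i - 1)"

lemma hull_labels_conv:
  assumes "i \<in> {1..n}" "j \<in> {1..n}" "i \<noteq> j"
  shows "hull_labels j i = (if j < i then [j..<i] else [j..<Suc n] @ [1..<i])"
  using assms upt_conv_Cons[of j i] upt_conv_Cons[of j "Suc n"] by (auto simp: hull_labels_def labels_between_def)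

lemma hull_labels_shift:
  assumes "i \<in> {1..n}" "j \<in> {1..n}" "i \<noteq> j"
  shows "hull_labels j i @ [i] = j # map nx (hull_labels j i)"
proof (cases "j < i")
  case True
  have "map nx [j..<i] = map Suc [j..<i]" using assms by (intro map_cong refl) (auto simp: nx_def)
  then show ?thesis
    unfolding hull_labels_conv[OF assms] using True upt_conv_Cons[of j "Suc i"] by (simp add: map_Suc_upt)
next
  case False
  have "map nx [j..<n] = map Suc [j..<n]" "map nx [1..<i] = map Suc [1..<i]"
    using assms by (intro map_cong refl; auto simp: nx_def)+
  then have nx: "map nx [j..<n] = [Suc j..<Suc n]" "map nx [1..<i] = [Suc 1..<Suc i]"
    by (simp_all only: map_Suc_upt)
  have "j \<le> n" "j < Suc n" "1 < Suc i" "1 \<le> i" using assms by auto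
  then have 1: "[j..<Suc n] = [j..<n] @ [n]" "j # [Suc j..<Suc n] = [j..<Suc n]"
    and 2: "1 # [Suc 1..<Suc i] = [1..<i] @ [i]"
    using upt_conv_Cons[of j "Suc n"] upt_conv_Cons[of 1 "Suc i"] upt_Suc_append[of 1 i] upt_Suc_append[of j n]
    by (simp_all del: upt_Suc)
  have "j # map nx ([j..<Suc n] @ [1..<i]) = (j # [Suc j..<Suc n]) @ (1 # [Suc 1..<Suc i])"
    unfolding 1(1) map_append nx by (simp add: nx_def del: upt_Suc)
  also have "\<dots> = ([j..<Suc n] @ [1..<i]) @ [i]" unfolding 1(2) 2 by simp
  finally show ?thesis
    unfolding hull_labels_conv[OF assms] using False by (simp del: upt_Suc)
qed

text \<open>The turns telescope, with a factor - 1 if the arc turns at label 1. For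
  \<open>i = 1\<close> the arc ends there without turning, although \<open>wrap_sign\<close> is - 1;
  the correcting factor depends on \<open>i\<close> only and is absorbed by the end factor in
  \<open>walk_sign\<close>.\<close>

lemma hull_labels_turn:
  assumes "i \<in> {1..n}" "j \<in> {1..n}" "i \<noteq> j" "n \<ge> 3"
  shows "half_turns (map hull_dir (hull_labels j i)) =
      wrap_sign i j * ((if i = 1 then - 1 else 1) * (cis (mid_angle (pv i) / 2) / cis (mid_angle j / 2)))"
    "no_opposite (map hull_dir (hull_labels j i))" "last (hull_labels j i) = pv i" "set (hull_labels j i) \<subseteq> {1..n}"
proof -
  have "half_turns (map hull_dir (hull_labels j i)) =
      wrap_sign i j * ((if i = 1 then - 1 else 1) * (cis (mid_angle (pv i) / 2) / cis (mid_angle j / 2)))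
    \<and> no_opposite (map hull_dir (hull_labels j i)) \<and> last (hull_labels j i) = pv i"
  proof (cases "j < i")
    case True
    obtain i' where i': "i = Suc i'" using True by (cases i) auto
    have "1 \<le> j" "j \<le> i'" "i' \<le> n" "i \<noteq> 1" using True assms i' by auto
    with hull_dirs_turn[of j i'] show ?thesis
      unfolding hull_labels_conv[OF assms(1-3)] using True assms(4) i'
      by (simp add: wrap_sign_def pv_def cis_divide diff_divide_distrib last_map del: upt_Suc)
  next
    case False
    note 1 = hull_dirs_turn[of j n]
    show ?thesis
    proof (cases "i = 1")
      case True
      then show ?thesis
        unfolding hull_labels_conv[OF assms(1-3)] using 1 False assms
        by (simp add: wrap_sign_def pv_def cis_divide diff_divide_distrib)
    next
      case i1: False
      then have i: "[1..<i] = [1..<Suc (i - 1)]" "1 \<le> i - 1" using assms by auto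
      note 2 = hull_dirs_turn[of 1 "i - 1", folded i(1)]
      have "1 < i" "j < Suc n" using assms i1 by auto
      then have ne: "map hull_dir [j..<Suc n] \<noteq> []" "map hull_dir [1..<i] \<noteq> []" by auto
      have lh: "last (map hull_dir [j..<Suc n]) = hull_dir n" "hd (map hull_dir [1..<i]) = hull_dir 1"
      proof -
        have "1 < i" using assms i1 by simp
        then show "last (map hull_dir [j..<Suc n]) = hull_dir n" "hd (map hull_dir [1..<i]) = hull_dir 1"
          using assms by (simp_all add: hd_map last_map)
      qed
      have "hull_labels j i = [j..<Suc n] @ [1..<i]" unfolding hull_labels_conv[OF assms(1-3)] using False by simp
      moreover have "last ([j..<Suc n] @ [1..<i]) = i - 1" using \<open>1 < i\<close> by (simp add: last_append)
      moreover have "cis ((mid_angle n - mid_angle j) / 2) * (- cis ((mid_angle 1 - mid_angle n) / 2)) * cis ((mid_angle (i - 1) - mid_angle 1) / 2)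
          = - (cis (mid_angle (i - 1) / 2) / cis (mid_angle j / 2))"
      proof -
        have "cis ((u - v) / 2) = cis (u / 2) / cis (v / 2)" for u v
          by (simp add: cis_divide diff_divide_distrib)
        note E = this
        show ?thesis unfolding E by simp
      qed
      ultimately show ?thesis
        using 1 2 i i1 False assms hull_dir_turn_wrap[OF assms(4)] half_turns_append[OF ne] no_opposite_append[OF ne]
        unfolding lh by (simp add: wrap_sign_def pv_def del: upt_Suc)
    qed
  qed
  then show "half_turns (map hull_dir (hull_labels j i)) =
      wrap_sign i j * ((if i = 1 then - 1 else 1) * (cis (mid_angle (pv i) / 2) / cis (mid_angle j / 2)))"
    "no_opposite (map hull_dir (hull_labels j i))" "last (hull_labels j i) = pv i" by blast+
  show "set (hull_labels j i) \<subseteq> {1..n}"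
    unfolding hull_labels_conv[OF assms(1-3)] using assms by auto
qed

text \<open>The hull edge from \<open>bd y\<close> to the next vertex lies on a supporting line with
  outer normal \<open>a\<close>: no boundary angle falls strictly between those of its ends, so no
  boundary vertex is farther out in this direction.\<close>

lemma hull_halfplane:
  assumes y: "y \<in> {1..n}" and n: "n \<ge> 3"
  defines "a \<equiv> cis (mid_angle y)" and "c \<equiv> cos ((nx_angle y - bangle y) / 2)"
  shows "inner a (bd y) = c" "inner a (bd (nx y)) = c" "v \<in> internal_vertices n N \<Longrightarrow> inner a v < c"
proof -
  have ip: "inner (cis s) (cis t) = cos (t - s)" for s t by (simp add: inner_complex_def cos_diff mult.commute)
  have e: "bangle y - mid_angle y = - ((nx_angle y - bangle y) / 2)" "nx_angle y - mid_angle y = (nx_angle y - bangle y) / 2"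
    unfolding mid_angle_def by (simp_all add: field_simps)
  show "inner a (bd y) = c" unfolding a_def c_def bangle(3)[OF y] ip e by simp
  show "inner a (bd (nx y)) = c" unfolding a_def c_def bd_nx[OF y] ip e ..
  have le: "inner a (bd z) \<le> c" if z: "z \<in> {1..n}" for z
  proof -
    \<comment> \<open>As a product of sines the difference is seen to be nonnegative: the two half
      angles have the same sign and are at most pi in absolute value.\<close>
    have "c - cos (bangle z - mid_angle y) = 2 * sin ((bangle z - bangle y) / 2) * sin ((bangle z - nx_angle y) / 2)"
    proof -
      have "((nx_angle y - bangle y) / 2 + (bangle z - mid_angle y)) / 2 = (bangle z - bangle y) / 2"
        "(bangle z - mid_angle y - (nx_angle y - bangle y) / 2) / 2 = (bangle z - nx_angle y) / 2"
        unfolding mid_angle_def by (simp_all add: field_simps)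
      note e = this
      show ?thesis unfolding c_def cos_diff_cos e ..
    qed
    moreover have "sin ((bangle z - bangle y) / 2) * sin ((bangle z - nx_angle y) / 2) \<ge> 0"
    proof (cases "z \<le> y")
      case True
      have "bangle z \<le> bangle y" using True bangle_less[OF z y] by (cases "z = y") auto
      moreover have "nx_angle y \<le> bangle z + 2 * pi"
      proof (cases "y = n")
        case True
        then show ?thesis using z bangle_less[of 1 z] n by (cases "z = 1") (auto simp: nx_angle_def)
      next
        case False
        then show ?thesis using bangle(2)[OF z, of "Suc y"] y by (auto simp: nx_angle_def)
      qed
      ultimately have "sin ((bangle y - bangle z) / 2) \<ge> 0" "sin ((nx_angle y - bangle z) / 2) \<ge> 0"
        using nx_angle_bounds(1)[OF y n] by (auto intro!: sin_ge_zero)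
      moreover have "sin ((bangle z - bangle y) / 2) = - sin ((bangle y - bangle z) / 2)"
        "sin ((bangle z - nx_angle y) / 2) = - sin ((nx_angle y - bangle z) / 2)"
        by (simp_all add: minus_divide_left flip: sin_minus)
      ultimately show ?thesis by simp
    next
      case False
      then have "y \<noteq> n" using z by auto
      then have "nx_angle y \<le> bangle z" using False bangle_less[of "Suc y" z] z
        by (cases "z = Suc y") (auto simp: nx_angle_def)
      moreover have "bangle z < bangle y + 2 * pi" using bangle(2)[OF y z] .
      ultimately have "sin ((bangle z - bangle y) / 2) \<ge> 0" "sin ((bangle z - nx_angle y) / 2) \<ge> 0"
        using nx_angle_bounds(1)[OF y n] by (auto intro!: sin_ge_zero)
      then show ?thesis by simp
    qed
    ultimately show ?thesis unfolding a_def bangle(3)[OF z] ip by linarith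
  qed
  assume v: "v \<in> internal_vertices n N"
  have "convex hull (boundary_vertices n N) \<subseteq> {z. inner a z \<le> c}"
    by (rule hull_minimal) (auto simp: boundary_vertices_conv le convex_halfspace_le)
  then have "interior (convex hull (boundary_vertices n N)) \<subseteq> interior {z. inner a z \<le> c}" by (rule interior_mono)
  moreover have "v \<in> interior (convex hull (boundary_vertices n N))" using net v by (auto simp: Net_def)
  moreover have "a \<noteq> 0" by (simp add: a_def)
  ultimately show "inner a v < c" by (auto simp: interior_halfspace_le)
qed

lemma hull_dir_not_opposite:
  assumes y: "y \<in> {1..n}" and n: "n \<ge> 3" and v: "v \<in> internal_vertices n N"
  shows "not_opposite (bd y - v) (hull_dir y)" "not_opposite (hull_dir y) (v - bd (nx y))"
proof -
  note h = hull_halfplane[OF y n]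
  have 0: "inner (cis (mid_angle y)) (hull_dir y) = 0" unfolding hull_dir_def inner_diff_right h(1,2) by simp
  show "not_opposite (bd y - v) (hull_dir y)" "not_opposite (hull_dir y) (v - bd (nx y))"
    by (rule not_opposite_functional[OF hull_dir_nonzero[OF y n] 0]; use h(1,2) h(3)[OF v] in \<open>simp add: inner_diff_right\<close>)+
qed

lemma internal_three: "v \<in> internal_vertices n N \<Longrightarrow> n \<ge> 3"
proof (rule ccontr)
  assume v: "v \<in> internal_vertices n N" and "\<not> n \<ge> 3"
  then have "card (boundary_vertices n N) \<le> DIM(complex)"
    using card_image_le[of "{1..n}" bd] by (simp add: boundary_vertices_conv)
  then have "interior (convex hull (boundary_vertices n N)) = {}"
    by (intro empty_interior_convex_hull) (simp add: boundary_vertices_conv)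
  then show False using net v by (auto simp: Net_def)
qed

lemma arrow_not_opposite:
  assumes "P \<in> walks i j" "i \<in> I" "j \<in> J" "(e, e') \<in> set (corners P)"
  shows "not_opposite (arrow e) (arrow e')"
proof -
  note c = corner_vertex[OF assms]
  have ne: "e \<noteq> e'" using c(3) edge_ends_neq[OF c(1)] by auto
  have a: "edge_dir (snd e) e = - arrow e" "edge_dir (snd e) e' = arrow e'"
    using edge_dir_simps[OF c(1)] edge_dir_simps[OF c(2)] c(3) by (simp_all add: arrow_def)
  have "Arg2pi (arrow e' / - arrow e) > 0"
    using edge_dir_ratio[OF c(1,2) ne, of "snd e"] c(3) unfolding a by simp
  then have "\<not> (arrow e' / - arrow e \<in> \<real> \<and> 0 \<le> Re (arrow e' / - arrow e))" using Arg2pi_eq_0[of "arrow e' / - arrow e"] by (metis less_irrefl)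
  then have "\<not> (arrow e' / arrow e \<in> \<real> \<and> Re (arrow e' / arrow e) < 0)" by auto
  moreover have "arrow e \<noteq> 0" "arrow e' \<noteq> 0" using edge_ends_neq[OF c(1)] edge_ends_neq[OF c(2)] by (auto simp: arrow_def)
  ultimately show ?thesis by (simp add: not_opposite_def)
qed

text \<open>It is the first or last edge of every path with an end at label \<open>y\<close>, so the
  factors of \<open>walk_sign\<close> at the ends depend on the labels only.\<close>

definition boundary_edge :: "nat \<Rightarrow> edge" where
  "boundary_edge y = (SOME e. e \<in> E \<and> (fst e = bd y \<or> snd e = bd y))"

lemma boundary_edge_eq:
  assumes "y \<in> {1..n}" "e \<in> E" "fst e = bd y \<or> snd e = bd y"
  shows "boundary_edge y = e"
proof -
  have "\<exists>e. e \<in> E \<and> (fst e = bd y \<or> snd e = bd y)" using assms by blast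
  from someI_ex[OF this, folded boundary_edge_def] show ?thesis
    using boundary_edge_unique[OF assms(1) _ assms(2)] assms(3) by blast
qed

text \<open>
  The sign is the product of factors for the two ends and for the corners of the path and of a
  factor for the boundary arc; only the last one is affected by exchanging tails.
\<close>

lemma walk_sign:
  assumes P: "P \<in> walks i j" "i \<in> I" "j \<in> J" and len: "length P \<ge> 2"
  shows "of_real (path_sign n N i j P) = wrap_sign i j
      * ((if i = 1 then 1 else - 1) * cis (mid_angle (pv i) / 2) * half_turn (hull_dir (pv i)) (arrow (boundary_edge i)))
      * (half_turn (arrow (boundary_edge j)) (hull_dir j) / cis (mid_angle j / 2))
      * half_turns (map arrow P)"
proof -
  note w = walksD[OF P]
  have r: "i \<in> {1..n}" "j \<in> {1..n}" "i \<noteq> j" using P labels in_range by auto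
  obtain h Q where hQ0: "P = h # Q" using w(1) by (cases P) simp_all
  then have hQ: "P = h # Q" "Q \<noteq> []" using len by auto
  obtain l R where lR0: "P = R @ [l]" using w(1) by (cases P rule: rev_cases) simp_all
  then have lR: "P = R @ [l]" "R \<noteq> []" using len by auto
  have "(h, hd Q) \<in> set (corners P)" using hQ by (simp add: corners_Cons)
  from corner_vertex[OF P this] have h: "snd h \<in> internal_vertices n N" by simp
  have "(last R, l) \<in> set (corners P)" using lR corners_append[of R "[l]"] by simp
  from corner_vertex[OF P this] have l: "fst l \<in> internal_vertices n N" by simp
  have n: "n \<ge> 3" by (rule internal_three[OF h])
  have "fst h = bd i" using w(4) hQ(1) by simp
  moreover have "snd l = bd j" using w(5) lR(1) by simp
  ultimately have ends: "fst h = bd i" "snd l = bd j" .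
  have "h \<in> E" using w(2) hQ(1) by simp
  then have be1: "boundary_edge i = h" by (rule boundary_edge_eq[OF r(1)]) (simp add: ends)
  have "l \<in> E" using w(2) lR(1) by simp
  then have "boundary_edge j = l" by (rule boundary_edge_eq[OF r(2)]) (simp add: ends)
  note be = be1 this
  note hl = hull_labels_turn[OF r n]
  define hs where "hs = map hull_dir (hull_labels j i)"
  define ps where "ps = closed_path n N i j P"
  define ds where "ds = map arrow P @ hs"
  have ps: "ps = map fst P @ map bd (hull_labels j i)"
    unfolding ps_def closed_path_def awalk_verts_with_proj_eq using pawalk_verts_pcas[OF w(3)]
    by (simp add: hull_labels_def)
  have shift: "ps @ [hd ps] = bd i # map snd P @ map (\<lambda>y. bd (nx y)) (hull_labels j i)"
  proof -
    have "hd ps = bd i" using hQ ends unfolding ps by simp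
    then have "ps @ [hd ps] = map fst P @ map bd (hull_labels j i @ [i])" unfolding ps by simp
    also have "\<dots> = (map fst P @ [bd j]) @ map (\<lambda>y. bd (nx y)) (hull_labels j i)"
      unfolding hull_labels_shift[OF r] by simp
    also have "\<dots> = bd i # map snd P @ map (\<lambda>y. bd (nx y)) (hull_labels j i)"
      unfolding pcas_shift[OF w(3)] by simp
    finally show ?thesis .
  qed
  have hs: "hs \<noteq> []" "hd hs = hull_dir j" "last hs = hull_dir (pv i)"
    using hl(3) by (auto simp: hs_def hull_labels_def last_map)
  have "hd (map arrow P) = arrow h" using hQ(1) by simp
  moreover have "last (map arrow P) = arrow l" using lR by simp
  ultimately have mP: "map arrow P \<noteq> []" "hd (map arrow P) = arrow h" "last (map arrow P) = arrow l"
    using w(1) by simp_all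
  have hd_ds: "hd ds = arrow h" unfolding ds_def using mP by simp
  have "pv i \<in> {1..n}" "nx (pv i) = i" using r n by (auto simp: pv_def nx_def)
  note opp = hull_dir_not_opposite[OF this(1) n h, unfolded this(2)] hull_dir_not_opposite[OF r(2) n l]
  have no: "no_opposite (ds @ [hd ds])"
  proof -
    have "no_opposite (map arrow P)"
      by (rule no_opposite_corners) (rule arrow_not_opposite[OF P])
    moreover have "not_opposite (arrow l) (hull_dir j)" "not_opposite (hull_dir (pv i)) (arrow h)"
      using opp ends unfolding arrow_def by auto
    ultimately show ?thesis
      using hl(2) hs mP unfolding hd_ds unfolding ds_def append_assoc
      by (simp add: no_opposite_append hs_def)
  qed
  have "(- 1) ^ concordance ps = half_turns (ds @ [hd ds])"
  proof (rule concordance_segments[OF _ _ _ no])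
    show "length ds = length ps" unfolding ds_def hs_def ps by simp
    show "ps \<noteq> []" unfolding ps hull_labels_def by simp
    fix k assume k: "k < length ps"
    show "ds ! k = (ps @ [hd ps]) ! Suc k - ps ! k"
      unfolding shift using k unfolding ps ds_def hs_def
      by (auto simp: nth_append arrow_def hull_dir_def)
  qed
  also have "\<dots> = half_turns (map arrow P) * half_turn (arrow l) (hull_dir j) * half_turns hs * half_turn (hull_dir (pv i)) (arrow h)"
    unfolding hd_ds unfolding ds_def append_assoc using hs mP by (simp add: half_turns_append)
  finally have conc: "(- 1) ^ concordance ps = half_turns (map arrow P) * half_turn (arrow l) (hull_dir j) * half_turns hs * half_turn (hull_dir (pv i)) (arrow h)" .
  \<comment> \<open>The exponent \<open>concordance - 1\<close> in \<open>path_sign\<close> is - 1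
    or 0, so the sign is the negative of the product of the half turns.\<close>
  have "concordance ps < 2" unfolding concordance_def concordance_along_def by simp
  then have "concordance ps = 0 \<or> concordance ps = 1" by linarith
  then have "of_real (path_sign n N i j P) = - ((- 1) ^ concordance ps :: complex)"
    unfolding path_sign_def ps_def[symmetric] by auto
  then show ?thesis
    unfolding conc hs_def hl(1) be by simp
qed

section \<open>Exchanging tails\<close>

text \<open>The total length \<open>L\<close> is preserved by exchanging tails. Fixing it makes the
  sums over pairs finite, and these sums are the coefficients of products of power series.\<close>

definition marked :: "nat \<Rightarrow> nat \<Rightarrow> nat \<Rightarrow> nat \<Rightarrow> nat \<Rightarrow> (edge list \<times> edge list) set" where
  "marked i j i' j' L = {(P, P'). P \<in> walks i j \<and> P' \<in> walks i' j' \<and> length P + length P' = L}"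

text \<open>Paths may pass a vertex several times, so a pair is listed once for every pair of
  positions at a common inner vertex. The predicate \<open>Q\<close> selects the colour.\<close>

definition visits :: "(complex \<Rightarrow> bool) \<Rightarrow> nat \<Rightarrow> nat \<Rightarrow> nat \<Rightarrow> nat \<Rightarrow> nat \<Rightarrow> (edge list \<times> edge list \<times> nat \<times> nat) set" where
  "visits Q i j i' j' L = {(P, P', t, s). (P, P') \<in> marked i j i' j' L \<and> Suc t < length P \<and> Suc s < length P' \<and>
     snd (P ! t) = snd (P' ! s) \<and> Q (snd (P ! t))}"

definition walk_weight :: "(edge \<Rightarrow> real) \<Rightarrow> nat \<Rightarrow> nat \<Rightarrow> edge list \<Rightarrow> real" where
  "walk_weight w i j P = path_sign n N i j P * (\<Prod>e\<leftarrow>P. w e)"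

definition visit_value :: "(edge \<Rightarrow> real) \<Rightarrow> nat \<Rightarrow> nat \<Rightarrow> nat \<Rightarrow> nat \<Rightarrow> edge list \<times> edge list \<times> nat \<times> nat \<Rightarrow> real" where
  "visit_value w i j i' j' = (\<lambda>(P, P', t, s). walk_weight w i j P * walk_weight w i' j' P' *
     eps (P ! t, P ! Suc t) (P' ! s, P' ! Suc s))"

text \<open>The positions are kept: in the new pair they mark the same vertex, which makes the map
  an involution.\<close>

definition tail_swap :: "edge list \<times> edge list \<times> nat \<times> nat \<Rightarrow> edge list \<times> edge list \<times> nat \<times> nat" where
  "tail_swap = (\<lambda>(P, P', t, s). (take (Suc t) P @ drop (Suc s) P', take (Suc s) P' @ drop (Suc t) P, t, s))"

lemma finite_walks_length: "finite {P. P \<in> walks i j \<and> length P = L}"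
proof (rule finite_subset)
  show "{P. P \<in> walks i j \<and> length P = L} \<subseteq> {P. set P \<subseteq> E \<and> length P = L}"
    unfolding walks_def awalk_def by auto
  show "finite {P. set P \<subseteq> E \<and> length P = L}" by (rule finite_lists_length_eq[OF finite_E])
qed

lemma finite_marked: "finite (marked i j i' j' L)"
proof (rule finite_subset)
  show "marked i j i' j' L \<subseteq> (\<Union>l\<in>{..L}. {P. P \<in> walks i j \<and> length P = l}) \<times> (\<Union>l\<in>{..L}. {P. P \<in> walks i' j' \<and> length P = l})"
    unfolding marked_def by auto
  show "finite ((\<Union>l\<in>{..L}. {P. P \<in> walks i j \<and> length P = l}) \<times> (\<Union>l\<in>{..L}. {P. P \<in> walks i' j' \<and> length P = l}))"
    by (intro finite_cartesian_product finite_UN_I finite_atMost finite_walks_length)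
qed

lemma pcas_append: "pcas u (P @ Q) v \<longleftrightarrow> (\<exists>m. pcas u P m \<and> pcas m Q v)"
  by (induction P arbitrary: u) auto

lemma pcas_split:
  assumes "pcas u P v" "Suc t < length P"
  shows "pcas u (take (Suc t) P) (snd (P ! t))" "pcas (snd (P ! t)) (drop (Suc t) P) v"
proof -
  have d: "drop (Suc t) P = P ! Suc t # drop (Suc (Suc t)) P" using assms(2) by (simp add: Cons_nth_drop_Suc)
  have c: "(P ! t, P ! Suc t) \<in> set (corners P)"
    using assms(2) by (auto simp: set_zip nth_tl intro!: exI[of _ t])
  obtain m where m: "pcas u (take (Suc t) P) m" "pcas m (drop (Suc t) P) v"
    using assms(1) pcas_append[of u "take (Suc t) P" "drop (Suc t) P" v] by auto
  have "m = snd (P ! t)" using m(2) pcas_corners[OF assms(1) c] unfolding d by simp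
  then show "pcas u (take (Suc t) P) (snd (P ! t))" "pcas (snd (P ! t)) (drop (Suc t) P) v" using m by simp_all
qed

lemma walks_swap:
  assumes P: "P \<in> walks i j" "Suc t < length P" and P': "P' \<in> walks i' j'" "Suc s < length P'"
    and v: "snd (P ! t) = snd (P' ! s)"
  shows "take (Suc t) P @ drop (Suc s) P' \<in> walks i j'"
proof -
  have w: "bd i \<in> pverts (graph N)" "set P \<subseteq> E" "pcas (bd i) P (bd j)" and w': "set P' \<subseteq> E" "pcas (bd i') P' (bd j')"
    using P(1) P'(1) unfolding walks_def awalk_def by auto
  have "pcas (bd i) (take (Suc t) P @ drop (Suc s) P') (bd j')"
    unfolding pcas_append using pcas_split(1)[OF w(3) P(2)] pcas_split(2)[OF w'(2) P'(2)] v by auto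
  moreover have "set (take (Suc t) P @ drop (Suc s) P') \<subseteq> E"
    using w(2) w'(1) set_take_subset[of "Suc t" P] set_drop_subset[of "Suc s" P'] by auto
  ultimately show ?thesis using w(1) unfolding walks_def awalk_def by simp
qed

lemma nth_swap:
  assumes "Suc t < length P" "Suc s < length P'"
  shows "(take (Suc t) P @ drop (Suc s) P') ! t = P ! t" "(take (Suc t) P @ drop (Suc s) P') ! Suc t = P' ! Suc s"
    "take (Suc t) (take (Suc t) P @ drop (Suc s) P') = take (Suc t) P"
    "drop (Suc t) (take (Suc t) P @ drop (Suc s) P') = drop (Suc s) P'"
  using assms by (auto simp: nth_append min_def)

lemma tail_swap_visits:
  assumes "x \<in> visits Q i j i' j' L"
  shows "tail_swap x \<in> visits Q i j' i' j L" "tail_swap (tail_swap x) = x"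
proof -
  obtain P P' t s where x: "x = (P, P', t, s)" by (metis prod.exhaust)
  note a = assms[unfolded x visits_def marked_def, simplified]
  have w: "take (Suc t) P @ drop (Suc s) P' \<in> walks i j'" by (rule walks_swap[of P i j t P' i' j' s]) (use a in auto)
  have w': "take (Suc s) P' @ drop (Suc t) P \<in> walks i' j" by (rule walks_swap[of P' i' j' s P i j t]) (use a in auto)
  note n = nth_swap[of t P s P'] and n' = nth_swap[of s P' t P]
  have "Suc t < length (take (Suc t) P @ drop (Suc s) P')" "Suc s < length (take (Suc s) P' @ drop (Suc t) P)"
    "length (take (Suc t) P @ drop (Suc s) P') + length (take (Suc s) P' @ drop (Suc t) P) = L"
    using a by (auto simp: min_def)
  then show "tail_swap x \<in> visits Q i j' i' j L"
    unfolding x tail_swap_def visits_def marked_def using w w' n n' a by auto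
  show "tail_swap (tail_swap x) = x"
    unfolding x tail_swap_def using n n' a by auto
qed

lemma corner_nth:
  "Suc t < length P \<Longrightarrow> (P ! t, P ! Suc t) \<in> set (corners P)"
  by (auto simp: set_zip nth_tl intro!: exI[of _ t])

text \<open>All factors of \<open>walk_sign\<close> except \<open>wrap_sign\<close> are only
  redistributed between the two paths. The end factors belong to the labels; at the common vertex
  the paths share their incoming or their outgoing edge, so that the two turns there are the same up
  to order.\<close>

lemma sign_swap:
  assumes ij: "i \<in> I" "j \<in> J" "i' \<in> I" "j' \<in> J"
    and x: "(P, P', t, s) \<in> visits Q i j i' j' L"
  shows "path_sign n N i j' (take (Suc t) P @ drop (Suc s) P') * path_sign n N i' j (take (Suc s) P' @ drop (Suc t) P)
    = swap_sign i i' j j' * (path_sign n N i j P * path_sign n N i' j' P')"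
proof -
  note a = x[unfolded visits_def marked_def, simplified]
  let ?R = "take (Suc t) P @ drop (Suc s) P'" and ?R' = "take (Suc s) P' @ drop (Suc t) P"
  have R: "?R \<in> walks i j'" by (rule walks_swap[of P i j t P' i' j' s]) (use a in auto)
  have R': "?R' \<in> walks i' j" by (rule walks_swap[of P' i' j' s P i j t]) (use a in auto)
  have len: "length P \<ge> 2" "length P' \<ge> 2" "length ?R \<ge> 2" "length ?R' \<ge> 2" using a by auto
  define g where "g Q Q' = half_turn (arrow Q) (arrow Q')" for Q Q'
  have ht: "half_turns (map arrow (take (Suc k) A @ drop l B)) =
      half_turns (map arrow (take (Suc k) A)) * g (A ! k) (B ! l) * half_turns (map arrow (drop l B))"
    if "k < length A" "l < length B" for A B k l
  proof -
    have "map arrow (take (Suc k) A) \<noteq> []" "map arrow (drop l B) \<noteq> []" using that by auto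
    note h = half_turns_append[OF this]
    have "last (map arrow (take (Suc k) A)) = arrow (A ! k)" using that by (simp add: take_Suc_conv_app_nth)
    moreover have "hd (map arrow (drop l B)) = arrow (B ! l)" using that by (simp add: hd_map hd_drop_conv_nth)
    ultimately show ?thesis using h by (simp add: g_def)
  qed
  have PP: "half_turns (map arrow P) = half_turns (map arrow (take (Suc t) P)) * g (P ! t) (P ! Suc t) * half_turns (map arrow (drop (Suc t) P))"
    "half_turns (map arrow P') = half_turns (map arrow (take (Suc s) P')) * g (P' ! s) (P' ! Suc s) * half_turns (map arrow (drop (Suc s) P'))"
    using ht[of t P "Suc t" P] ht[of s P' "Suc s" P'] a by auto
  have c: "(P ! t, P ! Suc t) \<in> set (corners P)" "(P' ! s, P' ! Suc s) \<in> set (corners P')"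
    using a by (auto intro!: corner_nth)
  have P: "P \<in> walks i j" "P' \<in> walks i' j'" using a by auto
  define v where "v = snd (P ! t)"
  have v: "v \<in> internal_vertices n N" "corner_at v (P ! t, P ! Suc t)" "corner_at v (P' ! s, P' ! Suc s)"
    using corner_at_walk[OF P(1) ij(1,2) c(1)] corner_at_walk[OF P(2) ij(3,4) c(2)] a unfolding v_def by auto
  have "g (P ! t) (P' ! Suc s) * g (P' ! s) (P ! Suc t) = g (P ! t) (P ! Suc t) * g (P' ! s) (P' ! Suc s)"
  proof (cases "white n N v")
    case True
    from white_eps(1,2)[OF v(1) True v(2,3)] show ?thesis by simp
  next
    case False
    then have b: "black n N v" using internal_edges(2)[OF v(1)] by blast
    from black_eps(1,2)[OF v(1) b v(2,3)] show ?thesis by simp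
  qed
  then have turns: "half_turns (map arrow ?R) * half_turns (map arrow ?R') = half_turns (map arrow P) * half_turns (map arrow P')"
    unfolding PP using ht[of t P "Suc s" P'] ht[of s P' "Suc t" P] a by (simp add: mult_ac)
  define C where "C i = (if i = 1 then 1 else - 1) * cis (mid_angle (pv i) / 2) * half_turn (hull_dir (pv i)) (arrow (boundary_edge i))" for i
  define D where "D j = half_turn (arrow (boundary_edge j)) (hull_dir j) / cis (mid_angle j / 2)" for j
  have sg: "of_real (path_sign n N i j P) = of_real (wrap_sign i j) * C i * D j * half_turns (map arrow P)"
    if "P \<in> walks i j" "i \<in> I" "j \<in> J" "length P \<ge> 2" for P i j
    unfolding C_def D_def by (rule walk_sign[OF that])
  have ss: "swap_sign i i' j j' * (wrap_sign i j * wrap_sign i' j') = wrap_sign i j' * wrap_sign i' j"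
    unfolding swap_sign_def by (simp add: wrap_sign_def)
  have "of_real (path_sign n N i j' ?R * path_sign n N i' j ?R')
      = of_real (wrap_sign i j' * wrap_sign i' j) * (C i * D j' * C i' * D j) * (half_turns (map arrow ?R) * half_turns (map arrow ?R'))"
    unfolding of_real_mult sg[OF R ij(1,4) len(3)] sg[OF R' ij(3,2) len(4)] by (simp add: mult_ac)
  also have "\<dots> = of_real (swap_sign i i' j j') * ((of_real (wrap_sign i j) * C i * D j * half_turns (map arrow P))
      * (of_real (wrap_sign i' j') * C i' * D j' * half_turns (map arrow P')))"
    unfolding turns ss[symmetric] by (simp add: mult_ac)
  also have "\<dots> = of_real (swap_sign i i' j j' * (path_sign n N i j P * path_sign n N i' j' P'))"
    unfolding of_real_mult sg[OF P(1) ij(1,2) len(1)] sg[OF P(2) ij(3,4) len(2)] ..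
  finally show ?thesis by (simp only: of_real_eq_iff)
qed

lemma visit_value_swap:
  assumes ij: "i \<in> I" "j \<in> J" "i' \<in> I" "j' \<in> J" and x: "x \<in> visits Q i j i' j' L"
    and Q: "\<And>v. v \<in> internal_vertices n N \<Longrightarrow> Q v \<Longrightarrow> white n N v \<longleftrightarrow> wh"
  shows "visit_value w i j' i' j (tail_swap x) = (if wh then - 1 else 1) * swap_sign i i' j j' * visit_value w i j i' j' x"
proof -
  obtain P P' t s where xx: "x = (P, P', t, s)" by (metis prod.exhaust)
  note a = x[unfolded xx visits_def marked_def, simplified]
  have c: "(P ! t, P ! Suc t) \<in> set (corners P)" "(P' ! s, P' ! Suc s) \<in> set (corners P')"
    using a by (auto intro!: corner_nth)
  have P: "P \<in> walks i j" "P' \<in> walks i' j'" using a by auto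
  define v where "v = snd (P ! t)"
  have v: "v \<in> internal_vertices n N" "corner_at v (P ! t, P ! Suc t)" "corner_at v (P' ! s, P' ! Suc s)"
    using corner_at_walk[OF P(1) ij(1,2) c(1)] corner_at_walk[OF P(2) ij(3,4) c(2)] a unfolding v_def by auto
  have e: "eps (P ! t, P' ! Suc s) (P' ! s, P ! Suc t) = (if wh then - 1 else 1) * eps (P ! t, P ! Suc t) (P' ! s, P' ! Suc s)"
    using eps_swap[OF v] Q[OF v(1)] a unfolding v_def by auto
  have pl: "(\<Prod>e\<leftarrow>take (Suc t) P @ drop (Suc s) P'. w e) * (\<Prod>e\<leftarrow>take (Suc s) P' @ drop (Suc t) P. w e) = (\<Prod>e\<leftarrow>P. w e) * (\<Prod>e\<leftarrow>P'. w e)"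
  proof -
    have "(\<Prod>e\<leftarrow>P. w e) = (\<Prod>e\<leftarrow>take (Suc t) P. w e) * (\<Prod>e\<leftarrow>drop (Suc t) P. w e)"
      "(\<Prod>e\<leftarrow>P'. w e) = (\<Prod>e\<leftarrow>take (Suc s) P'. w e) * (\<Prod>e\<leftarrow>drop (Suc s) P'. w e)"
      by (simp_all flip: prod_list.append map_append)
    then show ?thesis by simp
  qed
  have "visit_value w i j' i' j (tail_swap x)
      = (path_sign n N i j' (take (Suc t) P @ drop (Suc s) P') * path_sign n N i' j (take (Suc s) P' @ drop (Suc t) P))
        * ((\<Prod>e\<leftarrow>take (Suc t) P @ drop (Suc s) P'. w e) * (\<Prod>e\<leftarrow>take (Suc s) P' @ drop (Suc t) P. w e))
        * eps (P ! t, P' ! Suc s) (P' ! s, P ! Suc t)"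
    unfolding xx tail_swap_def visit_value_def walk_weight_def
    using nth_swap[of t P s P'] nth_swap[of s P' t P] a by (simp add: mult_ac)
  then show ?thesis
    unfolding sign_swap[OF ij x[unfolded xx]] pl e xx visit_value_def walk_weight_def by (simp add: mult_ac)
qed

lemma sum_visits_swap:
  assumes ij: "i \<in> I" "j \<in> J" "i' \<in> I" "j' \<in> J"
    and Q: "\<And>v. v \<in> internal_vertices n N \<Longrightarrow> Q v \<Longrightarrow> white n N v \<longleftrightarrow> wh"
  shows "(\<Sum>x\<in>visits Q i j i' j' L. visit_value w i j i' j' x)
    = (if wh then - 1 else 1) * swap_sign i i' j j' * (\<Sum>x\<in>visits Q i j' i' j L. visit_value w i j' i' j x)"
proof -
  have "(\<Sum>x\<in>visits Q i j' i' j L. visit_value w i j' i' j x)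
      = (\<Sum>x\<in>visits Q i j i' j' L. visit_value w i j' i' j (tail_swap x))"
    by (rule sum.reindex_bij_witness[of _ tail_swap tail_swap]) (auto simp: tail_swap_visits)
  also have "\<dots> = (\<Sum>x\<in>visits Q i j i' j' L. (if wh then - 1 else 1) * swap_sign i i' j j' * visit_value w i j i' j' x)"
    by (intro sum.cong refl visit_value_swap[OF ij] Q)
  also have "\<dots> = (if wh then - 1 else 1) * swap_sign i i' j j' * (\<Sum>x\<in>visits Q i j i' j' L. visit_value w i j i' j' x)"
    by (rule sum_distrib_left[symmetric])
  moreover have "swap_sign i i' j j' * swap_sign i i' j j' = 1" unfolding swap_sign_def wrap_sign_def by simp
  ultimately show ?thesis by (auto simp: mult.assoc[symmetric])
qed

lemma sum_list_corners: "(\<Sum>c\<leftarrow>corners P. g c) = (\<Sum>t<length P - 1. g (P ! t, P ! Suc t))"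
proof -
  have "(\<Sum>c\<leftarrow>corners P. g c) = (\<Sum>k<length (corners P). g (corners P ! k))"
    by (simp add: sum_list_sum_nth atLeast0LessThan)
  also have "\<dots> = (\<Sum>t<length P - 1. g (P ! t, P ! Suc t))"
    by (intro sum.cong) (auto simp: nth_tl)
  finally show ?thesis .
qed

lemma sum_visits:
  assumes ij: "i \<in> I" "j \<in> J" "i' \<in> I" "j' \<in> J"
  shows "(\<Sum>x\<in>visits Q i j i' j' L. visit_value w i j i' j' x)
    = (\<Sum>(P, P')\<in>marked i j i' j' L. walk_weight w i j P * walk_weight w i' j' P' *
        (\<Sum>c\<leftarrow>corners P. \<Sum>c'\<leftarrow>corners P'. (if Q (snd (fst c)) then eps c c' else 0)))"
proof -
  define U where "U = (SIGMA p:marked i j i' j' L. {..<length (fst p) - 1} \<times> {..<length (snd p) - 1})"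
  define G where "G = (\<lambda>(p, t, s). walk_weight w i j (fst p) * walk_weight w i' j' (snd p) *
      (if Q (snd (fst p ! t)) then eps (fst p ! t, fst p ! Suc t) (snd p ! s, snd p ! Suc s) else 0))"
  have finU: "finite U" unfolding U_def by (intro finite_SigmaI finite_marked) auto
  have "(\<Sum>x\<in>visits Q i j i' j' L. visit_value w i j i' j' x)
      = (\<Sum>y\<in>{((P, P'), t, s). (P, P', t, s) \<in> visits Q i j i' j' L}. G y)"
    by (rule sum.reindex_bij_witness[of _ "\<lambda>((P, P'), t, s). (P, P', t, s)" "\<lambda>(P, P', t, s). ((P, P'), t, s)"])
       (auto simp: G_def visit_value_def visits_def)
  also have "\<dots> = (\<Sum>y\<in>U. G y)"
  proof (rule sum.mono_neutral_left[OF finU])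
    show "{((P, P'), t, s). (P, P', t, s) \<in> visits Q i j i' j' L} \<subseteq> U"
      unfolding U_def visits_def by auto
    show "\<forall>y\<in>U - {((P, P'), t, s). (P, P', t, s) \<in> visits Q i j i' j' L}. G y = 0"
    proof
      fix y assume y: "y \<in> U - {((P, P'), t, s). (P, P', t, s) \<in> visits Q i j i' j' L}"
      obtain P P' t s where yy: "y = ((P, P'), t, s)" by (metis prod.exhaust)
      have a: "(P, P') \<in> marked i j i' j' L" "Suc t < length P" "Suc s < length P'"
        "\<not> (snd (P ! t) = snd (P' ! s) \<and> Q (snd (P ! t)))"
        using y unfolding yy U_def visits_def by auto
      have P: "P \<in> walks i j" "P' \<in> walks i' j'" using a(1) by (auto simp: marked_def)
      show "G y = 0"
        using corner_at_walk(1)[OF P(1) ij(1,2) corner_nth[OF a(2)]]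
          corner_at_walk(1)[OF P(2) ij(3,4) corner_nth[OF a(3)]] a(4)
          eps_different_vertex[of _ "(P ! t, P ! Suc t)" _ "(P' ! s, P' ! Suc s)"]
        unfolding G_def yy by (cases "snd (P ! t) = snd (P' ! s)") auto
    qed
  qed
  also have "\<dots> = (\<Sum>p\<in>marked i j i' j' L. \<Sum>(t, s)\<in>{..<length (fst p) - 1} \<times> {..<length (snd p) - 1}. G (p, t, s))"
    unfolding U_def by (subst sum.Sigma) (auto intro: finite_marked)
  also have "\<dots> = (\<Sum>(P, P')\<in>marked i j i' j' L. walk_weight w i j P * walk_weight w i' j' P' *
        (\<Sum>c\<leftarrow>corners P. \<Sum>c'\<leftarrow>corners P'. (if Q (snd (fst c)) then eps c c' else 0)))"
  proof (intro sum.cong refl)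
    fix p assume "p \<in> marked i j i' j' L"
    obtain P P' where p: "p = (P, P')" by (metis prod.exhaust)
    show "(\<Sum>(t, s)\<in>{..<length (fst p) - 1} \<times> {..<length (snd p) - 1}. G (p, t, s)) =
      (case p of (P, P') \<Rightarrow> walk_weight w i j P * walk_weight w i' j' P' *
        (\<Sum>c\<leftarrow>corners P. \<Sum>c'\<leftarrow>corners P'. (if Q (snd (fst c)) then eps c c' else 0)))"
      unfolding p sum_list_corners G_def
      by (simp add: sum.cartesian_product[symmetric] sum_distrib_left) (simp only: fst_conv snd_conv)
  qed
  finally show ?thesis .
qed

text \<open>The half sum of the two parameters goes with W + B, which \<open>sum_eps\<close>
  computes from the ends. The half difference goes with W - B, which the exchange of tails turns
  into a sum of the first kind for the exchanged pairs.\<close>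

lemma walk_pair_identity:
  assumes \<alpha>\<beta>: "skew3 \<alpha>" "skew3 \<beta>" and ij: "i \<in> I" "j \<in> J" "i' \<in> I" "j' \<in> J"
  shows "(\<Sum>(P, P')\<in>marked i j i' j' L. walk_weight w i j P * walk_weight w i' j' P' *
        (\<Sum>e\<leftarrow>P. \<Sum>f\<leftarrow>P'. edge_form (flag_coef \<alpha> \<beta>) e f))
    = (triple_param \<alpha> + triple_param \<beta>) / 2 * cyc i i' j j' *
        (\<Sum>(P, P')\<in>marked i j i' j' L. walk_weight w i j P * walk_weight w i' j' P')
      + (triple_param \<beta> - triple_param \<alpha>) / 2 * par_coef i i' j j' *
        (\<Sum>(P, P')\<in>marked i j' i' j L. walk_weight w i j' P * walk_weight w i' j P')"
proof -
  define W where "W i j i' j' = (\<Sum>x\<in>visits (\<lambda>v. white n N v) i j i' j' L. visit_value w i j i' j' x)" for i j i' j'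
  define B where "B i j i' j' = (\<Sum>x\<in>visits (\<lambda>v. \<not> white n N v) i j i' j' L. visit_value w i j i' j' x)" for i j i' j'
  define M where "M i j i' j' = (\<Sum>(P, P')\<in>marked i j i' j' L. walk_weight w i j P * walk_weight w i' j' P')" for i j i' j'
  have sumWB: "W i j i' j' + B i j i' j' = cyc i i' j j' * M i j i' j'"
    if ij: "i \<in> I" "j \<in> J" "i' \<in> I" "j' \<in> J" for i j i' j'
  proof -
    have "W i j i' j' + B i j i' j' = (\<Sum>(P, P')\<in>marked i j i' j' L. walk_weight w i j P * walk_weight w i' j' P' *
        (\<Sum>c\<leftarrow>corners P. \<Sum>c'\<leftarrow>corners P'. eps c c'))"
      unfolding W_def B_def sum_visits[OF ij] sum.distrib[symmetric]
    proof (intro sum.cong refl)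
      fix p assume "p \<in> marked i j i' j' L"
      obtain P P' where p: "p = (P, P')" by (metis prod.exhaust)
      have "(\<Sum>c\<leftarrow>corners P. \<Sum>c'\<leftarrow>corners P'. if white n N (snd (fst c)) then eps c c' else 0)
          + (\<Sum>c\<leftarrow>corners P. \<Sum>c'\<leftarrow>corners P'. if \<not> white n N (snd (fst c)) then eps c c' else 0)
        = (\<Sum>c\<leftarrow>corners P. \<Sum>c'\<leftarrow>corners P'. eps c c')"
        unfolding sum_list_addf[symmetric]
        by (intro arg_cong[of _ _ sum_list] map_cong refl) simp
      then show "(case p of (P, P') \<Rightarrow> walk_weight w i j P * walk_weight w i' j' P' *
          (\<Sum>c\<leftarrow>corners P. \<Sum>c'\<leftarrow>corners P'. if white n N (snd (fst c)) then eps c c' else 0))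
        + (case p of (P, P') \<Rightarrow> walk_weight w i j P * walk_weight w i' j' P' *
          (\<Sum>c\<leftarrow>corners P. \<Sum>c'\<leftarrow>corners P'. if \<not> white n N (snd (fst c)) then eps c c' else 0))
        = (case p of (P, P') \<Rightarrow> walk_weight w i j P * walk_weight w i' j' P' *
          (\<Sum>c\<leftarrow>corners P. \<Sum>c'\<leftarrow>corners P'. eps c c'))"
        unfolding p prod.case distrib_left[symmetric] by simp
    qed
    also have "\<dots> = (\<Sum>(P, P')\<in>marked i j i' j' L. walk_weight w i j P * walk_weight w i' j' P' * cyc i i' j j')"
      by (intro sum.cong refl) (auto simp: marked_def sum_eps ij)
    also have "\<dots> = cyc i i' j j' * M i j i' j'"
      unfolding M_def by (simp add: sum_distrib_left case_prod_beta mult_ac)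
    finally show ?thesis .
  qed
  have "(\<Sum>(P, P')\<in>marked i j i' j' L. walk_weight w i j P * walk_weight w i' j' P' *
        (\<Sum>e\<leftarrow>P. \<Sum>f\<leftarrow>P'. edge_form (flag_coef \<alpha> \<beta>) e f))
    = (\<Sum>(P, P')\<in>marked i j i' j' L. walk_weight w i j P * walk_weight w i' j' P' *
        (triple_param \<alpha> * (\<Sum>c\<leftarrow>corners P. \<Sum>c'\<leftarrow>corners P'. (if white n N (snd (fst c)) then eps c c' else 0))
         + triple_param \<beta> * (\<Sum>c\<leftarrow>corners P. \<Sum>c'\<leftarrow>corners P'. (if \<not> white n N (snd (fst c)) then eps c c' else 0))))"
  proof (intro sum.cong refl)
    fix p assume p: "p \<in> marked i j i' j' L"
    obtain P P' where pp: "p = (P, P')" by (metis prod.exhaust)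
    have P: "P \<in> walks i j" "P' \<in> walks i' j'" using p unfolding pp marked_def by auto
    have "(\<Sum>c\<leftarrow>corners P. \<Sum>c'\<leftarrow>corners P'. vertex_param \<alpha> \<beta> (snd (fst c)) * eps c c')
      = (\<Sum>c\<leftarrow>corners P. triple_param \<alpha> * (\<Sum>c'\<leftarrow>corners P'. (if white n N (snd (fst c)) then eps c c' else 0))
         + triple_param \<beta> * (\<Sum>c'\<leftarrow>corners P'. (if \<not> white n N (snd (fst c)) then eps c c' else 0)))"
      by (intro arg_cong[of _ _ sum_list] map_cong refl) (auto simp: vertex_param_def sum_list_const_mult)
    then show "(case p of (P, P') \<Rightarrow> walk_weight w i j P * walk_weight w i' j' P' *
        (\<Sum>e\<leftarrow>P. \<Sum>f\<leftarrow>P'. edge_form (flag_coef \<alpha> \<beta>) e f)) =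
      (case p of (P, P') \<Rightarrow> walk_weight w i j P * walk_weight w i' j' P' *
        (triple_param \<alpha> * (\<Sum>c\<leftarrow>corners P. \<Sum>c'\<leftarrow>corners P'. (if white n N (snd (fst c)) then eps c c' else 0))
         + triple_param \<beta> * (\<Sum>c\<leftarrow>corners P. \<Sum>c'\<leftarrow>corners P'. (if \<not> white n N (snd (fst c)) then eps c c' else 0))))"
      unfolding pp prod.case sum_flag_coef[OF \<alpha>\<beta> P(1) ij(1,2) P(2) ij(3,4)]
      by (simp only: sum_list_addf sum_list_const_mult)
  qed
  also have "\<dots> = triple_param \<alpha> * W i j i' j' + triple_param \<beta> * B i j i' j'"
    unfolding W_def B_def sum_visits[OF ij] sum_distrib_left sum.distrib[symmetric]
    by (intro sum.cong refl) (auto simp: algebra_simps)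
  also have "\<dots> = (triple_param \<alpha> + triple_param \<beta>) / 2 * (W i j i' j' + B i j i' j')
      + (triple_param \<alpha> - triple_param \<beta>) / 2 * (W i j i' j' - B i j i' j')"
    by (simp add: field_simps)
  \<comment> \<open>Up to the common factor \<open>swap_sign\<close>, the exchange negates the white
    part and keeps the black part, so the difference becomes a sum.\<close>
  also have "W i j i' j' - B i j i' j' = - swap_sign i i' j j' * (W i j' i' j + B i j' i' j)"
  proof -
    have "W i j i' j' = (if True then - 1 else 1) * swap_sign i i' j j' * W i j' i' j"
      unfolding W_def by (rule sum_visits_swap[OF ij]) simp
    moreover have "B i j i' j' = (if False then - 1 else 1) * swap_sign i i' j j' * B i j' i' j"
      unfolding B_def by (rule sum_visits_swap[OF ij]) simp
    ultimately show ?thesis by (simp add: algebra_simps)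
  qed
  also have "W i j' i' j + B i j' i' j = cyc i i' j' j * M i j' i' j" by (rule sumWB) (use ij in auto)
  also have "W i j i' j' + B i j i' j' = cyc i i' j j' * M i j i' j'" by (rule sumWB[OF ij])
  finally show ?thesis
    unfolding M_def par_coef_def by (simp add: field_simps)
qed

end

section \<open>Series along a line\<close>

definition monomials :: "'e set \<Rightarrow> nat \<Rightarrow> 'e multiset set" where
  "monomials E k = {a. set_mset a \<subseteq> E \<and> size a = k}"

lemma finite_monomials:
  assumes "finite E"
  shows "finite (monomials E k)"
proof (rule finite_subset)
  show "monomials E k \<subseteq> mset ` {xs. set xs \<subseteq> E \<and> length xs = k}"
  proof
    fix a assume "a \<in> monomials E k"
    moreover obtain xs where "a = mset xs" using ex_mset by metis
    ultimately show "a \<in> mset ` {xs. set xs \<subseteq> E \<and> length xs = k}" by (auto simp: monomials_def)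
  qed
  show "finite (mset ` {xs. set xs \<subseteq> E \<and> length xs = k})"
    by (intro finite_imageI finite_lists_length_eq assms)
qed

text \<open>
  Substituting \<open>t w\<close> for the variables turns polynomials and series in many variables into ones in
  the single variable \<open>t\<close>, where fractions can be cleared; the value at \<open>w\<close> is recovered at
  \<open>t = 1\<close>.
\<close>

definition poly_line :: "('e multiset \<Rightarrow> real) \<Rightarrow> ('e multiset \<Rightarrow>\<^sub>0 real) \<Rightarrow> real poly" where
  "poly_line \<phi> p = (\<Sum>a\<in>Poly_Mapping.keys p. monom (Poly_Mapping.lookup p a * \<phi> a) (size a))"

definition series_line :: "'e set \<Rightarrow> ('e multiset \<Rightarrow> real) \<Rightarrow> ('e multiset \<Rightarrow> real) \<Rightarrow> real fps" where
  "series_line E \<phi> s = Abs_fps (\<lambda>k. \<Sum>c\<in>monomials E k. s c * \<phi> c)"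

lemma poly_line_one: "poly (poly_line \<phi> p) 1 = (\<Sum>a\<in>Poly_Mapping.keys p. Poly_Mapping.lookup p a * \<phi> a)"
  by (simp add: poly_line_def poly_sum poly_monom)

lemma coeff_poly_line:
  "coeff (poly_line \<phi> p) k = (\<Sum>a\<in>Poly_Mapping.keys p. if size a = k then Poly_Mapping.lookup p a * \<phi> a else 0)"
  by (simp add: poly_line_def coeff_sum)

text \<open>The identity between coefficients is summed against an arbitrary function \<phi> of
  monomials of degree \<open>k\<close>. It can then be used with \<open>monomial_val\<close>, which
  is multiplicative, and with \<open>monomial_theta\<close>, which satisfies a Leibniz rule.\<close>

lemma represents_fraction_sum:
  assumes fin: "finite E" and rep: "represents_fraction E s p q"
  shows "(\<Sum>a\<in>Poly_Mapping.keys p. if size a = k then Poly_Mapping.lookup p a * \<phi> a else 0)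
    = (\<Sum>b\<in>Poly_Mapping.keys q. if size b \<le> k then \<Sum>c\<in>monomials E (k - size b). Poly_Mapping.lookup q b * s c * \<phi> (b + c) else 0)"
proof -
  let ?p = "Poly_Mapping.lookup p" and ?q = "Poly_Mapping.lookup q"
  have E: "\<And>a. a \<in> Poly_Mapping.keys p \<union> Poly_Mapping.keys q \<Longrightarrow> set_mset a \<subseteq> E"
    and eq: "poly_times_series q s a = ?p a" for a
    using rep unfolding represents_fraction_def by auto
  have "(\<Sum>a\<in>Poly_Mapping.keys p. if size a = k then ?p a * \<phi> a else 0) = (\<Sum>a\<in>{a \<in> Poly_Mapping.keys p. size a = k}. ?p a * \<phi> a)"
    by (simp add: sum.inter_filter)
  also have "\<dots> = (\<Sum>a\<in>monomials E k. ?p a * \<phi> a)"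
    by (rule sum.mono_neutral_left[OF finite_monomials[OF fin]])
       (use E in \<open>auto simp: monomials_def in_keys_iff\<close>)
  also have "\<dots> = (\<Sum>a\<in>monomials E k. \<Sum>b\<in>Poly_Mapping.keys q. if b \<subseteq># a then ?q b * s (a - b) * \<phi> a else 0)"
  proof (intro sum.cong refl)
    fix a
    have "?p a = (\<Sum>b\<in>Poly_Mapping.keys q. if b \<subseteq># a then ?q b * s (a - b) else 0)"
      unfolding eq[symmetric] poly_times_series_def by (simp add: sum.inter_filter)
    show "?p a * \<phi> a = (\<Sum>b\<in>Poly_Mapping.keys q. if b \<subseteq># a then ?q b * s (a - b) * \<phi> a else 0)"
      unfolding \<open>?p a = _\<close> sum_distrib_right by (intro sum.cong refl) simp
  qed
  also have "\<dots> = (\<Sum>b\<in>Poly_Mapping.keys q. \<Sum>a\<in>monomials E k. if b \<subseteq># a then ?q b * s (a - b) * \<phi> a else 0)"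
    by (rule sum.swap)
  also have "\<dots> = (\<Sum>b\<in>Poly_Mapping.keys q. if size b \<le> k then \<Sum>c\<in>monomials E (k - size b). ?q b * s c * \<phi> (b + c) else 0)"
  proof (intro sum.cong refl)
    fix b assume b: "b \<in> Poly_Mapping.keys q"
    have "(\<Sum>a\<in>monomials E k. if b \<subseteq># a then ?q b * s (a - b) * \<phi> a else 0)
        = (\<Sum>a\<in>{a \<in> monomials E k. b \<subseteq># a}. ?q b * s (a - b) * \<phi> a)"
      by (simp add: sum.inter_filter finite_monomials[OF fin])
    also have "\<dots> = (if size b \<le> k then \<Sum>c\<in>monomials E (k - size b). ?q b * s c * \<phi> (b + c) else 0)"
    proof (cases "size b \<le> k")
      case True
      have "(\<Sum>a\<in>{a \<in> monomials E k. b \<subseteq># a}. ?q b * s (a - b) * \<phi> a)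
          = (\<Sum>c\<in>monomials E (k - size b). ?q b * s c * \<phi> (b + c))"
        by (rule sum.reindex_bij_witness[of _ "\<lambda>c. b + c" "\<lambda>a. a - b"])
           (use True E b in \<open>auto simp: monomials_def size_Diff_submset dest: in_diffD\<close>)
      then show ?thesis using True by simp
    next
      case False
      then have z: "{a \<in> monomials E k. b \<subseteq># a} = {}" using size_mset_mono by (fastforce simp: monomials_def)
      show ?thesis unfolding z using False by simp
    qed
    finally show "(\<Sum>a\<in>monomials E k. if b \<subseteq># a then ?q b * s (a - b) * \<phi> a else 0)
        = (if size b \<le> k then \<Sum>c\<in>monomials E (k - size b). ?q b * s c * \<phi> (b + c) else 0)" .
  qed
  finally show ?thesis .
qed

lemma poly_line_times_series_line:
  "fps_nth (fps_of_poly (poly_line \<phi> q) * series_line E \<psi> s) k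
    = (\<Sum>b\<in>Poly_Mapping.keys q. if size b \<le> k then \<Sum>c\<in>monomials E (k - size b). Poly_Mapping.lookup q b * \<phi> b * (s c * \<psi> c) else 0)"
proof -
  have "fps_nth (fps_of_poly (poly_line \<phi> q) * series_line E \<psi> s) k
      = (\<Sum>l=0..k. \<Sum>b\<in>Poly_Mapping.keys q. if size b = l then Poly_Mapping.lookup q b * \<phi> b * (\<Sum>c\<in>monomials E (k - l). s c * \<psi> c) else 0)"
    unfolding fps_mult_nth fps_of_poly_nth coeff_poly_line series_line_def fps_nth_Abs_fps sum_distrib_right
    by (intro sum.cong refl) simp
  also have "\<dots> = (\<Sum>b\<in>Poly_Mapping.keys q. \<Sum>l=0..k. if size b = l then Poly_Mapping.lookup q b * \<phi> b * (\<Sum>c\<in>monomials E (k - l). s c * \<psi> c) else 0)"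
    by (rule sum.swap)
  also have "\<dots> = (\<Sum>b\<in>Poly_Mapping.keys q. if size b \<le> k then Poly_Mapping.lookup q b * \<phi> b * (\<Sum>c\<in>monomials E (k - size b). s c * \<psi> c) else 0)"
    by (intro sum.cong refl) (simp add: sum.delta)
  finally show ?thesis by (simp add: sum_distrib_left cong: if_cong)
qed

definition monomial_val :: "('e \<Rightarrow> real) \<Rightarrow> 'e multiset \<Rightarrow> real" where
  "monomial_val w a = (\<Prod>e\<in>#a. w e)"

text \<open>
  The Euler operator \<open>w\<^sub>e \<partial>/\<partial>w\<^sub>e\<close>.
\<close>

definition monomial_theta :: "('e \<Rightarrow> real) \<Rightarrow> 'e \<Rightarrow> 'e multiset \<Rightarrow> real" where
  "monomial_theta w e a = real (count a e) * monomial_val w a"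

lemma monomial_val_add: "monomial_val w (a + b) = monomial_val w a * monomial_val w b"
  by (simp add: monomial_val_def)

lemma monomial_theta_add:
  "monomial_theta w e (a + b) = monomial_theta w e a * monomial_val w b + monomial_val w a * monomial_theta w e b"
  by (simp add: monomial_theta_def monomial_val_add algebra_simps)

text \<open>Applying an Euler operator to p = q s gives the second equation, in the form of the
  Leibniz rule.\<close>

lemma fraction_line:
  assumes "finite E" "represents_fraction E s p q"
  shows "fps_of_poly (poly_line (monomial_val w) p) = fps_of_poly (poly_line (monomial_val w) q) * series_line E (monomial_val w) s"
    "fps_of_poly (poly_line (monomial_theta w e) p) = fps_of_poly (poly_line (monomial_theta w e) q) * series_line E (monomial_val w) s
      + fps_of_poly (poly_line (monomial_val w) q) * series_line E (monomial_theta w e) s"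
proof -
  show "fps_of_poly (poly_line (monomial_val w) p) = fps_of_poly (poly_line (monomial_val w) q) * series_line E (monomial_val w) s"
    by (rule fps_ext) (simp add: poly_line_times_series_line coeff_poly_line represents_fraction_sum[OF assms] monomial_val_add mult_ac cong: if_cong sum.cong)
  show "fps_of_poly (poly_line (monomial_theta w e) p) = fps_of_poly (poly_line (monomial_theta w e) q) * series_line E (monomial_val w) s
      + fps_of_poly (poly_line (monomial_val w) q) * series_line E (monomial_theta w e) s"
  proof (rule fps_ext)
    fix k
    show "fps_nth (fps_of_poly (poly_line (monomial_theta w e) p)) k
      = fps_nth (fps_of_poly (poly_line (monomial_theta w e) q) * series_line E (monomial_val w) s
      + fps_of_poly (poly_line (monomial_val w) q) * series_line E (monomial_theta w e) s) k"
      unfolding fps_add_nth poly_line_times_series_line fps_of_poly_nth coeff_poly_line represents_fraction_sum[OF assms]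
        sum.distrib[symmetric]
    proof (intro sum.cong refl)
      fix b
      have "(\<Sum>c\<in>monomials E (k - size b). Poly_Mapping.lookup q b * s c * monomial_theta w e (b + c))
        = (\<Sum>c\<in>monomials E (k - size b). Poly_Mapping.lookup q b * monomial_theta w e b * (s c * monomial_val w c))
        + (\<Sum>c\<in>monomials E (k - size b). Poly_Mapping.lookup q b * monomial_val w b * (s c * monomial_theta w e c))"
        unfolding sum.distrib[symmetric] monomial_theta_add by (intro sum.cong refl) (simp add: algebra_simps)
      then show "(if size b \<le> k then \<Sum>c\<in>monomials E (k - size b). Poly_Mapping.lookup q b * s c * monomial_theta w e (b + c) else 0)
        = (if size b \<le> k then \<Sum>c\<in>monomials E (k - size b). Poly_Mapping.lookup q b * monomial_theta w e b * (s c * monomial_val w c) else 0)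
        + (if size b \<le> k then \<Sum>c\<in>monomials E (k - size b). Poly_Mapping.lookup q b * monomial_val w b * (s c * monomial_theta w e c) else 0)"
        by simp
    qed
  qed
qed

lemma poly_eval_line: "poly_eval p w = poly (poly_line (monomial_val w) p) 1"
  by (simp add: poly_eval_def poly_line_one monomial_val_def)

definition poly_theta :: "('e multiset \<Rightarrow>\<^sub>0 real) \<Rightarrow> ('e \<Rightarrow> real) \<Rightarrow> 'e \<Rightarrow> real" where
  "poly_theta p w e = poly (poly_line (monomial_theta w e) p) 1"

text \<open>Two fractions for the same series satisfy p q' = p' q along the line through
  \<open>w\<close>, as an identity of power series and hence of polynomials. At t = 1 this compares
  the values, without any convergence of the series.\<close>

lemma rational_value_eq:
  assumes fin: "finite E" and rep: "represents_fraction E s p q" and q: "poly_eval q w \<noteq> 0"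
  shows "rational_value E s w = poly_eval p w / poly_eval q w"
proof -
  let ?l = "poly_line (monomial_val w)"
  have "r = poly_eval p w / poly_eval q w"
    if rep': "represents_fraction E s p' q'" and q': "poly_eval q' w \<noteq> 0" "r = poly_eval p' w / poly_eval q' w" for r p' q'
  proof -
    have "fps_of_poly (?l p * ?l q') = fps_of_poly (?l p' * ?l q)"
      unfolding fps_of_poly_mult fraction_line(1)[OF fin rep] fraction_line(1)[OF fin rep'] by (simp add: mult_ac)
    then have "?l p * ?l q' = ?l p' * ?l q" by (simp only: fps_of_poly_eq_iff)
    then have "poly_eval p w * poly_eval q' w = poly_eval p' w * poly_eval q w"
      unfolding poly_eval_line by (metis poly_mult)
    then have "poly_eval p' w * poly_eval q w = poly_eval p w * poly_eval q' w" by simp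
    then show ?thesis unfolding q'(2) using frac_eq_eq[OF q'(1) q] by blast
  qed
  then show ?thesis unfolding rational_value_def using rep q by (intro the_equality) blast+
qed

section \<open>The bracket identity for series and for rational functions\<close>

context perfect_network
begin

lemma boundary_series_walks:
  "boundary_series n N i j a = (\<Sum>P | P \<in> walks i j \<and> mset P = a. path_sign n N i j P)"
  unfolding boundary_series_def walks_def by simp

lemma series_line_boundary:
  assumes "\<And>P. P \<in> walks i j \<Longrightarrow> \<phi> (mset P) = (\<Prod>e\<leftarrow>P. w e) * g (mset P)"
  shows "series_line E \<phi> (boundary_series n N i j)
    = Abs_fps (\<lambda>k. \<Sum>P | P \<in> walks i j \<and> length P = k. walk_weight w i j P * g (mset P))"
  unfolding series_line_def
proof (rule arg_cong[of _ _ Abs_fps], rule ext)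
  fix k
  have "(\<Sum>c\<in>monomials E k. boundary_series n N i j c * \<phi> c)
      = (\<Sum>c\<in>monomials E k. \<Sum>P | P \<in> {P. P \<in> walks i j \<and> length P = k} \<and> mset P = c. walk_weight w i j P * g (mset P))"
  proof (intro sum.cong refl)
    fix c assume c: "c \<in> monomials E k"
    have "boundary_series n N i j c * \<phi> c = (\<Sum>P | P \<in> walks i j \<and> mset P = c. path_sign n N i j P * \<phi> (mset P))"
      unfolding boundary_series_walks by (simp add: sum_distrib_right)
    also have "\<dots> = (\<Sum>P | P \<in> walks i j \<and> mset P = c. walk_weight w i j P * g (mset P))"
    proof (intro sum.cong refl)
      fix P assume "P \<in> {P. P \<in> walks i j \<and> mset P = c}"
      then have "\<phi> (mset P) = (\<Prod>e\<leftarrow>P. w e) * g (mset P)" using assms by blast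
      then show "path_sign n N i j P * \<phi> (mset P) = walk_weight w i j P * g (mset P)"
        unfolding walk_weight_def by simp
    qed
    also have "{P. P \<in> walks i j \<and> mset P = c} = {P. P \<in> {P. P \<in> walks i j \<and> length P = k} \<and> mset P = c}"
      using c by (auto simp: monomials_def)
    finally show "boundary_series n N i j c * \<phi> c
      = (\<Sum>P | P \<in> {P. P \<in> walks i j \<and> length P = k} \<and> mset P = c. walk_weight w i j P * g (mset P))" .
  qed
  also have "\<dots> = (\<Sum>P | P \<in> walks i j \<and> length P = k. walk_weight w i j P * g (mset P))"
    by (rule sum.group[OF finite_walks_length finite_monomials[OF finite_E]])
       (auto simp: monomials_def walks_def awalk_def)
  finally show "(\<Sum>c\<in>monomials E k. boundary_series n N i j c * \<phi> c)
    = (\<Sum>P | P \<in> walks i j \<and> length P = k. walk_weight w i j P * g (mset P))" .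
qed

lemma walk_fps_mult_nth:
  "fps_nth (Abs_fps (\<lambda>k. \<Sum>P | P \<in> walks i j \<and> length P = k. F P) * Abs_fps (\<lambda>k. \<Sum>P | P \<in> walks i' j' \<and> length P = k. G P)) L
    = (\<Sum>(P, P')\<in>marked i j i' j' L. F P * G P' :: real)"
proof -
  let ?A = "\<lambda>k. {P. P \<in> walks i j \<and> length P = k}" and ?B = "\<lambda>k. {P. P \<in> walks i' j' \<and> length P = k}"
  have "fps_nth (Abs_fps (\<lambda>k. \<Sum>P\<in>?A k. F P) * Abs_fps (\<lambda>k. \<Sum>P\<in>?B k. G P)) L
      = (\<Sum>k=0..L. \<Sum>(P, P')\<in>?A k \<times> ?B (L - k). F P * G P')"
    by (simp add: fps_mult_nth sum_product sum.cartesian_product)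
  also have "\<dots> = (\<Sum>(P, P')\<in>(\<Union>k\<in>{0..L}. ?A k \<times> ?B (L - k)). F P * G P')"
    by (subst sum.UNION_disjoint) (auto intro!: finite_cartesian_product finite_walks_length)
  also have "(\<Union>k\<in>{0..L}. ?A k \<times> ?B (L - k)) = marked i j i' j' L"
    by (auto simp: marked_def)
  finally show ?thesis .
qed

lemma sum_list_count:
  fixes h :: "edge \<Rightarrow> real"
  assumes "set P \<subseteq> E"
  shows "(\<Sum>e\<leftarrow>P. h e) = (\<Sum>e\<in>E. real (count (mset P) e) * h e)"
  using assms
proof (induction P)
  case (Cons x P)
  have "(\<Sum>e\<in>E. real (count (mset (x # P)) e) * h e) = (\<Sum>e\<in>E. (if e = x then h e else 0) + real (count (mset P) e) * h e)"
    by (intro sum.cong refl) (simp add: algebra_simps)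
  also have "\<dots> = h x + (\<Sum>e\<in>E. real (count (mset P) e) * h e)"
    unfolding sum.distrib using Cons.prems by (simp add: sum.delta finite_E)
  finally show ?case using Cons by simp
qed simp

text \<open>An Euler operator multiplies the weight of a path by the number of its passages through
  the edge. Summing over all edges therefore restores the sums along the two paths, and each
  coefficient is an instance of \<open>walk_pair_identity\<close>.\<close>

lemma series_identity:
  fixes w :: "edge \<Rightarrow> real"
  assumes \<alpha>\<beta>: "skew3 \<alpha>" "skew3 \<beta>" and ij: "i \<in> I" "j \<in> J" "i' \<in> I" "j' \<in> J"
  defines "S \<equiv> \<lambda>i j. series_line E (monomial_val w) (boundary_series n N i j)"
    and "S' \<equiv> \<lambda>e i j. series_line E (monomial_theta w e) (boundary_series n N i j)"
  shows "(\<Sum>e\<in>E. \<Sum>f\<in>E. fps_const (edge_form (flag_coef \<alpha> \<beta>) e f) * (S' e i j * S' f i' j'))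
    = fps_const ((triple_param \<alpha> + triple_param \<beta>) / 2 * cyc i i' j j') * (S i j * S i' j')
      + fps_const ((triple_param \<beta> - triple_param \<alpha>) / 2 * par_coef i i' j j') * (S i j' * S i' j)"
proof (rule fps_ext)
  fix L
  have S: "S i j = Abs_fps (\<lambda>k. \<Sum>P | P \<in> walks i j \<and> length P = k. walk_weight w i j P)" for i j
    unfolding S_def by (subst series_line_boundary[where w = w and g = "\<lambda>_. 1"]) (simp_all add: monomial_val_def prod_mset_prod_list flip: mset_map)
  have S': "S' e i j = Abs_fps (\<lambda>k. \<Sum>P | P \<in> walks i j \<and> length P = k. walk_weight w i j P * real (count (mset P) e))" for e i j
    unfolding S'_def by (subst series_line_boundary[where w = w and g = "\<lambda>a. real (count a e)"])
      (simp_all add: monomial_theta_def monomial_val_def prod_mset_prod_list flip: mset_map)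
  let ?K = "edge_form (flag_coef \<alpha> \<beta>)"
  have "fps_nth (\<Sum>e\<in>E. \<Sum>f\<in>E. fps_const (?K e f) * (S' e i j * S' f i' j')) L
      = (\<Sum>e\<in>E. \<Sum>f\<in>E. \<Sum>(P, P')\<in>marked i j i' j' L. ?K e f *
          ((walk_weight w i j P * real (count (mset P) e)) * (walk_weight w i' j' P' * real (count (mset P') f))))"
    unfolding S' by (simp add: fps_sum_nth walk_fps_mult_nth sum_distrib_left case_prod_beta)
  also have "\<dots> = (\<Sum>e\<in>E. \<Sum>(P, P')\<in>marked i j i' j' L. \<Sum>f\<in>E. ?K e f *
          ((walk_weight w i j P * real (count (mset P) e)) * (walk_weight w i' j' P' * real (count (mset P') f))))"
    unfolding case_prod_beta by (intro sum.cong refl sum.swap)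
  also have "\<dots> = (\<Sum>(P, P')\<in>marked i j i' j' L. \<Sum>e\<in>E. \<Sum>f\<in>E. ?K e f *
          ((walk_weight w i j P * real (count (mset P) e)) * (walk_weight w i' j' P' * real (count (mset P') f))))"
    unfolding case_prod_beta by (rule sum.swap)
  also have "\<dots> = (\<Sum>(P, P')\<in>marked i j i' j' L. walk_weight w i j P * walk_weight w i' j' P' *
        (\<Sum>e\<leftarrow>P. \<Sum>f\<leftarrow>P'. ?K e f))"
  proof (intro sum.cong refl)
    fix p assume p: "p \<in> marked i j i' j' L"
    obtain P P' where pp: "p = (P, P')" by (metis prod.exhaust)
    have P: "set P \<subseteq> E" "set P' \<subseteq> E" using p unfolding pp marked_def walks_def awalk_def by auto
    have "(\<Sum>e\<leftarrow>P. \<Sum>f\<leftarrow>P'. ?K e f) = (\<Sum>e\<in>E. \<Sum>f\<in>E. real (count (mset P) e) * (real (count (mset P') f) * ?K e f))"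
      unfolding sum_list_count[OF P(1)] sum_list_count[OF P(2)] by (simp add: sum_distrib_left)
    then show "(case p of (P, P') \<Rightarrow> \<Sum>e\<in>E. \<Sum>f\<in>E. ?K e f *
          ((walk_weight w i j P * real (count (mset P) e)) * (walk_weight w i' j' P' * real (count (mset P') f))))
      = (case p of (P, P') \<Rightarrow> walk_weight w i j P * walk_weight w i' j' P' * (\<Sum>e\<leftarrow>P. \<Sum>f\<leftarrow>P'. ?K e f))"
      unfolding pp prod.case by (simp add: sum_distrib_left mult_ac)
  qed
  also have "\<dots> = fps_nth (fps_const ((triple_param \<alpha> + triple_param \<beta>) / 2 * cyc i i' j j') * (S i j * S i' j')
      + fps_const ((triple_param \<beta> - triple_param \<alpha>) / 2 * par_coef i i' j j') * (S i j' * S i' j)) L"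
    unfolding walk_pair_identity[OF \<alpha>\<beta> ij] S by (simp add: walk_fps_mult_nth)
  finally show "fps_nth (\<Sum>e\<in>E. \<Sum>f\<in>E. fps_const (?K e f) * (S' e i j * S' f i' j')) L
    = fps_nth (fps_const ((triple_param \<alpha> + triple_param \<beta>) / 2 * cyc i i' j j') * (S i j * S i' j')
      + fps_const ((triple_param \<beta> - triple_param \<alpha>) / 2 * par_coef i i' j j') * (S i j' * S i' j)) L" .
qed

text \<open>After multiplication by all denominators, both sides of \<open>series_identity\<close>
  are polynomials in the line parameter and can be evaluated at 1. By the quotient rule,
  \<open>M' i j e\<close> is the Euler derivative of \<open>M i j\<close> along
  \<open>e\<close>.\<close>

lemma rational_identity:
  fixes w :: "edge \<Rightarrow> real" and p q :: "nat \<Rightarrow> nat \<Rightarrow> (edge multiset \<Rightarrow>\<^sub>0 real)"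
  assumes \<alpha>\<beta>: "skew3 \<alpha>" "skew3 \<beta>" and ij: "i \<in> I" "j \<in> J" "i' \<in> I" "j' \<in> J"
    and rep: "\<And>i j. i \<in> I \<Longrightarrow> j \<in> J \<Longrightarrow> represents_fraction E (boundary_series n N i j) (p i j) (q i j)"
    and nz: "\<And>i j. i \<in> I \<Longrightarrow> j \<in> J \<Longrightarrow> poly_eval (q i j) w \<noteq> 0"
  defines "M \<equiv> \<lambda>i j. poly_eval (p i j) w / poly_eval (q i j) w"
    and "M' \<equiv> \<lambda>i j e. (poly_eval (q i j) w * poly_theta (p i j) w e - poly_theta (q i j) w e * poly_eval (p i j) w) / (poly_eval (q i j) w)\<^sup>2"
  shows "(\<Sum>e\<in>E. \<Sum>f\<in>E. edge_form (flag_coef \<alpha> \<beta>) e f * M' i j e * M' i' j' f)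
    = (triple_param \<alpha> + triple_param \<beta>) / 2 * cyc i i' j j' * M i j * M i' j'
      + (triple_param \<beta> - triple_param \<alpha>) / 2 * par_coef i i' j j' * M i j' * M i' j"
proof -
  let ?K = "edge_form (flag_coef \<alpha> \<beta>)"
  define k1 where "k1 = (triple_param \<alpha> + triple_param \<beta>) / 2 * cyc i i' j j'"
  define k2 where "k2 = (triple_param \<beta> - triple_param \<alpha>) / 2 * par_coef i i' j j'"
  define S where "S i j = series_line E (monomial_val w) (boundary_series n N i j)" for i j
  define S' where "S' e i j = series_line E (monomial_theta w e) (boundary_series n N i j)" for e i j
  define pp where "pp i j = poly_line (monomial_val w) (p i j)" for i j
  define qq where "qq i j = poly_line (monomial_val w) (q i j)" for i j
  \<comment> \<open>This is the numerator of the quotient rule: as a series, it is the square of the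
    denominator times \<open>S'\<close>.\<close>
  define aa where "aa e i j = qq i j * poly_line (monomial_theta w e) (p i j) - poly_line (monomial_theta w e) (q i j) * pp i j" for e i j
  define F where "F = (fps_of_poly :: real poly \<Rightarrow> real fps)"
  have F: "F (x * y) = F x * F y" "F (x + y) = F x + F y" "F (x - y) = F x - F y" "F (smult c x) = fps_const c * F x" for x y c
    unfolding F_def by (simp_all add: fps_of_poly_mult fps_of_poly_add fps_of_poly_diff fps_of_poly_smult)
  have P: "F (pp i j) = F (qq i j) * S i j" if "i \<in> I" "j \<in> J" for i j
    unfolding F_def pp_def qq_def S_def by (rule fraction_line(1)[OF finite_E rep[OF that]])
  have A: "F (aa e i j) = F (qq i j) * F (qq i j) * S' e i j" if "i \<in> I" "j \<in> J" for e i j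
  proof -
    have "F (poly_line (monomial_theta w e) (p i j)) = F (poly_line (monomial_theta w e) (q i j)) * S i j + F (qq i j) * S' e i j"
      unfolding F_def S_def S'_def qq_def by (rule fraction_line(2)[OF finite_E rep[OF that]])
    then show ?thesis unfolding aa_def F P[OF that] by (simp add: algebra_simps)
  qed
  define lhs where "lhs = (\<Sum>e\<in>E. \<Sum>f\<in>E. smult (?K e f) (aa e i j * aa f i' j' * (qq i j' * qq i' j)))"
  define rhs where "rhs = smult k1 (pp i j * pp i' j' * (qq i j * qq i' j' * qq i j' * qq i' j))
    + smult k2 (pp i j' * pp i' j * (qq i j * qq i j * qq i' j' * qq i' j'))"
  have id: "(\<Sum>e\<in>E. \<Sum>f\<in>E. fps_const (?K e f) * (S' e i j * S' f i' j'))
      = fps_const k1 * (S i j * S i' j') + fps_const k2 * (S i j' * S i' j)"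
    unfolding S_def S'_def k1_def k2_def by (rule series_identity[OF \<alpha>\<beta> ij])
  \<comment> \<open>The differentiated entries require the squares of their denominators, the
    exchanged entries only the denominators themselves.\<close>
  define Z where "Z = F (qq i j) * F (qq i j) * F (qq i' j') * F (qq i' j') * F (qq i j') * F (qq i' j)"
  have "F lhs = (\<Sum>e\<in>E. \<Sum>f\<in>E. fps_const (?K e f) * (F (aa e i j) * F (aa f i' j') * (F (qq i j') * F (qq i' j))))"
    unfolding lhs_def by (simp add: F_def fps_of_poly_sum fps_of_poly_smult fps_of_poly_mult)
  also have "\<dots> = (\<Sum>e\<in>E. \<Sum>f\<in>E. Z * (fps_const (?K e f) * (S' e i j * S' f i' j')))"
    unfolding A[OF ij(1,2)] A[OF ij(3,4)] Z_def by (simp add: mult_ac)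
  also have "\<dots> = Z * (fps_const k1 * (S i j * S i' j') + fps_const k2 * (S i j' * S i' j))"
    unfolding id[symmetric] by (simp add: sum_distrib_left)
  also have "\<dots> = F rhs"
    unfolding rhs_def F P[OF ij(1,2)] P[OF ij(3,4)] P[OF ij(1,4)] P[OF ij(3,2)] Z_def by (simp add: algebra_simps)
  finally have "lhs = rhs" unfolding F_def by (simp only: fps_of_poly_eq_iff)
  then have ev: "poly lhs 1 = poly rhs 1" by simp
  define y where "y i j = poly_eval (q i j) w" for i j
  define x where "x i j = poly_eval (p i j) w" for i j
  define z where "z e i j = poly_eval (q i j) w * poly_theta (p i j) w e - poly_theta (q i j) w e * poly_eval (p i j) w" for e i j
  have v: "poly (qq i j) 1 = y i j" "poly (pp i j) 1 = x i j" "poly (aa e i j) 1 = z e i j" for i j e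
    unfolding x_def y_def z_def aa_def qq_def pp_def poly_theta_def by (simp_all add: poly_eval_line)
  have "poly lhs 1 = (\<Sum>e\<in>E. \<Sum>f\<in>E. ?K e f * (z e i j * z f i' j' * (y i j' * y i' j)))"
    unfolding lhs_def by (simp add: poly_sum v)
  moreover have "poly rhs 1 = k1 * (x i j * x i' j' * (y i j * y i' j' * y i j' * y i' j)) + k2 * (x i j' * x i' j * (y i j * y i j * y i' j' * y i' j'))"
    unfolding rhs_def by (simp add: v)
  ultimately have eq: "(\<Sum>e\<in>E. \<Sum>f\<in>E. ?K e f * (z e i j * z f i' j' * (y i j' * y i' j)))
    = k1 * (x i j * x i' j' * (y i j * y i' j' * y i j' * y i' j)) + k2 * (x i j' * x i' j * (y i j * y i j * y i' j' * y i' j'))"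
    using ev by simp
  have y0: "y i j \<noteq> 0" "y i' j' \<noteq> 0" "y i j' \<noteq> 0" "y i' j \<noteq> 0" using nz ij unfolding y_def by auto
  define Y where "Y = (y i j)\<^sup>2 * (y i' j')\<^sup>2 * (y i j' * y i' j)"
  have Y0: "Y \<noteq> 0" unfolding Y_def using y0 by simp
  have M: "M i j = x i j / y i j" "M' i j e = z e i j / (y i j)\<^sup>2" for i j e
    unfolding M_def M'_def x_def y_def z_def by simp_all
  have "Y * (\<Sum>e\<in>E. \<Sum>f\<in>E. ?K e f * M' i j e * M' i' j' f) = (\<Sum>e\<in>E. \<Sum>f\<in>E. ?K e f * (z e i j * z f i' j' * (y i j' * y i' j)))"
    unfolding M Y_def sum_distrib_left using y0 by (intro sum.cong refl) (simp add: field_simps)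
  also have "\<dots> = Y * (k1 * M i j * M i' j' + k2 * M i j' * M i' j)"
    unfolding eq M Y_def using y0 by (simp add: field_simps power2_eq_square)
  finally show ?thesis using Y0 unfolding k1_def k2_def by simp
qed

end

section \<open>Boundary measurement maps are Poisson\<close>

lemma monomial_val_has_derivative:
  assumes "u0 \<noteq> (0::real)"
  shows "((\<lambda>u. monomial_val (w(e := u)) a) has_real_derivative monomial_theta (w(e := u0)) e a / u0) (at u0)"
proof (induction a)
  case empty
  then show ?case by (simp add: monomial_val_def monomial_theta_def)
next
  case (add x a)
  have v: "monomial_val (w(e := u)) (add_mset x a) = (if x = e then u else w x) * monomial_val (w(e := u)) a" for u
    by (simp add: monomial_val_def)
  have v0: "monomial_val (w(e := u0)) (add_mset x a) = (if x = e then u0 else w x) * monomial_val (w(e := u0)) a"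
    by (rule v)
  have th: "monomial_theta (w(e := u0)) e (add_mset x a) =
      (if x = e then monomial_val (w(e := u0)) (add_mset x a) else 0) + (if x = e then u0 else w x) * monomial_theta (w(e := u0)) e a"
    unfolding monomial_theta_def v0 by (simp add: algebra_simps)
  have "((\<lambda>u. if x = e then u else w x) has_real_derivative (if x = e then 1 else 0)) (at u0)"
    by (cases "x = e") simp_all
  from DERIV_mult[OF this add.IH]
  have "((\<lambda>u. (if x = e then u else w x) * monomial_val (w(e := u)) a) has_real_derivative
    (if x = e then 1 else 0) * monomial_val (w(e := u0)) a + monomial_theta (w(e := u0)) e a / u0 * (if x = e then u0 else w x)) (at u0)" .
  moreover have "(if x = e then 1 else 0) * monomial_val (w(e := u0)) a + monomial_theta (w(e := u0)) e a / u0 * (if x = e then u0 else w x)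
    = monomial_theta (w(e := u0)) e (add_mset x a) / u0"
    unfolding th v0 using assms by (cases "x = e") (simp_all add: field_simps del: fun_upd_apply)
  ultimately show ?case unfolding v by metis
qed

lemma poly_eval_has_derivative:
  assumes "u0 \<noteq> (0::real)"
  shows "((\<lambda>u. poly_eval p (w(e := u))) has_real_derivative poly_theta p (w(e := u0)) e / u0) (at u0)"
proof -
  have "((\<lambda>u. \<Sum>a\<in>Poly_Mapping.keys p. Poly_Mapping.lookup p a * monomial_val (w(e := u)) a) has_real_derivative
      (\<Sum>a\<in>Poly_Mapping.keys p. Poly_Mapping.lookup p a * (monomial_theta (w(e := u0)) e a / u0))) (at u0)"
  proof (rule DERIV_sum)
    fix a
    show "((\<lambda>u. Poly_Mapping.lookup p a * monomial_val (w(e := u)) a) has_real_derivative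
      Poly_Mapping.lookup p a * (monomial_theta (w(e := u0)) e a / u0)) (at u0)"
      by (rule DERIV_cmult[OF monomial_val_has_derivative[OF assms]])
  qed
  moreover have "(\<Sum>a\<in>Poly_Mapping.keys p. Poly_Mapping.lookup p a * (monomial_theta (w(e := u0)) e a / u0)) = poly_theta p (w(e := u0)) e / u0"
    by (simp add: poly_theta_def poly_line_one sum_divide_distrib)
  ultimately show ?thesis by (simp add: poly_eval_def monomial_val_def)
qed

text \<open>The edge weight is \<open>t * b\<close> because one flag coordinate \<open>t\<close> of
  the edge varies while the other one, \<open>b\<close>, is fixed. Near \<open>t0\<close> the
  denominator stays nonzero, so the same fraction computes all values.\<close>

lemma rational_value_has_derivative:
  assumes fin: "finite E" and rep: "represents_fraction E s p q" and q: "poly_eval q w \<noteq> 0"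
    and w: "w e = t0 * b" "t0 \<noteq> 0" "b \<noteq> 0"
  shows "((\<lambda>t. rational_value E s (w(e := t * b))) has_real_derivative
    (poly_eval q w * poly_theta p w e - poly_theta q w e * poly_eval p w) / (poly_eval q w)\<^sup>2 / t0) (at t0)"
proof -
  have we: "w(e := t0 * b) = w" using w(1) by auto
  have D: "((\<lambda>t. poly_eval g (w(e := t * b))) has_real_derivative poly_theta g w e / t0) (at t0)" for g
  proof -
    have "((\<lambda>u. poly_eval g (w(e := u))) has_real_derivative poly_theta g w e / (t0 * b)) (at (t0 * b))"
      using poly_eval_has_derivative[of "t0 * b" g w e] w unfolding we by simp
    moreover have "((\<lambda>t. t * b) has_real_derivative b) (at t0)" by (auto intro!: derivative_eq_intros)
    ultimately have "((\<lambda>t. poly_eval g (w(e := t * b))) has_real_derivative poly_theta g w e / (t0 * b) * b) (at t0)"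
      by (rule DERIV_chain2)
    then show ?thesis using w by simp
  qed
  have "((\<lambda>t. poly_eval p (w(e := t * b)) / poly_eval q (w(e := t * b))) has_real_derivative
    (poly_theta p w e / t0 * poly_eval q w - poly_eval p w * (poly_theta q w e / t0)) / (poly_eval q w * poly_eval q w)) (at t0)"
    using DERIV_divide[OF D[of p] D[of q]] q unfolding we by simp
  moreover have "(poly_theta p w e / t0 * poly_eval q w - poly_eval p w * (poly_theta q w e / t0)) / (poly_eval q w * poly_eval q w)
    = (poly_eval q w * poly_theta p w e - poly_theta q w e * poly_eval p w) / (poly_eval q w)\<^sup>2 / t0"
    using q w(2) by (simp add: field_simps power2_eq_square)
  moreover have "\<forall>\<^sub>F t in nhds t0. rational_value E s (w(e := t * b)) = poly_eval p (w(e := t * b)) / poly_eval q (w(e := t * b))"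
  proof -
    have "isCont (\<lambda>t. poly_eval q (w(e := t * b))) t0" using D[of q] by (rule DERIV_isCont)
    then have "((\<lambda>t. poly_eval q (w(e := t * b))) \<longlongrightarrow> poly_eval q (w(e := t0 * b))) (nhds t0)"
      unfolding isCont_def by (rule tendsto_at_iff_tendsto_nhds[where g = "\<lambda>t. poly_eval q (w(e := t * b))", THEN iffD1])
    then have "\<forall>\<^sub>F t in nhds t0. poly_eval q (w(e := t * b)) \<noteq> 0"
      by (rule tendsto_imp_eventually_ne) (use q we in metis)
    then show ?thesis by eventually_elim (rule rational_value_eq[OF fin rep])
  qed
  ultimately show ?thesis by (subst DERIV_cong_ev[OF refl _ refl]) simp_all
qed

context perfect_network
begin

lemma sum_flags:
  fixes G :: "flag \<Rightarrow> real"
  shows "(\<Sum>a\<in>flags N. G a) = (\<Sum>e\<in>E. G (fst e, e) + G (snd e, e))"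
proof -
  have eq: "flags N = (\<lambda>e. (fst e, e)) ` E \<union> (\<lambda>e. (snd e, e)) ` E" unfolding flags_def by auto
  have "(\<lambda>e. (fst e, e)) ` E \<inter> (\<lambda>e. (snd e, e)) ` E = {}" using edge_ends_neq by auto
  then have "(\<Sum>a\<in>flags N. G a) = (\<Sum>a\<in>(\<lambda>e. (fst e, e)) ` E. G a) + (\<Sum>a\<in>(\<lambda>e. (snd e, e)) ` E. G a)"
    unfolding eq by (intro sum.union_disjoint) (simp_all add: finite_E)
  also have "\<dots> = (\<Sum>e\<in>E. G (fst e, e)) + (\<Sum>e\<in>E. G (snd e, e))"
    by (simp add: sum.reindex inj_on_def)
  finally show ?thesis by (simp add: sum.distrib)
qed

lemma edge_weights_surj:
  assumes "w \<in> torus E"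
  shows "\<exists>x. x \<in> torus (flags N) \<and> edge_weights N x = w"
proof (intro exI conjI)
  let ?x = "\<lambda>a\<in>flags N. if fst a = fst (snd a) then w (snd a) else 1"
  show "?x \<in> torus (flags N)"
    using assms unfolding torus_def flags_def by (auto simp: PiE_iff)
  show "edge_weights N ?x = w"
  proof
    fix e show "edge_weights N ?x e = w e"
    proof (cases "e \<in> E")
      case True
      then have "(fst e, e) \<in> flags N" "(snd e, e) \<in> flags N" "snd e \<noteq> fst e"
        using edge_ends_neq[OF True] by (auto simp: flags_def)
      then show ?thesis using True by (simp add: edge_weights_def)
    next
      case False
      then show ?thesis using PiE_arb[OF assms[unfolded torus_def] False] by (simp add: edge_weights_def)
    qed
  qed
qed

lemma edge_weights_upd:
  assumes "(v, e) \<in> flags N"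
  shows "edge_weights N (x((v, e) := t)) = (edge_weights N x)(e := t * x (if v = fst e then snd e else fst e, e))"
  using assms edge_ends_neq[of e] by (auto simp: edge_weights_def flags_def fun_eq_iff mult.commute)

lemma flag_bracket_conv:
  "flag_bracket n \<alpha> \<beta> N f g x = (\<Sum>a\<in>flags N. \<Sum>b\<in>flags N. flag_coef \<alpha> \<beta> a b * x a * x b * partial_deriv a f x * partial_deriv b g x)"
  unfolding flag_bracket_def coord_bracket_def flag_coef_def by (intro sum.cong refl) auto

abbreviation row_label :: "nat \<Rightarrow> nat" where
  "row_label \<equiv> \<lambda>p. sorted_list_of_set I ! p"

abbreviation col_label :: "nat \<Rightarrow> nat" where
  "col_label \<equiv> \<lambda>p. sorted_list_of_set J ! p"

lemma finite_labels: "finite I" "finite J"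
  using labels(1) finite_subset[of I "{1..n}"] finite_subset[of J "{1..n}"] by auto

lemma row_label: "p < card I \<Longrightarrow> row_label p \<in> I" "i \<in> I \<Longrightarrow> \<exists>p<card I. row_label p = i"
  using finite_labels set_sorted_list_of_set[of I] length_sorted_list_of_set[of I]
  by (metis nth_mem, metis in_set_conv_nth)

lemma col_label: "p < card J \<Longrightarrow> col_label p \<in> J" "j \<in> J \<Longrightarrow> \<exists>p<card J. col_label p = j"
  using finite_labels set_sorted_list_of_set[of J] length_sorted_list_of_set[of J]
  by (metis nth_mem, metis in_set_conv_nth)

text \<open>On functions of the edge weights, the Euler operator of a flag coordinate equals that of
  the weight of its edge. So the result depends on \<open>w\<close> only and not on the preimage
  \<open>x\<close>.\<close>

lemma partial_deriv_measurement:
  fixes p q :: "nat \<Rightarrow> nat \<Rightarrow> (edge multiset \<Rightarrow>\<^sub>0 real)"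
  assumes f: "smooth (mat_index (card I) (card J)) f"
    and x: "x \<in> torus (flags N)" "edge_weights N x = w" and a: "a \<in> flags N"
    and rep: "\<And>i j. i \<in> I \<Longrightarrow> j \<in> J \<Longrightarrow> represents_fraction E (boundary_series n N i j) (p i j) (q i j)"
    and nz: "\<And>i j. i \<in> I \<Longrightarrow> j \<in> J \<Longrightarrow> poly_eval (q i j) w \<noteq> 0"
  defines "M' \<equiv> \<lambda>i j e. (poly_eval (q i j) w * poly_theta (p i j) w e - poly_theta (q i j) w e * poly_eval (p i j) w) / (poly_eval (q i j) w)\<^sup>2"
  shows "x a * partial_deriv a ((f \<circ> boundary_measurement n I J N) \<circ> edge_weights N) x =
    (\<Sum>c\<in>mat_index (card I) (card J). partial_deriv c f (boundary_measurement n I J N w) * M' (row_label (fst c)) (col_label (snd c)) (snd a))"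
proof -
  let ?S = "mat_index (card I) (card J)" and ?M = "boundary_measurement n I J N"
  obtain v e where a_eq: "a = (v, e)" by (metis prod.exhaust)
  have e: "e \<in> E" "v = fst e \<or> v = snd e" using a unfolding a_eq flags_def by auto
  define b where "b = x (if v = fst e then snd e else fst e, e)"
  have xa: "x a \<noteq> 0" using x(1) a by (auto simp: torus_def)
  have "(if v = fst e then snd e else fst e, e) \<in> flags N" using e by (auto simp: flags_def)
  then have b: "b \<noteq> 0" using x(1) unfolding b_def torus_def by auto
  have upd: "edge_weights N (x(a := t)) = w(e := t * b)" for t
    using edge_weights_upd[of v e x t] a x(2) unfolding a_eq b_def by simp
  have we: "w e = x a * b"
    using upd[of "x a"] x(2) by (metis fun_upd_same fun_upd_triv)
  have w: "w(e := x a * b) = w" using we by (metis fun_upd_triv)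
  define y where "y t = ?M (w(e := t * b))" for t
  have yX: "y t \<in> coord_space ?S" for t
    unfolding y_def boundary_measurement_def coord_space_def by auto
  have "((\<lambda>t. y t c) has_real_derivative M' (row_label (fst c)) (col_label (snd c)) e / x a) (at (x a))" if c: "c \<in> ?S" for c
  proof -
    obtain k l where cc: "c = (k, l)" by (metis prod.exhaust)
    have kl: "row_label k \<in> I" "col_label l \<in> J" using c row_label col_label unfolding cc mat_index_def by auto
    have "(\<lambda>t. y t c) = (\<lambda>t. rational_value E (boundary_series n N (row_label k) (col_label l)) (w(e := t * b)))"
      using c unfolding y_def boundary_measurement_def measurement_series_def cc by simp
    then show ?thesis
      using rational_value_has_derivative[OF finite_E rep[OF kl] nz[OF kl] we xa b] unfolding M'_def cc by simp
  qed
  from smooth_chain_rule[OF _ f yX this]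
  have "((\<lambda>t. f (y t)) has_real_derivative
      (\<Sum>c\<in>?S. partial_deriv c f (y (x a)) * (M' (row_label (fst c)) (col_label (snd c)) e / x a))) (at (x a))"
    by (simp add: mat_index_def)
  moreover have "y (x a) = ?M w" unfolding y_def w ..
  moreover have "(\<lambda>t. ((f \<circ> ?M) \<circ> edge_weights N) (x(a := t))) = (\<lambda>t. f (y t))"
    unfolding comp_def upd y_def ..
  ultimately have "partial_deriv a ((f \<circ> ?M) \<circ> edge_weights N) x
      = (\<Sum>c\<in>?S. partial_deriv c f (?M w) * (M' (row_label (fst c)) (col_label (snd c)) e / x a))"
    by (intro partial_deriv_eqI) simp
  then show ?thesis using xa unfolding a_eq by (simp add: sum_distrib_left)
qed

theorem measurement_poisson:
  assumes \<alpha>\<beta>: "skew3 \<alpha>" "skew3 \<beta>"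
    and \<theta>: "\<theta> 0 = (triple_param \<alpha> + triple_param \<beta>) / 2" "\<theta> 1 = (triple_param \<beta> - triple_param \<alpha>) / 2"
  shows "boundary_measurement_poisson n I J \<alpha> \<beta> (mat_family (card I) (card J) row_label col_label \<theta>) N"
  unfolding boundary_measurement_poisson_def Let_def
proof (intro ballI)
  let ?S = "mat_index (card I) (card J)" and ?M = "boundary_measurement n I J N"
  fix w f g assume w: "w \<in> measurement_domain n I J N" and fg: "f \<in> smooth_functions ?S" "g \<in> smooth_functions ?S"
  note sf = smooth_functionsD[OF fg(1)] and sg = smooth_functionsD[OF fg(2)]
  have wT: "w \<in> torus E" using w unfolding measurement_domain_def by blast
  have "\<exists>p q. represents_fraction E (boundary_series n N i j) p q \<and> poly_eval q w \<noteq> 0" if ij: "i \<in> I" "j \<in> J" for i j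
  proof -
    obtain k l where "k < card I" "row_label k = i" "l < card J" "col_label l = j"
      using row_label(2)[OF ij(1)] col_label(2)[OF ij(2)] by blast
    then have "(k, l) \<in> ?S" "measurement_series n I J N (k, l) = boundary_series n N i j"
      by (auto simp: mat_index_def measurement_series_def)
    then show ?thesis using w unfolding measurement_domain_def rational_regular_def by force
  qed
  then obtain p q where rep: "\<And>i j. i \<in> I \<Longrightarrow> j \<in> J \<Longrightarrow> represents_fraction E (boundary_series n N i j) (p i j) (q i j)"
    and nz: "\<And>i j. i \<in> I \<Longrightarrow> j \<in> J \<Longrightarrow> poly_eval (q i j) w \<noteq> 0" by metis
  define x where "x = (SOME x. x \<in> torus (flags N) \<and> edge_weights N x = w)"
  have x: "x \<in> torus (flags N)" "edge_weights N x = w"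
    using someI_ex[OF edge_weights_surj[OF wT], folded x_def] by auto
  define M' where "M' i j e = (poly_eval (q i j) w * poly_theta (p i j) w e - poly_theta (q i j) w e * poly_eval (p i j) w) / (poly_eval (q i j) w)\<^sup>2" for i j e
  define D where "D c e = M' (row_label (fst c)) (col_label (snd c)) e" for c :: "nat \<times> nat" and e
  have pd: "x a * partial_deriv a ((h \<circ> ?M) \<circ> edge_weights N) x = (\<Sum>c\<in>?S. partial_deriv c h (?M w) * D c (snd a))"
    if "smooth ?S h" "a \<in> flags N" for h a
    using partial_deriv_measurement[OF that(1) x that(2) rep nz] unfolding D_def M'_def by simp
  have Mv: "?M w (k, l) = poly_eval (p (row_label k) (col_label l)) w / poly_eval (q (row_label k) (col_label l)) w"
    if "(k, l) \<in> ?S" for k l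
  proof -
    have "row_label k \<in> I" "col_label l \<in> J" using that row_label col_label unfolding mat_index_def by auto
    then show ?thesis
      using that rational_value_eq[OF finite_E rep nz] unfolding boundary_measurement_def measurement_series_def by simp
  qed
  have id: "(\<Sum>a\<in>flags N. \<Sum>b\<in>flags N. flag_coef \<alpha> \<beta> a b * D c (snd a) * D d (snd b)) = mat_coef (\<theta> 0) (\<theta> 1) row_label col_label c d (?M w)"
    if cd: "c \<in> ?S" "d \<in> ?S" for c d
  proof -
    obtain k l k' l' where c: "c = (k, l)" and d: "d = (k', l')" by (metis prod.exhaust)
    have S: "(k, l) \<in> ?S" "(k', l') \<in> ?S" "(k, l') \<in> ?S" "(k', l) \<in> ?S"
      using cd unfolding c d mat_index_def by auto
    then have lab: "row_label k \<in> I" "col_label l \<in> J" "row_label k' \<in> I" "col_label l' \<in> J"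
      using row_label(1) col_label(1) unfolding mat_index_def by auto
    have "(\<Sum>a\<in>flags N. \<Sum>b\<in>flags N. flag_coef \<alpha> \<beta> a b * D c (snd a) * D d (snd b))
        = (\<Sum>e\<in>E. \<Sum>f\<in>E. edge_form (flag_coef \<alpha> \<beta>) e f * D c e * D d f)"
      unfolding sum_flags edge_form_def sum.distrib[symmetric] by (intro sum.cong refl) (simp add: algebra_simps)
    also have "\<dots> = (triple_param \<alpha> + triple_param \<beta>) / 2 * cyc (row_label k) (row_label k') (col_label l) (col_label l') * ?M w (k, l) * ?M w (k', l')
      + (triple_param \<beta> - triple_param \<alpha>) / 2 * par_coef (row_label k) (row_label k') (col_label l) (col_label l') * ?M w (k, l') * ?M w (k', l)"
      unfolding Mv[OF S(1)] Mv[OF S(2)] Mv[OF S(3)] Mv[OF S(4)] D_def c d fst_conv snd_conv M'_def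
      by (rule rational_identity[OF \<alpha>\<beta> lab rep nz])
    finally show ?thesis unfolding mat_coef_def c d \<theta> by simp
  qed
  have "network_bracket n \<alpha> \<beta> N (f \<circ> ?M) (g \<circ> ?M) w
      = flag_bracket n \<alpha> \<beta> N ((f \<circ> ?M) \<circ> edge_weights N) ((g \<circ> ?M) \<circ> edge_weights N) x"
    unfolding network_bracket_def pushforward_def x_def ..
  also have "\<dots> = (\<Sum>a\<in>flags N. \<Sum>b\<in>flags N. flag_coef \<alpha> \<beta> a b *
      (x a * partial_deriv a ((f \<circ> ?M) \<circ> edge_weights N) x) * (x b * partial_deriv b ((g \<circ> ?M) \<circ> edge_weights N) x))"
    unfolding flag_bracket_conv by (simp only: mult_ac)
  also have "\<dots> = (\<Sum>a\<in>flags N. \<Sum>b\<in>flags N. flag_coef \<alpha> \<beta> a b *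
      (\<Sum>c\<in>?S. partial_deriv c f (?M w) * D c (snd a)) * (\<Sum>d\<in>?S. partial_deriv d g (?M w) * D d (snd b)))"
    by (intro sum.cong refl) (simp only: pd[OF sf] pd[OF sg])
  also have "\<dots> = (\<Sum>a\<in>flags N. \<Sum>b\<in>flags N. \<Sum>c\<in>?S. \<Sum>d\<in>?S.
      partial_deriv c f (?M w) * partial_deriv d g (?M w) * (flag_coef \<alpha> \<beta> a b * D c (snd a) * D d (snd b)))"
    by (intro sum.cong refl) (simp add: sum_distrib_left sum_distrib_right mult_ac)
  also have "\<dots> = (\<Sum>c\<in>?S. \<Sum>d\<in>?S. \<Sum>a\<in>flags N. \<Sum>b\<in>flags N.
      partial_deriv c f (?M w) * partial_deriv d g (?M w) * (flag_coef \<alpha> \<beta> a b * D c (snd a) * D d (snd b)))"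
  proof -
    have sw: "(\<Sum>a\<in>A. \<Sum>b\<in>A. \<Sum>c\<in>C. \<Sum>d\<in>C. G a b c d) = (\<Sum>c\<in>C. \<Sum>d\<in>C. \<Sum>a\<in>A. \<Sum>b\<in>A. G a b c d)"
      for A :: "flag set" and C :: "(nat \<times> nat) set" and G :: "_ \<Rightarrow> _ \<Rightarrow> _ \<Rightarrow> _ \<Rightarrow> real"
    proof -
      have "(\<Sum>a\<in>A. \<Sum>b\<in>A. \<Sum>c\<in>C. \<Sum>d\<in>C. G a b c d) = (\<Sum>a\<in>A. \<Sum>c\<in>C. \<Sum>d\<in>C. \<Sum>b\<in>A. G a b c d)"
        by (rule sum.cong[OF refl]) (subst sum.swap, rule sum.cong[OF refl], rule sum.swap)
      also have "\<dots> = (\<Sum>c\<in>C. \<Sum>d\<in>C. \<Sum>a\<in>A. \<Sum>b\<in>A. G a b c d)"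
        by (subst sum.swap) (rule sum.cong[OF refl], rule sum.swap)
      finally show ?thesis .
    qed
    show ?thesis by (rule sw)
  qed
  also have "\<dots> = (\<Sum>c\<in>?S. \<Sum>d\<in>?S. partial_deriv c f (?M w) * partial_deriv d g (?M w) * mat_coef (\<theta> 0) (\<theta> 1) row_label col_label c d (?M w))"
    by (intro sum.cong refl) (simp add: sum_distrib_left[symmetric] id)
  also have "\<dots> = mat_family (card I) (card J) row_label col_label \<theta> f g (?M w)"
  proof -
    have "?M w \<in> coord_space ?S" unfolding boundary_measurement_def coord_space_def by auto
    then show ?thesis
      using fg unfolding mat_family_def smooth_bracket_def coord_bracket_def by (simp add: mult_ac)
  qed
  finally show "network_bracket n \<alpha> \<beta> N (f \<circ> ?M) (g \<circ> ?M) w = mat_family (card I) (card J) row_label col_label \<theta> f g (?M w)" .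
qed

end

section \<open>Caterpillar networks\<close>

text \<open>In a tree there is at most one path between two given ends, so the series is a single
  signed monomial or 0, and the denominator 1 is regular everywhere.\<close>

lemma single_walk_represents_fraction:
  assumes W: "W \<subseteq> {P0}" and E: "P0 \<in> W \<Longrightarrow> set P0 \<subseteq> E"
  shows "represents_fraction E (\<lambda>a. \<Sum>P | P \<in> W \<and> mset P = a. f P)
    (Poly_Mapping.single (mset P0) (if P0 \<in> W then f P0 else 0)) 1"
  unfolding represents_fraction_def
proof (intro conjI)
  show "(1 :: 'a multiset \<Rightarrow>\<^sub>0 real) \<noteq> 0" by simp
  show "\<forall>a\<in>Poly_Mapping.keys (Poly_Mapping.single (mset P0) (if P0 \<in> W then f P0 else 0)) \<union> Poly_Mapping.keys (1 :: 'a multiset \<Rightarrow>\<^sub>0 real). set_mset a \<subseteq> E"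
    using E by (simp split: if_splits)
  show "poly_times_series 1 (\<lambda>a. \<Sum>P | P \<in> W \<and> mset P = a. f P) =
    Poly_Mapping.lookup (Poly_Mapping.single (mset P0) (if P0 \<in> W then f P0 else 0))"
  proof
    fix a
    have k: "{b \<in> Poly_Mapping.keys (1 :: 'a multiset \<Rightarrow>\<^sub>0 real). b \<subseteq># a} = {{#}}" by auto
    have "poly_times_series 1 (\<lambda>a. \<Sum>P | P \<in> W \<and> mset P = a. f P) a = (\<Sum>P | P \<in> W \<and> mset P = a. f P)"
      unfolding poly_times_series_def k by (simp add: lookup_one)
    also have "{P. P \<in> W \<and> mset P = a} = (if P0 \<in> W \<and> mset P0 = a then {P0} else {})"
      using W by auto
    finally show "poly_times_series 1 (\<lambda>a. \<Sum>P | P \<in> W \<and> mset P = a. f P) a =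
      Poly_Mapping.lookup (Poly_Mapping.single (mset P0) (if P0 \<in> W then f P0 else 0)) a"
      by (simp add: lookup_single when_def)
  qed
qed

lemma poly_eval_one: "poly_eval 1 w = 1"
  by (simp add: poly_eval_def lookup_one)

lemma poly_eval_single: "poly_eval (Poly_Mapping.single a c) w = c * (\<Prod>e\<in>#a. w e)"
  by (simp add: poly_eval_def)

text \<open>
  Boundary positions are counted counterclockwise from the source following the sink \<open>r\<close>. The
  source in position 1 and the sink in position \<open>n\<close> are joined by a spine on which position \<open>a\<close>
  has a vertex \<open>V a\<close> below the boundary vertex \<open>B a\<close>, at half its height. Since the real
  parts decrease strictly with the position, edges meet in common ends only.
\<close>

locale caterpillar =
  fixes n r :: nat and I J :: "nat set"
  assumes labels: "I \<union> J = {1..n}" "I \<inter> J = {}" and n: "3 \<le> n"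
    and last_sink: "r \<in> J" and first_source: "(if r < n then Suc r else 1) \<in> I"
begin

definition pos :: "nat \<Rightarrow> nat" where
  "pos i = (if r < i then i - r else i + n - r)"

definition lab :: "nat \<Rightarrow> nat" where
  "lab a = (if r + a \<le> n then r + a else r + a - n)"

lemma r: "1 \<le> r" "r \<le> n"
  using last_sink labels by auto

lemma lab: "a \<in> {1..n} \<Longrightarrow> lab a \<in> {1..n}" "a \<in> {1..n} \<Longrightarrow> pos (lab a) = a"
  using r by (auto simp: lab_def pos_def)

lemma pos: "i \<in> {1..n} \<Longrightarrow> pos i \<in> {1..n}" "i \<in> {1..n} \<Longrightarrow> lab (pos i) = i"
  using r by (auto simp: lab_def pos_def)

lemma lab_first: "lab 1 \<in> I" and lab_last: "lab n \<in> J"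
  using first_source last_sink r by (auto simp: lab_def split: if_splits)

text \<open>The positions are spread over the closed upper half circle, with \<open>B 1\<close> at 1
  and \<open>B n\<close> at - 1.\<close>

definition angle :: "nat \<Rightarrow> real" where
  "angle a = pi * ((real a - 1) / (real n - 1))"

definition X :: "nat \<Rightarrow> real" where "X a = cos (angle a)"

definition Y :: "nat \<Rightarrow> real" where "Y a = sin (angle a)"

definition B :: "nat \<Rightarrow> complex" where "B a = cis (angle a)"

text \<open>At both ends the height is 0, so that the spine starts and ends in boundary
  vertices.\<close>

definition V :: "nat \<Rightarrow> complex" where "V a = Complex (X a) (Y a / 2)"

lemma angle_mono: "a < b \<Longrightarrow> angle a < angle b"
  using n by (simp add: angle_def divide_strict_right_mono)

lemma angle_ends: "angle 1 = 0" "angle n = pi"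
  using n by (simp_all add: angle_def)

lemma angle_bounds:
  assumes "a \<in> {1..n}"
  shows "0 \<le> angle a" "angle a \<le> pi"
proof -
  have "angle 1 \<le> angle a" using assms angle_mono[of 1 a] by (cases "a = 1") auto
  then show "0 \<le> angle a" unfolding angle_ends .
  have "angle a \<le> angle n" using assms angle_mono[of a n] by (cases "a = n") auto
  then show "angle a \<le> pi" by (simp add: angle_ends)
qed

lemma X_strict: "a \<in> {1..n} \<Longrightarrow> b \<in> {1..n} \<Longrightarrow> a < b \<Longrightarrow> X b < X a"
  unfolding X_def using cos_monotone_0_pi angle_bounds angle_mono by metis

lemma X_le: "a \<in> {1..n} \<Longrightarrow> b \<in> {1..n} \<Longrightarrow> X a \<le> X b \<longleftrightarrow> b \<le> a"
  using X_strict[of a b] X_strict[of b a] by (metis leD leI le_less nat_neq_iff)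

lemma X_eq: "a \<in> {1..n} \<Longrightarrow> b \<in> {1..n} \<Longrightarrow> X a = X b \<longleftrightarrow> a = b"
  using X_strict[of a b] X_strict[of b a] by (metis less_irrefl nat_neq_iff)

lemma Y_pos:
  assumes "1 < a" "a < n"
  shows "0 < Y a"
  using angle_mono[of 1 a] angle_mono[of a n] assms unfolding Y_def angle_ends by (intro sin_gt_zero) auto

lemma X_ends: "X 1 = 1" "X n = - 1" and Y_ends: "Y 1 = 0" "Y n = 0"
  unfolding X_def Y_def angle_ends by simp_all

lemma B_eq: "B a = Complex (X a) (Y a)"
  by (simp add: B_def X_def Y_def complex_eq_iff)

lemma V_ends: "V 1 = B 1" "V n = B n"
  by (simp_all only: B_eq V_def Y_ends) simp_all

lemma V_inj: "a \<in> {1..n} \<Longrightarrow> b \<in> {1..n} \<Longrightarrow> V a = V b \<longleftrightarrow> a = b"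
  and B_inj: "a \<in> {1..n} \<Longrightarrow> b \<in> {1..n} \<Longrightarrow> B a = B b \<longleftrightarrow> a = b"
  using X_eq[of a b] by (auto simp: V_def B_eq)

lemma V_B:
  assumes "a \<in> {1..n}" "b \<in> {1..n}"
  shows "V a = B b \<longleftrightarrow> a = b \<and> (a = 1 \<or> a = n)"
proof
  assume "V a = B b"
  then have "X a = X b" "Y a / 2 = Y b" by (auto simp: V_def B_eq)
  then have "a = b" "Y a = 0" using X_eq assms by auto
  then show "a = b \<and> (a = 1 \<or> a = n)" using Y_pos[of a] assms by force
qed (use V_ends in auto)

definition spine :: "nat \<Rightarrow> edge" where "spine a = (V a, V (Suc a))"

text \<open>The direction of the leg decides the colour: a sink makes \<open>V a\<close> white, a
  source makes it black.\<close>

definition leg :: "nat \<Rightarrow> edge" where "leg a = (if lab a \<in> I then (B a, V a) else (V a, B a))"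

definition arcs :: "edge set" where "arcs = spine ` {1..<n} \<union> leg ` {2..<n}"

definition caterpillar :: network where
  "caterpillar = \<lparr>graph = \<lparr>pverts = B ` {1..n} \<union> V ` {1..n}, parcs = arcs\<rparr>, bdry = (\<lambda>i. B (pos i)), weight = (\<lambda>e\<in>arcs. 1)\<rparr>"

lemma caterpillar_sel [simp]: "pverts (graph caterpillar) = B ` {1..n} \<union> V ` {1..n}"
  "parcs (graph caterpillar) = arcs" "bdry caterpillar i = B (pos i)" "weight caterpillar = (\<lambda>e\<in>arcs. 1)"
  by (simp_all add: caterpillar_def)

lemma spine_in_arcs: "a \<in> {1..<n} \<Longrightarrow> spine a \<in> arcs" and leg_in_arcs: "a \<in> {2..<n} \<Longrightarrow> leg a \<in> arcs"
  by (simp_all add: arcs_def)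

section \<open>The caterpillar is a perfect planar network\<close>

lemma arcs_cases:
  assumes "e \<in> arcs"
  obtains (spine) a where "a \<in> {1..<n}" "e = spine a" | (leg) a where "a \<in> {2..<n}" "e = leg a"
  using assms unfolding arcs_def by blast

lemma fst_V:
  assumes a: "a \<in> {1..n}"
  shows "{e \<in> arcs. fst e = V a} = (if a < n then {spine a} else {}) \<union> (if a \<in> {2..<n} \<and> lab a \<notin> I then {leg a} else {})"
proof (intro equalityI subsetI)
  fix e assume e: "e \<in> {e \<in> arcs. fst e = V a}"
  then have "e \<in> arcs" by simp
  then show "e \<in> (if a < n then {spine a} else {}) \<union> (if a \<in> {2..<n} \<and> lab a \<notin> I then {leg a} else {})"
  proof (cases rule: arcs_cases)
    case (spine b)
    then have "V b = V a" "b \<in> {1..n}" using e by (simp_all add: spine_def)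
    then have "b = a" using V_inj a by blast
    then show ?thesis using spine by auto
  next
    case (leg b)
    then have "a = b" "lab b \<notin> I" using e a V_inj[of b a] V_B[of a b] by (auto simp: leg_def split: if_splits)
    then show ?thesis using leg by auto
  qed
next
  fix e assume "e \<in> (if a < n then {spine a} else {}) \<union> (if a \<in> {2..<n} \<and> lab a \<notin> I then {leg a} else {})"
  then show "e \<in> {e \<in> arcs. fst e = V a}"
    using a spine_in_arcs[of a] leg_in_arcs[of a] by (auto simp: spine_def leg_def split: if_splits)
qed

lemma snd_V:
  assumes a: "a \<in> {1..n}"
  shows "{e \<in> arcs. snd e = V a} = (if 1 < a then {spine (a - 1)} else {}) \<union> (if a \<in> {2..<n} \<and> lab a \<in> I then {leg a} else {})"
proof (intro equalityI subsetI)
  fix e assume e: "e \<in> {e \<in> arcs. snd e = V a}"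
  then have "e \<in> arcs" by simp
  then show "e \<in> (if 1 < a then {spine (a - 1)} else {}) \<union> (if a \<in> {2..<n} \<and> lab a \<in> I then {leg a} else {})"
  proof (cases rule: arcs_cases)
    case (spine b)
    then have "V (Suc b) = V a" "Suc b \<in> {1..n}" using e by (simp_all add: spine_def)
    then have "a = Suc b" using V_inj a by blast
    then show ?thesis using spine by auto
  next
    case (leg b)
    then have "a = b" "lab b \<in> I" using e a V_inj[of b a] V_B[of a b] by (auto simp: leg_def split: if_splits)
    then show ?thesis using leg by auto
  qed
next
  fix e assume "e \<in> (if 1 < a then {spine (a - 1)} else {}) \<union> (if a \<in> {2..<n} \<and> lab a \<in> I then {leg a} else {})"
  then show "e \<in> {e \<in> arcs. snd e = V a}"
    using a spine_in_arcs[of "a - 1"] leg_in_arcs[of a] by (cases a) (auto simp: spine_def leg_def split: if_splits)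
qed

lemma fst_B:
  assumes a: "a \<in> {2..<n}"
  shows "{e \<in> arcs. fst e = B a} = (if lab a \<in> I then {leg a} else {})"
proof (intro equalityI subsetI)
  fix e assume e: "e \<in> {e \<in> arcs. fst e = B a}"
  then have "e \<in> arcs" by simp
  then show "e \<in> (if lab a \<in> I then {leg a} else {})"
  proof (cases rule: arcs_cases)
    case (spine b)
    then show ?thesis using e a V_B[of b a] by (auto simp: spine_def)
  next
    case (leg b)
    then have "a = b" "lab b \<in> I" using e a B_inj[of b a] V_B[of b a] by (auto simp: leg_def split: if_splits)
    then show ?thesis using leg by auto
  qed
next
  fix e assume "e \<in> (if lab a \<in> I then {leg a} else {})"
  then show "e \<in> {e \<in> arcs. fst e = B a}"
    using a leg_in_arcs[of a] by (auto simp: leg_def split: if_splits)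
qed

lemma snd_B:
  assumes a: "a \<in> {2..<n}"
  shows "{e \<in> arcs. snd e = B a} = (if lab a \<in> I then {} else {leg a})"
proof (intro equalityI subsetI)
  fix e assume e: "e \<in> {e \<in> arcs. snd e = B a}"
  then have "e \<in> arcs" by simp
  then show "e \<in> (if lab a \<in> I then {} else {leg a})"
  proof (cases rule: arcs_cases)
    case (spine b)
    then show ?thesis using e a V_B[of "Suc b" a] by (auto simp: spine_def)
  next
    case (leg b)
    then have "a = b" "lab b \<notin> I" using e a B_inj[of b a] V_B[of b a] by (auto simp: leg_def split: if_splits)
    then show ?thesis using leg by auto
  qed
next
  fix e assume "e \<in> (if lab a \<in> I then {} else {leg a})"
  then show "e \<in> {e \<in> arcs. snd e = B a}"
    using a leg_in_arcs[of a] by (auto simp: leg_def split: if_splits)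
qed

lemma in_degree_conv: "in_degree (graph caterpillar) v = card {e \<in> arcs. snd e = v}"
  by (simp add: in_degree_def in_arcs_def)

lemma out_degree_conv: "out_degree (graph caterpillar) v = card {e \<in> arcs. fst e = v}"
  by (simp add: out_degree_def out_arcs_def)

lemma boundary_vertices: "boundary_vertices n caterpillar = B ` {1..n}"
proof -
  have "pos ` {1..n} = {1..n}"
  proof
    show "pos ` {1..n} \<subseteq> {1..n}" using pos by blast
    show "{1..n} \<subseteq> pos ` {1..n}"
    proof
      fix a assume "a \<in> {1..n}" then show "a \<in> pos ` {1..n}" using lab[of a] by (intro image_eqI[of _ _ "lab a"]) auto
    qed
  qed
  then show ?thesis unfolding boundary_vertices_def by (simp add: image_image[symmetric])
qed

lemma internal_vertices: "internal_vertices n caterpillar = V ` {2..<n}"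
proof -
  have eq: "{1..n} = {1, n} \<union> {2..<n}" using n by auto
  have "V ` {1..n} = {B 1, B n} \<union> V ` {2..<n}" unfolding eq image_Un by (simp add: V_ends flip: One_nat_def)
  moreover have "V ` {2..<n} \<inter> B ` {1..n} = {}" using V_B by fastforce
  moreover have "B 1 \<in> B ` {1..n}" "B n \<in> B ` {1..n}" using n by auto
  ultimately show ?thesis unfolding internal_vertices_def boundary_vertices by auto
qed

lemma pair_digraph: "pair_digraph (graph caterpillar)"
proof
  have sp: "V a \<noteq> V (Suc a)" if "a \<in> {1..<n}" for a using that V_inj[of a "Suc a"] by auto
  have lg: "V a \<noteq> B a" if "a \<in> {2..<n}" for a using that V_B[of a a] by auto
  fix e assume "e \<in> parcs (graph caterpillar)"
  then have e: "e \<in> arcs" by simp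
  show "fst e \<in> pverts (graph caterpillar)" "snd e \<in> pverts (graph caterpillar)"
    using e by (cases rule: arcs_cases; force simp: spine_def leg_def)+
  show "fst e \<noteq> snd e"
    using e
  proof (cases rule: arcs_cases)
    case (spine a)
    then show ?thesis using sp[of a] by (simp add: spine_def)
  next
    case (leg a)
    then show ?thesis using lg[of a] not_sym[OF lg[of a]] by (simp add: leg_def)
  qed
qed (simp_all add: arcs_def)

lemma on_circle: "boundary_on_circle n caterpillar"
  unfolding boundary_on_circle_def
proof (intro exI conjI ballI)
  \<comment> \<open>The labels up to \<open>r\<close> come last in position. Subtracting a full turn
    from their angles makes the angles increase with the labels.\<close>
  define \<theta> where "\<theta> i = (if r < i then angle (i - r) else angle (i + n - r) - 2 * pi)" for i
  have b1: "0 \<le> \<theta> i" "\<theta> i \<le> pi" if "i \<in> {1..n}" "r < i" for i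
  proof -
    have "i - r \<in> {1..n}" using that by auto
    from angle_bounds[OF this] show "0 \<le> \<theta> i" "\<theta> i \<le> pi" using that by (simp_all add: \<theta>_def)
  qed
  have b2: "- 2 * pi \<le> \<theta> i" "\<theta> i \<le> - pi" if "i \<in> {1..n}" "i \<le> r" for i
  proof -
    have "i + n - r \<in> {1..n}" using that r by auto
    from angle_bounds[OF this] show "- 2 * pi \<le> \<theta> i" "\<theta> i \<le> - pi" using that by (simp_all add: \<theta>_def)
  qed
  have pp: "0 < pi" by (rule pi_gt_zero)
  show "strict_mono_on {1..n} \<theta>"
  proof (rule strict_mono_onI)
    fix i j assume ij: "i \<in> {1..n}" "j \<in> {1..n}" "i < j"
    consider "r < i" | "i \<le> r" "r < j" | "j \<le> r" using ij by linarith
    then show "\<theta> i < \<theta> j"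
    proof cases
      case 1 then show ?thesis using ij angle_mono[of "i - r" "j - r"] by (simp add: \<theta>_def)
    next
      case 2 then show ?thesis using b1[of j] b2[of i] ij pp by linarith
    next
      case 3 then show ?thesis using ij r angle_mono[of "i + n - r" "j + n - r"] by (auto simp: \<theta>_def)
    qed
  qed
  fix i assume i: "i \<in> {1..n}"
  show "bdry caterpillar i = cis (\<theta> i)"
    by (simp add: B_def pos_def \<theta>_def cis_divide[symmetric])
  fix j assume j: "j \<in> {1..n}"
  consider "r < i" "r < j" | "r < i" "j \<le> r" | "i \<le> r" "r < j" | "i \<le> r" "j \<le> r" by linarith
  then show "\<theta> j < \<theta> i + 2 * pi"
  proof cases
    case 1 then show ?thesis using b1[OF i] b1[OF j] pp by linarith
  next
    case 2 then show ?thesis using b1[OF i] b2[OF j] pp by linarith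
  next
    case 3
    then have "j - r < i + n - r" using i j r by auto
    then show ?thesis using angle_mono[of "j - r" "i + n - r"] 3 by (simp add: \<theta>_def)
  next
    case 4 then show ?thesis using b2[OF i] b2[OF j] pp by linarith
  qed
qed

lemma interior_V:
  assumes a: "a \<in> {2..<n}"
  shows "V a \<in> interior (convex hull (B ` {1..n}))"
proof -
  have y: "0 < Y a" using a Y_pos by auto
  have x: "X a < 1" "- 1 < X a" using X_strict[of 1 a] X_strict[of a n] a n X_ends by auto
  have B1: "B 1 = 1" "B n = - 1" using X_ends Y_ends unfolding B_eq by (auto simp: complex_eq_iff)
  have nc: "\<not> collinear {1, - 1, B a}"
  proof
    assume "collinear {1, - 1, B a}"
    then have "B a \<in> affine hull {1, - 1}" by (rule collinear_3_imp_in_affine_hull) simp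
    then have "Im (B a) = 0" by (auto simp: affine_hull_2)
    then show False using y by (simp add: B_eq)
  qed
  have "V a \<in> interior (convex hull {1, - 1, B a})"
    unfolding interior_convex_hull_3_minimal[OF nc DIM_complex]
  proof (standard, intro exI conjI)
    \<comment> \<open>\<open>V a\<close> is the midpoint of \<open>B a\<close> and of the point
      \<open>X a\<close> on the segment from - 1 to 1, whose coordinates with respect to 1 and - 1
      are (1 + X a) / 2 and (1 - X a) / 2.\<close>
    show "0 < (1 + X a) / 4" "0 < (1 - X a) / 4" "0 < (1 / 2 :: real)" using x by auto
    show "(1 + X a) / 4 + (1 - X a) / 4 + 1 / 2 = 1" by (simp add: field_simps)
    show "((1 + X a) / 4) *\<^sub>R 1 + ((1 - X a) / 4) *\<^sub>R - 1 + (1 / 2 :: real) *\<^sub>R B a = V a"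
      by (simp add: complex_eq_iff V_def B_eq field_simps)
  qed
  moreover have "{1, - 1, B a} \<subseteq> B ` {1..n}"
  proof -
    have "B 1 \<in> B ` {1..n}" "B n \<in> B ` {1..n}" "B a \<in> B ` {1..n}" using a n by (intro imageI; auto)+
    then show ?thesis unfolding B1 by blast
  qed
  ultimately show ?thesis using interior_mono[OF hull_mono] by blast
qed

lemma spine_segment:
  assumes a: "a \<in> {1..<n}" and z: "z \<in> closed_segment (fst (spine a)) (snd (spine a))"
  shows "X (Suc a) \<le> Re z" "Re z \<le> X a" "b \<in> {1..n} \<Longrightarrow> Re z = X b \<Longrightarrow> (b = a \<or> b = Suc a) \<and> z = V b"
proof -
  obtain u where u: "0 \<le> u" "u \<le> 1" "z = (1 - u) *\<^sub>R V a + u *\<^sub>R V (Suc a)"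
    using z by (auto simp: in_segment spine_def)
  have lt: "X (Suc a) < X a" using X_strict[of a "Suc a"] a by auto
  have re: "Re z = X a - u * (X a - X (Suc a))" "Re z = X (Suc a) + (1 - u) * (X a - X (Suc a))"
    unfolding u(3) by (simp_all add: V_def algebra_simps)
  show 1: "X (Suc a) \<le> Re z" unfolding re(2) using u(2) lt by simp
  show 2: "Re z \<le> X a" unfolding re(1) using u(1) lt by simp
  assume b: "b \<in> {1..n}" "Re z = X b"
  have "a \<le> b" "b \<le> Suc a" using 1 2 X_le[of b a] X_le[of "Suc a" b] a b by auto
  then consider "b = a" | "b = Suc a" by linarith
  then show "(b = a \<or> b = Suc a) \<and> z = V b"
  proof cases
    case 1
    then have "u = 0" using re(1) b(2) lt by simp
    then show ?thesis using 1 u(3) by simp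
  next
    case 2
    then have "u = 1" using re(2) b(2) lt by simp
    then show ?thesis using 2 u(3) by simp
  qed
qed

lemma leg_segment:
  assumes "z \<in> closed_segment (fst (leg a)) (snd (leg a))"
  shows "Re z = X a"
proof -
  obtain u where u: "z = (1 - u) *\<^sub>R fst (leg a) + u *\<^sub>R snd (leg a)"
    using assms by (auto simp: in_segment)
  have "Re (fst (leg a)) = X a" "Re (snd (leg a)) = X a" by (simp_all add: leg_def V_def B_eq)
  then have "Re z = (1 - u) * X a + u * X a" unfolding u by simp
  then show ?thesis by (simp add: algebra_simps)
qed

lemma segments_meet:
  assumes "e \<in> arcs" "e' \<in> arcs" "e \<noteq> e'"
    and "z \<in> closed_segment (fst e) (snd e)" "z \<in> closed_segment (fst e') (snd e')"
  shows "z \<in> {fst e, snd e} \<inter> {fst e', snd e'}"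
proof -
  have ss: "z \<in> {fst (spine a), snd (spine a)} \<inter> {fst (spine b), snd (spine b)}"
    if "a \<in> {1..<n}" "b \<in> {1..<n}" "a < b" "z \<in> closed_segment (fst (spine a)) (snd (spine a))"
      "z \<in> closed_segment (fst (spine b)) (snd (spine b))" for a b
  proof -
    note s = spine_segment[OF that(1,4)] and t = spine_segment[OF that(2,5)]
    have "X b \<le> X (Suc a)" using X_le[of b "Suc a"] that by auto
    then have "Re z = X b" using s(1) t(2) by simp
    then have "z = V b" "b = Suc a" using s(3)[of b] t(3)[of b] that by auto
    then show ?thesis by (simp add: spine_def)
  qed
  have sl: "z \<in> {fst (spine a), snd (spine a)} \<inter> {fst (leg b), snd (leg b)}"
    if "a \<in> {1..<n}" "b \<in> {2..<n}" "z \<in> closed_segment (fst (spine a)) (snd (spine a))"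
      "z \<in> closed_segment (fst (leg b)) (snd (leg b))" for a b
    using spine_segment(3)[OF that(1,3), of b] leg_segment[OF that(4)] that by (auto simp: spine_def leg_def)
  show ?thesis
    using assms(1)
  proof (cases rule: arcs_cases)
    case a: (spine a)
    from assms(2) show ?thesis
    proof (cases rule: arcs_cases)
      case b: (spine b)
      have "a \<noteq> b" using a b assms(3) by auto
      then consider "a < b" | "b < a" by linarith
      then show ?thesis using ss[of a b] ss[of b a] a b assms(4,5) by cases blast+
    next
      case b: (leg b)
      show ?thesis using sl[of a b] a b assms(4,5) by blast
    qed
  next
    case a: (leg a)
    from assms(2) show ?thesis
    proof (cases rule: arcs_cases)
      case b: (spine b)
      show ?thesis using sl[of b a] a b assms(4,5) by blast
    next
      case b: (leg b)
      have "Re z = X a" "Re z = X b" using leg_segment[of z a] leg_segment[of z b] assms(4,5) a(2) b(2) by simp_all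
      then have "a = b" using X_eq[of a b] a b by auto
      then show ?thesis using a b assms(3) by simp
    qed
  qed
qed

lemma segment_vertices:
  assumes "e \<in> arcs"
  shows "closed_segment (fst e) (snd e) \<inter> (B ` {1..n} \<union> V ` {1..n}) = {fst e, snd e}"
proof
  have "fst e \<in> B ` {1..n} \<union> V ` {1..n}" "snd e \<in> B ` {1..n} \<union> V ` {1..n}"
    using assms by (cases rule: arcs_cases; force simp: spine_def leg_def)+
  then show "{fst e, snd e} \<subseteq> closed_segment (fst e) (snd e) \<inter> (B ` {1..n} \<union> V ` {1..n})" by auto
  show "closed_segment (fst e) (snd e) \<inter> (B ` {1..n} \<union> V ` {1..n}) \<subseteq> {fst e, snd e}"
  proof
    fix z assume z: "z \<in> closed_segment (fst e) (snd e) \<inter> (B ` {1..n} \<union> V ` {1..n})"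
    then obtain b where b: "b \<in> {1..n}" "z = B b \<or> z = V b" by auto
    then have re: "Re z = X b" by (auto simp: B_eq V_def)
    from assms show "z \<in> {fst e, snd e}"
    proof (cases rule: arcs_cases)
      case (spine a)
      then show ?thesis using spine_segment(3)[OF _ _ b(1) re, of a] z by (auto simp: spine_def)
    next
      case (leg a)
      then have "a = b" using leg_segment[of z a] z re X_eq[of a b] b(1) by auto
      then show ?thesis using leg b by (auto simp: leg_def)
    qed
  qed
qed

lemma spine_neq_leg: "a \<in> {1..<n} \<Longrightarrow> b \<in> {2..<n} \<Longrightarrow> spine a \<noteq> leg b"
  using V_B[of a b] V_B[of "Suc a" b] by (auto simp: spine_def leg_def)

lemma boundary_degrees:
  assumes a: "a \<in> {1..n}"
  shows "lab a \<in> I \<Longrightarrow> in_degree (graph caterpillar) (B a) = 0 \<and> out_degree (graph caterpillar) (B a) = 1"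
    and "lab a \<in> J \<Longrightarrow> in_degree (graph caterpillar) (B a) = 1 \<and> out_degree (graph caterpillar) (B a) = 0"
proof -
  have m: "1 \<in> {1..n}" "n \<in> {1..n}" using n by auto
  have 1: "in_degree (graph caterpillar) (B 1) = 0 \<and> out_degree (graph caterpillar) (B 1) = 1"
    unfolding in_degree_conv out_degree_conv V_ends[symmetric] fst_V[OF m(1)] snd_V[OF m(1)] using n by simp
  have n': "in_degree (graph caterpillar) (B n) = 1 \<and> out_degree (graph caterpillar) (B n) = 0"
    unfolding in_degree_conv out_degree_conv V_ends[symmetric] fst_V[OF m(2)] snd_V[OF m(2)] using n by simp
  have disj: "lab a \<in> J \<longleftrightarrow> lab a \<notin> I" using labels lab[OF a] by blast
  have l1: "lab 1 \<notin> J" and ln: "lab n \<notin> I" using lab_first lab_last labels by blast+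
  consider "a = 1" | "a = n" | "a \<in> {2..<n}" using a by force
  note c = this
  show "in_degree (graph caterpillar) (B a) = 0 \<and> out_degree (graph caterpillar) (B a) = 1" if "lab a \<in> I"
    using c by cases (use that 1 ln in \<open>simp_all add: fst_B snd_B in_degree_conv out_degree_conv\<close>)
  show "in_degree (graph caterpillar) (B a) = 1 \<and> out_degree (graph caterpillar) (B a) = 0" if "lab a \<in> J"
    using c by cases (use that n' l1 disj in \<open>simp_all add: fst_B snd_B in_degree_conv out_degree_conv\<close>)
qed

lemma internal_degrees:
  assumes a: "a \<in> {2..<n}"
  shows "in_degree (graph caterpillar) (V a) = (if lab a \<in> I then 2 else 1)"
    "out_degree (graph caterpillar) (V a) = (if lab a \<in> I then 1 else 2)"
proof -
  have m: "a \<in> {1..n}" "a - 1 \<in> {1..<n}" "a \<in> {1..<n}" using a by auto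
  note nq = spine_neq_leg[OF m(2) a] spine_neq_leg[OF m(3) a]
  show "in_degree (graph caterpillar) (V a) = (if lab a \<in> I then 2 else 1)"
    unfolding in_degree_conv snd_V[OF m(1)] using a nq by simp
  show "out_degree (graph caterpillar) (V a) = (if lab a \<in> I then 1 else 2)"
    unfolding out_degree_conv fst_V[OF m(1)] using a nq by simp
qed

lemma caterpillar_Net: "caterpillar \<in> Net n I J"
  unfolding Net_def
proof (standard, intro conjI ballI)
  show "boundary_vertices n caterpillar \<subseteq> pverts (graph caterpillar)" unfolding boundary_vertices by simp
  show "internal_vertices n caterpillar \<subseteq> interior (convex hull (boundary_vertices n caterpillar))"
    unfolding internal_vertices boundary_vertices using interior_V by blast
  show "straight_plane_drawing caterpillar"
    unfolding straight_plane_drawing_def using segment_vertices segments_meet by (simp add: subset_iff)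
  show "weight caterpillar \<in> torus (parcs (graph caterpillar))" by (simp add: torus_def)
next
  fix i assume i: "i \<in> I"
  then have "i \<in> {1..n}" using labels by auto
  then show "in_degree (graph caterpillar) (bdry caterpillar i) = 0" "out_degree (graph caterpillar) (bdry caterpillar i) = 1"
    using boundary_degrees(1)[of "pos i"] pos[of i] i by auto
next
  fix i assume i: "i \<in> J"
  then have "i \<in> {1..n}" using labels by auto
  then show "in_degree (graph caterpillar) (bdry caterpillar i) = 1" "out_degree (graph caterpillar) (bdry caterpillar i) = 0"
    using boundary_degrees(2)[of "pos i"] pos[of i] i by auto
next
  fix v assume v: "v \<in> internal_vertices n caterpillar"
  then obtain a where a: "a \<in> {2..<n}" "v = V a" unfolding internal_vertices by auto
  show "in_degree (graph caterpillar) v + out_degree (graph caterpillar) v = 3"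
    using internal_degrees[OF a(1)] a(2) by simp
  show "white n caterpillar v \<or> black n caterpillar v"
    using internal_degrees[OF a(1)] a(2) v by (simp add: white_def black_def)
qed (rule pair_digraph on_circle)+

sublocale perfect_network n I J caterpillar
  by standard (rule labels caterpillar_Net)+

section \<open>Paths and boundary measurements of the caterpillar\<close>

lemma awalk_from_V:
  assumes "a \<in> {1..n}" "awalk (V a) P x"
  shows "\<exists>b\<in>{a..n}. (x = V b \<and> P = map spine [a..<b]) \<or>
    (b \<in> {2..<n} \<and> lab b \<notin> I \<and> x = B b \<and> P = map spine [a..<b] @ [leg b])"
  using assms
proof (induction P arbitrary: a)
  case Nil
  then have "x = V a" by (simp add: awalk_Nil_iff)
  then show ?case using Nil.prems by (intro bexI[of _ a]) simp_all
next
  case (Cons e P)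
  have e: "e \<in> {e \<in> arcs. fst e = V a}" and P: "awalk (snd e) P x"
    using Cons.prems(2) by (auto simp: awalk_Cons_iff)
  from e consider (spine) "a < n" "e = spine a" | (leg) "a \<in> {2..<n}" "lab a \<notin> I" "e = leg a"
    unfolding fst_V[OF Cons.prems(1)] by (auto split: if_splits)
  then show ?case
  proof cases
    case spine
    then have "Suc a \<in> {1..n}" "awalk (V (Suc a)) P x" using P by (auto simp: spine_def)
    from Cons.IH[OF this] obtain b where b: "b \<in> {Suc a..n}" and
      alt: "(x = V b \<and> P = map spine [Suc a..<b]) \<or> (b \<in> {2..<n} \<and> lab b \<notin> I \<and> x = B b \<and> P = map spine [Suc a..<b] @ [leg b])"
      by blast
    have "[a..<b] = a # [Suc a..<b]" using b by (intro upt_conv_Cons) auto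
    then show ?thesis using b alt spine by (intro bexI[of _ b]) auto
  next
    case leg
    then have "awalk (B a) P x" using P by (simp add: leg_def)
    moreover have "{e \<in> arcs. fst e = B a} = {}" using fst_B[OF leg(1)] leg(2) by simp
    ultimately have "P = []" "x = B a" by (cases P; auto simp: awalk_Cons_iff awalk_Nil_iff)+
    then show ?thesis using leg by (intro bexI[of _ a]) auto
  qed
qed

lemma awalk_spine:
  assumes "1 \<le> a" "a \<le> b" "b \<le> n"
  shows "awalk (V a) (map spine [a..<b]) (V b)"
  using assms(2,3)
proof (induction rule: dec_induct)
  case base
  then show ?case using assms(1) by (simp add: awalk_Nil_iff)
next
  case (step b)
  have "awalk (V b) [spine b] (V (Suc b))"
    using step assms(1) spine_in_arcs[of b] by (simp add: awalk_Cons_iff awalk_Nil_iff) (simp add: spine_def)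
  then show ?case using step awalk_appendI by fastforce
qed

definition path :: "nat \<Rightarrow> nat \<Rightarrow> edge list" where
  "path a b = (if a = 1 then [] else [leg a]) @ map spine [a..<b] @ (if b = n then [] else [leg b])"

lemma pos_source: "i \<in> I \<Longrightarrow> pos i \<in> {1..<n}" "i \<in> I \<Longrightarrow> lab (pos i) \<in> I"
  and pos_sink: "j \<in> J \<Longrightarrow> pos j \<in> {2..n}" "j \<in> J \<Longrightarrow> lab (pos j) \<notin> I"
proof -
  show "pos i \<in> {1..<n}" "lab (pos i) \<in> I" if "i \<in> I"
  proof -
    have i: "i \<in> {1..n}" using that labels by auto
    then show "lab (pos i) \<in> I" using pos that by simp
    then have "pos i \<noteq> n" using lab_last labels by auto
    then show "pos i \<in> {1..<n}" using pos(1)[OF i] by auto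
  qed
  show "pos j \<in> {2..n}" "lab (pos j) \<notin> I" if "j \<in> J"
  proof -
    have j: "j \<in> {1..n}" using that labels by auto
    then show "lab (pos j) \<notin> I" using pos that labels by auto
    then have "pos j \<noteq> 1" using lab_first by metis
    then show "pos j \<in> {2..n}" using pos(1)[OF j] by auto
  qed
qed

lemma walks_subset:
  assumes i: "i \<in> I" and j: "j \<in> J"
  shows "walks i j \<subseteq> {path (pos i) (pos j)}"
proof
  fix P assume "P \<in> walks i j"
  moreover define a b where ab: "a = pos i" "b = pos j"
  ultimately have P: "awalk (B a) P (B b)" by (simp add: walks_def)
  have a: "a \<in> {1..<n}" "lab a \<in> I" and b: "b \<in> {2..n}" "lab b \<notin> I"
    using pos_source[OF i] pos_sink[OF j] unfolding ab by auto
  have Q: "Q = map spine [a..<b] @ (if b = n then [] else [leg b])" if Q: "awalk (V a) Q (B b)" for Q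
  proof -
    have "a \<in> {1..n}" using a by auto
    from awalk_from_V[OF this Q] obtain c where c: "c \<in> {a..n}" and
      alt: "(B b = V c \<and> Q = map spine [a..<c]) \<or> (c \<in> {2..<n} \<and> lab c \<notin> I \<and> B b = B c \<and> Q = map spine [a..<c] @ [leg c])"
      by blast
    from alt show ?thesis
    proof (elim disjE conjE)
      assume h: "B b = V c" "Q = map spine [a..<c]"
      have "c \<in> {1..n}" "b \<in> {1..n}" using a b c by auto
      from V_B[OF this] h(1) have "c = b" "b = 1 \<or> b = n" by auto
      then show ?thesis using h b by auto
    next
      assume h: "c \<in> {2..<n}" "B b = B c" "Q = map spine [a..<c] @ [leg c]"
      have "c \<in> {1..n}" "b \<in> {1..n}" using b h by auto
      from B_inj[OF this] h have "c = b" by simp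
      then show ?thesis using h by auto
    qed
  qed
  have "P = path a b"
  proof (cases "a = 1")
    case True
    then show ?thesis using Q[of P] P V_ends(1) by (simp add: path_def)
  next
    case False
    have "a \<noteq> b" using a b by auto
    then have "B a \<noteq> B b" using B_inj[of a b] a b by auto
    then obtain e Q where e: "P = e # Q" using P by (cases P) (auto simp: awalk_Nil_iff)
    have a2: "a \<in> {2..<n}" using False a by auto
    have "e \<in> {e \<in> arcs. fst e = B a}" "awalk (snd e) Q (B b)" using P unfolding e by (auto simp: awalk_Cons_iff)
    then have "e = leg a" "awalk (V a) Q (B b)" unfolding fst_B[OF a2] using a(2) by (auto simp: leg_def)
    then show ?thesis using Q[of Q] False e by (simp add: path_def)
  qed
  then show "P \<in> {path (pos i) (pos j)}" unfolding ab by simp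
qed

lemma path_walk:
  assumes i: "i \<in> I" and j: "j \<in> J" and le: "pos i < pos j"
  shows "path (pos i) (pos j) \<in> walks i j"
proof -
  define a b where ab: "a = pos i" "b = pos j"
  have a: "a \<in> {1..<n}" "lab a \<in> I" and b: "b \<in> {2..n}" "lab b \<notin> I"
    using pos_source[OF i] pos_sink[OF j] unfolding ab by auto
  have 1: "awalk (B a) (if a = 1 then [] else [leg a]) (V a)"
    using a leg_in_arcs[of a] V_ends(1) by (auto simp: awalk_Nil_iff awalk_Cons_iff leg_def)
  have 2: "awalk (V a) (map spine [a..<b]) (V b)"
    using awalk_spine a b le ab by auto
  have 3: "awalk (V b) (if b = n then [] else [leg b]) (B b)"
    using b leg_in_arcs[of b] V_ends(2) by (auto simp: awalk_Nil_iff awalk_Cons_iff leg_def)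
  have "awalk (B a) (path a b) (B b)"
    unfolding path_def using awalk_appendI[OF 1 awalk_appendI[OF 2 3]] .
  then show ?thesis unfolding ab by (simp add: walks_def)
qed

definition unit_weights :: "edge \<Rightarrow> real" where "unit_weights = (\<lambda>e\<in>arcs. 1)"

lemma measurement_fraction:
  assumes i: "i \<in> I" and j: "j \<in> J"
  defines "P \<equiv> path (pos i) (pos j)"
  shows "represents_fraction arcs (boundary_series n caterpillar i j)
    (Poly_Mapping.single (mset P) (if P \<in> walks i j then path_sign n caterpillar i j P else 0)) 1"
proof -
  have "P \<in> walks i j \<Longrightarrow> set P \<subseteq> arcs" using walksD(2)[of P i j] i j by simp
  from single_walk_represents_fraction[OF walks_subset[OF i j, folded P_def] this, of "path_sign n caterpillar i j"]
  show ?thesis by (simp add: boundary_series_def[abs_def] walks_def)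
qed

lemma unit_weights_domain: "unit_weights \<in> measurement_domain n I J caterpillar"
  unfolding measurement_domain_def
proof (standard, intro conjI ballI)
  show "unit_weights \<in> torus (parcs (graph caterpillar))" by (simp add: unit_weights_def torus_def)
  fix c assume "c \<in> mat_index (card I) (card J)"
  then obtain k l where c: "c = (k, l)" "row_label k \<in> I" "col_label l \<in> J"
    using row_label(1) col_label(1) unfolding mat_index_def by auto
  have "poly_eval 1 unit_weights \<noteq> 0" by (simp add: poly_eval_one)
  with measurement_fraction[OF c(2,3)]
  show "rational_regular (parcs (graph caterpillar)) (measurement_series n I J caterpillar c) unit_weights"
    unfolding rational_regular_def c(1) measurement_series_def by auto
qed

lemma measurement_neq_0:
  assumes c: "(k, l) \<in> mat_index (card I) (card J)" and le: "pos (row_label k) < pos (col_label l)"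
  shows "boundary_measurement n I J caterpillar unit_weights (k, l) \<noteq> 0"
proof -
  have kl: "row_label k \<in> I" "col_label l \<in> J" using c row_label(1) col_label(1) unfolding mat_index_def by auto
  let ?P = "path (pos (row_label k)) (pos (col_label l))"
  have P: "?P \<in> walks (row_label k) (col_label l)" by (rule path_walk[OF kl le])
  have "set ?P \<subseteq> arcs" using walksD(2)[OF P kl] by simp
  then have "(\<Prod>e\<in>#mset ?P. unit_weights e) \<noteq> 0" by (auto simp: prod_mset_zero_iff unit_weights_def)
  moreover have "boundary_measurement n I J caterpillar unit_weights (k, l)
      = path_sign n caterpillar (row_label k) (col_label l) ?P * (\<Prod>e\<in>#mset ?P. unit_weights e)"
    unfolding boundary_measurement_def measurement_series_def
    using rational_value_eq[OF _ measurement_fraction[OF kl], of unit_weights] c P finite_E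
    by (simp add: poly_eval_one poly_eval_single)
  ultimately show ?thesis by (simp add: path_sign_def)
qed

lemma measurement_row_neq_0:
  "\<exists>k<card I. \<forall>l<card J. boundary_measurement n I J caterpillar unit_weights (k, l) \<noteq> 0"
proof -
  obtain k where k: "k < card I" "row_label k = lab 1" using row_label(2)[OF lab_first] by blast
  have "pos (row_label k) = 1" unfolding k(2) using lab(2)[of 1] n by simp
  then have "boundary_measurement n I J caterpillar unit_weights (k, l) \<noteq> 0" if "l < card J" for l
    using measurement_neq_0[of k l] k(1) that pos_sink(1)[OF col_label(1)[OF that]] by (simp add: mat_index_def)
  then show ?thesis using k(1) by blast
qed

lemma measurement_col_neq_0:
  "\<exists>l<card J. \<forall>k<card I. boundary_measurement n I J caterpillar unit_weights (k, l) \<noteq> 0"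
proof -
  obtain l where l: "l < card J" "col_label l = lab n" using col_label(2)[OF lab_last] by blast
  have "pos (col_label l) = n" unfolding l(2) using lab(2)[of n] n by simp
  then have "boundary_measurement n I J caterpillar unit_weights (k, l) \<noteq> 0" if "k < card I" for k
    using measurement_neq_0[of k l] l(1) that pos_source(1)[OF row_label(1)[OF that]] by (simp add: mat_index_def)
  then show ?thesis using l(1) by blast
qed

end

section \<open>Uniqueness\<close>

text \<open>Within a row both terms of the bracket are multiples of the same monomial, and the wrap
  signs occur squared. So only \<open>u - v\<close> is visible, which is the parameter of the white
  vertices.\<close>

lemma mat_coef_same_row:
  assumes "fst c = fst d"
  shows "mat_coef u v r q c d x = (u - v) * cyc (r (fst c)) (r (fst d)) (q (snd c)) (q (snd d)) * x c * x d"
proof -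
  obtain a b b' where c: "c = (a, b)" and d: "d = (a, b')" using assms by (metis prod.collapse)
  have "par_coef (r a) (r a) (q b) (q b') = - cyc (r a) (r a) (q b) (q b') * (wrap_sign (r a) (q b) * wrap_sign (r a) (q b)) * (wrap_sign (r a) (q b') * wrap_sign (r a) (q b'))"
    unfolding par_coef_def swap_sign_def cyc_skew[of "r a" "r a" "q b'" "q b", symmetric] by simp
  then show ?thesis unfolding c d mat_coef_def wrap_sign_sq by (simp add: algebra_simps)
qed

text \<open>As in \<open>mat_coef_same_row\<close>, but with \<open>cyc\<close> unchanged when the
  equal columns are exchanged; \<open>u + v\<close> is the parameter of the black vertices.\<close>

lemma mat_coef_same_col:
  assumes "snd c = snd d"
  shows "mat_coef u v r q c d x = (u + v) * cyc (r (fst c)) (r (fst d)) (q (snd c)) (q (snd d)) * x c * x d"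
proof -
  obtain a a' b where c: "c = (a, b)" and d: "d = (a', b)" using assms by (metis prod.collapse)
  have "par_coef (r a) (r a') (q b) (q b) = cyc (r a) (r a') (q b) (q b) * (wrap_sign (r a) (q b) * wrap_sign (r a) (q b)) * (wrap_sign (r a') (q b) * wrap_sign (r a') (q b))"
    unfolding par_coef_def swap_sign_def by simp
  then show ?thesis unfolding c d mat_coef_def wrap_sign_sq by (simp add: algebra_simps)
qed

lemma mat_coef_self: "mat_coef u v r q c c x = 0"
  unfolding mat_coef_same_row[OF refl] by (simp add: cyc_def sg_skew[of "q (snd c)"])

text \<open>The parameters themselves are recovered only if there are at least two rows and two
  columns. A single row involves only \<open>u - v\<close>, a single column only
  \<open>u + v\<close>, and a single entry neither, so the conclusion is about the
  coefficients.\<close>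

lemma mat_coef_determined:
  assumes r: "inj_on r {..<k}" and q: "inj_on q {..<m}" and rq: "\<And>i j. i < k \<Longrightarrow> j < m \<Longrightarrow> r i \<noteq> q j"
    and row: "p' < k" "\<And>l. l < m \<Longrightarrow> x (p', l) \<noteq> 0" and col: "l' < m" "\<And>p. p < k \<Longrightarrow> x (p, l') \<noteq> 0"
    and eq: "\<And>c d. c \<in> mat_index k m \<Longrightarrow> d \<in> mat_index k m \<Longrightarrow> mat_coef u v r q c d x = mat_coef u' v' r q c d x"
    and cd: "c \<in> mat_index k m" "d \<in> mat_index k m"
  shows "mat_coef u v r q c d = mat_coef u' v' r q c d"
proof -
  have minus: "u - v = u' - v'" if m: "2 \<le> m"
  proof -
    let ?c = "(p', 0)" and ?d = "(p', 1)"
    have "?c \<in> mat_index k m" "?d \<in> mat_index k m" using row m by (auto simp: mat_index_def)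
    from eq[OF this] have "(u - v) * (cyc (r p') (r p') (q 0) (q 1) * x ?c * x ?d) = (u' - v') * (cyc (r p') (r p') (q 0) (q 1) * x ?c * x ?d)"
      by (simp add: mat_coef_same_row mult.assoc)
    moreover have "q 0 \<noteq> q 1" using inj_onD[OF q, of 0 1] m by auto
    \<comment> \<open>One of the four signs vanishes and the other three are 1 or - 1, so their sum
      is odd.\<close>
    then have "cyc (r p') (r p') (q 0) (q 1) \<noteq> 0"
      using rq[OF row(1), of 0] rq[OF row(1), of 1] m by (auto simp: cyc_def sg_def sgn_real_def)
    then have "cyc (r p') (r p') (q 0) (q 1) * x ?c * x ?d \<noteq> 0" using row(2)[of 0] row(2)[of 1] m by simp
    ultimately show ?thesis by (metis mult_right_cancel)
  qed
  have plus: "u + v = u' + v'" if k: "2 \<le> k"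
  proof -
    let ?c = "(0, l')" and ?d = "(1, l')"
    have "?c \<in> mat_index k m" "?d \<in> mat_index k m" using col k by (auto simp: mat_index_def)
    from eq[OF this] have "(u + v) * (cyc (r 0) (r 1) (q l') (q l') * x ?c * x ?d) = (u' + v') * (cyc (r 0) (r 1) (q l') (q l') * x ?c * x ?d)"
      by (simp add: mat_coef_same_col mult.assoc)
    moreover have "r 0 \<noteq> r 1" using inj_onD[OF r, of 0 1] k by auto
    then have "cyc (r 0) (r 1) (q l') (q l') \<noteq> 0"
      using rq[OF _ col(1), of 0] rq[OF _ col(1), of 1] k by (auto simp: cyc_def sg_def sgn_real_def)
    then have "cyc (r 0) (r 1) (q l') (q l') * x ?c * x ?d \<noteq> 0" using col(2)[of 0] col(2)[of 1] k by simp
    ultimately show ?thesis by (metis mult_right_cancel)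
  qed
  show ?thesis
  proof (rule ext)
    fix y
    have bounds: "fst c < k" "fst d < k" "snd c < m" "snd d < m" using cd by (auto simp: mat_index_def)
    consider "2 \<le> k" "2 \<le> m" | "k = 1" | "m = 1" using row(1) col(1) by linarith
    then show "mat_coef u v r q c d y = mat_coef u' v' r q c d y"
    proof cases
      case 1
      with minus plus have "u = u'" "v = v'" by linarith+
      then show ?thesis by simp
    next
      case 2
      then have e: "fst c = fst d" using bounds by linarith
      show ?thesis
      proof (cases "c = d")
        case True
        then show ?thesis by (simp add: mat_coef_self)
      next
        case False
        then have "2 \<le> m" using e bounds by (cases c; cases d) auto
        then show ?thesis using mat_coef_same_row[OF e] minus by metis
      qed
    next
      case 3
      then have e: "snd c = snd d" using bounds by linarith
      show ?thesis
      proof (cases "c = d")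
        case True
        then show ?thesis by (simp add: mat_coef_self)
      next
        case False
        then have "2 \<le> k" using e bounds by (cases c; cases d) auto
        then show ?thesis using mat_coef_same_col[OF e] plus by metis
      qed
    qed
  qed
qed

lemma mat_family_coordinates:
  assumes "c \<in> mat_index k m" "d \<in> mat_index k m" "x \<in> coord_space (mat_index k m)"
  shows "mat_family k m r q \<theta> (\<lambda>y\<in>coord_space (mat_index k m). y c) (\<lambda>y\<in>coord_space (mat_index k m). y d) x
    = mat_coef (\<theta> 0) (\<theta> 1) r q c d x"
proof -
  let ?S = "mat_index k m"
  have fin: "finite ?S" by (simp add: mat_index_def)
  have sm: "(\<lambda>y\<in>coord_space ?S. y e) \<in> smooth_functions ?S" for e
    by (rule restrict_smooth_functions[OF smooth_coordinate])
  have "mat_family k m r q \<theta> (\<lambda>y\<in>coord_space ?S. y c) (\<lambda>y\<in>coord_space ?S. y d) x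
      = coord_bracket ?S (mat_coef (\<theta> 0) (\<theta> 1) r q) (\<lambda>y\<in>coord_space ?S. y c) (\<lambda>y\<in>coord_space ?S. y d) x"
    unfolding mat_family_def smooth_bracket_def
    by (simp only: restrict_apply' sm assms(3))
  also have "\<dots> = coord_bracket ?S (mat_coef (\<theta> 0) (\<theta> 1) r q) (\<lambda>y. y c) (\<lambda>y. y d) x"
    by (rule coord_bracket_cong) (simp_all add: assms(3))
  also have "\<dots> = mat_coef (\<theta> 0) (\<theta> 1) r q c d x"
    unfolding coord_bracket_def partial_deriv_coordinate using assms fin
    by (simp add: if_distrib[of "\<lambda>z. _ * z"] if_distrib[of "\<lambda>z. z * _"] sum.If_cases sum.delta cong: if_cong)
  finally show ?thesis .
qed

lemma mat_family_cong:
  assumes "\<And>c d. c \<in> mat_index k m \<Longrightarrow> d \<in> mat_index k m \<Longrightarrow> mat_coef (\<theta> 0) (\<theta> 1) r q c d = mat_coef (\<theta>' 0) (\<theta>' 1) r q c d"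
  shows "mat_family k m r q \<theta> = mat_family k m r q \<theta>'"
  unfolding mat_family_def smooth_bracket_def coord_bracket_def
  by (intro restrict_ext sum.cong refl) (simp only: assms)

text \<open>Otherwise \<open>J\<close> would be closed under the cyclic successor and contain every
  label.\<close>

lemma exists_sink_before_source:
  assumes labels: "I \<union> J = {1..n}" "I \<inter> J = {}" and ne: "I \<noteq> {}" "J \<noteq> {}"
  shows "\<exists>r\<in>J. (if r < n then Suc r else 1) \<in> I"
proof (rule ccontr)
  assume neg: "\<not> ?thesis"
  have step: "(if r < n then Suc r else 1) \<in> J" if "r \<in> J" for r
  proof -
    have "(if r < n then Suc r else 1) \<in> {1..n}" using that labels by auto
    then show ?thesis using neg that labels by blast
  qed
  have up: "s \<in> J" if "r \<in> J" "r \<le> s" "s \<le> n" for r s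
    using that(2,3)
  proof (induction rule: dec_induct)
    case base
    then show ?case using that(1) by simp
  next
    case (step s)
    then show ?case using \<open>\<And>r. r \<in> J \<Longrightarrow> (if r < n then Suc r else 1) \<in> J\<close>[of s] by simp
  qed
  obtain r where r: "r \<in> J" using ne by blast
  then have "n \<in> J" using up[of r n] labels by auto
  then have "1 \<in> J" using step[of n] by simp
  then have "{1..n} \<subseteq> J" using up by auto
  then show False using labels ne by blast
qed

lemma mat_family_unique:
  fixes n :: nat and I J :: "nat set"
  defines "F \<equiv> mat_family (card I) (card J) (\<lambda>p. sorted_list_of_set I ! p) (\<lambda>p. sorted_list_of_set J ! p)"
  assumes labels: "I \<union> J = {1..n}" "I \<inter> J = {}"
    and poisson: "\<And>N. N \<in> Net n I J \<Longrightarrow> boundary_measurement_poisson n I J \<alpha> \<beta> (F \<theta>) N"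
      "\<And>N. N \<in> Net n I J \<Longrightarrow> boundary_measurement_poisson n I J \<alpha> \<beta> (F \<theta>') N"
  shows "F \<theta> = F \<theta>'"
proof -
  let ?r = "\<lambda>p. sorted_list_of_set I ! p" and ?q = "\<lambda>p. sorted_list_of_set J ! p"
  let ?S = "mat_index (card I) (card J)"
  have fin: "finite I" "finite J" using labels(1) by (metis finite_Un finite_atLeastAtMost)+
  have "mat_coef (\<theta> 0) (\<theta> 1) ?r ?q c d = mat_coef (\<theta>' 0) (\<theta>' 1) ?r ?q c d" if cd: "c \<in> ?S" "d \<in> ?S" for c d
  proof (cases "c = d")
    case True
    then show ?thesis by (simp add: mat_coef_self fun_eq_iff)
  next
    case False
    have card: "card I + card J = n" using card_Un_disjoint[OF fin labels(2)] labels(1) by simp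
    \<comment> \<open>Two different entries need two rows or two columns, hence at least three
      labels, which is what the caterpillar requires.\<close>
    have ne: "I \<noteq> {}" "J \<noteq> {}" and n: "3 \<le> n" using cd False card by (auto simp: mat_index_def)
    obtain r where "r \<in> J" "(if r < n then Suc r else 1) \<in> I"
      using exists_sink_before_source[OF labels ne] by blast
    then interpret caterpillar n r I J using labels n by unfold_locales
    let ?x = "boundary_measurement n I J caterpillar unit_weights"
    obtain p0 l0 where p0: "p0 < card I" "\<And>l. l < card J \<Longrightarrow> ?x (p0, l) \<noteq> 0"
      and l0: "l0 < card J" "\<And>p. p < card I \<Longrightarrow> ?x (p, l0) \<noteq> 0"
      using measurement_row_neq_0 measurement_col_neq_0 by blast
    have x: "?x \<in> coord_space ?S" unfolding boundary_measurement_def coord_space_def by simp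
    have eq: "mat_coef (\<theta> 0) (\<theta> 1) ?r ?q c d ?x = mat_coef (\<theta>' 0) (\<theta>' 1) ?r ?q c d ?x" if "c \<in> ?S" "d \<in> ?S" for c d
    proof -
      let ?f = "\<lambda>c. \<lambda>y\<in>coord_space ?S. y c"
      have sm: "?f c \<in> smooth_functions ?S" for c
        by (rule restrict_smooth_functions[OF smooth_coordinate])
      have "F \<theta> (?f c) (?f d) ?x = F \<theta>' (?f c) (?f d) ?x"
        using poisson[OF caterpillar_Net] sm unit_weights_domain
        unfolding boundary_measurement_poisson_def Let_def by metis
      then show ?thesis unfolding F_def mat_family_coordinates[OF that x] .
    qed
    have inj: "inj_on ?r {..<card I}" "inj_on ?q {..<card J}"
      by (auto simp: inj_on_def nth_eq_iff_index_eq)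
    have neq: "?r i \<noteq> ?q j" if "i < card I" "j < card J" for i j
      using row_label(1)[OF that(1)] col_label(1)[OF that(2)] labels(2) by auto
    show ?thesis
      by (rule mat_coef_determined[where x = ?x and p' = p0 and l' = l0 and k = "card I" and m = "card J"])
        (fact inj neq p0 l0 eq cd)+
  qed
  then show ?thesis unfolding F_def by (rule mat_family_cong)
qed

theorem theorem3p2:
  fixes n k m :: nat and I J :: "nat set"
  assumes "I \<union> J = {1..n}" and "I \<inter> J = {}" and "card I = k" and "card J = m" and "m = n - k"
  shows "\<exists>F. two_parametric_family (mat_index k m) F \<and>
    (\<forall>\<alpha> \<beta>. skew3 \<alpha> \<longrightarrow> skew3 \<beta> \<longrightarrow>
      (\<exists>!B. B \<in> F ` coord_space {..<2} \<and>
        (\<forall>N \<in> Net n I J. boundary_measurement_poisson n I J \<alpha> \<beta> B N)))"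
proof (intro exI conjI allI impI)
  let ?r = "\<lambda>p. sorted_list_of_set I ! p" and ?q = "\<lambda>p. sorted_list_of_set J ! p"
  let ?F = "mat_family (card I) (card J) ?r ?q"
  have fin: "finite I" "finite J" using assms(1) by (metis finite_Un finite_atLeastAtMost)+
  show "two_parametric_family (mat_index k m) ?F"
    unfolding assms(3,4)[symmetric]
  proof (rule two_parametric_family_mat_family)
    show "inj_on ?r {..<card I}" "inj_on ?q {..<card J}" by (auto simp: inj_on_def nth_eq_iff_index_eq)
    show "?r i \<noteq> ?q j" if "i < card I" "j < card J" for i j
      using nth_mem[of i "sorted_list_of_set I"] nth_mem[of j "sorted_list_of_set J"] that fin assms(2) by auto
  qed
  fix \<alpha> \<beta> assume \<alpha>\<beta>: "skew3 \<alpha>" "skew3 \<beta>"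
  \<comment> \<open>With this choice u - v and u + v are the values of \<open>triple_param\<close>
    for white and for black vertices.\<close>
  define \<theta> where "\<theta> = (\<lambda>i\<in>{..<2::nat}. if i = 0 then (triple_param \<alpha> + triple_param \<beta>) / 2 else (triple_param \<beta> - triple_param \<alpha>) / 2)"
  have \<theta>: "\<theta> 0 = (triple_param \<alpha> + triple_param \<beta>) / 2" "\<theta> 1 = (triple_param \<beta> - triple_param \<alpha>) / 2"
    by (simp_all add: \<theta>_def)
  have poisson: "boundary_measurement_poisson n I J \<alpha> \<beta> (?F \<theta>) N" if "N \<in> Net n I J" for N
  proof -
    interpret perfect_network n I J N using assms(1,2) that by unfold_locales
    show ?thesis by (rule measurement_poisson[OF \<alpha>\<beta> \<theta>])
  qed
  show "\<exists>!B. B \<in> ?F ` coord_space {..<2} \<and> (\<forall>N \<in> Net n I J. boundary_measurement_poisson n I J \<alpha> \<beta> B N)"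
  proof (intro ex1I[of _ "?F \<theta>"] conjI ballI)
    show "?F \<theta> \<in> ?F ` coord_space {..<2}" by (rule imageI) (simp only: \<theta>_def coord_space_def restrict_PiE_iff UNIV_I ball_triv simp_thms)
    fix B assume "B \<in> ?F ` coord_space {..<2} \<and> (\<forall>N \<in> Net n I J. boundary_measurement_poisson n I J \<alpha> \<beta> B N)"
    then obtain \<theta>' where "B = ?F \<theta>'" "\<And>N. N \<in> Net n I J \<Longrightarrow> boundary_measurement_poisson n I J \<alpha> \<beta> (?F \<theta>') N" by blast
    then show "B = ?F \<theta>" using mat_family_unique[OF assms(1,2) _ poisson] by blast
  qed (rule poisson)
qed

end
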